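(* Let $f:\mathcal I\to\mathbb{C}$ be multiplicative with $|f(\mathfrak a)|\le1$ for all $\mathfrak a$. Let $J=[\theta_1,\theta_2)\subset[0,\pi/2)$ (possibly depending on $x$), let $\delta_J=|J|/(\pi/2)$, and let $T=T(x)\ge2$ be an integer. For $m\in\mathbb{Z}$, $x\ge3$ put \[ M_m(x):=\min_{|t|\le\log x}\ \sum_{\mathrm{N}\mathfrak p\le x}\frac{1-\Re\bigl(f(\mathfrak p)\lambda_m(\mathfrak p)(\mathrm{N}\mathfrak p)^{-it}\bigr)}{\mathrm{N}\mathfrak p}. \] Then for all $x\ge3$, \[ \Bigl|S_{f,J}(x)-\delta_JS_f(x)\Bigr|\ll x\log(T+1)\max_{1\le|m|\le T}\Bigl((1+M_m(x))e^{-M_m(x)}\Bigr)+\frac{x}{\log x}(\log\log x)\log(T+1)+\frac{x\log(T+1)}{T}+x^{1/2}, \] with an absolute implied constant, uniform in $J$ and $T$. Here $S_f(x)=\sum_{\mathrm{N}\mathfrak a\le x}f(\mathfrak a)$ and $S_{f,J}(x)=\sum_{\mathrm{N}\mathfrak a\le x,\ \arg(\mathfrak a)\in J}f(\mathfrak a)$.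
   Context: $\mathcal I$ is the set of nonzero ideals of $\mathbb{Z}[i]$, $\mathrm{N}$ the ideal norm, sums over $\mathfrak p$ are over prime ideals; $f$ multiplicative means $f(\mathbb{Z}[i])=1$ and $f(\mathfrak a\mathfrak b)=f(\mathfrak a)f(\mathfrak b)$ for coprime $\mathfrak a,\mathfrak b$. For $\mathfrak a\in\mathcal I$, $z_{\mathfrak a}$ is its unique generator with $0\le\arg z_{\mathfrak a}<\pi/2$, $\arg(\mathfrak a):=\arg z_{\mathfrak a}$, and $\lambda_m(\mathfrak a):=e^{4im\arg(\mathfrak a)}$. *)

theory Defs
  imports "HOL-Analysis.Analysis" "HOL-Algebra.QuotRing" "HOL-Algebra.Ideal_Product"
begin

definition ZI :: "complex ring" where
  "ZI = \<lparr> carrier = {z. Re z \<in> \<int> \<and> Im z \<in> \<int>}, mult = (*), one = 1, zero = 0, add = (+) \<rparr>"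

lemma ZI_cring: "cring ZI"
proof (rule cringI)
  show "abelian_group ZI"
  proof (rule abelian_groupI)
    fix z assume "z \<in> carrier ZI"
    then show "\<exists>w\<in>carrier ZI. w \<oplus>\<^bsub>ZI\<^esub> z = \<zero>\<^bsub>ZI\<^esub>"
      by (intro bexI[of _ "- z"]) (auto simp: ZI_def)
  qed (auto simp: ZI_def)
  show "comm_monoid ZI"
    by (rule comm_monoidI) (auto simp: ZI_def)
qed (auto simp: ZI_def algebra_simps)

definition nz_ideals :: "complex set set" where
  "nz_ideals = {I. ideal I ZI \<and> I \<noteq> {\<zero>\<^bsub>ZI\<^esub>}}"

definition nz_primes :: "complex set set" where
  "nz_primes = {P \<in> nz_ideals. primeideal P ZI}"

definition idl_norm :: "complex set \<Rightarrow> nat" where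
  "idl_norm I = card (carrier (ZI Quot I))"

definition coprime_idl :: "complex set \<Rightarrow> complex set \<Rightarrow> bool" where
  "coprime_idl I K \<longleftrightarrow> I <+>\<^bsub>ZI\<^esub> K = carrier ZI"

(* Arithmetic functions are total on complex set; only their values on nz_ideals matter. *)
definition multiplicative_idl :: "(complex set \<Rightarrow> complex) \<Rightarrow> bool" where
  "multiplicative_idl f \<longleftrightarrow> f (carrier ZI) = 1 \<and>
     (\<forall>I\<in>nz_ideals. \<forall>K\<in>nz_ideals. coprime_idl I K \<longrightarrow> f (ideal_prod ZI I K) = f I * f K)"

(* Arg takes values in (-pi, pi], so the condition below singles out the half-open first quadrant. *)
definition idl_gen :: "complex set \<Rightarrow> complex" where
  "idl_gen I = (THE z. z \<in> carrier ZI \<and> PIdl\<^bsub>ZI\<^esub> z = I \<and> 0 \<le> Arg z \<and> Arg z < pi / 2)"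

definition idl_arg :: "complex set \<Rightarrow> real" where
  "idl_arg I = Arg (idl_gen I)"

definition hecke_char :: "int \<Rightarrow> complex set \<Rightarrow> complex" where
  "hecke_char m I = exp (4 * \<i> * of_int m * of_real (idl_arg I))"

definition S_all :: "(complex set \<Rightarrow> complex) \<Rightarrow> real \<Rightarrow> complex" where
  "S_all f x = (\<Sum>I | I \<in> nz_ideals \<and> real (idl_norm I) \<le> x. f I)"

definition S_arg :: "(complex set \<Rightarrow> complex) \<Rightarrow> real set \<Rightarrow> real \<Rightarrow> complex" where
  "S_arg f J x = (\<Sum>I | I \<in> nz_ideals \<and> real (idl_norm I) \<le> x \<and> idl_arg I \<in> J. f I)"

definition twist_dist :: "(complex set \<Rightarrow> complex) \<Rightarrow> int \<Rightarrow> real \<Rightarrow> real \<Rightarrow> real" where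
  "twist_dist f m x t =
     (\<Sum>P | P \<in> nz_primes \<and> real (idl_norm P) \<le> x.
        (1 - Re (f P * hecke_char m P * of_nat (idl_norm P) powr (- \<i> * of_real t)))
          / real (idl_norm P))"

(* The infimum is a minimum: see M_dist_attained. *)
definition M_dist :: "(complex set \<Rightarrow> complex) \<Rightarrow> int \<Rightarrow> real \<Rightarrow> real" where
  "M_dist f m x = (INF t\<in>{t. \<bar>t\<bar> \<le> ln x}. twist_dist f m x t)"

lemma M_dist_attained:
  assumes "x \<ge> 1"
  shows "\<exists>t. \<bar>t\<bar> \<le> ln x \<and> M_dist f m x = twist_dist f m x t \<and>
    (\<forall>s. \<bar>s\<bar> \<le> ln x \<longrightarrow> twist_dist f m x t \<le> twist_dist f m x s)"
proof -
  have powr_cont: "continuous_on A (\<lambda>t. (of_nat n :: complex) powr (- \<i> * of_real t))"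
    for n :: nat and A :: "real set"
    by (cases "n = 0") (auto simp: powr_def intro!: continuous_intros)
  have cont: "continuous_on A (twist_dist f m x)" for A
    unfolding twist_dist_def divide_inverse
    by (intro continuous_intros powr_cont)
  have eq: "{t. \<bar>t\<bar> \<le> ln x} = {- ln x..ln x}" by auto
  have "\<exists>t\<in>{- ln x..ln x}. \<forall>s\<in>{- ln x..ln x}. twist_dist f m x t \<le> twist_dist f m x s"
    by (rule continuous_attains_inf) (use assms cont in auto)
  then obtain t where t: "t \<in> {- ln x..ln x}"
    and le: "\<And>s. s \<in> {- ln x..ln x} \<Longrightarrow> twist_dist f m x t \<le> twist_dist f m x s"
    by blast
  have "M_dist f m x = twist_dist f m x t"
    unfolding M_dist_def eq by (rule cInf_eq_minimum) (use t le in auto)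
  moreover have "\<bar>t\<bar> \<le> ln x" using t by auto
  moreover have "twist_dist f m x t \<le> twist_dist f m x s" if "\<bar>s\<bar> \<le> ln x" for s
    using that by (intro le) auto
  ultimately show ?thesis by blast
qed

end

theory Submission
  imports Defs "HOL-Complex_Analysis.Complex_Analysis" "HOL-Probability.Sinc_Integral"
    "HOL-Real_Asymp.Real_Asymp" "HOL-Computational_Algebra.Euclidean_Algorithm"
begin

text \<open>
  Fejer's kernel approximates the indicator of \<open>J\<close> by a trigonometric polynomial of degree \<open>T\<close> in
  \<open>4 arg\<close> whose coefficients have absolute sum \<open>O(log T)\<close>. The error is concentrated near the end
  points of \<open>J\<close>, where ideals are counted as lattice points in thin sectors; this gives
  \<open>x log T / T\<close>. What remains are the sums of \<open>f \<lambda>\<^sub>m\<close> over norms up to \<open>x\<close>, for which one needs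
  Halasz's theorem over the Gaussian integers.

  For completely multiplicative \<open>g\<close> with summatory function \<open>S\<close>, Selberg's weight of order two and the
  Chebyshev bounds yield \<open>|S(x)| log\<^sup>2 x \<le> 2x \<integral> |S(u)| u powr (- 2) (1 + log (x/u)) du + O(x log x)\<close>. The integral is
  split dyadically according to a damping exponent \<open>a\<close> and estimated by Cauchy-Schwarz and Plancherel:
  the derivative of the Dirichlet series \<open>F\<close> of \<open>g\<close> equals \<open>- F \<Lambda>\<close>, where \<open>F\<close> is bounded in terms of the
  distance \<open>M\<close> on the line \<open>1 + 1 / log x\<close> by dividing out Euler factors, hence by Poisson's kernel on
  every line to its right, and \<open>\<Lambda>\<close> is bounded in mean square. A general multiplicative \<open>f\<close> is \<open>g * h\<close>
  with \<open>g\<close> completely multiplicative and \<open>h\<close> supported on square-full elements, and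
  \<open>\<Sum> |h| N powr (- 3/4)\<close> converges.
\<close>

section \<open>The Fejer kernel and arcs\<close>

text \<open>With the weight log alone, passing from a sum of von Mangoldt weights times |S(x / N)|
  to an integral would need more about primes than Chebyshev bounds. The weight \<open>mang2\<close>
  has the elementary main term 2 y ln y with error O(y), since a count with square root error
  survives Moebius inversion. Complete multiplicativity enters here: g(A) = g(B) g(A - B) for every
  divisor B turns a sum of g log^2 into a convolution of g \<open>mang2\<close> with g. About M
  blocks are limited by the first entry and the others form a geometric series; hence (1 + M)
  e^(-M). A bounded error on each of about ln L blocks produces ln ln x / ln x. The distance
  controls F only for |t| \<le> L. Beyond L / 2 the mean square is estimated by the same Plancherel
  identity at a much larger abscissa, which gains a factor of order 1 / L.\<close>

definition fejer :: "nat \<Rightarrow> real \<Rightarrow> real" where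
  "fejer n y = 1 + 2 * (\<Sum>m=1..n. (1 - real m / real (n + 1)) * cos (real m * y))"

text \<open>The primitive of the Fejer kernel with value 0 at 0. It climbs from about -pi to about
  pi near 0, so a difference of two translates is about 2 pi times the indicator of an arc. Its sine
  coefficients are O(1 / m), which is the source of the factor log T.\<close>

definition fejer_prim :: "nat \<Rightarrow> real \<Rightarrow> real" where
  "fejer_prim n y = y + 2 * (\<Sum>m=1..n. (1 - real m / real (n + 1)) / real m * sin (real m * y))"

text \<open>Writing D for the exponential sum, one more term e changes |D|^2 by 1 + 2 Re (e cnj D),
  and this real part is the cosine sum over 1..n+1. Induction on n therefore avoids rearranging a
  double sum.\<close>

lemma fejer_square: "real (n + 1) * fejer n y = (cmod (\<Sum>k\<le>n. cis (real k * y)))\<^sup>2"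
proof -
  have "(cmod (\<Sum>k\<le>n. cis (real k * y)))\<^sup>2 = real (n + 1) + 2 * (\<Sum>m=1..n. (real (n + 1) - real m) * cos (real m * y))"
  proof (induction n)
    case 0
    then show ?case by simp
  next
    case (Suc n)
    define D where "D = (\<Sum>k\<le>n. cis (real k * y))"
    define e where "e = cis (real (Suc n) * y)"
    have cr: "(cmod (D + e))\<^sup>2 = (cmod D)\<^sup>2 + 1 + 2 * Re (e * cnj D)"
    proof -
      have "(cmod (D + e))\<^sup>2 = (cmod D)\<^sup>2 + (cmod e)\<^sup>2 + 2 * Re (e * cnj D)"
        by (simp only: cmod_power2) (simp add: power2_eq_square algebra_simps)
      then show ?thesis by (simp add: e_def)
    qed
    have "Re (e * cnj D) = (\<Sum>k\<le>n. cos (real (Suc n - k) * y))"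
    proof -
      have "e * cnj D = (\<Sum>k\<le>n. cis (real (Suc n) * y) * cis (- (real k * y)))"
        by (simp add: D_def e_def sum_distrib_left cis_cnj)
      also have "\<dots> = (\<Sum>k\<le>n. cis (real (Suc n - k) * y))"
      proof (rule sum.cong[OF refl])
        fix k assume "k \<in> {..n}"
        then have "real (Suc n - k) = real (Suc n) - real k" by (simp add: of_nat_diff)
        then show "cis (real (Suc n) * y) * cis (- (real k * y)) = cis (real (Suc n - k) * y)"
          by (simp add: cis_mult left_diff_distrib)
      qed
      finally show ?thesis by simp
    qed
    also have "\<dots> = (\<Sum>m=1..Suc n. cos (real m * y))"
      by (rule sum.reindex_bij_witness[of _ "\<lambda>m. Suc n - m" "\<lambda>k. Suc n - k"]) auto
    finally have R: "Re (e * cnj D) = (\<Sum>m=1..Suc n. cos (real m * y))" .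
    have "(\<Sum>m=1..Suc n. (real (Suc n + 1) - real m) * cos (real m * y))
      = (\<Sum>m=1..Suc n. (real (n + 1) - real m) * cos (real m * y)) + (\<Sum>m=1..Suc n. cos (real m * y))"
      by (simp add: algebra_simps flip: sum.distrib)
    also have "(\<Sum>m=1..Suc n. (real (n + 1) - real m) * cos (real m * y)) = (\<Sum>m=1..n. (real (n + 1) - real m) * cos (real m * y))"
      by simp
    finally have S: "(\<Sum>m=1..Suc n. (real (Suc n + 1) - real m) * cos (real m * y))
      = (\<Sum>m=1..n. (real (n + 1) - real m) * cos (real m * y)) + (\<Sum>m=1..Suc n. cos (real m * y))" .
    have "(\<Sum>k\<le>Suc n. cis (real k * y)) = D + e" by (simp add: D_def e_def)
    then have "(cmod (\<Sum>k\<le>Suc n. cis (real k * y)))\<^sup>2 = (cmod D)\<^sup>2 + 1 + 2 * (\<Sum>m=1..Suc n. cos (real m * y))"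
      by (simp only: cr R)
    also have "(cmod D)\<^sup>2 = real (n + 1) + 2 * (\<Sum>m=1..n. (real (n + 1) - real m) * cos (real m * y))"
      unfolding D_def by (rule Suc)
    finally show ?case unfolding S by simp
  qed
  also have "\<dots> = real (n + 1) * fejer n y"
    unfolding fejer_def distrib_left sum_distrib_left
    by (intro arg_cong2[where f="(+)"] sum.cong refl) (simp_all add: field_simps)
  finally show ?thesis by simp
qed

lemma fejer_nonneg: "fejer n y \<ge> 0"
proof -
  have "0 \<le> real (n + 1) * fejer n y" unfolding fejer_square by simp
  then show ?thesis by (simp add: zero_le_mult_iff)
qed

text \<open>The cubic Taylor bound sin t \<ge> t - t^3 / 6 with t^2 \<le> 4. The range up to 2
  covers y / 2 for y \<le> pi.\<close>

lemma sin_ge_third: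
  fixes t :: real assumes "0 \<le> t" "t \<le> 2" shows "t / 3 \<le> sin t"
proof -
  have "\<bar>sin t - (\<Sum>m<3. sin_coeff m * t ^ m)\<bar> \<le> inverse (fact 3) * \<bar>t\<bar> ^ 3"
    by (rule Maclaurin_sin_bound)
  moreover have "(\<Sum>m<3. sin_coeff m * t ^ m) = t" by (simp add: sin_coeff_def numeral_eq_Suc)
  ultimately have "\<bar>sin t - t\<bar> \<le> t ^ 3 / 6" using assms by (simp add: fact_numeral field_simps)
  then have "t - t ^ 3 / 6 \<le> sin t" by linarith
  moreover have "t ^ 3 \<le> 4 * t"
  proof -
    have "t * (t * t) \<le> t * (2 * 2)" using assms by (intro mult_left_mono mult_mono) auto
    then show ?thesis by (simp add: power3_eq_cube mult_ac)
  qed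
  ultimately show ?thesis by linarith
qed

lemma norm_one_minus_cis:
  assumes "0 \<le> y" "y \<le> pi"
  shows "y / 3 \<le> cmod (1 - cis y)"
proof -
  have "(cmod (1 - cis y))\<^sup>2 = 1 - 2 * cos y + ((sin y)\<^sup>2 + (cos y)\<^sup>2)"
    unfolding cmod_power2 by (simp add: power2_diff)
  then have "(cmod (1 - cis y))\<^sup>2 = 2 - 2 * cos y" unfolding sin_cos_squared_add by simp
  also have "cos y = 1 - 2 * (sin (y / 2))\<^sup>2" using cos_double_sin[of "y / 2"] by simp
  finally have "(cmod (1 - cis y))\<^sup>2 = (2 * sin (y / 2))\<^sup>2" by (simp add: power2_eq_square)
  moreover have s: "(y / 2) / 3 \<le> sin (y / 2)" using assms pi_half_less_two by (intro sin_ge_third) auto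
  moreover have "2 * sin (y / 2) \<ge> 0" using s assms by linarith
  ultimately have "cmod (1 - cis y) = 2 * sin (y / 2)" using power2_eq_imp_eq norm_ge_zero by blast
  then show ?thesis using s by simp
qed

text \<open>Summing the geometric series gives |D| \<le> 2 / |1 - cis y| \<le> 6 / y, which is then
  squared.\<close>

lemma fejer_le:
  assumes y: "0 < y" "y \<le> pi"
  shows "fejer n y \<le> 36 / (real (n + 1) * y\<^sup>2)"
proof -
  define D where "D = (\<Sum>k\<le>n. cis (real k * y))"
  have D: "D = (\<Sum>k\<le>n. cis y ^ k)" unfolding D_def by (intro sum.cong refl) (rule Complex.DeMoivre[symmetric])
  have "(1 - cis y) * D = 1 - cis y ^ Suc n" unfolding D by (rule sum_gp_basic)
  then have "cmod (1 - cis y) * cmod D = cmod (1 - cis y ^ Suc n)" by (metis norm_mult)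
  also have "\<dots> \<le> 1 + 1" by (rule order_trans[OF norm_triangle_ineq4]) (simp add: norm_power norm_mult)
  finally have "cmod (1 - cis y) * cmod D \<le> 2" by simp
  moreover have "y / 3 * cmod D \<le> cmod (1 - cis y) * cmod D"
    using y by (intro mult_right_mono norm_one_minus_cis) auto
  ultimately have "cmod D \<le> 6 / y" using y by (simp add: field_simps)
  then have "(cmod D)\<^sup>2 \<le> (6 / y)\<^sup>2" by (intro power_mono) auto
  then have "real (n + 1) * fejer n y \<le> 36 / y\<^sup>2" unfolding fejer_square D_def by (simp add: power_divide)
  then have "fejer n y * real (n + 1) \<le> 36 / y\<^sup>2" by (simp only: mult.commute)
  then have "fejer n y \<le> 36 / y\<^sup>2 / real (n + 1)" by (subst pos_le_divide_eq) simp_all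
  then show ?thesis by (simp only: divide_divide_eq_left mult.commute)
qed

lemma fejer_prim_deriv: "(fejer_prim n has_real_derivative fejer n y) (at y)"
proof -
  have d: "((\<lambda>y. c / m * sin (m * y)) has_real_derivative c / m * (cos (m * y) * m)) (at y)" for c m :: real
    by (auto intro!: derivative_eq_intros)
  have "((\<lambda>y. y + 2 * (\<Sum>m=1..n. (1 - real m / real (n + 1)) / real m * sin (real m * y))) has_real_derivative
     1 + 2 * (\<Sum>m=1..n. (1 - real m / real (n + 1)) / real m * (cos (real m * y) * real m))) (at y)"
    by (rule DERIV_add[OF DERIV_ident DERIV_cmult[OF DERIV_sum[OF d]]])
  also have "(\<Sum>m=1..n. (1 - real m / real (n + 1)) / real m * (cos (real m * y) * real m)) = (\<Sum>m=1..n. (1 - real m / real (n + 1)) * cos (real m * y))"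
    by (intro sum.cong refl) simp
  finally show ?thesis unfolding fejer_def fejer_prim_def[abs_def] .
qed

lemma fejer_prim_0 [simp]: "fejer_prim n 0 = 0" by (simp add: fejer_prim_def)
lemma fejer_prim_pi [simp]: "fejer_prim n pi = pi" by (simp add: fejer_prim_def)
lemma fejer_prim_minus: "fejer_prim n (- y) = - fejer_prim n y" by (simp add: fejer_prim_def sum_negf)

text \<open>\<open>fejer_prim n y - y\<close> is odd with period 2 pi. This carries the estimate on
  [0, pi] over to [pi, 2 pi].\<close>

lemma fejer_prim_reflect: "fejer_prim n (2 * pi - y) = 2 * pi - fejer_prim n y"
proof -
  have "sin (real m * (2 * pi - y)) = - sin (real m * y)" for m :: nat
  proof -
    have "real m * (2 * pi - y) = real m * (2 * pi) - real m * y" by (simp add: algebra_simps)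
    then show ?thesis using sin_int_2pin[of "int m"] cos_int_2pin[of "int m"] by (simp add: sin_diff mult.commute)
  qed
  then show ?thesis by (simp add: fejer_prim_def sum_negf)
qed

lemma fejer_prim_mono: "x \<le> y \<Longrightarrow> fejer_prim n x \<le> fejer_prim n y"
  by (rule DERIV_nonneg_imp_nondecreasing[of x y "fejer_prim n"]) (use fejer_prim_deriv fejer_nonneg in blast)+

text \<open>A majorant for the distance of \<open>fejer_prim\<close> from its limiting step: the
  constant pi within 1 / (n + 1) of the jump, and further out the integral of the kernel bound 36 /
  ((n + 1) y^2) over the tail.\<close>

definition fejer_weight :: "nat \<Rightarrow> real \<Rightarrow> real" where
  "fejer_weight n v = (if real (n + 1) * \<bar>v\<bar> \<le> 1 then pi else 36 / (real (n + 1) * \<bar>v\<bar>))"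

lemma fejer_weight_nonneg: "fejer_weight n v \<ge> 0" by (simp add: fejer_weight_def)

lemma fejer_prim_near_pi:
  assumes y: "0 \<le> y" "y \<le> pi"
  shows "0 \<le> pi - fejer_prim n y" "pi - fejer_prim n y \<le> fejer_weight n y"
proof -
  show "0 \<le> pi - fejer_prim n y" using fejer_prim_mono[of y pi n] y by simp
  show "pi - fejer_prim n y \<le> fejer_weight n y"
  proof (cases "real (n + 1) * \<bar>y\<bar> \<le> 1")
    case True
    then show ?thesis using fejer_prim_mono[of 0 y n] y by (simp add: fejer_weight_def)
  next
    case False
    then have y0: "y > 0" using y by (cases "y = 0") auto
    define \<kappa> where "\<kappa> = 36 / real (n + 1)"
    have \<kappa>: "36 / (real (n + 1) * v) = \<kappa> / v" for v by (simp add: \<kappa>_def)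
    \<comment> \<open>\<open>\<psi>\<close> is nondecreasing by \<open>fejer_le\<close> and at most
      0 at pi; this replaces an integration of the kernel bound over [y, pi].\<close>
    define \<psi> where "\<psi> = (\<lambda>u. pi - fejer_prim n u - \<kappa> / u)"
    have "\<psi> y \<le> \<psi> pi"
    proof (rule DERIV_nonneg_imp_nondecreasing[OF y(2)])
      fix u assume u: "y \<le> u" "u \<le> pi"
      have u0: "u > 0" using u y0 by simp
      have "(\<psi> has_real_derivative (- fejer n u + \<kappa> / u\<^sup>2)) (at u)"
        unfolding \<psi>_def using u0
        by (auto intro!: derivative_eq_intros fejer_prim_deriv simp: power2_eq_square)
      moreover have "- fejer n u + \<kappa> / u\<^sup>2 \<ge> 0" using fejer_le[OF u0 u(2), of n] by (simp only: \<kappa>)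
      ultimately show "\<exists>d. (\<psi> has_real_derivative d) (at u) \<and> 0 \<le> d" by blast
    qed
    also have "\<psi> pi \<le> 0" by (simp add: \<psi>_def \<kappa>_def)
    finally show ?thesis using False y0 unfolding fejer_weight_def \<psi>_def by (simp add: \<kappa>[simplified])
  qed
qed

lemma fejer_prim_pos_bound:
  assumes y: "0 \<le> y" "y \<le> 2 * pi"
  shows "\<bar>pi - fejer_prim n y\<bar> \<le> fejer_weight n y + fejer_weight n (y - 2 * pi)"
proof (cases "y \<le> pi")
  case True
  then show ?thesis using fejer_prim_near_pi[of y n] y fejer_weight_nonneg[of n "y - 2 * pi"] by simp
next
  case False
  have "\<bar>pi - fejer_prim n y\<bar> = \<bar>pi - fejer_prim n (2 * pi - y)\<bar>" by (simp add: fejer_prim_reflect)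
  also have "\<dots> \<le> fejer_weight n (2 * pi - y)" using fejer_prim_near_pi[of "2 * pi - y" n] y False by simp
  also have "\<dots> = fejer_weight n (y - 2 * pi)" by (simp add: fejer_weight_def abs_minus_commute)
  finally show ?thesis using fejer_weight_nonneg[of n y] by simp
qed

lemma fejer_prim_neg_bound:
  assumes y: "- 2 * pi \<le> y" "y \<le> 0"
  shows "\<bar>- pi - fejer_prim n y\<bar> \<le> fejer_weight n y + fejer_weight n (y + 2 * pi)"
proof -
  have "\<bar>- pi - fejer_prim n y\<bar> = \<bar>pi - fejer_prim n (- y)\<bar>" by (simp add: fejer_prim_minus)
  also have "\<dots> \<le> fejer_weight n (- y) + fejer_weight n (- y - 2 * pi)" by (rule fejer_prim_pos_bound) (use y in auto)
  also have "\<dots> = fejer_weight n y + fejer_weight n (y + 2 * pi)"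
  proof -
    have "\<bar>- y - 2 * pi\<bar> = \<bar>y + 2 * pi\<bar>" by linarith
    then show ?thesis by (simp add: fejer_weight_def)
  qed
  finally show ?thesis .
qed

text \<open>Differences of two angles in [0, 2 pi] lie in [-2 pi, 2 pi]. There
  \<open>fejer_prim\<close> departs from the step at 0 near the jump itself and near both ends,
  where it climbs to the next step; hence three translates.\<close>

definition fejer_weight3 :: "nat \<Rightarrow> real \<Rightarrow> real" where
  "fejer_weight3 n v = fejer_weight n v + fejer_weight n (v - 2 * pi) + fejer_weight n (v + 2 * pi)"

lemma indicator_fejer:
  assumes ab: "0 \<le> a" "a \<le> b" "b \<le> 2 * pi" and p: "0 \<le> p" "p < 2 * pi"
  shows "\<bar>(if a \<le> p \<and> p < b then 1 else 0) - (fejer_prim n (p - a) - fejer_prim n (p - b)) / (2 * pi)\<bar> \<le> fejer_weight3 n (p - a) + fejer_weight3 n (p - b)"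
proof -
  \<comment> \<open>The step takes the value pi at 0, so a difference of two steps is 2 pi times the
    indicator of the half-open arc [a, b).\<close>
  define rho where "rho = (\<lambda>y::real. if 0 \<le> y then pi else - pi)"
  have r: "\<bar>rho y - fejer_prim n y\<bar> \<le> fejer_weight3 n y" if "- 2 * pi \<le> y" "y \<le> 2 * pi" for y
    using fejer_prim_pos_bound[of y n] fejer_prim_neg_bound[of y n] that
      fejer_weight_nonneg[of n "y - 2 * pi"] fejer_weight_nonneg[of n "y + 2 * pi"] unfolding rho_def fejer_weight3_def
    by (cases "0 \<le> y") auto
  have "(if a \<le> p \<and> p < b then 1 else 0) = (rho (p - a) - rho (p - b)) / (2 * pi)"
    using ab by (auto simp: rho_def)
  then have "(if a \<le> p \<and> p < b then 1 else 0) - (fejer_prim n (p - a) - fejer_prim n (p - b)) / (2 * pi)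
     = ((rho (p - a) - fejer_prim n (p - a)) - (rho (p - b) - fejer_prim n (p - b))) / (2 * pi)"
    by (simp add: diff_divide_distrib)
  also have "\<bar>\<dots>\<bar> \<le> (fejer_weight3 n (p - a) + fejer_weight3 n (p - b)) / (2 * pi)"
  proof -
    have "\<bar>(rho (p - a) - fejer_prim n (p - a)) - (rho (p - b) - fejer_prim n (p - b))\<bar> \<le> fejer_weight3 n (p - a) + fejer_weight3 n (p - b)"
      using r[of "p - a"] r[of "p - b"] ab p by auto
    then show ?thesis by (simp add: abs_divide divide_right_mono)
  qed
  also have "\<dots> \<le> fejer_weight3 n (p - a) + fejer_weight3 n (p - b)"
  proof -
    have "0 \<le> fejer_weight3 n (p - a) + fejer_weight3 n (p - b)" by (simp add: fejer_weight3_def fejer_weight_nonneg)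
    moreover have "2 * pi \<ge> 1" using pi_gt3 by simp
    ultimately show ?thesis using divide_left_mono[of 1 "2 * pi"] by simp
  qed
  finally show ?thesis .
qed

lemma harmonic_le: "(\<Sum>k\<in>{1..m}. 1 / real k) \<le> 1 + ln (real m)" if "m \<ge> 1" for m :: nat
  using that
proof (induction m rule: dec_induct)
  case (step m)
  have m: "real m > 0" using step by simp
  have "ln (real m / real (Suc m)) \<le> real m / real (Suc m) - 1" using m by (intro ln_le_minus_one) auto
  also have "\<dots> = - (1 / real (Suc m))" by (simp add: field_simps)
  finally have "1 / real (Suc m) \<le> ln (real (Suc m)) - ln (real m)" using m by (simp add: ln_div)
  then show ?case using step by simp
qed simp

lemma ln_ge_1: "n \<ge> 2 \<Longrightarrow> ln (real n + 1) \<ge> 1"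
proof -
  assume "n \<ge> 2"
  then have "exp 1 \<le> real n + 1" using exp_le by linarith
  then show ?thesis by (simp add: ln_ge_iff)
qed

text \<open>The points are sorted by the integer part \<open>\<kappa>\<close> of (n + 1) |4 \<theta>
  - \<tau>|. Each class lies in two sectors of width 1 / (4 (n + 1)), so \<open>cnt\<close> bounds
  all classes alike, and the weight on class k is at most 72 / (k + 1). The harmonic sum gives the
  logarithm.\<close>

lemma sum_fejer_weight_le:
  fixes \<theta> :: "'a \<Rightarrow> real"
  assumes X: "finite X" and th: "\<And>a. a \<in> X \<Longrightarrow> 0 \<le> \<theta> a \<and> \<theta> a < pi / 2"
    and cnt: "\<And>\<alpha> \<beta>. \<alpha> \<le> \<beta> \<Longrightarrow> real (card {a \<in> X. \<alpha> \<le> \<theta> a \<and> \<theta> a \<le> \<beta>}) \<le> K * ((\<beta> - \<alpha>) * x + s)"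
    and K: "K \<ge> 0" "x \<ge> 0" "s \<ge> 0" and n: "n \<ge> 2" and tau: "\<bar>\<tau>\<bar> \<le> 4 * pi"
  shows "(\<Sum>a\<in>X. fejer_weight n (4 * \<theta> a - \<tau>)) \<le> 1008 * K * ln (real n + 1) * (x / real n + s)"
proof -
  define M where "M = real (n + 1)"
  have M: "M > 0" by (simp add: M_def)
  define \<kappa> where "\<kappa> = (\<lambda>a. nat \<lfloor>M * \<bar>4 * \<theta> a - \<tau>\<bar>\<rfloor>)"
  have kap: "real (\<kappa> a) \<le> M * \<bar>4 * \<theta> a - \<tau>\<bar>" "M * \<bar>4 * \<theta> a - \<tau>\<bar> < real (\<kappa> a) + 1" for a
  proof -
    have "0 \<le> M * \<bar>4 * \<theta> a - \<tau>\<bar>" using M by simp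
    then show "real (\<kappa> a) \<le> M * \<bar>4 * \<theta> a - \<tau>\<bar>" "M * \<bar>4 * \<theta> a - \<tau>\<bar> < real (\<kappa> a) + 1"
      unfolding \<kappa>_def by linarith+
  qed
  have w: "fejer_weight n (4 * \<theta> a - \<tau>) \<le> 72 * (1 / real (Suc (\<kappa> a)))" for a
  proof (cases "M * \<bar>4 * \<theta> a - \<tau>\<bar> \<le> 1")
    case True
    then have "real (\<kappa> a) \<le> 1" using kap(1)[of a] by linarith
    then have "36 \<le> 72 * (1 / real (Suc (\<kappa> a)))" by (simp add: field_simps)
    then show ?thesis using True pi_less_4 by (simp add: fejer_weight_def M_def)
  next
    case False
    define v where "v = M * \<bar>4 * \<theta> a - \<tau>\<bar>"
    have v: "v > 1" "real (\<kappa> a) \<le> v" using False kap by (auto simp: v_def)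
    have "fejer_weight n (4 * \<theta> a - \<tau>) = 36 / v" using False by (simp add: fejer_weight_def M_def v_def)
    also have "\<dots> \<le> 72 * (1 / real (Suc (\<kappa> a)))" using v by (simp add: field_simps)
    finally show ?thesis .
  qed
  \<comment> \<open>4 \<theta> < 2 pi < 8 and |\<tau>| \<le> 4 pi < 16, so (n + 1) |4 \<theta> -
    \<tau>| \<le> 24 (n + 1), which is below \<open>m\<close>.\<close>
  define m where "m = 25 * (n + 1)"
  have kb: "\<kappa> a < m" if "a \<in> X" for a
  proof -
    have "\<bar>4 * \<theta> a - \<tau>\<bar> \<le> 24" using th[OF that] tau pi_less_4 by linarith
    then have "M * \<bar>4 * \<theta> a - \<tau>\<bar> \<le> M * 24" using M by (intro mult_left_mono) auto
    then have "real (\<kappa> a) \<le> M * 24" using kap(1)[of a] by linarith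
    also have "\<dots> < real m" by (simp add: M_def m_def)
    finally show ?thesis by simp
  qed
  have cardk: "real (card {a \<in> X. \<kappa> a = k}) \<le> 2 * K * (x / real n + s)" for k
  proof -
    define A1 where "A1 = {a \<in> X. (\<tau> + real k / M) / 4 \<le> \<theta> a \<and> \<theta> a \<le> (\<tau> + (real k + 1) / M) / 4}"
    define A2 where "A2 = {a \<in> X. (\<tau> - (real k + 1) / M) / 4 \<le> \<theta> a \<and> \<theta> a \<le> (\<tau> - real k / M) / 4}"
    have sub: "{a \<in> X. \<kappa> a = k} \<subseteq> A1 \<union> A2"
    proof
      fix a assume a: "a \<in> {a \<in> X. \<kappa> a = k}"
      then have "real k \<le> M * \<bar>4 * \<theta> a - \<tau>\<bar>" "M * \<bar>4 * \<theta> a - \<tau>\<bar> < real k + 1" using kap[of a] by auto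
      then have "real k / M \<le> \<bar>4 * \<theta> a - \<tau>\<bar>" "\<bar>4 * \<theta> a - \<tau>\<bar> \<le> (real k + 1) / M" using M by (simp_all add: field_simps)
      then show "a \<in> A1 \<union> A2" using a unfolding A1_def A2_def by (cases "4 * \<theta> a - \<tau> \<ge> 0") auto
    qed
    have d: "(real k + 1) / M - real k / M = 1 / M" by (simp add: add_divide_distrib)
    have "1 / M \<le> 1 / real n" using n by (simp add: M_def frac_le)
    then have "x * (1 / M) \<le> x * (1 / real n)" using K by (intro mult_left_mono) auto
    moreover have "1 / M / 4 * x = x * (1 / M) / 4" "x * (1 / M) \<ge> 0" using K M by simp_all
    ultimately have xn: "1 / M / 4 * x \<le> x / real n" by simp
    have e: "K * (1 / M / 4 * x + s) \<le> K * (x / real n + s)" using xn K by (intro mult_left_mono) auto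
    have km: "real k / M \<le> (real k + 1) / M" using M by (intro divide_right_mono) auto
    have "(\<tau> + real k / M) / 4 \<le> (\<tau> + (real k + 1) / M) / 4" "(\<tau> - (real k + 1) / M) / 4 \<le> (\<tau> - real k / M) / 4"
      using divide_right_mono[OF add_left_mono[OF km], of 4 \<tau>] divide_right_mono[OF diff_left_mono[OF km], of 4 \<tau>] by simp_all
    from this[THEN cnt] have "real (card A1) \<le> K * (((\<tau> + (real k + 1) / M) / 4 - (\<tau> + real k / M) / 4) * x + s)"
       "real (card A2) \<le> K * (((\<tau> - real k / M) / 4 - (\<tau> - (real k + 1) / M) / 4) * x + s)"
      unfolding A1_def A2_def .
    moreover have "(\<tau> + (real k + 1) / M) / 4 - (\<tau> + real k / M) / 4 = 1 / M / 4" "(\<tau> - real k / M) / 4 - (\<tau> - (real k + 1) / M) / 4 = 1 / M / 4"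
      using d by (simp_all add: diff_divide_distrib[symmetric])
    ultimately have "real (card A1) \<le> K * (x / real n + s)" "real (card A2) \<le> K * (x / real n + s)" using e by auto
    moreover have "card {a \<in> X. \<kappa> a = k} \<le> card A1 + card A2"
    proof -
      have "finite (A1 \<union> A2)" unfolding A1_def A2_def using X by simp
      then have "card {a \<in> X. \<kappa> a = k} \<le> card (A1 \<union> A2)" using sub by (intro card_mono)
      also have "\<dots> \<le> card A1 + card A2" by (rule card_Un_le)
      finally show ?thesis .
    qed
    ultimately show ?thesis by linarith
  qed
  have "(\<Sum>a\<in>X. fejer_weight n (4 * \<theta> a - \<tau>)) \<le> (\<Sum>a\<in>X. 72 * (1 / real (Suc (\<kappa> a))))" by (rule sum_mono) (rule w)
  also have "\<dots> = (\<Sum>k\<in>{..<m}. \<Sum>a | a \<in> X \<and> \<kappa> a = k. 72 * (1 / real (Suc (\<kappa> a))))"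
    by (rule sum.group[symmetric]) (use X kb in auto)
  also have "\<dots> = (\<Sum>k\<in>{..<m}. real (card {a \<in> X. \<kappa> a = k}) * (72 * (1 / real (Suc k))))" by simp
  also have "\<dots> \<le> (\<Sum>k\<in>{..<m}. (2 * K * (x / real n + s)) * (72 * (1 / real (Suc k))))"
    by (intro sum_mono mult_right_mono cardk) auto
  also have "\<dots> = 144 * K * (x / real n + s) * (\<Sum>k\<in>{..<m}. 1 / real (Suc k))"
    unfolding sum_distrib_left by (intro sum.cong refl) (simp add: mult_ac)
  also have "(\<Sum>k\<in>{..<m}. 1 / real (Suc k)) = (\<Sum>k\<in>{1..m}. 1 / real k)"
    by (rule sum.reindex_bij_witness[of _ "\<lambda>k. k - 1" Suc]) auto
  also have "144 * K * (x / real n + s) * \<dots> \<le> 144 * K * (x / real n + s) * (7 * ln (real n + 1))"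
  proof (rule mult_left_mono)
    have l2: "ln (2::real) \<le> 1" using ln_le_minus_one[of 2] by simp
    have "(\<Sum>k\<in>{1..m}. 1 / real k) \<le> 1 + ln (real m)" by (rule harmonic_le) (simp add: m_def)
    \<comment> \<open>25 \<le> 2^5 makes the harmonic sum at most 1 + 5 ln 2 + ln (n + 1) \<le> 7 ln
      (n + 1). Together with the factor 144 this is the constant 1008.\<close>
    also have "ln (real m) \<le> ln (2 ^ 5 * (real n + 1))" by (simp add: m_def)
    also have "\<dots> = 5 * ln 2 + ln (real n + 1)" 
    proof -
      have "ln ((2::real) ^ 5) = 5 * ln 2" by (subst ln_realpow) simp_all
      then show ?thesis by (subst ln_mult) auto
    qed
    finally show "(\<Sum>k\<in>{1..m}. 1 / real k) \<le> 7 * ln (real n + 1)" using l2 ln_ge_1[OF n] by linarith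
    show "0 \<le> 144 * K * (x / real n + s)" using K by simp
  qed
  finally show ?thesis by (simp add: algebra_simps)
qed

text \<open>Multiplying the angle by 4 turns [0, pi/2) into a full circle, on which \<open>B\<close>
  bounds the twisted sums. The mean value of the trigonometric polynomial \<open>V\<close> supplies
  the expected proportion, its sine terms are bounded by \<open>B\<close>, and \<open>I - V\<close>
  is paid for by sector counts.\<close>

theorem arc_discrepancy:
  fixes \<theta> :: "'a \<Rightarrow> real" and f :: "'a \<Rightarrow> complex"
  assumes X: "finite X" and th: "\<And>a. a \<in> X \<Longrightarrow> 0 \<le> \<theta> a \<and> \<theta> a < pi / 2"
    and f: "\<And>a. a \<in> X \<Longrightarrow> cmod (f a) \<le> 1"
    and cnt: "\<And>\<alpha> \<beta>. \<alpha> \<le> \<beta> \<Longrightarrow> real (card {a \<in> X. \<alpha> \<le> \<theta> a \<and> \<theta> a \<le> \<beta>}) \<le> K * ((\<beta> - \<alpha>) * x + s)"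
    and K: "K \<ge> 0" "x \<ge> 0" "s \<ge> 0" and n: "n \<ge> 2"
    and B: "\<And>m. 1 \<le> \<bar>m\<bar> \<Longrightarrow> \<bar>m\<bar> \<le> int n \<Longrightarrow> cmod (\<Sum>a\<in>X. f a * cis (of_int m * (4 * \<theta> a))) \<le> B"
    and t: "0 \<le> \<theta>1" "\<theta>1 \<le> \<theta>2" "\<theta>2 \<le> pi / 2"
  shows "cmod ((\<Sum>a | a \<in> X \<and> \<theta> a \<in> {\<theta>1..<\<theta>2}. f a) - of_real ((\<theta>2 - \<theta>1) / (pi / 2)) * (\<Sum>a\<in>X. f a))
     \<le> ln (real n + 1) * (2 * B + 6048 * K * (x / real n + s))"
proof -
  define a1 b1 where "a1 = 4 * \<theta>1" and "b1 = 4 * \<theta>2"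
  have ab: "0 \<le> a1" "a1 \<le> b1" "b1 \<le> 2 * pi" using t by (auto simp: a1_def b1_def)
  define p where "p = (\<lambda>a. 4 * \<theta> a)"
  have p: "0 \<le> p a" "p a < 2 * pi" if "a \<in> X" for a using th[OF that] by (auto simp: p_def)
  define V where "V = (\<lambda>a. (fejer_prim n (p a - a1) - fejer_prim n (p a - b1)) / (2 * pi))"
  define I where "I = (\<lambda>a. if a1 \<le> p a \<and> p a < b1 then 1 else (0::real))"
  define w where "w = (\<lambda>m. (1 - real m / real (n + 1)) / real m)"
  have "(\<Sum>a | a \<in> X \<and> \<theta> a \<in> {\<theta>1..<\<theta>2}. f a) = (\<Sum>a\<in>X. f a * of_real (I a))"
  proof -
    have "(\<Sum>a\<in>X. f a * of_real (I a)) = (\<Sum>a\<in>X. if \<theta> a \<in> {\<theta>1..<\<theta>2} then f a else 0)"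
      by (intro sum.cong refl) (auto simp: I_def a1_def b1_def p_def)
    then show ?thesis using X by (simp add: sum.inter_filter)
  qed
  also have "\<dots> = (\<Sum>a\<in>X. f a * of_real (I a - V a)) + (\<Sum>a\<in>X. f a * of_real (V a))"
    by (simp add: algebra_simps flip: sum.distrib)
  finally have 1: "(\<Sum>a | a \<in> X \<and> \<theta> a \<in> {\<theta>1..<\<theta>2}. f a) = \<dots>" .
  have 2: "cmod (\<Sum>a\<in>X. f a * of_real (I a - V a)) \<le> 6048 * K * ln (real n + 1) * (x / real n + s)"
  proof -
    \<comment> \<open>Three translates for each of the two end points use \<open>W\<close> six
      times, and 6 * 1008 = 6048.\<close>
    define W where "W = 1008 * K * ln (real n + 1) * (x / real n + s)"
    have fs: "(\<Sum>a\<in>X. fejer_weight n (4 * \<theta> a - \<tau>)) \<le> W" if "\<bar>\<tau>\<bar> \<le> 4 * pi" for \<tau>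
      unfolding W_def by (rule sum_fejer_weight_le[OF X th cnt K n that])
    have f3: "(\<Sum>a\<in>X. fejer_weight3 n (p a - \<tau>)) \<le> 3 * W" if "0 \<le> \<tau>" "\<tau> \<le> 2 * pi" for \<tau>
    proof -
      have "(\<Sum>a\<in>X. fejer_weight3 n (p a - \<tau>)) = (\<Sum>a\<in>X. fejer_weight n (4 * \<theta> a - \<tau>)) + (\<Sum>a\<in>X. fejer_weight n (4 * \<theta> a - (\<tau> + 2 * pi))) + (\<Sum>a\<in>X. fejer_weight n (4 * \<theta> a - (\<tau> - 2 * pi)))"
        by (simp add: fejer_weight3_def p_def sum.distrib algebra_simps)
      then show ?thesis using fs[of \<tau>] fs[of "\<tau> + 2 * pi"] fs[of "\<tau> - 2 * pi"] that by auto
    qed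
    have "cmod (\<Sum>a\<in>X. f a * of_real (I a - V a)) \<le> (\<Sum>a\<in>X. fejer_weight3 n (p a - a1) + fejer_weight3 n (p a - b1))"
    proof (rule order_trans[OF norm_sum sum_mono])
      fix a assume a: "a \<in> X"
      have "cmod (f a * of_real (I a - V a)) \<le> 1 * \<bar>I a - V a\<bar>"
        unfolding norm_mult norm_of_real using f[OF a] by (intro mult_right_mono) auto
      also have "\<dots> \<le> fejer_weight3 n (p a - a1) + fejer_weight3 n (p a - b1)"
        unfolding I_def V_def using indicator_fejer[OF ab p[OF a], of n] by simp
      finally show "cmod (f a * of_real (I a - V a)) \<le> fejer_weight3 n (p a - a1) + fejer_weight3 n (p a - b1)" .
    qed
    also have "\<dots> \<le> 3 * W + 3 * W" unfolding sum.distrib using ab by (intro add_mono f3) auto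
    finally show ?thesis by (simp add: W_def)
  qed
  \<comment> \<open>A sine combines the frequencies m and -m, so the hypothesis on \<open>B\<close>
    is used for both signs.\<close>
  have Bs: "cmod (\<Sum>a\<in>X. f a * of_real (sin (real m * (p a - \<tau>)))) \<le> B" if m: "1 \<le> m" "m \<le> n" for m \<tau>
  proof -
    have s: "complex_of_real (sin y) = (cis y - cis (- y)) / (2 * \<i>)" for y
      by (simp add: complex_eq_iff)
    have "(\<Sum>a\<in>X. f a * of_real (sin (real m * (p a - \<tau>))))
       = (cis (- (real m * \<tau>)) * (\<Sum>a\<in>X. f a * cis (of_int (int m) * (4 * \<theta> a))) - cis (real m * \<tau>) * (\<Sum>a\<in>X. f a * cis (of_int (- int m) * (4 * \<theta> a)))) / (2 * \<i>)"
      unfolding s sum_distrib_left sum_subtractf[symmetric] sum_divide_distrib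
    proof (intro sum.cong refl)
      fix a
      have e: "cis (real m * (p a - \<tau>)) = cis (- (real m * \<tau>)) * cis (of_int (int m) * (4 * \<theta> a))"
        "cis (- (real m * (p a - \<tau>))) = cis (real m * \<tau>) * cis (of_int (- int m) * (4 * \<theta> a))"
        by (simp_all add: cis_mult p_def algebra_simps)
      show "f a * ((cis (real m * (p a - \<tau>)) - cis (- (real m * (p a - \<tau>)))) / (2 * \<i>)) =
         (cis (- (real m * \<tau>)) * (f a * cis (of_int (int m) * (4 * \<theta> a))) - cis (real m * \<tau>) * (f a * cis (of_int (- int m) * (4 * \<theta> a)))) / (2 * \<i>)"
        unfolding e by (simp add: algebra_simps)
    qed
    also have "cmod \<dots> \<le> (B + B) / 2"
    proof -
      have "cmod (cis (- (real m * \<tau>)) * (\<Sum>a\<in>X. f a * cis (of_int (int m) * (4 * \<theta> a))) - cis (real m * \<tau>) * (\<Sum>a\<in>X. f a * cis (of_int (- int m) * (4 * \<theta> a)))) \<le> B + B"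
        by (rule order_trans[OF norm_triangle_ineq4 add_mono]) (use B[of "int m"] B[of "- int m"] m in \<open>simp_all add: norm_mult\<close>)
      then show ?thesis by (simp add: norm_divide norm_mult)
    qed
    finally show ?thesis by simp
  qed
  have Veq: "V a = (\<theta>2 - \<theta>1) / (pi / 2) + (1 / pi) * (\<Sum>m=1..n. w m * (sin (real m * (p a - a1)) - sin (real m * (p a - b1))))" for a
  proof -
    have "fejer_prim n (p a - a1) - fejer_prim n (p a - b1) = 4 * (\<theta>2 - \<theta>1) + 2 * (\<Sum>m=1..n. w m * (sin (real m * (p a - a1)) - sin (real m * (p a - b1))))"
      by (simp add: fejer_prim_def w_def a1_def b1_def right_diff_distrib sum_subtractf)
    then have "V a = (4 * (\<theta>2 - \<theta>1) + 2 * (\<Sum>m=1..n. w m * (sin (real m * (p a - a1)) - sin (real m * (p a - b1))))) / (2 * pi)"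
      unfolding V_def by (simp only:)
    then show ?thesis by (simp only: add_divide_distrib) (simp add: divide_simps)
  qed
  have "(\<Sum>a\<in>X. f a * of_real (V a)) = of_real ((\<theta>2 - \<theta>1) / (pi / 2)) * (\<Sum>a\<in>X. f a)
     + of_real (1 / pi) * (\<Sum>a\<in>X. \<Sum>m=1..n. of_real (w m) * (f a * of_real (sin (real m * (p a - a1))) - f a * of_real (sin (real m * (p a - b1)))))"
  proof -
    have "f a * of_real (V a) = of_real ((\<theta>2 - \<theta>1) / (pi / 2)) * f a
      + of_real (1 / pi) * (\<Sum>m=1..n. of_real (w m) * (f a * of_real (sin (real m * (p a - a1))) - f a * of_real (sin (real m * (p a - b1)))))" for a
    proof -
      have "(\<Sum>m=1..n. of_real (w m) * (f a * of_real (sin (real m * (p a - a1))) - f a * of_real (sin (real m * (p a - b1)))))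
        = f a * of_real (\<Sum>m=1..n. w m * (sin (real m * (p a - a1)) - sin (real m * (p a - b1))))"
        unfolding of_real_sum sum_distrib_left by (intro sum.cong refl) (simp add: algebra_simps)
      then show ?thesis unfolding Veq of_real_add of_real_mult by (simp only: algebra_simps)
    qed
    then show ?thesis by (simp only: sum.distrib sum_distrib_left)
  qed
  also have "(\<Sum>a\<in>X. \<Sum>m=1..n. of_real (w m) * (f a * of_real (sin (real m * (p a - a1))) - f a * of_real (sin (real m * (p a - b1)))))
    = (\<Sum>m=1..n. of_real (w m) * ((\<Sum>a\<in>X. f a * of_real (sin (real m * (p a - a1)))) - (\<Sum>a\<in>X. f a * of_real (sin (real m * (p a - b1))))))"
    by (subst sum.swap) (simp only: sum_distrib_left[symmetric] sum_subtractf)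
  finally have 3: "(\<Sum>a\<in>X. f a * of_real (V a)) - of_real ((\<theta>2 - \<theta>1) / (pi / 2)) * (\<Sum>a\<in>X. f a) = of_real (1 / pi) * \<dots>"
    by (simp only: add_diff_cancel_left')
  have B0: "B \<ge> 0" using n by (intro order_trans[OF norm_ge_zero B[of 1]]) simp_all
  have "cmod (\<Sum>m=1..n. of_real (w m) * ((\<Sum>a\<in>X. f a * of_real (sin (real m * (p a - a1)))) - (\<Sum>a\<in>X. f a * of_real (sin (real m * (p a - b1)))))) \<le> (\<Sum>m=1..n. (1 / real m) * (2 * B))"
  proof (rule order_trans[OF norm_sum sum_mono])
    fix m assume m: "m \<in> {1..n}"
    have w: "\<bar>w m\<bar> \<le> 1 / real m"
    proof -
      have "0 \<le> 1 - real m / real (n + 1)" "1 - real m / real (n + 1) \<le> 1" using m by (auto simp: field_simps)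
      then show ?thesis unfolding w_def using m by (simp add: abs_divide divide_right_mono)
    qed
    have "cmod ((\<Sum>a\<in>X. f a * of_real (sin (real m * (p a - a1)))) - (\<Sum>a\<in>X. f a * of_real (sin (real m * (p a - b1))))) \<le> 2 * B"
      using norm_triangle_ineq4[of "\<Sum>a\<in>X. f a * of_real (sin (real m * (p a - a1)))" "\<Sum>a\<in>X. f a * of_real (sin (real m * (p a - b1)))"] Bs[of m a1] Bs[of m b1] m by auto
    then show "cmod (of_real (w m) * ((\<Sum>a\<in>X. f a * of_real (sin (real m * (p a - a1)))) - (\<Sum>a\<in>X. f a * of_real (sin (real m * (p a - b1)))))) \<le> (1 / real m) * (2 * B)"
      unfolding norm_mult norm_of_real using w by (intro mult_mono) auto
  qed
  also have "\<dots> = (\<Sum>m=1..n. 1 / real m) * (2 * B)" by (rule sum_distrib_right[symmetric])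
  also have "\<dots> \<le> (2 * ln (real n + 1)) * (2 * B)"
  proof (rule mult_right_mono)
    have "(\<Sum>m=1..n. 1 / real m) \<le> 1 + ln (real n)" using n by (intro harmonic_le) auto
    also have "ln (real n) \<le> ln (real n + 1)" using n by simp
    finally show "(\<Sum>m=1..n. 1 / real m) \<le> 2 * ln (real n + 1)" using ln_ge_1[OF n] by linarith
  qed (use B0 in auto)
  finally have "cmod ((\<Sum>a\<in>X. f a * of_real (V a)) - of_real ((\<theta>2 - \<theta>1) / (pi / 2)) * (\<Sum>a\<in>X. f a)) \<le> (1 / pi) * ((2 * ln (real n + 1)) * (2 * B))"
    unfolding 3 norm_mult norm_of_real by (simp add: abs_divide divide_right_mono)
  also have "\<dots> \<le> (1 / 2) * ((2 * ln (real n + 1)) * (2 * B))"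
    using pi_gt3 B0 by (intro mult_right_mono frac_le) auto
  finally have 4: "cmod ((\<Sum>a\<in>X. f a * of_real (V a)) - of_real ((\<theta>2 - \<theta>1) / (pi / 2)) * (\<Sum>a\<in>X. f a)) \<le> 2 * B * ln (real n + 1)" by simp
  have "cmod ((\<Sum>a | a \<in> X \<and> \<theta> a \<in> {\<theta>1..<\<theta>2}. f a) - of_real ((\<theta>2 - \<theta>1) / (pi / 2)) * (\<Sum>a\<in>X. f a))
     \<le> cmod (\<Sum>a\<in>X. f a * of_real (I a - V a)) + cmod ((\<Sum>a\<in>X. f a * of_real (V a)) - of_real ((\<theta>2 - \<theta>1) / (pi / 2)) * (\<Sum>a\<in>X. f a))"
    unfolding 1 add_diff_eq[symmetric] by (rule norm_triangle_ineq)
  with 2 4 show ?thesis by (simp add: algebra_simps)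
qed

section \<open>Mean values of Dirichlet series\<close>

text \<open>The residue of exp(i v w) / (w^2 + 1) at i, taken on the rectangle with base [-R, R] and
  height R. For v \<ge> 0 the exponential is at most 1 in the upper half plane; the other three
  sides have total length 4 R and stay at distance at least R from 0.\<close>

lemma cauchy_kernel_contour:
  fixes v R :: real
  assumes v: "v \<ge> 0" and R: "R > 1"
  shows "cmod (integral {-R..R} (\<lambda>t. exp (\<i> * of_real (v * t)) / of_real (1 + t\<^sup>2)) - of_real (pi * exp (- v)))
           \<le> 4 * R / (R\<^sup>2 - 1)"
proof -
  define f where "f = (\<lambda>w. exp (\<i> * of_real v * w) / (w + \<i>))"
  define g where "g = (\<lambda>w. f w / (w - \<i>))"
  \<comment> \<open>A convex open set that contains the rectangle and the pole i but not -i, so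
    \<open>f\<close> is holomorphic on it.\<close>
  define S where "S = {w. Im w > - (1/2)}"
  have geq: "g w = exp (\<i> * of_real v * w) / (w\<^sup>2 + 1)" for w
    by (simp add: g_def f_def power2_eq_square algebra_simps)
  have S: "convex S" "open S"
    unfolding S_def using convex_halfspace_Im_gt open_halfspace_Im_gt by auto
  have hol: "f holomorphic_on S"
    unfolding f_def by (intro holomorphic_intros) (auto simp: S_def complex_eq_iff)
  define a1 a3 where "a1 = Complex (-R) 0" and "a3 = Complex R R"
  define b0 where "b0 = Complex R 0"
  define c0 where "c0 = Complex (-R) R"
  have rp: "rectpath a1 a3 = linepath a1 b0 +++ linepath b0 a3 +++ linepath a3 c0 +++ linepath c0 a1"
    by (simp add: rectpath_def a1_def a3_def Let_def b0_def c0_def)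
  have iin: "\<i> \<in> box a1 a3" using R by (auto simp: in_box_complex_iff a1_def a3_def)
  have pI: "path_image (rectpath a1 a3) \<subseteq> S - {\<i>}"
  proof -
    have "path_image (rectpath a1 a3) \<subseteq> cbox a1 a3 - box a1 a3"
      using R by (subst path_image_rectpath_cbox_minus_box) (auto simp: a1_def a3_def)
    moreover have "cbox a1 a3 \<subseteq> S" using R by (auto simp: in_cbox_complex_iff a1_def a3_def S_def)
    ultimately show ?thesis using iin by auto
  qed
  have "(g has_contour_integral (2*pi * \<i> * winding_number (rectpath a1 a3) \<i> * f \<i>)) (rectpath a1 a3)"
    unfolding g_def
  proof (rule Cauchy_integral_formula_convex_simple[OF S(1) hol])
    show "\<i> \<in> interior S" using S by (simp add: interior_open S_def)
  qed (use pI in auto)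
  moreover have "2*pi * \<i> * winding_number (rectpath a1 a3) \<i> * f \<i> = of_real (pi * exp (- v))"
    using winding_number_rectpath[OF iin] by (simp add: f_def field_simps exp_of_real[symmetric])
  ultimately have gI: "(g has_contour_integral of_real (pi * exp (- v))) (rectpath a1 a3)" by metis
  have ci: "g contour_integrable_on linepath p q" if "closed_segment p q \<subseteq> path_image (rectpath a1 a3)" for p q
  proof -
    have "continuous_on (closed_segment p q) g"
      unfolding g_def using that pI hol
      by (intro continuous_intros continuous_on_subset[OF holomorphic_on_imp_continuous_on[OF hol]]) auto
    then show ?thesis by (rule contour_integrable_continuous_linepath)
  qed
  have pim: "path_image (rectpath a1 a3) = closed_segment a1 b0 \<union> closed_segment b0 a3 \<union> closed_segment a3 c0 \<union> closed_segment c0 a1"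
    unfolding rp by (simp add: path_image_join Un_assoc)
  have c4: "g contour_integrable_on linepath a1 b0" "g contour_integrable_on linepath b0 a3"
      "g contour_integrable_on linepath a3 c0" "g contour_integrable_on linepath c0 a1"
    by (rule ci, use pim in blast)+
  have tot: "of_real (pi * exp (- v)) = contour_integral (linepath a1 b0) g + (contour_integral (linepath b0 a3) g
       + (contour_integral (linepath a3 c0) g + contour_integral (linepath c0 a1) g))"
    using contour_integral_unique[OF gI] c4 unfolding rp by simp
  have nb: "cmod (g w) \<le> 1 / (R\<^sup>2 - 1)" if "Im w \<ge> 0" "cmod w \<ge> R" for w
  proof -
    have "R\<^sup>2 \<le> (cmod w)\<^sup>2" using that R by (intro power_mono) auto
    moreover have "cmod (w\<^sup>2 + 1) \<ge> cmod (w\<^sup>2) - 1" using norm_triangle_ineq2[of "w\<^sup>2" "-1"] by simp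
    ultimately have 1: "cmod (w\<^sup>2+1) \<ge> R\<^sup>2 - 1" by (simp add: norm_power)
    have 2: "cmod (exp (\<i> * of_real v * w)) \<le> 1" using v that by simp
    have "R\<^sup>2 > 1" using R by (simp add: one_less_power)
    then show ?thesis unfolding geq norm_divide using 1 2 by (intro frac_le) auto
  qed
  have R2: "R\<^sup>2 > 1" using R by (simp add: one_less_power)
  have RR: "\<bar>Re w\<bar> \<le> cmod w" "\<bar>Im w\<bar> \<le> cmod w" for w
    by (rule abs_Re_le_cmod, rule abs_Im_le_cmod)
  have seg: "Im w \<ge> 0 \<and> cmod w \<ge> R" if "w \<in> closed_segment b0 a3 \<or> w \<in> closed_segment a3 c0 \<or> w \<in> closed_segment c0 a1" for w
  proof -
    have "Im w \<ge> 0 \<and> (\<bar>Re w\<bar> = R \<or> \<bar>Im w\<bar> = R)"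
      using that R by (auto simp: b0_def a3_def c0_def a1_def closed_segment_same_Re closed_segment_same_Im closed_segment_eq_real_ivl)
    then show ?thesis using RR[of w] by auto
  qed
  have e1: "cmod (contour_integral (linepath b0 a3) g) \<le> 1/(R\<^sup>2-1) * cmod (a3 - b0)"
    by (rule has_contour_integral_bound_linepath[OF has_contour_integral_integral[OF c4(2)]]) (use nb seg R2 in auto)
  have e2: "cmod (contour_integral (linepath a3 c0) g) \<le> 1/(R\<^sup>2-1) * cmod (c0 - a3)"
    by (rule has_contour_integral_bound_linepath[OF has_contour_integral_integral[OF c4(3)]]) (use nb seg R2 in auto)
  have e3: "cmod (contour_integral (linepath c0 a1) g) \<le> 1/(R\<^sup>2-1) * cmod (a1 - c0)"
    by (rule has_contour_integral_bound_linepath[OF has_contour_integral_integral[OF c4(4)]]) (use nb seg R2 in auto)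
  have d: "cmod (a3 - b0) = R" "cmod (c0 - a3) = 2 * R" "cmod (a1 - c0) = R"
    using R by (simp_all add: a3_def b0_def c0_def a1_def cmod_def real_sqrt_mult)
  have "contour_integral (linepath a1 b0) g = integral {-R..R} (\<lambda>t. g (of_real t))"
    using contour_integral_linepath_Reals_eq[of a1 b0 g] R by (simp add: a1_def b0_def complex_is_Real_iff)
  also have "\<dots> = integral {-R..R} (\<lambda>t. exp (\<i> * of_real (v * t)) / of_real (1 + t\<^sup>2))"
    by (simp add: geq algebra_simps)
  finally have "integral {-R..R} (\<lambda>t. exp (\<i> * of_real (v * t)) / of_real (1 + t\<^sup>2)) - of_real (pi * exp (- v))
      = - (contour_integral (linepath b0 a3) g + (contour_integral (linepath a3 c0) g + contour_integral (linepath c0 a1) g))"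
    using tot by (simp add: algebra_simps)
  also have "cmod \<dots> \<le> 1/(R\<^sup>2-1) * R + (1/(R\<^sup>2-1) * (2*R) + 1/(R\<^sup>2-1)*R)"
    unfolding norm_minus_cancel using e1 e2 e3 unfolding d
    by (intro norm_triangle_mono) auto
  also have "\<dots> = 4 * R / (R\<^sup>2-1)" by (simp add: add_divide_distrib[symmetric])
  finally show ?thesis .
qed

lemma integrable_cauchy1: "integrable lborel (\<lambda>t::real. 1 / (1 + t\<^sup>2))"
  using integrable_inverse_1_plus_square by (simp add: set_integrable_def divide_inverse)

lemma integral_cauchy_ft1:
  fixes v :: real assumes v: "v \<ge> 0"
  shows "(LBINT t. exp (\<i> * of_real (v * t)) / of_real (1 + t\<^sup>2)) = of_real (pi * exp (- v))"
    and "integrable lborel (\<lambda>t. exp (\<i> * of_real (v * t)) / of_real (1 + t\<^sup>2))"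
proof -
  let ?f = "\<lambda>t. exp (\<i> * of_real (v * t)) / of_real (1 + t\<^sup>2)"
  have nf: "cmod (?f t) = 1 / (1 + t\<^sup>2)" for t
  proof -
    have "cmod (of_real (1 + t\<^sup>2)) = 1 + t\<^sup>2" by (simp only: norm_of_real) simp
    then show ?thesis by (simp only: norm_divide) simp
  qed
  show int: "integrable lborel ?f"
    by (rule Bochner_Integration.integrable_bound[OF integrable_cauchy1]) (use nf in auto)
  have "(\<lambda>n. integral {- real (n+2)..real (n+2)} ?f) \<longlonglongrightarrow> (LBINT t. ?f t)"
  proof -
    have "(\<lambda>n. LBINT t. indicator {- real (n+2)..real (n+2)} t *\<^sub>R ?f t) \<longlonglongrightarrow> (LBINT t. ?f t)"
    proof (rule integral_dominated_convergence[OF _ _ integrable_cauchy1])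
      show "AE t in lborel. (\<lambda>n. indicator {- real (n+2)..real (n+2)} t *\<^sub>R ?f t) \<longlonglongrightarrow> ?f t"
      proof (rule AE_I2)
        fix t :: real
        have "eventually (\<lambda>n. indicator {- real (n+2)..real (n+2)} t *\<^sub>R ?f t = ?f t) sequentially"
          using eventually_ge_at_top[of "nat \<lceil>\<bar>t\<bar>\<rceil>"]
        proof eventually_elim
          case (elim n)
          then have "\<bar>t\<bar> \<le> real n" by linarith
          then show ?case by (auto simp: indicator_def)
        qed
        then show "(\<lambda>n. indicator {- real (n+2)..real (n+2)} t *\<^sub>R ?f t) \<longlonglongrightarrow> ?f t"
          by (rule tendsto_eventually)
      qed
    next
      show "\<And>n. AE t in lborel. norm (indicator {- real (n+2)..real (n+2)} t *\<^sub>R ?f t) \<le> 1/(1+t\<^sup>2)"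
        using nf by (auto simp: indicator_def simp del: of_real_add)
    qed auto
    moreover have "(LBINT t. indicator {- real (n+2)..real (n+2)} t *\<^sub>R ?f t) = integral {- real (n+2)..real (n+2)} ?f" for n
    proof -
      have "set_integrable lborel {- real (n+2)..real (n+2)} ?f"
        unfolding set_integrable_def by (rule integrable_mult_indicator[OF _ int]) simp
      from set_borel_integral_eq_integral(2)[OF this] show ?thesis
        unfolding set_lebesgue_integral_def .
    qed
    ultimately show ?thesis by simp
  qed
  moreover have "(\<lambda>n. integral {- real (n+2)..real (n+2)} ?f) \<longlonglongrightarrow> of_real (pi * exp (- v))"
  proof (rule LIM_zero_cancel, rule Lim_null_comparison)
    show "\<forall>\<^sub>F n in sequentially. cmod (integral {- real (n+2)..real (n+2)} ?f - of_real (pi * exp (- v)))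
       \<le> 4 * real (n+2) / ((real (n+2))\<^sup>2 - 1)"
      by (intro always_eventually allI cauchy_kernel_contour[OF v]) auto
    show "(\<lambda>n. 4 * real (n+2) / ((real (n+2))\<^sup>2 - 1)) \<longlonglongrightarrow> 0"
      by real_asymp
  qed
  ultimately show "(LBINT t. ?f t) = of_real (pi * exp (- v))"
    using LIMSEQ_unique by blast
qed

lemma has_bochner_integral_cauchy_ft:
  fixes v b :: real assumes b: "b > 0"
  shows "has_bochner_integral lborel (\<lambda>t. cis (v * t) / of_real (b\<^sup>2 + t\<^sup>2)) (of_real (pi / b * exp (- b * \<bar>v\<bar>)))"
proof -
  have pos: "has_bochner_integral lborel (\<lambda>t. cis (v * t) / of_real (b\<^sup>2 + t\<^sup>2)) (of_real (pi / b * exp (- b * v)))" if v: "v \<ge> 0" for v :: real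
  proof -
    have "has_bochner_integral lborel (\<lambda>t. exp (\<i> * of_real ((b * v) * t)) / of_real (1 + t\<^sup>2)) (of_real (pi * exp (- (b * v))))"
      using integral_cauchy_ft1[of "b * v"] v b by (simp add: has_bochner_integral_iff)
    from lborel_has_bochner_integral_real_affine_iff[of "1/b" "\<lambda>t. exp (\<i> * of_real ((b * v) * t)) / of_real (1 + t\<^sup>2)" _ 0, THEN iffD1, OF _ this]
    have "has_bochner_integral lborel (\<lambda>t. exp (\<i> * of_real (v * t)) / of_real (1 + (t/b)\<^sup>2)) (of_real (b * (pi * exp (- (b * v)))))"
      using b by (simp add: scaleR_conv_of_real)
    then have *: "has_bochner_integral lborel (\<lambda>t. of_real (1/b\<^sup>2) * (exp (\<i> * of_real (v * t)) / of_real (1 + (t/b)\<^sup>2))) (of_real (1/b\<^sup>2) * of_real (b * (pi * exp (- (b * v)))) :: complex)"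
      by (intro has_bochner_integral_mult_right)
    have e1: "of_real (1/b\<^sup>2) * (exp (\<i> * of_real (v * t)) / of_real (1 + (t/b)\<^sup>2)) = cis (v * t) / of_real (b\<^sup>2 + t\<^sup>2)" for t
    proof -
      have "b\<^sup>2 + t\<^sup>2 = b\<^sup>2 * (1 + (t/b)\<^sup>2)" using b by (simp add: field_simps)
      then show ?thesis by (simp only: cis_conv_exp of_real_mult of_real_divide) (simp)
    qed
    have e2: "of_real (1/b\<^sup>2) * of_real (b * (pi * exp (- (b * v)))) = (of_real (pi / b * exp (- b * v)) :: complex)"
      unfolding of_real_mult[symmetric] using b by (simp add: power2_eq_square)
    show ?thesis using * unfolding e1 e2 .
  qed
  show ?thesis
  proof (cases "v \<ge> 0")
    case True then show ?thesis using pos[of v] by simp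
  next
    case False
    from lborel_has_bochner_integral_real_affine_iff[of "-1" "\<lambda>t. cis (-v * t) / of_real (b\<^sup>2 + t\<^sup>2)" _ 0, THEN iffD1, OF _ pos[of "-v"]] False
    show ?thesis by simp
  qed
qed

lemma has_bochner_integral_cauchy:
  fixes b :: real assumes b: "b > 0"
  shows "has_bochner_integral lborel (\<lambda>t. 1 / (b\<^sup>2 + t\<^sup>2)) (pi / b)"
proof -
  have "has_bochner_integral lborel (\<lambda>t. Re (cis (0 * t) / of_real (b\<^sup>2 + t\<^sup>2))) (Re (of_real (pi / b * exp (- b * \<bar>0\<bar>))))"
    by (rule has_bochner_integral_bounded_linear[OF bounded_linear_Re has_bochner_integral_cauchy_ft[OF b]])
  then show ?thesis by (simp add: Re_divide_of_real del: of_real_add of_real_power)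
qed

section \<open>Plancherel's identity for Dirichlet polynomials and absolutely convergent Dirichlet
  series\<close>

lemma has_bochner_integral_powr_to_inf:
  fixes m e :: real assumes m: "m > 0" and e: "e > 0"
  shows "has_bochner_integral lborel (\<lambda>u. indicator {m..} u * u powr (- 1 - e)) (m powr (- e) / e)"
proof (rule has_bochner_integral_nn_integral)
  have "(\<integral>\<^sup>+u. ennreal (indicator {m..} u * u powr (-1-e)) \<partial>lborel) = (\<integral>\<^sup>+u. ennreal (u powr (-1-e)) * indicator {m..} u \<partial>lborel)"
    by (intro nn_integral_cong) (auto simp: indicator_def)
  also have "\<dots> = ennreal (0 - (- (m powr (-e) / e)))"
  proof (rule nn_integral_FTC_atLeast)
    fix x assume "m \<le> x"
    then show "((\<lambda>x. - (x powr (-e) / e)) has_real_derivative x powr (-1-e)) (at x)"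
      using m e by (auto intro!: derivative_eq_intros simp: field_simps powr_diff powr_minus)
    show "0 \<le> x powr (-1-e)" by simp
  next
    show "((\<lambda>x. - (x powr (-e) / e)) \<longlongrightarrow> 0) at_top"
      using e by real_asymp
  qed auto
  finally show "(\<integral>\<^sup>+u. ennreal (indicator {m..} u * u powr (-1-e)) \<partial>lborel) = ennreal (m powr (-e) / e)" by simp
qed (use e in auto)

text \<open>Both integrals are the same quadratic form in \<open>d\<close>, with kernel exp(- b |ln
  N_k - ln N_j|) / (2 b) up to the factor 2 pi. On the frequency side the kernel is the Fourier
  transform of 1 / (b^2 + t^2); on the other side it is (N_j N_k)^b times the integral of u^(-1-2b)
  from max(N_j, N_k) to infinity.\<close>

lemma plancherel_finite:
  fixes K :: "'k set" and N :: "'k \<Rightarrow> real" and d :: "'k \<Rightarrow> complex"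
  assumes K: "finite K" and N: "\<And>k. k \<in> K \<Longrightarrow> N k \<ge> 1" and b: "b > 0"
  obtains I where
    "has_bochner_integral lborel (\<lambda>t. (cmod (\<Sum>k\<in>K. d k * cis (- t * ln (N k))))\<^sup>2 / (b\<^sup>2 + t\<^sup>2)) (2 * pi * I)"
    "has_bochner_integral lborel (\<lambda>u. indicator {1..} u * ((cmod (\<Sum>k | k \<in> K \<and> N k \<le> u. d k * of_real (N k powr b)))\<^sup>2 * u powr (- 1 - 2 * b))) I"
proof -
  define I where "I = (\<Sum>j\<in>K. \<Sum>k\<in>K. d j * cnj (d k) * of_real (exp (- b * \<bar>ln (N k) - ln (N j)\<bar>) / (2 * b)))"
  have "has_bochner_integral lborel (\<lambda>t. \<Sum>j\<in>K. \<Sum>k\<in>K. d j * cnj (d k) * (cis ((ln (N k) - ln (N j)) * t) / of_real (b\<^sup>2 + t\<^sup>2)))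
     (\<Sum>j\<in>K. \<Sum>k\<in>K. d j * cnj (d k) * of_real (pi / b * exp (- b * \<bar>ln (N k) - ln (N j)\<bar>)))"
    by (intro has_bochner_integral_sum has_bochner_integral_mult_right has_bochner_integral_cauchy_ft b)
  also have "(\<lambda>t. \<Sum>j\<in>K. \<Sum>k\<in>K. d j * cnj (d k) * (cis ((ln (N k) - ln (N j)) * t) / of_real (b\<^sup>2 + t\<^sup>2)))
     = (\<lambda>t. of_real ((cmod (\<Sum>k\<in>K. d k * cis (- t * ln (N k))))\<^sup>2 / (b\<^sup>2 + t\<^sup>2)))" (is "?l = ?r")
  proof
    fix t
    have "(\<Sum>k\<in>K. d k * cis (- t * ln (N k))) * cnj (\<Sum>k\<in>K. d k * cis (- t * ln (N k)))
      = (\<Sum>j\<in>K. \<Sum>k\<in>K. d j * cnj (d k) * cis ((ln (N k) - ln (N j)) * t))"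
      unfolding cnj_sum sum_product
    proof (intro sum.cong refl)
      fix j k
      have "cis ((ln (N k) - ln (N j)) * t) = cis (- t * ln (N j)) * cis (t * ln (N k))"
        by (simp add: cis_mult algebra_simps)
      then show "d j * cis (- t * ln (N j)) * cnj (d k * cis (- t * ln (N k))) = d j * cnj (d k) * cis ((ln (N k) - ln (N j)) * t)"
        by (simp add: cis_cnj mult_ac)
    qed
    note z = this
    have "?l t = (\<Sum>j\<in>K. \<Sum>k\<in>K. d j * cnj (d k) * cis ((ln (N k) - ln (N j)) * t)) / of_real (b\<^sup>2 + t\<^sup>2)"
      by (simp only: sum_divide_distrib times_divide_eq_right)
    also have "\<dots> = of_real ((cmod (\<Sum>k\<in>K. d k * cis (- t * ln (N k))))\<^sup>2) / of_real (b\<^sup>2 + t\<^sup>2)"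
      unfolding z[symmetric] complex_norm_square ..
    finally show "?l t = ?r t" by (simp only: of_real_divide)
  qed
  also have "(\<Sum>j\<in>K. \<Sum>k\<in>K. d j * cnj (d k) * of_real (pi / b * exp (- b * \<bar>ln (N k) - ln (N j)\<bar>))) = of_real (2 * pi) * I"
    unfolding I_def sum_distrib_left using b by (intro sum.cong refl) simp
  finally have f1: "has_bochner_integral lborel (\<lambda>t. complex_of_real ((cmod (\<Sum>k\<in>K. d k * cis (- t * ln (N k))))\<^sup>2 / (b\<^sup>2 + t\<^sup>2))) (of_real (2 * pi) * I)" .
  have F: "has_bochner_integral lborel (\<lambda>t. (cmod (\<Sum>k\<in>K. d k * cis (- t * ln (N k))))\<^sup>2 / (b\<^sup>2 + t\<^sup>2)) (2 * pi * Re I)"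
    using has_bochner_integral_bounded_linear[OF bounded_linear_Re f1] by simp
  let ?w = "\<lambda>m u. indicator {m..} u * u powr (- 1 - 2 * b)"
  have "has_bochner_integral lborel (\<lambda>u. \<Sum>j\<in>K. \<Sum>k\<in>K. (d j * cnj (d k) * of_real (N j powr b * N k powr b)) * of_real (?w (max (N j) (N k)) u))
     (\<Sum>j\<in>K. \<Sum>k\<in>K. (d j * cnj (d k) * of_real (N j powr b * N k powr b)) * of_real (max (N j) (N k) powr (- (2*b)) / (2*b)))"
  proof (intro has_bochner_integral_sum has_bochner_integral_mult_right has_bochner_integral_of_real)
    fix j k assume jk: "j \<in> K" "k \<in> K"
    show "has_bochner_integral lborel (?w (max (N j) (N k))) (max (N j) (N k) powr (- (2*b)) / (2*b))"
      using has_bochner_integral_powr_to_inf[of "max (N j) (N k)" "2*b"] N[OF jk(1)] b by auto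
  qed
  also have "(\<Sum>j\<in>K. \<Sum>k\<in>K. (d j * cnj (d k) * of_real (N j powr b * N k powr b)) * of_real (max (N j) (N k) powr (- (2*b)) / (2*b))) = I"
    unfolding I_def
  proof (intro sum.cong refl)
    fix j k assume jk: "j \<in> K" "k \<in> K"
    have pos: "N j > 0" "N k > 0" using N[of j] N[of k] jk by auto
    have "N j powr b * N k powr b * max (N j) (N k) powr (- (2*b)) = exp (b * ln (N j) + b * ln (N k) - 2 * b * ln (max (N j) (N k)))"
      using pos by (auto simp: powr_def exp_add exp_diff max_def exp_minus field_simps)
    also have "b * ln (N j) + b * ln (N k) - 2 * b * ln (max (N j) (N k)) = - b * \<bar>ln (N k) - ln (N j)\<bar>"
      using pos by (cases "N j \<le> N k") (auto simp: max_def algebra_simps abs_if)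
    finally show "(d j * cnj (d k) * of_real (N j powr b * N k powr b)) * of_real (max (N j) (N k) powr (- (2*b)) / (2*b))
      = d j * cnj (d k) * of_real (exp (- b * \<bar>ln (N k) - ln (N j)\<bar>) / (2 * b))"
      by (metis (no_types, lifting) mult.assoc of_real_mult times_divide_eq_right)
  qed
  also have "(\<lambda>u. \<Sum>j\<in>K. \<Sum>k\<in>K. (d j * cnj (d k) * of_real (N j powr b * N k powr b)) * of_real (?w (max (N j) (N k)) u))
     = (\<lambda>u. of_real (indicator {1..} u * ((cmod (\<Sum>k | k \<in> K \<and> N k \<le> u. d k * of_real (N k powr b)))\<^sup>2 * u powr (- 1 - 2 * b))))" (is "?l = ?r")
  proof
    fix u :: real
    show "?l u = ?r u"
    proof (cases "u \<ge> 1")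
      case False
      have "?w (max (N j) (N k)) u = 0" if "j \<in> K" for j k
        using N[OF that] False by (auto simp: indicator_def)
      then show ?thesis using False by (auto simp: indicator_def intro!: sum.neutral)
    next
      case True
      let ?e = "\<lambda>k. if N k \<le> u then d k * of_real (N k powr b) else 0"
      have s: "(\<Sum>k | k \<in> K \<and> N k \<le> u. d k * of_real (N k powr b)) = (\<Sum>k\<in>K. ?e k)"
        using K by (simp add: sum.inter_filter)
      have "?r u = of_real (u powr (-1-2*b)) * ((\<Sum>k\<in>K. ?e k) * cnj (\<Sum>k\<in>K. ?e k))"
        unfolding complex_norm_square[symmetric] s using True by (simp add: indicator_def)
      also have "\<dots> = (\<Sum>j\<in>K. \<Sum>k\<in>K. of_real (u powr (-1-2*b)) * (?e j * cnj (?e k)))"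
        unfolding cnj_sum sum_product by (simp add: sum_distrib_left)
      also have "\<dots> = ?l u"
        by (intro sum.cong refl) (auto simp: indicator_def)
      finally show ?thesis by simp
    qed
  qed
  finally have "has_bochner_integral lborel (\<lambda>u. complex_of_real (indicator {1..} u * ((cmod (\<Sum>k | k \<in> K \<and> N k \<le> u. d k * of_real (N k powr b)))\<^sup>2 * u powr (- 1 - 2 * b)))) I" .
  from has_bochner_integral_bounded_linear[OF bounded_linear_Re this]
  have "has_bochner_integral lborel (\<lambda>u. indicator {1..} u * ((cmod (\<Sum>k | k \<in> K \<and> N k \<le> u. d k * of_real (N k powr b)))\<^sup>2 * u powr (- 1 - 2 * b))) (Re I)"
    by simp
  then show thesis using that F by blast
qed

text \<open>A Dirichlet series on one vertical line inside its region of absolute convergence, as a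
  function of the height t; the coefficients \<open>d\<close> already contain the factor
  N^(-\<sigma>).\<close>

locale abs_dirichlet =
  fixes K :: "'k set" and N :: "'k \<Rightarrow> real" and d :: "'k \<Rightarrow> complex"
  assumes N_ge_1: "k \<in> K \<Longrightarrow> N k \<ge> 1"
    and finite_le: "finite {k \<in> K. N k \<le> Y}"
    and summable: "(\<lambda>k. cmod (d k)) summable_on K"
begin

definition "D t = (\<Sum>\<^sub>\<infinity>k\<in>K. d k * cis (- t * ln (N k)))"
definition "DY Y t = (\<Sum>k | k \<in> K \<and> N k \<le> Y. d k * cis (- t * ln (N k)))"
definition "A = (\<Sum>\<^sub>\<infinity>k\<in>K. cmod (d k))"

lemma A_nonneg: "A \<ge> 0" unfolding A_def by (rule infsum_nonneg) auto

lemma abs_summable_D: "(\<lambda>k. cmod (d k * cis (- t * ln (N k)))) summable_on K"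
  using summable by (simp add: norm_mult)

lemma D_le: "cmod (D t) \<le> A"
  using norm_infsum_bound[OF abs_summable_D[of t]] by (simp add: D_def A_def norm_mult)

text \<open>The error is bounded by a tail of the series of absolute values, which does not depend
  on t. Hence the results for Dirichlet polynomials carry over at the cost of an arbitrarily small
  error.\<close>

lemma trunc:
  assumes e: "e > 0"
  obtains Y0 where "\<And>Y t. Y \<ge> Y0 \<Longrightarrow> cmod (D t - DY Y t) \<le> e"
proof -
  have "((\<lambda>k. cmod (d k)) has_sum A) K" using summable by (simp add: A_def)
  from has_sum_finite_approximation[OF this e] obtain F0
    where F0: "finite F0" "F0 \<subseteq> K" "dist (\<Sum>k\<in>F0. cmod (d k)) A \<le> e" by blast
  define Y0 where "Y0 = Max (insert 0 (N ` F0))"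
  have "cmod (D t - DY Y t) \<le> e" if Y: "Y \<ge> Y0" for Y t
  proof -
    let ?F = "{k\<in>K. N k \<le> Y}"
    have sub: "F0 \<subseteq> ?F"
    proof
      fix k assume "k \<in> F0"
      then have "N k \<le> Y0" unfolding Y0_def using F0(1) by (intro Max_ge) auto
      then show "k \<in> ?F" using Y \<open>k \<in> F0\<close> F0(2) by auto
    qed
    have fin: "finite ?F" by (rule finite_le)
    have sK: "(\<lambda>k. d k * cis (- t * ln (N k))) summable_on K"
      by (rule Infinite_Sum.abs_summable_summable[OF abs_summable_D])
    have "D t - DY Y t = (\<Sum>\<^sub>\<infinity>k\<in>K - ?F. d k * cis (- t * ln (N k)))"
      unfolding D_def DY_def using infsum_Diff[OF sK, of ?F] fin by auto
    also have "cmod \<dots> \<le> (\<Sum>\<^sub>\<infinity>k\<in>K - ?F. cmod (d k * cis (- t * ln (N k))))"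
      by (rule norm_infsum_bound, rule summable_on_subset_banach[OF abs_summable_D]) auto
    also have "\<dots> = (\<Sum>\<^sub>\<infinity>k\<in>K - ?F. cmod (d k))" by (simp add: norm_mult)
    also have "\<dots> = A - (\<Sum>k\<in>?F. cmod (d k))"
      unfolding A_def using infsum_Diff[OF summable, of ?F] fin by auto
    finally have "cmod (D t - DY Y t) \<le> A - (\<Sum>k\<in>?F. cmod (d k))" .
    moreover have "(\<Sum>k\<in>?F. cmod (d k)) \<ge> (\<Sum>k\<in>F0. cmod (d k))"
      using sub fin by (intro sum_mono2) auto
    ultimately show ?thesis using F0(3) by (simp add: dist_real_def)
  qed
  then show thesis using that by blast
qed

lemma continuous_DY: "continuous_on UNIV (DY Y)"
  unfolding DY_def cis_conv_exp by (intro continuous_intros)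

lemma continuous_D: "continuous_on UNIV D"
proof (rule uniform_limit_theorem[of _ "\<lambda>n. DY (real n)"])
  show "uniform_limit UNIV (\<lambda>n. DY (real n)) D sequentially"
  proof (rule uniform_limitI)
    fix e :: real assume "e > 0"
    then obtain Y0 where Y0: "\<And>Y t. Y \<ge> Y0 \<Longrightarrow> cmod (D t - DY Y t) \<le> e/2" using trunc[of "e/2"] by auto
    show "\<forall>\<^sub>F n in sequentially. \<forall>x\<in>UNIV. dist (DY (real n) x) (D x) < e"
      using eventually_ge_at_top[of "nat \<lceil>Y0\<rceil>"]
    proof eventually_elim
      case (elim n)
      then have "real n \<ge> Y0" by linarith
      then have "cmod (DY (real n) x - D x) \<le> e / 2" for x using Y0[of "real n" x] by (simp add: norm_minus_commute)
      moreover have "e / 2 < e" using \<open>e > 0\<close> by simp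
      ultimately show ?case unfolding dist_norm by (blast intro: le_less_trans)
    qed
  qed
  show "\<forall>\<^sub>F n in sequentially. continuous_on UNIV (DY (real n))"
    by (intro always_eventually allI continuous_DY)
qed auto

lemma measurable_D [measurable]: "D \<in> borel_measurable borel"
  using continuous_D by (rule borel_measurable_continuous_onI)
lemma measurable_DY [measurable]: "DY Y \<in> borel_measurable borel"
  using continuous_DY by (rule borel_measurable_continuous_onI)

lemma integrable_D:
  assumes b: "b > 0"
  shows "integrable lborel (\<lambda>t. (cmod (D t))\<^sup>2 / (b\<^sup>2 + t\<^sup>2))"
proof (rule Bochner_Integration.integrable_bound)
  show "integrable lborel (\<lambda>t. A\<^sup>2 * (1 / (b\<^sup>2 + t\<^sup>2)))"
    using has_bochner_integral_cauchy[OF b] by (intro integrable_mult_right) (auto simp: has_bochner_integral_iff)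
  have "(cmod (D t))\<^sup>2 / (b\<^sup>2+t\<^sup>2) \<le> A\<^sup>2 / (b\<^sup>2+t\<^sup>2)" for t
    using D_le[of t] b by (intro divide_right_mono power_mono) auto
  then show "AE t in lborel. norm ((cmod (D t))\<^sup>2 / (b\<^sup>2 + t\<^sup>2)) \<le> norm (A\<^sup>2 * (1 / (b\<^sup>2 + t\<^sup>2)))"
    by (intro AE_I2) simp
qed measurable

lemma square_approx:
  fixes x y e :: real
  assumes "\<bar>x - y\<bar> \<le> e" "0 \<le> y" "0 \<le> x" "y \<le> B" "e \<le> 1" "e > 0"
  shows "x\<^sup>2 \<le> y\<^sup>2 + (2 * B + 1) * e"
proof -
  have "x\<^sup>2 \<le> (y + e)\<^sup>2" using assms by (intro power_mono) auto
  also have "\<dots> = y\<^sup>2 + (2 * y + e) * e" by (simp add: power2_eq_square algebra_simps)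
  also have "\<dots> \<le> y\<^sup>2 + (2 * B + 1) * e" using assms by (intro add_left_mono mult_right_mono) auto
  finally show ?thesis .
qed

lemma DY_le: "cmod (DY Y t) \<le> A"
proof -
  have "cmod (DY Y t) \<le> (\<Sum>k | k \<in> K \<and> N k \<le> Y. cmod (d k))"
    unfolding DY_def by (rule order_trans[OF norm_sum]) (simp add: norm_mult)
  also have "\<dots> \<le> A" unfolding A_def by (rule finite_sum_le_infsum[OF summable finite_le]) auto
  finally show ?thesis .
qed

lemma le_by_eps:
  fixes x y c :: real assumes "\<And>e. e > 0 \<Longrightarrow> e \<le> 1 \<Longrightarrow> x \<le> y + c * e" and "c \<ge> 0"
  shows "x \<le> y"
proof (rule field_le_epsilon)
  fix e :: real assume e: "e > 0"
  define e' where "e' = min 1 (e / (c + 1))"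
  have "e' > 0" "e' \<le> 1" using e assms(2) by (auto simp: e'_def)
  have "c * e' \<le> c * (e / (c+1))" using assms(2) by (intro mult_left_mono) (auto simp: e'_def)
  also have "\<dots> \<le> e" using e assms(2) by (simp add: field_simps)
  finally show "x \<le> y + e" using assms(1)[OF \<open>e' > 0\<close> \<open>e' \<le> 1\<close>] by linarith
qed

text \<open>A truncation at Y \<ge> X leaves the sums over N k \<le> u unchanged for all u \<le> X.
  So the finite identity applies, and only the frequency side changes, by O(e).\<close>

theorem time_le_freq:
  assumes b: "b > 0"
  shows "(LBINT u:{1..X}. (cmod (\<Sum>k | k \<in> K \<and> N k \<le> u. d k * of_real (N k powr b)))\<^sup>2 * u powr (- 1 - 2 * b))
    \<le> (LBINT t. (cmod (D t))\<^sup>2 / (b\<^sup>2 + t\<^sup>2)) / (2 * pi)" (is "?L \<le> ?R")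
    and "set_integrable lborel {1..X} (\<lambda>u. (cmod (\<Sum>k | k \<in> K \<and> N k \<le> u. d k * of_real (N k powr b)))\<^sup>2 * u powr (- 1 - 2 * b))"
proof -
  let ?S = "\<lambda>u. (cmod (\<Sum>k | k \<in> K \<and> N k \<le> u. d k * of_real (N k powr b)))\<^sup>2 * u powr (- 1 - 2 * b)"
  have main: "set_integrable lborel {1..X} ?S \<and> ?L \<le> ?R + ((2*A+1) / (2*b)) * e" if e: "e > 0" "e \<le> 1" for e
  proof -
    obtain Y0 where Y0: "\<And>Y t. Y \<ge> Y0 \<Longrightarrow> cmod (D t - DY Y t) \<le> e" using trunc[OF e(1)] by auto
    define Y where "Y = max X Y0"
    let ?K = "{k\<in>K. N k \<le> Y}"
    obtain I where I: "has_bochner_integral lborel (\<lambda>t. (cmod (\<Sum>k\<in>?K. d k * cis (- t * ln (N k))))\<^sup>2 / (b\<^sup>2 + t\<^sup>2)) (2 * pi * I)"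
      "has_bochner_integral lborel (\<lambda>u. indicator {1..} u * ((cmod (\<Sum>k | k \<in> ?K \<and> N k \<le> u. d k * of_real (N k powr b)))\<^sup>2 * u powr (- 1 - 2 * b))) I"
      using plancherel_finite[of ?K N b d] N_ge_1 finite_le[of Y] b by auto
    let ?T = "\<lambda>u. indicator {1..} u * ((cmod (\<Sum>k | k \<in> ?K \<and> N k \<le> u. d k * of_real (N k powr b)))\<^sup>2 * u powr (- 1 - 2 * b))"
    have eq: "indicator {1..X} u *\<^sub>R ?S u = indicator {1..X} u *\<^sub>R ?T u" for u
    proof (cases "u \<in> {1..X}")
      case True
      then have "{k. k \<in> ?K \<and> N k \<le> u} = {k. k \<in> K \<and> N k \<le> u}" by (auto simp: Y_def)
      then show ?thesis using True by (simp add: indicator_def)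
    qed auto
    have intT: "integrable lborel ?T" using I(2) by (simp add: has_bochner_integral_iff)
    have si: "set_integrable lborel {1..X} ?S"
      unfolding set_integrable_def eq by (rule integrable_mult_indicator[OF _ intT]) simp
    have "?L = (LBINT u. indicator {1..X} u *\<^sub>R ?T u)"
      unfolding set_lebesgue_integral_def eq ..
    also have "\<dots> \<le> (LBINT u. ?T u)"
      by (rule integral_mono[OF integrable_mult_indicator[OF _ intT] intT]) (auto simp: indicator_def)
    also have "\<dots> = I" using I(2) by (simp add: has_bochner_integral_iff)
    finally have 1: "?L \<le> I" .
    have 2: "2 * pi * I = (LBINT t. (cmod (DY Y t))\<^sup>2 / (b\<^sup>2 + t\<^sup>2))"
      using I(1) by (simp add: has_bochner_integral_iff DY_def)
    have "(LBINT t. (cmod (DY Y t))\<^sup>2 / (b\<^sup>2 + t\<^sup>2)) \<le> (LBINT t. (cmod (D t))\<^sup>2 / (b\<^sup>2 + t\<^sup>2) + (2*A+1)*e * (1 / (b\<^sup>2 + t\<^sup>2)))"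
    proof (rule integral_mono)
      show "integrable lborel (\<lambda>t. (cmod (DY Y t))\<^sup>2 / (b\<^sup>2 + t\<^sup>2))"
        using I(1) by (simp add: has_bochner_integral_iff DY_def)
      show "integrable lborel (\<lambda>t. (cmod (D t))\<^sup>2 / (b\<^sup>2 + t\<^sup>2) + (2*A+1)*e * (1 / (b\<^sup>2 + t\<^sup>2)))"
        using has_bochner_integral_cauchy[OF b] integrable_D[OF b]
        by (intro Bochner_Integration.integrable_add integrable_mult_right) (auto simp: has_bochner_integral_iff)
      fix t
      have "\<bar>cmod (DY Y t) - cmod (D t)\<bar> \<le> e"
        using Y0[of Y t] norm_triangle_ineq3[of "D t" "DY Y t"] by (simp add: Y_def)
      then have "(cmod (DY Y t))\<^sup>2 \<le> (cmod (D t))\<^sup>2 + (2*A+1)*e"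
        using square_approx[of "cmod (DY Y t)" "cmod (D t)" e A] D_le e by auto
      then have "(cmod (DY Y t))\<^sup>2 / (b\<^sup>2+t\<^sup>2) \<le> ((cmod (D t))\<^sup>2 + (2*A+1)*e) / (b\<^sup>2+t\<^sup>2)"
        using b by (intro divide_right_mono) auto
      then show "(cmod (DY Y t))\<^sup>2 / (b\<^sup>2 + t\<^sup>2) \<le> (cmod (D t))\<^sup>2 / (b\<^sup>2 + t\<^sup>2) + (2*A+1)*e * (1 / (b\<^sup>2 + t\<^sup>2))"
        by (simp add: add_divide_distrib)
    qed
    also have "\<dots> = (LBINT t. (cmod (D t))\<^sup>2 / (b\<^sup>2 + t\<^sup>2)) + (2*A+1)*e * (pi / b)"
      by (rule has_bochner_integral_integral_eq, intro has_bochner_integral_add has_bochner_integral_mult_right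
           has_bochner_integral_cauchy b has_bochner_integral_integrable integrable_D)
    finally have "2 * pi * ?L \<le> ((LBINT t. (cmod (D t))\<^sup>2 / (b\<^sup>2 + t\<^sup>2)) + (2*A+1)*e * (pi / b))"
      using mult_left_mono[OF 1, of "2*pi"] 2 by simp
    then have "?L \<le> ((LBINT t. (cmod (D t))\<^sup>2 / (b\<^sup>2 + t\<^sup>2)) + (2*A+1)*e * (pi / b)) / (2*pi)"
      by (subst pos_le_divide_eq) (simp_all only: mult.commute[of _ "2 * pi"], simp)
    also have "\<dots> = ?R + (2*A+1)*e * (pi / b) / (2*pi)" by (simp only: add_divide_distrib)
    also have "(2*A+1)*e * (pi / b) / (2*pi) = ((2*A+1) / (2*b)) * e" using b by (simp add: divide_simps)
    finally show ?thesis using si by blast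
  qed
  show "set_integrable lborel {1..X} ?S" using main[of 1] by simp
  show "?L \<le> ?R" by (rule le_by_eps[of _ _ "(2*A+1) / (2*b)"]) (use main A_nonneg b in auto)
qed

text \<open>The finite identity produces truncated sums. Replacing them by a majorant
  \<open>B\<close> of the sums of absolute values makes the bound independent of the
  truncation.\<close>

theorem freq_le_time:
  assumes b: "b > 0"
    and B: "\<And>u. u \<ge> 1 \<Longrightarrow> (\<Sum>k | k \<in> K \<and> N k \<le> u. cmod (d k) * N k powr b) \<le> B u"
    and I: "integrable lborel (\<lambda>u. indicator {1..} u * ((B u)\<^sup>2 * u powr (- 1 - 2 * b)))"
  shows "(LBINT t. (cmod (D t))\<^sup>2 / (b\<^sup>2 + t\<^sup>2)) \<le> 2 * pi * (LBINT u. indicator {1..} u * ((B u)\<^sup>2 * u powr (- 1 - 2 * b)))"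
   (is "?L \<le> ?R")
proof -
  have main: "?L \<le> ?R + ((2*A+1) * pi / b) * e" if e: "e > 0" "e \<le> 1" for e
  proof -
    obtain Y where "\<And>Z t. Z \<ge> Y \<Longrightarrow> cmod (D t - DY Z t) \<le> e" using trunc[OF e(1)] by auto
    then have Y: "cmod (D t - DY Y t) \<le> e" for t by simp
    let ?K = "{k\<in>K. N k \<le> Y}"
    obtain J where J: "has_bochner_integral lborel (\<lambda>t. (cmod (\<Sum>k\<in>?K. d k * cis (- t * ln (N k))))\<^sup>2 / (b\<^sup>2 + t\<^sup>2)) (2 * pi * J)"
      "has_bochner_integral lborel (\<lambda>u. indicator {1..} u * ((cmod (\<Sum>k | k \<in> ?K \<and> N k \<le> u. d k * of_real (N k powr b)))\<^sup>2 * u powr (- 1 - 2 * b))) J"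
      using plancherel_finite[of ?K N b d] N_ge_1 finite_le[of Y] b by auto
    have "?L \<le> (LBINT t. (cmod (DY Y t))\<^sup>2 / (b\<^sup>2 + t\<^sup>2) + (2*A+1)*e * (1 / (b\<^sup>2 + t\<^sup>2)))"
    proof (rule integral_mono[OF integrable_D[OF b]])
      show "integrable lborel (\<lambda>t. (cmod (DY Y t))\<^sup>2 / (b\<^sup>2 + t\<^sup>2) + (2*A+1)*e * (1 / (b\<^sup>2 + t\<^sup>2)))"
        using has_bochner_integral_cauchy[OF b] J(1)
        by (intro Bochner_Integration.integrable_add integrable_mult_right) (auto simp: has_bochner_integral_iff DY_def)
      fix t
      have "\<bar>cmod (D t) - cmod (DY Y t)\<bar> \<le> e"
        using Y[of t] norm_triangle_ineq3[of "D t" "DY Y t"] by simp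
      then have "(cmod (D t))\<^sup>2 \<le> (cmod (DY Y t))\<^sup>2 + (2*A+1)*e"
        using square_approx[of "cmod (D t)" "cmod (DY Y t)" e A] DY_le e by auto
      then have "(cmod (D t))\<^sup>2 / (b\<^sup>2+t\<^sup>2) \<le> ((cmod (DY Y t))\<^sup>2 + (2*A+1)*e) / (b\<^sup>2+t\<^sup>2)"
        using b by (intro divide_right_mono) auto
      then show "(cmod (D t))\<^sup>2 / (b\<^sup>2 + t\<^sup>2) \<le> (cmod (DY Y t))\<^sup>2 / (b\<^sup>2 + t\<^sup>2) + (2*A+1)*e * (1 / (b\<^sup>2 + t\<^sup>2))"
        by (simp add: add_divide_distrib)
    qed
    also have "\<dots> = 2 * pi * J + (2*A+1)*e * (pi / b)"
      by (rule has_bochner_integral_integral_eq, intro has_bochner_integral_add has_bochner_integral_mult_right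
           has_bochner_integral_cauchy b) (use J(1) in \<open>simp add: DY_def\<close>)
    finally have 1: "?L \<le> 2 * pi * J + (2*A+1)*e * (pi / b)" .
    have "J \<le> (LBINT u. indicator {1..} u * ((B u)\<^sup>2 * u powr (- 1 - 2 * b)))"
    proof -
      have "J = (LBINT u. indicator {1..} u * ((cmod (\<Sum>k | k \<in> ?K \<and> N k \<le> u. d k * of_real (N k powr b)))\<^sup>2 * u powr (- 1 - 2 * b)))"
        using J(2) by (simp add: has_bochner_integral_iff)
      also have "\<dots> \<le> (LBINT u. indicator {1..} u * ((B u)\<^sup>2 * u powr (- 1 - 2 * b)))"
      proof (rule integral_mono[OF _ I])
        show "integrable lborel (\<lambda>u. indicator {1..} u * ((cmod (\<Sum>k | k \<in> ?K \<and> N k \<le> u. d k * of_real (N k powr b)))\<^sup>2 * u powr (- 1 - 2 * b)))"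
          using J(2) by (simp add: has_bochner_integral_iff)
        fix u :: real
        show "indicator {1..} u * ((cmod (\<Sum>k | k \<in> ?K \<and> N k \<le> u. d k * of_real (N k powr b)))\<^sup>2 * u powr (- 1 - 2 * b))
           \<le> indicator {1..} u * ((B u)\<^sup>2 * u powr (- 1 - 2 * b))"
        proof (cases "u \<ge> 1")
          case True
          have "cmod (\<Sum>k | k \<in> ?K \<and> N k \<le> u. d k * of_real (N k powr b)) \<le> (\<Sum>k | k \<in> ?K \<and> N k \<le> u. cmod (d k) * N k powr b)"
            by (rule order_trans[OF norm_sum]) (simp add: norm_mult)
          also have "\<dots> \<le> (\<Sum>k | k \<in> K \<and> N k \<le> u. cmod (d k) * N k powr b)"
            by (rule sum_mono2) (use finite_le[of u] in auto)
          also have "\<dots> \<le> B u" by (rule B[OF True])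
          finally show ?thesis by (intro mult_left_mono mult_right_mono power_mono) auto
        qed auto
      qed
      finally show ?thesis .
    qed
    then have "2 * pi * J \<le> ?R" by (intro mult_left_mono) auto
    moreover have "(2*A+1)*e * (pi / b) = ((2*A+1) * pi / b) * e" by simp
    ultimately show ?thesis using 1 by linarith
  qed
  show "?L \<le> ?R" by (rule le_by_eps[of _ _ "(2*A+1) * pi / b"]) (use main A_nonneg b in auto)
qed

text \<open>Moving the line of summation to the right is convolution with the Poisson kernel.\<close>

theorem shift_bound:
  assumes b: "\<beta> > 0" and H: "H > 0"
    and G: "\<And>u. \<bar>u\<bar> \<le> 2 * H \<Longrightarrow> cmod (D u) \<le> G" and G0: "G \<ge> 0" and t: "\<bar>t\<bar> \<le> H"
  shows "cmod (\<Sum>\<^sub>\<infinity>k\<in>K. d k * of_real (N k powr (- \<beta>)) * cis (- t * ln (N k))) \<le> G + 2 * \<beta> * A / H"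
proof -
  have Npos: "N k powr (- \<beta>) \<le> 1" if "k \<in> K" for k
    using N_ge_1[OF that] b by (simp add: powr_le_one_le powr_minus field_simps ge_one_powr_ge_zero)
  interpret D': abs_dirichlet K N "\<lambda>k. d k * of_real (N k powr (- \<beta>))"
  proof
    show "(\<lambda>k. cmod (d k * of_real (N k powr (- \<beta>)))) summable_on K"
      by (rule summable_on_comparison_test[OF summable]) (auto simp: norm_mult intro!: mult_left_le Npos)
  qed (use N_ge_1 finite_le in auto)
  have main: "cmod (D'.D t) \<le> G + 2 * \<beta> * A / H + 2 * e" if e: "e > 0" "e \<le> 1" for e
  proof -
    obtain Y1 where Y1: "\<And>Y t. Y \<ge> Y1 \<Longrightarrow> cmod (D t - DY Y t) \<le> e" using trunc[OF e(1)] by auto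
    obtain Y2 where Y2: "\<And>Y t. Y \<ge> Y2 \<Longrightarrow> cmod (D'.D t - D'.DY Y t) \<le> e" using D'.trunc[OF e(1)] by auto
    define Y where "Y = max Y1 Y2"
    \<comment> \<open>Against 1 / (\<beta>^2 + u^2), each term cis (- u ln N) integrates to (pi /
      \<beta>) N^(-\<beta>), because N \<ge> 1.\<close>
    have "has_bochner_integral lborel (\<lambda>u. \<Sum>k | k \<in> K \<and> N k \<le> Y. d k * cis (- t * ln (N k)) * (cis (- ln (N k) * u) / of_real (\<beta>\<^sup>2 + u\<^sup>2)))
       (\<Sum>k | k \<in> K \<and> N k \<le> Y. d k * cis (- t * ln (N k)) * of_real (pi / \<beta> * exp (- \<beta> * \<bar>- ln (N k)\<bar>)))"
      by (intro has_bochner_integral_sum has_bochner_integral_mult_right has_bochner_integral_cauchy_ft b)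
    also have "(\<lambda>u. \<Sum>k | k \<in> K \<and> N k \<le> Y. d k * cis (- t * ln (N k)) * (cis (- ln (N k) * u) / of_real (\<beta>\<^sup>2 + u\<^sup>2)))
       = (\<lambda>u. DY Y (t + u) / of_real (\<beta>\<^sup>2 + u\<^sup>2))"
      by (rule ext) (simp add: DY_def sum_divide_distrib cis_mult algebra_simps flip: of_real_power of_real_add)
    also have "(\<Sum>k | k \<in> K \<and> N k \<le> Y. d k * cis (- t * ln (N k)) * of_real (pi / \<beta> * exp (- \<beta> * \<bar>- ln (N k)\<bar>)))
       = of_real (pi / \<beta>) * D'.DY Y t"
      unfolding D'.DY_def sum_distrib_left
    proof (intro sum.cong refl)
      fix k assume "k \<in> {k. k \<in> K \<and> N k \<le> Y}"
      then have "N k \<ge> 1" using N_ge_1 by auto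
      then have "exp (- \<beta> * \<bar>- ln (N k)\<bar>) = N k powr (- \<beta>)" by (simp add: powr_def)
      then show "d k * cis (- t * ln (N k)) * of_real (pi / \<beta> * exp (- \<beta> * \<bar>- ln (N k)\<bar>)) =
         of_real (pi / \<beta>) * (d k * of_real (N k powr - \<beta>) * cis (- t * ln (N k)))"
        by (simp add: mult_ac)
    qed
    finally have hb: "has_bochner_integral lborel (\<lambda>u. DY Y (t + u) / of_real (\<beta>\<^sup>2 + u\<^sup>2)) (of_real (pi / \<beta>) * D'.DY Y t)" .
    \<comment> \<open>The majorant of the integrand. For |u| \<le> H the argument t + u stays within
      2 H, where \<open>G\<close> applies. For |u| > H the trivial bound \<open>A\<close> is used
      with 1 / (\<beta>^2 + u^2) \<le> 2 / (H^2 + u^2), valid because u^2 \<ge> H^2.\<close>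
    have c1: "has_bochner_integral lborel (\<lambda>u. (G + e) * (1 / (\<beta>\<^sup>2 + u\<^sup>2)) + 2 * A * (1 / (H\<^sup>2 + u\<^sup>2))) ((G + e) * (pi/\<beta>) + 2 * A * (pi / H))"
      by (intro has_bochner_integral_add has_bochner_integral_mult_right has_bochner_integral_cauchy b H)
    have "cmod (of_real (pi / \<beta>) * D'.DY Y t) \<le> (G + e) * (pi/\<beta>) + 2 * A * (pi / H)"
    proof -
      have "cmod (LBINT u. DY Y (t + u) / of_real (\<beta>\<^sup>2 + u\<^sup>2)) \<le> (LBINT u. (G + e) * (1 / (\<beta>\<^sup>2 + u\<^sup>2)) + 2 * A * (1 / (H\<^sup>2 + u\<^sup>2)))"
      proof (rule Bochner_Integration.integral_norm_bound_integral)
        fix u :: real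
        have n: "cmod (of_real (\<beta>\<^sup>2 + u\<^sup>2)) = \<beta>\<^sup>2 + u\<^sup>2" by (simp only: norm_of_real) simp
        have p1: "\<beta>\<^sup>2 + u\<^sup>2 > 0" "H\<^sup>2 + u\<^sup>2 > 0" using b H by (auto intro: add_pos_nonneg)
        show "cmod (DY Y (t + u) / of_real (\<beta>\<^sup>2 + u\<^sup>2)) \<le> (G + e) * (1 / (\<beta>\<^sup>2 + u\<^sup>2)) + 2 * A * (1 / (H\<^sup>2 + u\<^sup>2))"
        proof (cases "\<bar>u\<bar> \<le> H")
          case True
          have "cmod (DY Y (t+u)) \<le> cmod (D (t+u)) + e"
            using Y1[of Y "t+u"] norm_triangle_ineq3[of "D (t+u)" "DY Y (t+u)"] by (simp add: Y_def)
          also have "cmod (D (t+u)) \<le> G" using True t by (intro G) auto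
          finally have "cmod (DY Y (t+u)) / (\<beta>\<^sup>2+u\<^sup>2) \<le> (G+e) / (\<beta>\<^sup>2+u\<^sup>2)" using p1 by (intro divide_right_mono) auto
          moreover have "0 \<le> 2 * A * (1 / (H\<^sup>2 + u\<^sup>2))" using A_nonneg p1 by simp
          ultimately show ?thesis unfolding norm_divide n by simp
        next
          case False
          have "H\<^sup>2 \<le> u\<^sup>2" using False H by (metis abs_le_square_iff abs_of_pos le_cases)
          then have "1 / (\<beta>\<^sup>2 + u\<^sup>2) \<le> 2 / (H\<^sup>2 + u\<^sup>2)" using p1
            by (simp add: divide_simps) (use zero_le_power2[of \<beta>] in linarith)
          then have "cmod (DY Y (t+u)) * (1 / (\<beta>\<^sup>2 + u\<^sup>2)) \<le> A * (2 / (H\<^sup>2 + u\<^sup>2))"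
            using DY_le p1 A_nonneg by (intro mult_mono) auto
          moreover have "0 \<le> (G + e) * (1 / (\<beta>\<^sup>2 + u\<^sup>2))" using G0 e p1 by simp
          ultimately show ?thesis unfolding norm_divide n by (simp add: mult.commute)
        qed
      qed (use hb c1 in \<open>auto simp: has_bochner_integral_iff\<close>)
      then show ?thesis using hb c1 by (simp only: has_bochner_integral_iff)
    qed
    moreover have "cmod (of_real (pi / \<beta>) * D'.DY Y t) = (pi / \<beta>) * cmod (D'.DY Y t)"
      using b by (simp only: norm_mult norm_of_real) simp
    ultimately have "(pi / \<beta>) * cmod (D'.DY Y t) \<le> (pi/\<beta>) * (G + e + 2 * \<beta> * A / H)"
      using b H by (simp add: field_simps)
    then have "cmod (D'.DY Y t) \<le> G + e + 2 * \<beta> * A / H"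
      using b pi_gt_zero by (subst (asm) mult_le_cancel_left_pos) auto
    moreover have "cmod (D'.D t) \<le> cmod (D'.DY Y t) + e"
      using Y2[of Y t] norm_triangle_ineq3[of "D'.D t" "D'.DY Y t"] by (simp add: Y_def)
    ultimately show ?thesis by simp
  qed
  have "cmod (D'.D t) \<le> G + 2 * \<beta> * A / H"
    by (rule le_by_eps[of _ _ 2]) (use main in auto)
  then show ?thesis by (simp add: D'.D_def)
qed

end

section \<open>Multisets of primes\<close>

text \<open>The analysis only uses unique factorisation and a count with a square root error, so ideals are
  replaced by multisets over an abstract set of primes.\<close>

locale prime_system =
  fixes P :: "'p set" and nrm :: "'p \<Rightarrow> nat" and c C0 :: real
  assumes nrm_ge_2: "p \<in> P \<Longrightarrow> nrm p \<ge> 2"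
    and c_pos: "c > 0"
    and finite_count: "finite {A. set_mset A \<subseteq> P \<and> real (\<Prod>p\<in>#A. nrm p) \<le> x}"
    and count: "x \<ge> 1 \<Longrightarrow> \<bar>real (card {A. set_mset A \<subseteq> P \<and> real (\<Prod>p\<in>#A. nrm p) \<le> x}) - c * x\<bar> \<le> C0 * sqrt x"
begin

definition N :: "'p multiset \<Rightarrow> real" where "N A = real (\<Prod>p\<in>#A. nrm p)"
definition Ms :: "'p multiset set" where "Ms = {A. set_mset A \<subseteq> P}"
definition le :: "real \<Rightarrow> 'p multiset set" where "le x = {A \<in> Ms. N A \<le> x}"
definition cnt :: "real \<Rightarrow> real" where "cnt x = real (card (le x))"

lemma finite_le [simp, intro]: "finite (le x)"
  using finite_count[of x] by (simp add: le_def Ms_def N_def)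

lemma cnt_approx: "x \<ge> 1 \<Longrightarrow> \<bar>cnt x - c * x\<bar> \<le> C0 * sqrt x"
  using count[of x] by (simp add: cnt_def le_def Ms_def N_def)

lemma N_empty [simp]: "N {#} = 1" by (simp add: N_def)
lemma N_plus [simp]: "N (A + B) = N A * N B" by (simp add: N_def)
lemma N_add_mset [simp]: "N (add_mset p A) = real (nrm p) * N A" by (simp add: N_def)
lemma Ms_empty [simp]: "{#} \<in> Ms" by (simp add: Ms_def)
lemma Ms_plus [simp]: "A + B \<in> Ms \<longleftrightarrow> A \<in> Ms \<and> B \<in> Ms" by (auto simp: Ms_def)
lemma Ms_add_mset [simp]: "add_mset p B \<in> Ms \<longleftrightarrow> p \<in> P \<and> B \<in> Ms" by (auto simp: Ms_def)
lemma Ms_subset: "A \<in> Ms \<Longrightarrow> B \<subseteq># A \<Longrightarrow> B \<in> Ms"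
  unfolding Ms_def using set_mset_mono by blast
lemma Ms_diff: "A \<in> Ms \<Longrightarrow> A - B \<in> Ms"
  by (rule Ms_subset) auto

lemma N_ge_1: "A \<in> Ms \<Longrightarrow> N A \<ge> 1"
proof (induction A)
  case (add p A)
  then have "real (nrm p) \<ge> 1" "N A \<ge> 1" using nrm_ge_2[of p] by auto
  then have "1 * 1 \<le> real (nrm p) * N A" by (intro mult_mono) auto
  then show ?case by simp
qed simp

lemma N_pos: "A \<in> Ms \<Longrightarrow> N A > 0" using N_ge_1[of A] by simp

lemma N_diff: "A \<in> Ms \<Longrightarrow> B \<subseteq># A \<Longrightarrow> N (A - B) = N A / N B"
  using N_plus[of B "A - B"] N_pos[of B] Ms_subset[of A B] by (simp add: field_simps)

lemma N_mono: "A \<in> Ms \<Longrightarrow> B \<subseteq># A \<Longrightarrow> N B \<le> N A"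
proof -
  assume *: "A \<in> Ms" "B \<subseteq># A"
  have "N B * 1 \<le> N B * N (A - B)"
    using * N_ge_1[of "A - B"] N_ge_1[of B] Ms_subset[of A B] Ms_diff[of A B] by (intro mult_left_mono) auto
  then show ?thesis using N_plus[of B "A - B"] * by simp
qed

lemma le_empty: "x < 1 \<Longrightarrow> le x = {}" using N_ge_1 by (force simp: le_def)

lemma finite_subs [simp, intro]: "finite {B. B \<subseteq># A}"
proof (induction A)
  case (add p A)
  have "{B. B \<subseteq># add_mset p A} \<subseteq> {B. B \<subseteq># A} \<union> add_mset p ` {B. B \<subseteq># A}"
  proof
    fix B assume B: "B \<in> {B. B \<subseteq># add_mset p A}"
    show "B \<in> {B. B \<subseteq># A} \<union> add_mset p ` {B. B \<subseteq># A}"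
    proof (cases "p \<in># B")
      case True
      then obtain B' where "B = add_mset p B'" by (metis insert_DiffM)
      then show ?thesis using B by auto
    next
      case False
      then have "B \<subseteq># A" using B
        by (metis add_mset_remove_trivial diff_single_trivial mem_Collect_eq subset_eq_diff_conv add_mset_add_single)
      then show ?thesis by auto
    qed
  qed
  then show ?case using add finite_subset by blast
qed simp

text \<open>The rearrangement behind every Dirichlet convolution below: divisors are submultisets,
  and a pair (B, A - B) with N A \<le> x is a pair (B, D) with N B N D \<le> x.\<close>

lemma sum_conv:
  fixes G :: "'p multiset \<Rightarrow> 'p multiset \<Rightarrow> 'b::comm_monoid_add"
  shows "(\<Sum>A\<in>le x. \<Sum>B | B \<subseteq># A. G B (A - B)) = (\<Sum>B\<in>le x. \<Sum>D\<in>le (x / N B). G B D)"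
proof -
  have "(\<Sum>A\<in>le x. \<Sum>B | B \<subseteq># A. G B (A - B)) = (\<Sum>(A,B)\<in>Sigma (le x) (\<lambda>A. {B. B \<subseteq># A}). G B (A - B))"
    by (rule sum.Sigma) auto
  also have "\<dots> = (\<Sum>(B,D)\<in>Sigma (le x) (\<lambda>B. le (x / N B)). G B D)"
  proof (rule sum.reindex_bij_witness[of _ "\<lambda>(B,D). (B + D, B)" "\<lambda>(A,B). (B, A - B)"])
    fix a assume "a \<in> Sigma (le x) (\<lambda>A. {B. B \<subseteq># A})"
    then obtain A B where a: "a = (A,B)" "A \<in> Ms" "N A \<le> x" "B \<subseteq># A" by (auto simp: le_def)
    show "(case case a of (A, B) \<Rightarrow> (B, A - B) of (B, D) \<Rightarrow> (B + D, B)) = a" using a by auto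
    have "N B \<le> x" using N_mono[of A B] a by simp
    moreover have "N (A - B) \<le> x / N B" using N_diff[of A B] N_pos[of B] Ms_subset[of A B] a by (simp add: divide_right_mono)
    ultimately show "(case a of (A, B) \<Rightarrow> (B, A - B)) \<in> (SIGMA B:le x. le (x / N B))"
      using a Ms_subset[of A B] Ms_diff[of A B] by (auto simp: le_def)
  next
    fix b assume "b \<in> (SIGMA B:le x. le (x / N B))"
    then obtain B D where b: "b = (B,D)" "B \<in> Ms" "D \<in> Ms" "N D \<le> x / N B" by (auto simp: le_def)
    have "N B * N D \<le> x" using b N_pos[of B] by (simp add: field_simps)
    then show "(case b of (B, D) \<Rightarrow> (B + D, B)) \<in> Sigma (le x) (\<lambda>A. {B. B \<subseteq># A})"
      using b by (auto simp: le_def)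
    show "(case case b of (B, D) \<Rightarrow> (B + D, B) of (A, B) \<Rightarrow> (B, A - B)) = b" using b by auto
  qed auto
  also have "\<dots> = (\<Sum>B\<in>le x. \<Sum>D\<in>le (x / N B). G B D)"
    by (rule sum.Sigma[symmetric]) auto
  finally show ?thesis .
qed

text \<open>The von Mangoldt function: prime powers are the multisets with one distinct element. The
  next definition, \<open>mu\<close>, is the Moebius function.\<close>

definition mang :: "'p multiset \<Rightarrow> real" where
  "mang A = (if card (set_mset A) = 1 then ln (real (nrm (the_elem (set_mset A)))) else 0)"

definition mu :: "'p multiset \<Rightarrow> real" where
  "mu A = (if \<forall>p. count A p \<le> 1 then (-1) ^ size A else 0)"

lemma mang_replicate: "k > 0 \<Longrightarrow> mang (replicate_mset k p) = ln (real (nrm p))"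
  by (simp add: mang_def)

lemma card1_replicate:
  assumes "card (set_mset A) = 1"
  obtains p k where "k > 0" "A = replicate_mset k p"
proof -
  obtain p where p: "set_mset A = {p}" using assms card_1_singletonE by blast
  have "A = replicate_mset (count A p) p"
    by (rule multiset_eqI) (use p in \<open>auto simp: not_in_iff[symmetric]\<close>)
  moreover have "count A p > 0" using p by auto
  ultimately show thesis using that by blast
qed

lemma mang_nonneg: "A \<in> Ms \<Longrightarrow> mang A \<ge> 0"
proof (cases "card (set_mset A) = 1")
  case True assume "A \<in> Ms"
  from True obtain p k where "k > 0" "A = replicate_mset k p" by (rule card1_replicate)
  then show ?thesis using \<open>A \<in> Ms\<close> nrm_ge_2[of p] by (auto simp: mang_replicate Ms_def)
qed (simp add: mang_def)

lemma N_prod: "N A = (\<Prod>p\<in>set_mset A. real (nrm p) ^ count A p)"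
  by (simp add: N_def image_prod_mset_multiplicity)

text \<open>The prime power divisors of A are the p^k with 1 \<le> k \<le> \<open>count A p\<close>,
  so the sum is the logarithm of the factorisation of N A.\<close>

lemma sum_mang: 
  assumes A: "A \<in> Ms"
  shows "(\<Sum>B | B \<subseteq># A. mang B) = ln (N A)"
proof -
  have "(\<Sum>B | B \<subseteq># A. mang B) = (\<Sum>B | B \<subseteq># A \<and> card (set_mset B) = 1. mang B)"
    by (rule sum.mono_neutral_right) (auto simp: mang_def)
  also have "\<dots> = (\<Sum>(p,k)\<in>Sigma (set_mset A) (\<lambda>p. {1..count A p}). ln (real (nrm p)))"
  proof (rule sum.reindex_bij_witness[of _ "\<lambda>(p,k). replicate_mset k p" "\<lambda>B. (the_elem (set_mset B), size B)"])
    fix B assume B: "B \<in> {B. B \<subseteq># A \<and> card (set_mset B) = 1}"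
    then have "card (set_mset B) = 1" by simp
    then obtain p k where pk: "k > 0" "B = replicate_mset k p" by (rule card1_replicate)
    show "(case (the_elem (set_mset B), size B) of (p, k) \<Rightarrow> replicate_mset k p) = B" using pk by simp
    have "k \<le> count A p" using B pk by (simp add: count_le_replicate_mset_subset_eq)
    then show "(the_elem (set_mset B), size B) \<in> (SIGMA p:set_mset A. {1..count A p})" using pk
      by (auto simp: count_greater_zero_iff[symmetric] simp del: count_greater_zero_iff)
    show "(case (the_elem (set_mset B), size B) of (p, k) \<Rightarrow> ln (real (nrm p))) = mang B" using pk by (simp add: mang_replicate)
  next
    fix b assume "b \<in> (SIGMA p:set_mset A. {1..count A p})"
    then show "(the_elem (set_mset (case b of (p, k) \<Rightarrow> replicate_mset k p)), size (case b of (p, k) \<Rightarrow> replicate_mset k p)) = b"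
      "(case b of (p, k) \<Rightarrow> replicate_mset k p) \<in> {B. B \<subseteq># A \<and> card (set_mset B) = 1}"
      by (auto simp: count_le_replicate_mset_subset_eq[symmetric])
  qed
  also have "\<dots> = (\<Sum>p\<in>set_mset A. \<Sum>k\<in>{1..count A p}. ln (real (nrm p)))"
    by (rule sum.Sigma[symmetric]) auto
  also have "\<dots> = (\<Sum>p\<in>set_mset A. ln (real (nrm p) ^ count A p))"
    using A nrm_ge_2 by (intro sum.cong refl) (auto simp: Ms_def ln_realpow)
  also have "\<dots> = ln (N A)" unfolding N_prod
    using A nrm_ge_2 by (subst ln_prod) (force simp: Ms_def)+
  finally show ?thesis .
qed

lemma mang_le:
  assumes "A \<in> Ms"
  shows "mang A \<le> ln (N A)"
proof -
  have "mang A \<le> (\<Sum>B | B \<subseteq># A. mang B)"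
    by (rule member_le_sum) (use assms Ms_subset in \<open>auto intro!: mang_nonneg\<close>)
  then show ?thesis using sum_mang[OF assms] by simp
qed

lemma abs_mu_le_1: "\<bar>mu A\<bar> \<le> 1" by (simp add: mu_def power_abs)

text \<open>Fix a prime p of A. Each squarefree divisor without p is paired with the one that has p
  added, and the two values cancel.\<close>

lemma sum_mu: "(\<Sum>B | B \<subseteq># A. mu B) = (if A = {#} then 1 else 0)"
proof (cases "A = {#}")
  case True then show ?thesis by (simp add: mu_def)
next
  case False
  then obtain p where p: "p \<in># A" by blast
  let ?X = "{B. B \<subseteq># A \<and> (\<forall>q. count B q \<le> 1) \<and> p \<notin># B}"
  have fX: "finite ?X" by (rule finite_subset[OF _ finite_subs[of A]]) auto
  have inj: "inj_on (add_mset p) ?X" by (auto simp: inj_on_def)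
  have split: "{B. B \<subseteq># A \<and> (\<forall>q. count B q \<le> 1)} = ?X \<union> add_mset p ` ?X"
  proof (intro equalityI subsetI)
    fix B assume B: "B \<in> {B. B \<subseteq># A \<and> (\<forall>q. count B q \<le> 1)}"
    show "B \<in> ?X \<union> add_mset p ` ?X"
    proof (cases "p \<in># B")
      case True
      then obtain B' where B': "B = add_mset p B'" by (metis insert_DiffM)
      have c1: "count B q \<le> 1" for q using B by simp
      have 1: "count B' q \<le> 1" for q using c1[of q] by (auto simp: B' split: if_splits)
      have 2: "p \<notin># B'" using c1[of p] by (simp add: B' count_eq_zero_iff)
      have "B \<subseteq># A" using B by blast
      then have 3: "B' \<subseteq># A" unfolding B' by (rule subset_mset.order_trans[rotated]) simp
      show ?thesis unfolding B' using 1 2 3 by blast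
    next
      case False
      then show ?thesis using B by blast
    qed
  next
    fix B assume "B \<in> ?X \<union> add_mset p ` ?X"
    then show "B \<in> {B. B \<subseteq># A \<and> (\<forall>q. count B q \<le> 1)}"
    proof
      assume "B \<in> add_mset p ` ?X"
      then obtain B' where B': "B = add_mset p B'" "B' \<subseteq># A" "\<forall>q. count B' q \<le> 1" "p \<notin># B'" by blast
      have "count B q \<le> count A q" for q
        using B'(2)[unfolded subseteq_mset_def, rule_format, of q] p B'(4) by (auto simp: B'(1) not_in_iff Suc_le_eq)
      then have "B \<subseteq># A" by (simp add: subseteq_mset_def)
      moreover have "count B q \<le> 1" for q using B'(3)[rule_format, of q] B'(4) unfolding B'(1) by (cases "p = q") (simp_all add: not_in_iff)
      ultimately show ?thesis by blast
    qed blast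
  qed
  have "(\<Sum>B | B \<subseteq># A. mu B) = (\<Sum>B | B \<subseteq># A \<and> (\<forall>q. count B q \<le> 1). mu B)"
    by (rule sum.mono_neutral_right) (auto simp: mu_def)
  also have "\<dots> = sum mu ?X + sum mu (add_mset p ` ?X)"
    unfolding split by (rule sum.union_disjoint) (use fX in auto)
  also have "sum mu (add_mset p ` ?X) = (\<Sum>B\<in>?X. - mu B)"
  proof (subst sum.reindex[OF inj], rule sum.cong[OF refl])
    fix B assume B: "B \<in> ?X"
    then have "\<forall>q. count (add_mset p B) q \<le> 1" by (auto simp: not_in_iff)
    then show "(mu \<circ> add_mset p) B = - mu B" using B by (simp add: mu_def)
  qed
  finally show ?thesis using False by (simp add: sum_negf)
qed

text \<open>Inserting the definition of \<open>W\<close> and collecting terms by the product of the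
  two factors leaves complete divisor sums of \<open>mu\<close>, which vanish except at the empty
  multiset.\<close>

lemma moebius_inversion:
  assumes W: "\<And>y. y \<ge> 1 \<Longrightarrow> W y = (\<Sum>A\<in>le y. E (y / N A))" and x: "x \<ge> 1"
  shows "E x = (\<Sum>A\<in>le x. mu A * W (x / N A))"
proof -
  have "(\<Sum>A\<in>le x. mu A * W (x / N A)) = (\<Sum>A\<in>le x. \<Sum>D\<in>le (x / N A). mu A * E (x / (N A * N D)))"
  proof (rule sum.cong[OF refl])
    fix A assume "A \<in> le x"
    then have "x / N A \<ge> 1" using N_pos[of A] by (auto simp: le_def field_simps)
    then show "mu A * W (x / N A) = (\<Sum>D\<in>le (x / N A). mu A * E (x / (N A * N D)))"
      by (simp add: W sum_distrib_left)
  qed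
  also have "\<dots> = (\<Sum>A\<in>le x. \<Sum>B | B \<subseteq># A. mu B * E (x / (N B * N (A - B))))"
    by (rule sum_conv[symmetric])
  also have "\<dots> = (\<Sum>A\<in>le x. \<Sum>B | B \<subseteq># A. mu B * E (x / N A))"
    by (intro sum.cong refl) (simp flip: N_plus)
  also have "\<dots> = (\<Sum>A\<in>le x. if A = {#} then E x else 0)"
    by (intro sum.cong refl) (simp add: sum_mu flip: sum_distrib_right)
  also have "\<dots> = E x"
  proof -
    have "{#} \<in> le x" using x by (simp add: le_def)
    then show ?thesis by (simp add: sum.delta)
  qed
  finally show ?thesis by simp
qed

text \<open>Partial summation: each A contributes e A times the integral of k from N A to x. Stated
  with \<open>has_integral\<close>, it also yields the integrability of the step functions
  involved.\<close>

lemma abel: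
  fixes e :: "'p multiset \<Rightarrow> real"
  assumes k: "continuous_on {1..x} k" and x: "x \<ge> 1"
  shows "((\<lambda>u. k u * (\<Sum>A\<in>le u. e A)) has_integral (\<Sum>A\<in>le x. e A * integral {N A..x} k)) {1..x}"
proof -
  have "((\<lambda>u. \<Sum>A\<in>le x. e A * (if u \<in> {N A..x} then k u else 0)) has_integral (\<Sum>A\<in>le x. e A * integral {N A..x} k)) {1..x}"
  proof (intro has_integral_sum finite_le has_integral_mult_right)
    fix A assume "A \<in> le x"
    then have A: "N A \<ge> 1" "N A \<le> x" using N_ge_1 by (auto simp: le_def)
    have "(k has_integral integral {N A..x} k) {N A..x}"
      using k A by (intro integrable_integral integrable_continuous_interval continuous_on_subset[OF k]) auto
    then show "((\<lambda>u. if u \<in> {N A..x} then k u else 0) has_integral integral {N A..x} k) {1..x}"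
      using A by (subst has_integral_restrict) auto
  qed
  then show ?thesis
  proof (rule has_integral_eq[rotated])
    fix u assume u: "u \<in> {1..x}"
    have "(\<Sum>A\<in>le x. e A * (if u \<in> {N A..x} then k u else 0)) = (\<Sum>A\<in>le u. e A * (if u \<in> {N A..x} then k u else 0))"
      by (rule sum.mono_neutral_right[OF finite_le]) (use u in \<open>auto simp: le_def\<close>)
    also have "\<dots> = (\<Sum>A\<in>le u. e A * k u)" using u by (intro sum.cong) (auto simp: le_def)
    finally show "(\<Sum>A\<in>le x. e A * (if u \<in> {N A..x} then k u else 0)) = k u * (\<Sum>A\<in>le u. e A)"
      by (simp add: sum_distrib_left mult.commute)
  qed
qed

lemma abel_deriv:
  fixes e :: "'p multiset \<Rightarrow> real"
  assumes k: "continuous_on {1..x} k" and x: "x \<ge> 1"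
    and h: "\<And>u. u \<in> {1..x} \<Longrightarrow> (h has_real_derivative k u) (at u)"
  shows "((\<lambda>u. k u * (\<Sum>A\<in>le u. e A)) has_integral (\<Sum>A\<in>le x. e A * (h x - h (N A)))) {1..x}"
proof -
  have "integral {N A..x} k = h x - h (N A)" if "A \<in> le x" for A
  proof (rule integral_unique, rule fundamental_theorem_of_calculus)
    have A: "N A \<ge> 1" "N A \<le> x" using N_ge_1 that by (auto simp: le_def)
    then show "N A \<le> x" by simp
    fix u assume "u \<in> {N A..x}"
    then show "(h has_vector_derivative k u) (at u within {N A..x})"
      using h[of u] A by (auto simp: has_real_derivative_iff_has_vector_derivative intro: has_vector_derivative_at_within)
  qed
  then show ?thesis using abel[OF k x, of e] by simp
qed

section \<open>Bounds for the counting function and for sums over norms\<close>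

lemma cnt_sum: "cnt u = (\<Sum>A\<in>le u. 1)" by (simp add: cnt_def)

lemma C0_nonneg: "C0 \<ge> 0" using cnt_approx[of 1] by simp

definition "C1 = c + C0"

lemma C1_pos: "C1 > 0" using C0_nonneg c_pos by (simp add: C1_def)

lemma sqrt_le_self: "(x::real) \<ge> 1 \<Longrightarrow> sqrt x \<le> x"
  by (simp add: real_le_lsqrt real_sqrt_le_iff sqrt_le_D power2_eq_square)

lemma cnt_le: "x \<ge> 1 \<Longrightarrow> cnt x \<le> C1 * x"
proof -
  assume x: "x \<ge> 1"
  have "C0 * sqrt x \<le> C0 * x" using C0_nonneg sqrt_le_self[OF x] by (intro mult_left_mono) auto
  then show ?thesis using cnt_approx[OF x] by (simp add: C1_def algebra_simps)
qed

text \<open>A lower density valid for all x \<ge> 1. Once sqrt x \<ge> 2 C0 / c + 1, the error is at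
  most half of c x; for smaller x the empty multiset alone makes the count at least 1.\<close>

definition "c1 = min (c / 2) (1 / (2 * C0 / c + 1)\<^sup>2)"

lemma c1_pos: "c1 > 0"
proof -
  have "2 * C0 / c + 1 > 0" using c_pos C0_nonneg by (simp add: add_nonneg_pos)
  then show ?thesis using c_pos by (simp add: c1_def)
qed

lemma cnt_ge: "x \<ge> 1 \<Longrightarrow> cnt x \<ge> c1 * x"
proof (cases "sqrt x \<ge> 2 * C0 / c + 1")
  case True assume x: "x \<ge> 1"
  have "sqrt x \<ge> 2 * C0 / c" using True by simp
  then have "2 * C0 * 1 \<le> sqrt x * c" using c_pos by (simp add: field_simps)
  then have "2 * C0 * sqrt x \<le> sqrt x * c * sqrt x" using x by (simp add: mult_right_mono)
  also have "\<dots> = c * x" using x by (simp add: mult_ac)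
  finally have "cnt x \<ge> c / 2 * x" using cnt_approx[OF x] by linarith
  moreover have "c1 * x \<le> c / 2 * x" using x by (intro mult_right_mono) (auto simp: c1_def)
  ultimately show ?thesis by linarith
next
  case False assume x: "x \<ge> 1"
  define y where "y = 2 * C0 / c + 1"
  have y: "y > 0" using c_pos C0_nonneg by (simp add: y_def add_nonneg_pos)
  have "x \<le> y\<^sup>2" using False x y by (metis y_def less_eq_real_def linorder_not_le real_le_lsqrt real_sqrt_le_iff real_sqrt_unique sqrt_le_D)
  have "c1 * x \<le> (1 / y\<^sup>2) * y\<^sup>2" using c1_pos x \<open>x \<le> y\<^sup>2\<close> y by (intro mult_mono) (auto simp: c1_def y_def)
  also have "\<dots> = 1" using y by simp
  also have "1 \<le> cnt x"
  proof -
    have "{{#}} \<subseteq> le x" using x by (auto simp: le_def)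
    from card_mono[OF finite_le this] show ?thesis by (simp add: cnt_def)
  qed
  finally show ?thesis .
qed

lemma has_integral_powr: 
  fixes a x :: real assumes "x \<ge> 1" "a \<noteq> -1"
  shows "((\<lambda>u. u powr a) has_integral (x powr (a+1) - 1) / (a+1)) {1..x}"
proof -
  have "((\<lambda>u. u powr a) has_integral x powr (a+1) / (a+1) - 1 powr (a+1) / (a+1)) {1..x}"
    using assms by (intro fundamental_theorem_of_calculus)
      (auto intro!: derivative_eq_intros simp flip: has_real_derivative_iff_has_vector_derivative)
  then show ?thesis by (simp add: diff_divide_distrib)
qed

text \<open>Partial summation from \<open>cnt_le\<close>. The constant stays finite for every
  exponent below 1, which is why error terms with a power saving are harmless under summation over x
  / N A.\<close>

lemma sum_powr_le:
  assumes x: "x \<ge> 1" and t: "0 \<le> \<theta>" "\<theta> < 1"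
  shows "(\<Sum>A\<in>le x. (x / N A) powr \<theta>) \<le> C1 / (1 - \<theta>) * x"
proof -
  define k where "k = (\<lambda>u. \<theta> * x powr \<theta> * u powr (- \<theta> - 1))"
  have "((\<lambda>u. k u * (\<Sum>A\<in>le u. 1)) has_integral (\<Sum>A\<in>le x. 1 * (- (x powr \<theta> * x powr (- \<theta>)) - - (x powr \<theta> * N A powr (- \<theta>))))) {1..x}"
    by (rule abel_deriv) (use x in \<open>auto simp: k_def intro!: continuous_intros derivative_eq_intros\<close>)
  moreover have "((\<lambda>u. \<theta> * x powr \<theta> * C1 * u powr (- \<theta>)) has_integral (\<theta> * x powr \<theta> * C1 * ((x powr (- \<theta>+1) - 1) / (- \<theta>+1)))) {1..x}"
    by (intro has_integral_mult_right has_integral_powr) (use x t in auto)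
  ultimately have "(\<Sum>A\<in>le x. 1 * (- (x powr \<theta> * x powr (- \<theta>)) - - (x powr \<theta> * N A powr (- \<theta>)))) \<le> \<theta> * x powr \<theta> * C1 * ((x powr (- \<theta>+1) - 1) / (- \<theta>+1))"
  proof (rule has_integral_le)
    fix u assume u: "u \<in> {1..x}"
    have "k u * cnt u \<le> k u * (C1 * u)" using cnt_le[of u] u t by (intro mult_left_mono) (auto simp: k_def)
    also have "\<dots> = \<theta> * x powr \<theta> * C1 * u powr (- \<theta>)" using u by (simp add: k_def powr_diff)
    finally show "k u * (\<Sum>A\<in>le u. 1) \<le> \<theta> * x powr \<theta> * C1 * u powr (- \<theta>)" by (simp add: cnt_sum)
  qed
  also have "(\<Sum>A\<in>le x. 1 * (- (x powr \<theta> * x powr (- \<theta>)) - - (x powr \<theta> * N A powr (- \<theta>)))) = (\<Sum>A\<in>le x. (x / N A) powr \<theta> - 1)"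
    by (intro sum.cong refl) (use x in \<open>auto simp: powr_divide powr_minus field_simps\<close>)
  also have "\<dots> = (\<Sum>A\<in>le x. (x / N A) powr \<theta>) - cnt x" by (simp add: sum_subtractf cnt_def)
  also have "\<theta> * x powr \<theta> * C1 * ((x powr (- \<theta>+1) - 1) / (- \<theta>+1)) \<le> \<theta> * x powr \<theta> * C1 * (x powr (- \<theta>+1) / (- \<theta>+1))"
    using t x C1_pos by (intro mult_left_mono divide_right_mono) auto
  also have "\<dots> = \<theta> * C1 / (1 - \<theta>) * (x powr \<theta> * x powr (- \<theta>+1))" by simp
  also have "x powr \<theta> * x powr (- \<theta>+1) = x" using x by (simp flip: powr_add)
  finally have "(\<Sum>A\<in>le x. (x / N A) powr \<theta>) \<le> \<theta> * C1 / (1 - \<theta>) * x + C1 * x" using cnt_le[OF x] by linarith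
  also have "\<dots> = C1 / (1 - \<theta>) * x" using t by (simp add: field_simps)
  finally show ?thesis .
qed

lemma sum_inverse_le:
  assumes x: "x \<ge> 1"
  shows "(\<Sum>A\<in>le x. 1 / N A) \<le> C1 * (1 + ln x)"
proof -
  have "((\<lambda>u. u powr (-2) * (\<Sum>A\<in>le u. 1)) has_integral (\<Sum>A\<in>le x. 1 * (- (1 / x) - - (1 / N A)))) {1..x}"
    by (rule abel_deriv) (use x in \<open>auto intro!: continuous_intros derivative_eq_intros simp: powr_minus power2_eq_square divide_simps\<close>)
  moreover have "((\<lambda>u. C1 * (1 / u)) has_integral (C1 * (ln x - ln 1))) {1..x}"
    by (intro has_integral_mult_right fundamental_theorem_of_calculus)
       (use x in \<open>auto intro!: derivative_eq_intros simp flip: has_real_derivative_iff_has_vector_derivative\<close>)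
  ultimately have "(\<Sum>A\<in>le x. 1 * (- (1 / x) - - (1 / N A))) \<le> C1 * (ln x - ln 1)"
  proof (rule has_integral_le)
    fix u assume u: "u \<in> {1..x}"
    have "u powr (-2) * cnt u \<le> u powr (-2) * (C1 * u)" using cnt_le[of u] u by (intro mult_left_mono) auto
    also have "\<dots> = C1 * (1 / u)" using u by (simp add: powr_minus power2_eq_square field_simps)
    finally show "u powr (-2) * (\<Sum>A\<in>le u. 1) \<le> C1 * (1 / u)" by (simp add: cnt_sum)
  qed
  also have "(\<Sum>A\<in>le x. 1 * (- (1 / x) - - (1 / N A))) = (\<Sum>A\<in>le x. 1 / N A) - cnt x / x"
    by (simp add: sum_subtractf cnt_def)
  finally have "(\<Sum>A\<in>le x. 1 / N A) - cnt x / x \<le> C1 * ln x" by simp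
  moreover have "cnt x / x \<le> C1" using cnt_le[OF x] x by (simp add: field_simps)
  ultimately show ?thesis by (simp add: algebra_simps)
qed

text \<open>The upper half of Mertens' theorem: as cnt y \<ge> c1 y, the sum is dominated by the sum
  of mang B cnt (x / N B), which equals the sum of ln (N A) over N A \<le> x.\<close>

lemma sum_mang_div_le:
  assumes x: "x \<ge> 1"
  shows "(\<Sum>B\<in>le x. mang B / N B) \<le> C1 / c1 * ln x"
proof -
  have "c1 * x * (\<Sum>B\<in>le x. mang B / N B) = (\<Sum>B\<in>le x. mang B * (c1 * (x / N B)))"
    by (simp add: sum_distrib_left mult_ac)
  also have "\<dots> \<le> (\<Sum>B\<in>le x. mang B * cnt (x / N B))"
  proof (intro sum_mono mult_left_mono cnt_ge)
    fix B assume "B \<in> le x"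
    then show "1 \<le> x / N B" "mang B \<ge> 0" using N_pos[of B] mang_nonneg[of B] by (auto simp: le_def field_simps)
  qed
  also have "\<dots> = (\<Sum>B\<in>le x. \<Sum>D\<in>le (x / N B). mang B)" by (simp add: cnt_def mult.commute)
  also have "\<dots> = (\<Sum>A\<in>le x. \<Sum>B | B \<subseteq># A. mang B)" by (rule sum_conv[symmetric])
  also have "\<dots> = (\<Sum>A\<in>le x. ln (N A))" by (intro sum.cong refl sum_mang) (simp add: le_def)
  also have "\<dots> \<le> (\<Sum>A\<in>le x. ln x)"
    by (rule sum_mono) (use N_pos x in \<open>auto simp: le_def\<close>)
  also have "\<dots> = cnt x * ln x" by (simp add: cnt_def)
  also have "\<dots> \<le> C1 * x * ln x" using x by (intro mult_right_mono cnt_le) auto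
  finally show ?thesis using c1_pos x by (simp add: field_simps)
qed

end

section \<open>Selberg's formula\<close>

text \<open>The truncated integrals form a Cauchy family with rate x^(-a). Their limit supplies the
  constants in the asymptotic formulas below.\<close>

lemma improper_integral_tail:
  fixes \<phi> :: "real \<Rightarrow> real"
  assumes int: "\<And>x. x \<ge> 1 \<Longrightarrow> \<phi> integrable_on {1..x}"
    and bd: "\<And>u. u \<ge> 1 \<Longrightarrow> \<bar>\<phi> u\<bar> \<le> K * u powr (- 1 - a)" and a: "a > 0" and K: "K \<ge> 0"
  obtains L where "\<And>x. x \<ge> 1 \<Longrightarrow> \<bar>integral {1..x} \<phi> - L\<bar> \<le> K / a * x powr (- a)"
proof -
  define I where "I = (\<lambda>x. integral {1..x} \<phi>)"
  have diff: "\<bar>I y - I x\<bar> \<le> K / a * x powr (- a)" if xy: "1 \<le> x" "x \<le> y" for x y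
  proof -
    have "I y = I x + integral {x..y} \<phi>"
      unfolding I_def using xy int[of y] Henstock_Kurzweil_Integration.integral_combine[of 1 x y \<phi>] by simp
    then have "\<bar>I y - I x\<bar> = \<bar>integral {x..y} \<phi>\<bar>" by simp
    also have "\<dots> \<le> integral {x..y} (\<lambda>u. K * u powr (- 1 - a))"
    proof -
      have "norm (integral {x..y} \<phi>) \<le> integral {x..y} (\<lambda>u. K * u powr (- 1 - a))"
      proof (rule Henstock_Kurzweil_Integration.integral_norm_bound_integral)
        show "\<phi> integrable_on {x..y}"
          by (rule integrable_subinterval_real[OF int[of y]]) (use xy in simp_all)
        show "(\<lambda>u. K * u powr (- 1 - a)) integrable_on {x..y}"
          using xy by (intro integrable_continuous_interval continuous_intros) auto
      qed (use bd xy in auto)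
      then show ?thesis by simp
    qed
    also have "\<dots> = - (K / a * y powr (- a)) - (- (K / a * x powr (- a)))"
      using xy a by (intro integral_unique fundamental_theorem_of_calculus)
        (auto intro!: derivative_eq_intros simp: field_simps powr_diff powr_minus simp flip: has_real_derivative_iff_has_vector_derivative)
    also have "\<dots> \<le> K / a * x powr (- a)" using K a by simp
    finally show ?thesis .
  qed
  have lim0: "(\<lambda>n. K / a * (1 + real n) powr (- a)) \<longlonglongrightarrow> 0"
    using a by real_asymp
  have "Cauchy (\<lambda>n. I (1 + real n))"
  proof (rule CauchyI)
    fix e :: real assume "e > 0"
    then have "eventually (\<lambda>n. K / a * (1 + real n) powr (- a) < e) sequentially"
      using lim0 order_tendstoD(2) by blast
    then obtain M where M: "\<And>n. n \<ge> M \<Longrightarrow> K / a * (1 + real n) powr (- a) < e" by (auto simp: eventually_sequentially)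
    have "\<bar>I (1 + real m) - I (1 + real n)\<bar> < e" if "n \<ge> M" "m \<ge> n" for m n
      using diff[of "1 + real n" "1 + real m"] M[OF that(1)] that by simp
    then show "\<exists>M. \<forall>m\<ge>M. \<forall>n\<ge>M. norm (I (1 + real m) - I (1 + real n)) < e"
      by (metis abs_minus_commute nle_le real_norm_def)
  qed
  then obtain L where L: "(\<lambda>n. I (1 + real n)) \<longlonglongrightarrow> L" using Cauchy_convergent convergent_def by blast
  have "\<bar>I x - L\<bar> \<le> K / a * x powr (- a)" if x: "x \<ge> 1" for x
  proof (rule tendsto_upperbound)
    show "(\<lambda>n. \<bar>I x - I (1 + real n)\<bar>) \<longlonglongrightarrow> \<bar>I x - L\<bar>" by (intro tendsto_intros L)
    show "\<forall>\<^sub>F n in sequentially. \<bar>I x - I (1 + real n)\<bar> \<le> K / a * x powr (- a)"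
      using eventually_ge_at_top[of "nat \<lceil>x\<rceil>"]
    proof eventually_elim
      case (elim n)
      then have "x \<le> 1 + real n" by linarith
      then show ?case using diff[OF x, of "1 + real n"] by (subst abs_minus_commute) simp
    qed
  qed simp
  then show thesis unfolding I_def by (rule that)
qed

context prime_system
begin

text \<open>Selberg's weight of order two, whose Dirichlet series is Z'' / Z for the zeta function Z
  of the system.\<close>

definition mang2 :: "'p multiset \<Rightarrow> real" where
  "mang2 A = mang A * ln (N A) + (\<Sum>B | B \<subseteq># A. mang B * mang (A - B))"

text \<open>Associativity of convolution: chains D \<subseteq> B \<subseteq> A correspond to pairs
  D, E with D + E \<subseteq> A, by E = B - D.\<close>

lemma sum_nested:
  fixes G :: "'p multiset \<Rightarrow> 'p multiset \<Rightarrow> 'b::comm_monoid_add"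
  shows "(\<Sum>B | B \<subseteq># A. \<Sum>D | D \<subseteq># B. G D (B - D)) = (\<Sum>D | D \<subseteq># A. \<Sum>E | E \<subseteq># A - D. G D E)"
proof -
  have 1: "(\<Sum>B | B \<subseteq># A. \<Sum>D | D \<subseteq># B. G D (B - D)) = (\<Sum>(B,D)\<in>Sigma {B. B \<subseteq># A} (\<lambda>B. {D. D \<subseteq># B}). G D (B - D))"
    by (rule sum.Sigma) auto
  have 2: "(\<Sum>D | D \<subseteq># A. \<Sum>E | E \<subseteq># A - D. G D E) = (\<Sum>(D,E)\<in>Sigma {D. D \<subseteq># A} (\<lambda>D. {E. E \<subseteq># A - D}). G D E)"
    by (rule sum.Sigma) auto
  show ?thesis unfolding 1 2
  proof (rule sum.reindex_bij_witness[of _ "\<lambda>(D,E). (D + E, D)" "\<lambda>(B,D). (D, B - D)"])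
    fix a assume "a \<in> Sigma {B. B \<subseteq># A} (\<lambda>B. {D. D \<subseteq># B})"
    then obtain B D where a: "a = (B,D)" "B \<subseteq># A" "D \<subseteq># B" by auto
    show "(case case a of (B, D) \<Rightarrow> (D, B - D) of (D, E) \<Rightarrow> (D + E, D)) = a" using a by simp
    have "D \<subseteq># A" using a by (meson subset_mset.order_trans)
    moreover have "B - D \<subseteq># A - D" using a by (auto simp: subseteq_mset_def intro: diff_le_mono)
    ultimately show "(case a of (B, D) \<Rightarrow> (D, B - D)) \<in> Sigma {D. D \<subseteq># A} (\<lambda>D. {E. E \<subseteq># A - D})" using a by simp
    show "(case case a of (B, D) \<Rightarrow> (D, B - D) of (D, E) \<Rightarrow> G D E) = (case a of (B, D) \<Rightarrow> G D (B - D))" using a by simp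
  next
    fix b assume "b \<in> Sigma {D. D \<subseteq># A} (\<lambda>D. {E. E \<subseteq># A - D})"
    then obtain D E where b: "b = (D,E)" "D \<subseteq># A" "E \<subseteq># A - D" by auto
    have "D + E \<subseteq># A"
      using subset_mset.add_left_mono[OF b(3), of D] b(2) by simp
    then show "(case b of (D, E) \<Rightarrow> (D + E, D)) \<in> Sigma {B. B \<subseteq># A} (\<lambda>B. {D. D \<subseteq># B})" using b by simp
    show "(case case b of (D, E) \<Rightarrow> (D + E, D) of (B, D) \<Rightarrow> (D, B - D)) = b" using b by simp
  qed
qed

lemma mang2_ge: "A \<in> Ms \<Longrightarrow> mang A * ln (N A) \<le> mang2 A"
  unfolding mang2_def using Ms_subset[of A] Ms_diff[of A]
  by (auto intro!: sum_nonneg mult_nonneg_nonneg mang_nonneg)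

lemma mang2_nonneg: "A \<in> Ms \<Longrightarrow> mang2 A \<ge> 0"
  using mang2_ge[of A] mang_nonneg[of A] N_ge_1[of A] by (meson ln_ge_zero mult_nonneg_nonneg order_trans)

text \<open>Associativity reduces the divisor sum of the convolution square of \<open>mang\<close>
  to a sum of mang D ln (N (A - D)). As ln (N B) + ln (N (A - B)) = ln (N A), one factor ln (N A)
  comes out and \<open>sum_mang\<close> gives the other.\<close>

lemma sum_mang2:
  assumes A: "A \<in> Ms"
  shows "(\<Sum>B | B \<subseteq># A. mang2 B) = (ln (N A))\<^sup>2"
proof -
  have "(\<Sum>B | B \<subseteq># A. mang2 B) = (\<Sum>B | B \<subseteq># A. mang B * ln (N B)) + (\<Sum>B | B \<subseteq># A. \<Sum>D | D \<subseteq># B. mang D * mang (B - D))"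
    by (simp add: mang2_def sum.distrib)
  also have "(\<Sum>B | B \<subseteq># A. \<Sum>D | D \<subseteq># B. mang D * mang (B - D)) = (\<Sum>D | D \<subseteq># A. \<Sum>E | E \<subseteq># A - D. mang D * mang E)"
    by (rule sum_nested)
  also have "\<dots> = (\<Sum>D | D \<subseteq># A. mang D * ln (N (A - D)))"
    using A by (intro sum.cong refl) (simp add: sum_mang Ms_diff flip: sum_distrib_left)
  also have "(\<Sum>B | B \<subseteq># A. mang B * ln (N B)) + \<dots> = (\<Sum>B | B \<subseteq># A. mang B * ln (N A))"
    unfolding sum.distrib[symmetric]
  proof (intro sum.cong refl)
    fix B assume "B \<in> {B. B \<subseteq># A}"
    then have "B \<subseteq># A" "B \<in> Ms" using A Ms_subset by auto
    then show "mang B * ln (N B) + mang B * ln (N (A - B)) = mang B * ln (N A)"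
      using A N_pos[of B] N_pos[of A] by (simp add: N_diff ln_div algebra_simps)
  qed
  also have "\<dots> = (ln (N A))\<^sup>2" by (simp add: sum_mang[OF A] power2_eq_square flip: sum_distrib_right)
  finally show ?thesis .
qed

lemma integral_inverse: 
  assumes x: "x \<ge> 1" shows "((\<lambda>u. 1 / u) has_integral ln x) {1..x::real}"
proof -
  have "((\<lambda>u. 1 / u) has_integral (ln x - ln 1)) {1..x}"
    using x by (intro fundamental_theorem_of_calculus)
      (auto intro!: derivative_eq_intros simp flip: has_real_derivative_iff_has_vector_derivative)
  then show ?thesis by simp
qed

lemma abel_cnt:
  assumes "continuous_on {1..x} k" and "x \<ge> 1"
    and "\<And>u. u \<in> {1..x} \<Longrightarrow> (h has_real_derivative k u) (at u)"
  shows "((\<lambda>u. k u * cnt u) has_integral (cnt x * h x - (\<Sum>A\<in>le x. h (N A)))) {1..x}"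
  using abel_deriv[OF assms, of "\<lambda>_. 1"] by (simp add: cnt_def sum_subtractf)

lemma powr_add': "x powr a * x powr b = x powr d" if "d = a + b" for x a b d :: real
  using that by (simp add: powr_add)

lemma diff_diff_subs: "B \<subseteq># A \<Longrightarrow> A - (A - B) = B"
  by (auto intro!: multiset_eqI simp: subseteq_mset_def)

lemma sum_diff_subs: "(\<Sum>B | B \<subseteq># A. f (A - B)) = (\<Sum>B | B \<subseteq># A. f B)"
  by (rule sum.reindex_bij_witness[of _ "\<lambda>B. A - B" "\<lambda>B. A - B"]) (auto simp: diff_diff_subs)

text \<open>Partial summation with cnt u = c u + R u. The integral of R u / u^2 converges, and its
  value plus c is the constant \<gamma>.\<close>

lemma sum_inverse_asymp:
  obtains \<gamma> K where "K \<ge> 0" "\<And>x. x \<ge> 1 \<Longrightarrow> \<bar>(\<Sum>A\<in>le x. 1 / N A) - c * ln x - \<gamma>\<bar> \<le> K * x powr (- 1/2)"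
proof -
  define R where "R = (\<lambda>u. cnt u - c * u)"
  have ha: "((\<lambda>u. u powr (-2) * cnt u) has_integral (cnt x * (- (1 / x)) - (\<Sum>A\<in>le x. - (1 / N A)))) {1..x}" if x: "x \<ge> 1" for x
    by (rule abel_cnt) (use x in \<open>auto intro!: continuous_intros derivative_eq_intros simp: powr_minus power2_eq_square divide_simps\<close>)
  have hR: "((\<lambda>u. u powr (-2) * R u) has_integral ((\<Sum>A\<in>le x. 1 / N A) - cnt x / x - c * ln x)) {1..x}" if x: "x \<ge> 1" for x
  proof -
    have "((\<lambda>u. u powr (-2) * cnt u - c * (1 / u)) has_integral (cnt x * (- (1 / x)) - (\<Sum>A\<in>le x. - (1 / N A))) - c * ln x) {1..x}"
      by (intro has_integral_diff ha x has_integral_mult_right integral_inverse)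
    also have "(cnt x * (- (1 / x)) - (\<Sum>A\<in>le x. - (1 / N A))) - c * ln x = (\<Sum>A\<in>le x. 1 / N A) - cnt x / x - c * ln x"
      by (simp add: sum_negf)
    finally have *: "((\<lambda>u. u powr (-2) * cnt u - c * (1 / u)) has_integral \<dots>) {1..x}" .
    show ?thesis
    proof (rule has_integral_eq[OF _ *])
      fix u assume "u \<in> {1..x}"
      then show "u powr (-2) * cnt u - c * (1 / u) = u powr (-2) * R u"
        by (simp add: R_def powr_minus power2_eq_square field_simps)
    qed
  qed
  have Rb: "\<bar>u powr (-2) * R u\<bar> \<le> C0 * u powr (- 1 - 1/2)" if "u \<ge> 1" for u
  proof -
    have "\<bar>u powr (-2) * R u\<bar> = u powr (-2) * \<bar>R u\<bar>" by (simp add: abs_mult)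
    also have "\<dots> \<le> u powr (-2) * (C0 * u powr (1/2))"
      using cnt_approx[OF that] that by (intro mult_left_mono) (auto simp: R_def powr_half_sqrt)
    also have "\<dots> = C0 * (u powr (-2) * u powr (1/2))" by simp
    also have "u powr (-2) * u powr (1/2) = u powr (- 1 - 1/2)" by (rule powr_add') simp
    finally show ?thesis .
  qed
  obtain L where L: "\<And>x. x \<ge> 1 \<Longrightarrow> \<bar>integral {1..x} (\<lambda>u. u powr (-2) * R u) - L\<bar> \<le> C0 / (1/2) * x powr (- (1/2))"
    by (rule improper_integral_tail[OF has_integral_integrable[OF hR] Rb _ C0_nonneg], assumption, assumption, simp, blast)
  have "\<bar>(\<Sum>A\<in>le x. 1 / N A) - c * ln x - (L + c)\<bar> \<le> (3 * C0) * x powr (- 1/2)" if x: "x \<ge> 1" for x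
  proof -
    have "cnt x / x - c = R x / x" using x by (simp add: R_def diff_divide_distrib)
    then have "\<bar>cnt x / x - c\<bar> = \<bar>R x\<bar> / x" using x by (simp add: abs_divide)
    also have "\<dots> \<le> C0 * sqrt x / x" using cnt_approx[OF x] x by (simp add: R_def divide_right_mono)
    also have "\<dots> = C0 * (x powr (1/2) * x powr (-1))" using x by (simp add: powr_half_sqrt powr_minus field_simps)
    also have "x powr (1/2) * x powr (-1) = x powr (-1/2)" by (rule powr_add') simp
    finally have "\<bar>cnt x / x - c\<bar> \<le> C0 * x powr (-1/2)" .
    then show ?thesis using L[OF x] integral_unique[OF hR[OF x]] by simp
  qed
  note * = this
  show thesis by (rule that[OF _ *]) (use C0_nonneg in simp)
qed

text \<open>The preceding asymptotic formula is integrated against du / u; its error term has a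
  convergent integral, which is \<gamma>1.\<close>

lemma sum_inverse_log_asymp:
  obtains \<gamma> \<gamma>1 K where "K \<ge> 0" "\<And>x. x \<ge> 1 \<Longrightarrow> \<bar>(\<Sum>A\<in>le x. 1 / N A) - c * ln x - \<gamma>\<bar> \<le> K * x powr (- 1/2)"
     "\<And>x. x \<ge> 1 \<Longrightarrow> \<bar>(\<Sum>A\<in>le x. 1 / N A * ln (x / N A)) - c / 2 * (ln x)\<^sup>2 - \<gamma> * ln x - \<gamma>1\<bar> \<le> K * x powr (- 1/2)"
proof -
  obtain \<gamma> K where K: "K \<ge> 0" and V: "\<And>x. x \<ge> 1 \<Longrightarrow> \<bar>(\<Sum>A\<in>le x. 1 / N A) - c * ln x - \<gamma>\<bar> \<le> K * x powr (- 1/2)"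
    by (rule sum_inverse_asymp) blast
  define E where "E = (\<lambda>x. (\<Sum>A\<in>le x. 1 / N A) - c * ln x - \<gamma>)"
  have hE: "((\<lambda>u. 1 / u * E u) has_integral ((\<Sum>A\<in>le x. 1 / N A * ln (x / N A)) - c / 2 * (ln x)\<^sup>2 - \<gamma> * ln x)) {1..x}" if x: "x \<ge> 1" for x
  proof -
    have 1: "((\<lambda>u. 1 / u * (\<Sum>A\<in>le u. 1 / N A)) has_integral (\<Sum>A\<in>le x. 1 / N A * (ln x - ln (N A)))) {1..x}"
      by (rule abel_deriv) (use x in \<open>auto intro!: continuous_intros derivative_eq_intros\<close>)
    have "((\<lambda>u. c * (ln u / u)) has_integral (c / 2 * (ln x)\<^sup>2 - c / 2 * (ln 1)\<^sup>2)) {1..x}"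
      using x by (intro fundamental_theorem_of_calculus) 
        (auto intro!: derivative_eq_intros simp: field_simps simp flip: has_real_derivative_iff_has_vector_derivative)
    then have 2: "((\<lambda>u. c * (ln u / u)) has_integral (c / 2 * (ln x)\<^sup>2)) {1..x}" by simp
    have "((\<lambda>u. 1 / u * (\<Sum>A\<in>le u. 1 / N A) - c * (ln u / u) - \<gamma> * (1 / u)) has_integral
        ((\<Sum>A\<in>le x. 1 / N A * (ln x - ln (N A))) - c / 2 * (ln x)\<^sup>2 - \<gamma> * ln x)) {1..x}"
      by (intro has_integral_diff 1 2 has_integral_mult_right integral_inverse x)
    moreover have "(\<Sum>A\<in>le x. 1 / N A * (ln x - ln (N A))) = (\<Sum>A\<in>le x. 1 / N A * ln (x / N A))"
      using x N_pos by (intro sum.cong refl) (auto simp: le_def ln_div)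
    ultimately have *: "((\<lambda>u. 1 / u * (\<Sum>A\<in>le u. 1 / N A) - c * (ln u / u) - \<gamma> * (1 / u)) has_integral
        ((\<Sum>A\<in>le x. 1 / N A * ln (x / N A)) - c / 2 * (ln x)\<^sup>2 - \<gamma> * ln x)) {1..x}" by simp
    show ?thesis
    proof (rule has_integral_eq[OF _ *])
      fix u assume "u \<in> {1..x}"
      then show "1 / u * (\<Sum>A\<in>le u. 1 / N A) - c * (ln u / u) - \<gamma> * (1 / u) = 1 / u * E u"
        by (simp add: E_def algebra_simps diff_divide_distrib)
    qed
  qed
  have Eb: "\<bar>1 / u * E u\<bar> \<le> K * u powr (- 1 - 1/2)" if u: "u \<ge> 1" for u
  proof -
    have "\<bar>1 / u * E u\<bar> = \<bar>E u\<bar> * u powr (-1)" using u by (simp add: abs_mult powr_minus field_simps)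
    also have "\<dots> \<le> K * u powr (-1/2) * u powr (-1)" using V[OF u] by (intro mult_right_mono) (auto simp: E_def)
    also have "\<dots> = K * (u powr (-1/2) * u powr (-1))" by (simp only: mult.assoc)
    also have "u powr (-1/2) * u powr (-1) = u powr (- 1 - 1/2)" by (rule powr_add') simp
    finally show ?thesis .
  qed
  obtain L where L: "\<And>x. x \<ge> 1 \<Longrightarrow> \<bar>integral {1..x} (\<lambda>u. 1 / u * E u) - L\<bar> \<le> K / (1/2) * x powr (- (1/2))"
    by (rule improper_integral_tail[OF has_integral_integrable[OF hE] Eb _ K], assumption, assumption, simp, blast)
  show thesis
  proof (rule that[of "2 * K" \<gamma> L])
    fix x :: real assume x: "x \<ge> 1"
    have "K * x powr (- 1/2) \<le> 2 * K * x powr (- 1/2)" using K by simp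
    then show "\<bar>(\<Sum>A\<in>le x. 1 / N A) - c * ln x - \<gamma>\<bar> \<le> 2 * K * x powr (- 1/2)" using V[OF x] by linarith
    show "\<bar>(\<Sum>A\<in>le x. 1 / N A * ln (x / N A)) - c / 2 * (ln x)\<^sup>2 - \<gamma> * ln x - L\<bar> \<le> 2 * K * x powr (- 1/2)"
      using L[OF x] integral_unique[OF hE[OF x]] by simp
  qed (use K in auto)
qed

text \<open>Trades two logarithms for a power x^(1/4), so that the single exponent 3/4 < 1 serves
  for all error terms.\<close>

lemma log_square_le: "(x::real) \<ge> 1 \<Longrightarrow> sqrt x * (1 + ln x)\<^sup>2 \<le> 81 * x powr (3/4)"
proof -
  assume x: "x \<ge> 1"
  have "ln x \<le> x powr (1/8) / (1/8)" using x by (intro ln_powr_bound) auto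
  moreover have "1 \<le> x powr (1/8)" using x by (simp add: ge_one_powr_ge_zero)
  ultimately have "1 + ln x \<le> 9 * x powr (1/8)" by simp
  then have "(1 + ln x)\<^sup>2 \<le> (9 * x powr (1/8))\<^sup>2" using x by (intro power_mono) auto
  also have "\<dots> = 81 * x powr (1/4)" using x by (simp add: power_mult_distrib powr_power)
  finally have "sqrt x * (1 + ln x)\<^sup>2 \<le> x powr (1/2) * (81 * x powr (1/4))" using x by (simp add: powr_half_sqrt)
  also have "\<dots> = 81 * (x powr (1/2) * x powr (1/4))" by simp
  also have "x powr (1/2) * x powr (1/4) = x powr (3/4)" by (rule powr_add') simp
  finally show ?thesis .
qed

lemma sum_log_square_asymp:
  assumes x: "x \<ge> 1"
  shows "\<bar>(\<Sum>A\<in>le x. (ln (N A))\<^sup>2) - (c * x * (ln x)\<^sup>2 - 2 * c * x * ln x + 2 * c * x)\<bar> \<le> (486 * C0 + 2 * c) * x powr (3/4)"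
proof -
  define R where "R = (\<lambda>u. cnt u - c * u)"
  have 1: "((\<lambda>u. 2 * ln u / u * cnt u) has_integral (cnt x * (ln x)\<^sup>2 - (\<Sum>A\<in>le x. (ln (N A))\<^sup>2))) {1..x}"
    by (rule abel_cnt) (use x in \<open>auto intro!: continuous_intros derivative_eq_intros\<close>)
  have "((\<lambda>u. 2 * c * ln u) has_integral (2 * c * (x * ln x - x) - 2 * c * (1 * ln 1 - 1))) {1..x}"
    using x by (intro fundamental_theorem_of_calculus) 
      (auto intro!: derivative_eq_intros simp: algebra_simps simp flip: has_real_derivative_iff_has_vector_derivative)
  then have 2: "((\<lambda>u. 2 * c * ln u) has_integral (2 * c * (x * ln x - x + 1))) {1..x}" by (simp add: algebra_simps)
  have 3: "((\<lambda>u. 2 * ln u / u * R u) has_integral (cnt x * (ln x)\<^sup>2 - (\<Sum>A\<in>le x. (ln (N A))\<^sup>2) - 2 * c * (x * ln x - x + 1))) {1..x}"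
  proof (rule has_integral_eq[OF _ has_integral_diff[OF 1 2]])
    fix u assume "u \<in> {1..x}"
    then have "u > 0" by simp
    then show "2 * ln u / u * cnt u - 2 * c * ln u = 2 * ln u / u * R u"
      by (simp add: R_def field_simps)
  qed
  have 4: "((\<lambda>u. 2 * ln x * C0 * u powr (-1/2)) has_integral (2 * ln x * C0 * ((x powr (-1/2+1) - 1) / (-1/2+1)))) {1..x}"
    by (intro has_integral_mult_right has_integral_powr x) auto
  have 5: "\<bar>2 * ln u / u * R u\<bar> \<le> 2 * ln x * C0 * u powr (-1/2)" if u: "u \<in> {1..x}" for u
  proof -
    have "\<bar>2 * ln u / u * R u\<bar> = 2 * ln u * u powr (-1) * \<bar>R u\<bar>" using u by (simp add: abs_mult powr_minus field_simps)
    also have "\<dots> \<le> 2 * ln x * u powr (-1) * (C0 * u powr (1/2))"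
      using u cnt_approx[of u] C0_nonneg by (intro mult_mono) (auto simp: R_def powr_half_sqrt)
    also have "\<dots> = 2 * ln x * C0 * (u powr (-1) * u powr (1/2))" by simp
    also have "u powr (-1) * u powr (1/2) = u powr (-1/2)" by (rule powr_add') simp
    finally show ?thesis .
  qed
  have "\<bar>cnt x * (ln x)\<^sup>2 - (\<Sum>A\<in>le x. (ln (N A))\<^sup>2) - 2 * c * (x * ln x - x + 1)\<bar> \<le> 2 * ln x * C0 * ((x powr (-1/2+1) - 1) / (-1/2+1))"
  proof -
    have "norm (integral {1..x} (\<lambda>u. 2 * ln u / u * R u)) \<le> integral {1..x} (\<lambda>u. 2 * ln x * C0 * u powr (-1/2))"
      by (rule Henstock_Kurzweil_Integration.integral_norm_bound_integral) (use 3 4 5 in auto)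
    then show ?thesis unfolding integral_unique[OF 3] integral_unique[OF 4] real_norm_def .
  qed
  also have "\<dots> \<le> 2 * ln x * C0 * (2 * sqrt x)"
    using x C0_nonneg by (intro mult_left_mono) (auto simp: powr_half_sqrt)
  finally have 6: "\<bar>cnt x * (ln x)\<^sup>2 - (\<Sum>A\<in>le x. (ln (N A))\<^sup>2) - 2 * c * (x * ln x - x + 1)\<bar> \<le> 4 * C0 * (sqrt x * ln x)"
    by (simp add: mult_ac)
  have 7: "\<bar>cnt x * (ln x)\<^sup>2 - c * x * (ln x)\<^sup>2\<bar> \<le> C0 * (sqrt x * (ln x)\<^sup>2)"
  proof -
    have "\<bar>cnt x * (ln x)\<^sup>2 - c * x * (ln x)\<^sup>2\<bar> = \<bar>cnt x - c * x\<bar> * (ln x)\<^sup>2" by (simp add: abs_mult flip: left_diff_distrib)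
    also have "\<dots> \<le> C0 * sqrt x * (ln x)\<^sup>2" by (intro mult_right_mono cnt_approx x) auto
    finally show ?thesis by simp
  qed
  have l0: "ln x \<ge> 0" using x by simp
  have 8: "sqrt x * ln x \<le> sqrt x * (1 + ln x)\<^sup>2" "sqrt x * (ln x)\<^sup>2 \<le> sqrt x * (1 + ln x)\<^sup>2"
    using l0 x by (intro mult_left_mono; simp add: power2_eq_square algebra_simps)+
  have 9: "4 * C0 * (sqrt x * ln x) \<le> 4 * C0 * (81 * x powr (3/4))" "C0 * (sqrt x * (ln x)\<^sup>2) \<le> C0 * (81 * x powr (3/4))"
    using 8 log_square_le[OF x] C0_nonneg by (intro mult_left_mono; linarith)+
  have "1 \<le> x powr (3/4)" using x by (simp add: ge_one_powr_ge_zero)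
  then have "2 * c \<le> 2 * c * x powr (3/4)" using c_pos by simp
  moreover have "0 \<le> C0 * x powr (3/4)" using C0_nonneg by simp
  moreover have "\<bar>(\<Sum>A\<in>le x. (ln (N A))\<^sup>2) - (c * x * (ln x)\<^sup>2 - 2 * c * x * ln x + 2 * c * x)\<bar>
     \<le> 4 * C0 * (sqrt x * ln x) + C0 * (sqrt x * (ln x)\<^sup>2) + 2 * c"
  proof -
    have "(\<Sum>A\<in>le x. (ln (N A))\<^sup>2) - (c * x * (ln x)\<^sup>2 - 2 * c * x * ln x + 2 * c * x)
      = (cnt x * (ln x)\<^sup>2 - c * x * (ln x)\<^sup>2) - (cnt x * (ln x)\<^sup>2 - (\<Sum>A\<in>le x. (ln (N A))\<^sup>2) - 2 * c * (x * ln x - x + 1)) - 2 * c"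
      by (simp add: algebra_simps)
    then show ?thesis using 6 7 c_pos by linarith
  qed
  ultimately show ?thesis using 9 unfolding distrib_right by linarith
qed

text \<open>The summatory function of \<open>mang2\<close> is compared with 2 y ln y + k1 y + k2,
  with constants such that the sums of both over x / N A agree up to O(x^(3/4)). Since the exponent
  is below 1, inversion with only |mu| \<le> 1 returns O(x), so nothing about the distribution of
  primes is presupposed.\<close>

theorem selberg_formula:
  obtains C where "C \<ge> 0" "\<And>x. x \<ge> 1 \<Longrightarrow> \<bar>(\<Sum>A\<in>le x. mang2 A) - 2 * x * ln x\<bar> \<le> C * x"
proof -
  obtain \<gamma> \<gamma>1 K where K: "K \<ge> 0" and V: "\<And>x. x \<ge> 1 \<Longrightarrow> \<bar>(\<Sum>A\<in>le x. 1 / N A) - c * ln x - \<gamma>\<bar> \<le> K * x powr (- 1/2)"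
    and V1: "\<And>x. x \<ge> 1 \<Longrightarrow> \<bar>(\<Sum>A\<in>le x. 1 / N A * ln (x / N A)) - c / 2 * (ln x)\<^sup>2 - \<gamma> * ln x - \<gamma>1\<bar> \<le> K * x powr (- 1/2)"
    by (rule sum_inverse_log_asymp) blast
  \<comment> \<open>The solutions of the two linear equations stated below; they cancel the terms of
    order x ln x and x in \<open>W\<close>. The terms x ln^2 x cancel by themselves.\<close>
  define k1 where "k1 = - 2 - 2 * \<gamma> / c"
  define k2 where "k2 = 2 - (2 * \<gamma>1 + k1 * \<gamma>) / c"
  have k1: "2 * \<gamma> + k1 * c = - 2 * c" using c_pos by (simp add: k1_def field_simps)
  have k2: "2 * \<gamma>1 + k1 * \<gamma> + k2 * c = 2 * c" using c_pos by (simp add: k2_def field_simps)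
  define Psi where "Psi = (\<lambda>x. \<Sum>A\<in>le x. mang2 A)"
  define E where "E = (\<lambda>y. Psi y - 2 * y * ln y - k1 * y - k2)"
  define W where "W = (\<lambda>y. \<Sum>A\<in>le y. E (y / N A))"
  define KW where "KW = (486 * C0 + 2 * c) + 2 * K + \<bar>k1\<bar> * K + \<bar>k2\<bar> * C0"
  have KW: "KW \<ge> 0" using K C0_nonneg c_pos by (simp add: KW_def)
  have Wb: "\<bar>W x\<bar> \<le> KW * x powr (3/4)" if x: "x \<ge> 1" for x
  proof -
    have "(\<Sum>A\<in>le x. Psi (x / N A)) = (\<Sum>A\<in>le x. \<Sum>B | B \<subseteq># A. mang2 (A - B))"
      unfolding Psi_def by (rule sum_conv[symmetric])
    also have "\<dots> = (\<Sum>A\<in>le x. \<Sum>B | B \<subseteq># A. mang2 B)"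
      by (intro sum.cong refl sum_diff_subs)
    also have "\<dots> = (\<Sum>A\<in>le x. (ln (N A))\<^sup>2)" by (intro sum.cong refl sum_mang2) (simp add: le_def)
    finally have T: "(\<Sum>A\<in>le x. Psi (x / N A)) = (\<Sum>A\<in>le x. (ln (N A))\<^sup>2)" .
    have "W x = (\<Sum>A\<in>le x. Psi (x / N A) - 2 * x * (1 / N A * ln (x / N A)) - k1 * x * (1 / N A) - k2)"
      unfolding W_def E_def by (intro sum.cong refl) simp
    also have "\<dots> = (\<Sum>A\<in>le x. (ln (N A))\<^sup>2) - 2 * x * (\<Sum>A\<in>le x. 1 / N A * ln (x / N A)) - k1 * x * (\<Sum>A\<in>le x. 1 / N A) - k2 * cnt x"
      by (simp only: sum_subtractf T sum_distrib_left[symmetric] cnt_def) simp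
    finally have W: "W x = \<dots>" .
    define l where "l = ln x"
    define eT where "eT = (\<Sum>A\<in>le x. (ln (N A))\<^sup>2) - (c * x * l\<^sup>2 - 2 * c * x * l + 2 * c * x)"
    define e1 where "e1 = (\<Sum>A\<in>le x. 1 / N A * ln (x / N A)) - c / 2 * l\<^sup>2 - \<gamma> * l - \<gamma>1"
    define eV where "eV = (\<Sum>A\<in>le x. 1 / N A) - c * l - \<gamma>"
    define eC where "eC = cnt x - c * x"
    have "W x = eT - 2 * x * e1 - k1 * x * eV - k2 * eC
       + (c * x * l\<^sup>2 - 2 * c * x * l + 2 * c * x - 2 * x * (c / 2 * l\<^sup>2 + \<gamma> * l + \<gamma>1) - k1 * x * (c * l + \<gamma>) - k2 * (c * x))"
      unfolding W eT_def e1_def eV_def eC_def by (simp add: algebra_simps)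
    also have "c * x * l\<^sup>2 - 2 * c * x * l + 2 * c * x - 2 * x * (c / 2 * l\<^sup>2 + \<gamma> * l + \<gamma>1) - k1 * x * (c * l + \<gamma>) - k2 * (c * x)
      = - x * l * (2 * \<gamma> + k1 * c + 2 * c) - x * (2 * \<gamma>1 + k1 * \<gamma> + k2 * c - 2 * c)" by (simp add: algebra_simps)
    also have "\<dots> = 0" using k1 k2 by simp
    finally have Weq: "W x = eT - 2 * x * e1 - k1 * x * eV - k2 * eC" by simp
    have half: "x powr (1/2) \<le> x powr (3/4)" using x by (simp add: powr_mono)
    have xh: "x * x powr (-1/2) = x powr (1/2)" using x by (simp add: powr_mult_base)
    have bT: "\<bar>eT\<bar> \<le> (486 * C0 + 2 * c) * x powr (3/4)" unfolding eT_def l_def by (rule sum_log_square_asymp[OF x])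
    have b1: "\<bar>2 * x * e1\<bar> \<le> 2 * K * x powr (3/4)"
    proof -
      have "\<bar>2 * x * e1\<bar> = 2 * x * \<bar>e1\<bar>" using x by (simp add: abs_mult)
      also have "\<dots> \<le> 2 * x * (K * x powr (-1/2))" using V1[OF x] x by (intro mult_left_mono) (auto simp: e1_def l_def)
      also have "\<dots> = 2 * K * x powr (1/2)" using xh by (simp add: mult_ac)
      also have "\<dots> \<le> 2 * K * x powr (3/4)" using half K by (intro mult_left_mono) auto
      finally show ?thesis .
    qed
    have bV: "\<bar>k1 * x * eV\<bar> \<le> \<bar>k1\<bar> * K * x powr (3/4)"
    proof -
      have "\<bar>k1 * x * eV\<bar> = \<bar>k1\<bar> * x * \<bar>eV\<bar>" using x by (simp add: abs_mult)
      also have "\<dots> \<le> \<bar>k1\<bar> * x * (K * x powr (-1/2))" using V[OF x] x by (intro mult_left_mono) (auto simp: eV_def l_def)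
      also have "\<dots> = \<bar>k1\<bar> * K * x powr (1/2)" using xh by (simp add: mult_ac)
      also have "\<dots> \<le> \<bar>k1\<bar> * K * x powr (3/4)" using half K by (intro mult_left_mono) auto
      finally show ?thesis .
    qed
    have bC: "\<bar>k2 * eC\<bar> \<le> \<bar>k2\<bar> * C0 * x powr (3/4)"
    proof -
      have "\<bar>k2 * eC\<bar> \<le> \<bar>k2\<bar> * (C0 * x powr (1/2))" using cnt_approx[OF x] x
        by (simp add: abs_mult eC_def powr_half_sqrt mult_left_mono)
      also have "\<dots> \<le> \<bar>k2\<bar> * (C0 * x powr (3/4))" using half C0_nonneg by (intro mult_left_mono) auto
      finally show ?thesis by simp
    qed
    show ?thesis using bT b1 bV bC unfolding Weq KW_def by (simp add: algebra_simps)
  qed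
  have Eb: "\<bar>E x\<bar> \<le> 4 * KW * C1 * x" if x: "x \<ge> 1" for x
  proof -
    have "E x = (\<Sum>A\<in>le x. mu A * W (x / N A))"
      by (rule moebius_inversion[OF _ x]) (simp add: W_def)
    then have "\<bar>E x\<bar> = \<bar>\<Sum>A\<in>le x. mu A * W (x / N A)\<bar>" by simp
    also have "\<dots> \<le> (\<Sum>A\<in>le x. KW * (x / N A) powr (3/4))"
    proof (rule order_trans[OF sum_abs], rule sum_mono)
      fix A assume "A \<in> le x"
      then have "x / N A \<ge> 1" using N_pos[of A] by (auto simp: le_def field_simps)
      have "\<bar>mu A * W (x / N A)\<bar> \<le> 1 * (KW * (x / N A) powr (3/4))"
        unfolding abs_mult using Wb[OF \<open>x / N A \<ge> 1\<close>] abs_mu_le_1 by (intro mult_mono) auto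
      then show "\<bar>mu A * W (x / N A)\<bar> \<le> KW * (x / N A) powr (3/4)" by simp
    qed
    also have "\<dots> = KW * (\<Sum>A\<in>le x. (x / N A) powr (3/4))" by (simp add: sum_distrib_left)
    also have "\<dots> \<le> KW * (C1 / (1 - 3/4) * x)" by (intro mult_left_mono sum_powr_le KW x) auto
    finally show ?thesis by simp
  qed
  have "\<bar>Psi x - 2 * x * ln x\<bar> \<le> (4 * KW * C1 + \<bar>k1\<bar> + \<bar>k2\<bar>) * x" if x: "x \<ge> 1" for x
  proof -
    have "\<bar>k1 * x\<bar> = \<bar>k1\<bar> * x" using x by (simp add: abs_mult)
    moreover have "\<bar>k2\<bar> * 1 \<le> \<bar>k2\<bar> * x" using x by (intro mult_left_mono) auto
    moreover have "\<bar>Psi x - 2 * x * ln x\<bar> \<le> \<bar>E x\<bar> + \<bar>k1 * x\<bar> + \<bar>k2\<bar>" unfolding E_def by linarith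
    ultimately show ?thesis using Eb[OF x] by (simp add: distrib_right)
  qed
  then show thesis using that[of "4 * KW * C1 + \<bar>k1\<bar> + \<bar>k2\<bar>"] KW C1_pos unfolding Psi_def by auto
qed

text \<open>For N A > sqrt x, mang A is at most (2 / ln x) mang2 A, and Selberg's formula divided by
  ln x is O(x). The elements of norm at most sqrt x contribute at most cnt (sqrt x) (ln x) /
  2.\<close>

lemma chebyshev:
  obtains C where "C > 0" "\<And>x. x \<ge> 1 \<Longrightarrow> (\<Sum>A\<in>le x. mang A) \<le> C * x"
proof -
  obtain C where C: "C \<ge> 0" "\<And>x. x \<ge> 1 \<Longrightarrow> \<bar>(\<Sum>A\<in>le x. mang2 A) - 2 * x * ln x\<bar> \<le> C * x"
    by (rule selberg_formula) blast
  have "(\<Sum>A\<in>le x. mang A) \<le> (C1 + 4 + 2 * C) * x" if x: "x \<ge> 1" for x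
  proof (cases "ln x \<ge> 1")
    case False
    have "(\<Sum>A\<in>le x. mang A) \<le> (\<Sum>A\<in>le x. 1)"
    proof (rule sum_mono)
      fix A assume "A \<in> le x"
      then have "mang A \<le> ln (N A)" "ln (N A) \<le> ln x" using mang_le[of A] N_pos[of A] x by (auto simp: le_def)
      then show "mang A \<le> 1" using False by linarith
    qed
    also have "\<dots> \<le> C1 * x" using cnt_le[OF x] by (simp add: cnt_def)
    also have "\<dots> \<le> (C1 + 4 + 2 * C) * x" using x C by (intro mult_right_mono) auto
    finally show ?thesis .
  next
    case True
    define l where "l = ln x"
    have l: "l \<ge> 1" using True by (simp add: l_def)
    have lx: "l \<le> 2 * sqrt x"
      using ln_powr_bound[of x "1/2"] x by (simp add: l_def powr_half_sqrt)
    have sq: "sqrt x \<ge> 1" using x by simp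
    have "mang A \<le> (2 / l) * mang2 A + (if A \<in> le (sqrt x) then l / 2 else 0)" if A: "A \<in> le x" for A
    proof (cases "N A \<le> sqrt x")
      case True
      have "mang A \<le> ln (N A)" using A mang_le[of A] by (simp add: le_def)
      also have "\<dots> \<le> ln (sqrt x)" using True A N_pos[of A] x by (simp add: le_def)
      also have "\<dots> = l / 2" using x by (simp add: l_def ln_sqrt)
      finally have "mang A \<le> l / 2" .
      moreover have "0 \<le> 2 / l * mang2 A" using mang2_nonneg[of A] A l by (simp add: le_def)
      ultimately show ?thesis using A True by (simp add: le_def)
    next
      case False
      have "l / 2 = ln (sqrt x)" using x by (simp add: l_def ln_sqrt)
      also have "\<dots> \<le> ln (N A)" using False A N_pos[of A] x by (simp add: le_def)
      finally have "mang A * (l / 2) \<le> mang A * ln (N A)" using mang_nonneg[of A] A by (intro mult_left_mono) (auto simp: le_def)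
      also have "\<dots> \<le> mang2 A" using A mang2_ge[of A] by (simp add: le_def)
      finally have "mang A \<le> (2 / l) * mang2 A" using l by (simp add: field_simps)
      then show ?thesis using l by (simp add: le_def False)
    qed
    then have "(\<Sum>A\<in>le x. mang A) \<le> (\<Sum>A\<in>le x. (2 / l) * mang2 A + (if A \<in> le (sqrt x) then l / 2 else 0))"
      by (rule sum_mono)
    also have "\<dots> = (2 / l) * (\<Sum>A\<in>le x. mang2 A) + (\<Sum>A\<in>le x \<inter> le (sqrt x). l / 2)"
      unfolding sum.distrib sum_distrib_left by (subst sum.inter_restrict) simp_all
    also have "(\<Sum>A\<in>le x \<inter> le (sqrt x). l / 2) \<le> (\<Sum>A\<in>le (sqrt x). l / 2)"
      by (rule sum_mono2) (use l in auto)
    also have "\<dots> = cnt (sqrt x) * (l / 2)" by (simp add: cnt_def)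
    also have "\<dots> \<le> (C1 * sqrt x) * sqrt x" using cnt_le[OF sq] lx l C1_pos sq by (intro mult_mono) auto
    also have "\<dots> = C1 * x" using x by simp
    also have "(2 / l) * (\<Sum>A\<in>le x. mang2 A) \<le> (2 / l) * (2 * x * l + C * x)"
      using C(2)[OF x] l by (intro mult_left_mono) (auto simp: l_def)
    also have "\<dots> = 4 * x + 2 * (C * x) / l" using l by (simp add: field_simps)
    also have "2 * (C * x) / l \<le> 2 * (C * x)" using divide_left_mono[of 1 l "2 * (C * x)"] l C(1) x by simp
    finally show ?thesis by (simp add: algebra_simps)
  qed
  then show thesis using that[of "C1 + 4 + 2 * C"] C1_pos C by simp
qed

end

section \<open>Halasz's theorem\<close>

context prime_system
begin

definition completely_mult :: "('p multiset \<Rightarrow> complex) \<Rightarrow> bool" where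
  "completely_mult g \<longleftrightarrow> g {#} = 1 \<and> (\<forall>A\<in>Ms. \<forall>B\<in>Ms. g (A + B) = g A * g B) \<and> (\<forall>A\<in>Ms. cmod (g A) \<le> 1)"

definition S :: "('p multiset \<Rightarrow> complex) \<Rightarrow> real \<Rightarrow> complex" where
  "S g u = (\<Sum>A\<in>le u. g A)"

lemma completely_mult_le: "completely_mult g \<Longrightarrow> A \<in> Ms \<Longrightarrow> cmod (g A) \<le> 1" by (simp add: completely_mult_def)

lemma completely_mult_diff:
  assumes "completely_mult g" "A \<in> Ms" "B \<subseteq># A"
  shows "g A = g B * g (A - B)"
proof -
  have "g (B + (A - B)) = g B * g (A - B)"
    using assms Ms_subset[of A B] Ms_diff[of A B] by (simp only: completely_mult_def)
  then show ?thesis using assms(3) by simp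
qed

text \<open>The jumps of \<open>u \<mapsto> |S g u|\<close> are spread evenly over the elements of a given norm, so that this
  function too is a summatory function with weights of size at most 1.\<close>

lemma abs_S_weights:
  assumes g: "\<forall>A\<in>Ms. cmod (g A) \<le> 1"
  shows "\<exists>e :: 'p multiset \<Rightarrow> real. (\<forall>A\<in>Ms. \<bar>e A\<bar> \<le> 1) \<and> (\<forall>u\<ge>0. cmod (S g u) = (\<Sum>A\<in>le u. e A))"
proof -
  define eqN where "eqN = (\<lambda>x. {A \<in> Ms. N A = x})"
  define lt where "lt = (\<lambda>x. {A \<in> Ms. N A < x})"
  have fin: "finite (eqN x)" "finite (lt x)" for x
    by (rule finite_subset[OF _ finite_le[of x]]; auto simp: eqN_def lt_def le_def)+
  define e where "e = (\<lambda>A. (cmod (S g (N A)) - cmod (\<Sum>B\<in>lt (N A). g B)) / real (card (eqN (N A))))"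
  have split: "le x = lt x \<union> eqN x" "lt x \<inter> eqN x = {}" for x by (auto simp: le_def lt_def eqN_def)
  have e1: "\<bar>e A\<bar> \<le> 1" if A: "A \<in> Ms" for A
  proof -
    have "S g (N A) = (\<Sum>B\<in>lt (N A). g B) + (\<Sum>B\<in>eqN (N A). g B)"
      unfolding S_def split(1) by (rule sum.union_disjoint[OF fin(2) fin(1) split(2)])
    then have "\<bar>cmod (S g (N A)) - cmod (\<Sum>B\<in>lt (N A). g B)\<bar> \<le> cmod (\<Sum>B\<in>eqN (N A). g B)"
      using norm_triangle_ineq3[of "S g (N A)" "\<Sum>B\<in>lt (N A). g B"] by simp
    also have "\<dots> \<le> (\<Sum>B\<in>eqN (N A). 1)"
      by (rule order_trans[OF norm_sum sum_mono]) (use g in \<open>auto simp: eqN_def\<close>)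
    finally have "\<bar>cmod (S g (N A)) - cmod (\<Sum>B\<in>lt (N A). g B)\<bar> \<le> real (card (eqN (N A)))" by simp
    moreover have "card (eqN (N A)) > 0" using A fin by (auto simp: eqN_def card_gt_0_iff)
    ultimately show ?thesis by (simp add: e_def abs_divide)
  qed
  \<comment> \<open>Norms are integers, so \<open>S g\<close> is constant between consecutive
    integers and the jumps telescope along the natural numbers.\<close>
  have nat: "cmod (S g (real n)) = (\<Sum>A\<in>le (real n). e A)" for n
  proof (induction n)
    case 0
    then show ?case by (simp add: S_def le_empty)
  next
    case (Suc n)
    let ?x = "real (Suc n)"
    have ln: "lt ?x = le (real n)"
    proof -
      have "N A < ?x \<longleftrightarrow> N A \<le> real n" for A
        unfolding N_def by (simp only: of_nat_less_iff of_nat_le_iff less_Suc_eq_le)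
      then show ?thesis by (auto simp: lt_def le_def)
    qed
    have "(\<Sum>A\<in>le ?x. e A) = (\<Sum>A\<in>le (real n). e A) + (\<Sum>A\<in>eqN ?x. e A)"
      unfolding split(1)[of ?x] ln[symmetric] by (rule sum.union_disjoint[OF fin(2) fin(1) split(2)])
    also have "(\<Sum>A\<in>eqN ?x. e A) = (\<Sum>A\<in>eqN ?x. (cmod (S g ?x) - cmod (S g (real n))) / real (card (eqN ?x)))"
    proof (rule sum.cong[OF refl])
      fix A assume "A \<in> eqN ?x"
      then have NA: "N A = ?x" by (simp only: eqN_def mem_Collect_eq)
      show "e A = (cmod (S g ?x) - cmod (S g (real n))) / real (card (eqN ?x))"
        unfolding e_def NA ln S_def ..
    qed
    also have "\<dots> = cmod (S g ?x) - cmod (S g (real n))"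
    proof (cases "eqN ?x = {}")
      case True
      then have "le ?x = le (real n)" using split(1)[of ?x] ln by simp
      then show ?thesis using True by (simp add: S_def)
    next
      case False
      then have "card (eqN ?x) \<noteq> 0" using fin by simp
      then show ?thesis by simp
    qed
    finally show ?case using Suc by simp
  qed
  have "cmod (S g u) = (\<Sum>A\<in>le u. e A)" if u: "u \<ge> 0" for u
  proof -
    have "real n \<le> u \<longleftrightarrow> n \<le> nat \<lfloor>u\<rfloor>" for n :: nat
      using u by (simp add: le_nat_iff le_floor_iff)
    then have "N A \<le> u \<longleftrightarrow> N A \<le> real (nat \<lfloor>u\<rfloor>)" for A
      unfolding N_def by simp
    then have "le u = le (real (nat \<lfloor>u\<rfloor>))" by (simp add: le_def)
    then show ?thesis using nat[of "nat \<lfloor>u\<rfloor>"] by (simp add: S_def)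
  qed
  then show ?thesis using e1 by blast
qed

lemma sum_conv': "(\<Sum>B\<in>le x. \<Sum>D\<in>le (x / N B). G B D) = (\<Sum>D\<in>le x. \<Sum>B\<in>le (x / N D). G B D)"
  for G :: "'p multiset \<Rightarrow> 'p multiset \<Rightarrow> 'b::comm_monoid_add"
proof -
  have "(\<Sum>B\<in>le x. \<Sum>D\<in>le (x / N B). G B D) = (\<Sum>A\<in>le x. \<Sum>B | B \<subseteq># A. G B (A - B))"
    by (rule sum_conv[symmetric])
  also have "\<dots> = (\<Sum>A\<in>le x. \<Sum>B | B \<subseteq># A. G (A - B) B)"
  proof (rule sum.cong[OF refl])
    fix A
    have "(\<Sum>B | B \<subseteq># A. G (A - B) B) = (\<Sum>B | B \<subseteq># A. (\<lambda>B. G B (A - B)) (A - B))"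
      by (intro sum.cong refl) (simp add: diff_diff_subs)
    then show "(\<Sum>B | B \<subseteq># A. G B (A - B)) = (\<Sum>B | B \<subseteq># A. G (A - B) B)"
      using sum_diff_subs[of "\<lambda>B. G B (A - B)" A] by simp
  qed
  also have "\<dots> = (\<Sum>D\<in>le x. \<Sum>B\<in>le (x / N D). G B D)" by (rule sum_conv)
  finally show ?thesis .
qed

lemma abs_S_integrable:
  assumes g: "\<forall>A\<in>Ms. cmod (g A) \<le> 1" and k: "continuous_on {1..x} k" and x: "x \<ge> 1"
  shows "(\<lambda>u. k u * cmod (S g u)) integrable_on {1..x}"
proof -
  obtain e :: "'p multiset \<Rightarrow> real" where "\<forall>A\<in>Ms. \<bar>e A\<bar> \<le> 1" and "\<forall>u\<ge>0. cmod (S g u) = (\<Sum>A\<in>le u. e A)"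
    using abs_S_weights[OF g] by blast
  then have e: "\<And>A. A \<in> Ms \<Longrightarrow> \<bar>e A\<bar> \<le> 1" "\<And>u. u \<ge> 0 \<Longrightarrow> cmod (S g u) = (\<Sum>A\<in>le u. e A)" by auto
  have "((\<lambda>u. k u * cmod (S g u)) has_integral (\<Sum>A\<in>le x. e A * integral {N A..x} k)) {1..x}"
    by (rule has_integral_eq[OF _ abel[OF k x, of e]]) (simp add: e(2))
  then show ?thesis by blast
qed

lemma sum_log_quot_le:
  assumes x: "x \<ge> 1"
  shows "(\<Sum>A\<in>le x. ln (x / N A)) \<le> 4 * C1 * x"
proof -
  have "(\<Sum>A\<in>le x. ln (x / N A)) \<le> (\<Sum>A\<in>le x. 2 * (x / N A) powr (1/2))"
  proof (rule sum_mono)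
    fix A assume "A \<in> le x"
    then have "x / N A \<ge> 1" using N_pos[of A] by (auto simp: le_def field_simps)
    then show "ln (x / N A) \<le> 2 * (x / N A) powr (1/2)" using ln_powr_bound[of "x / N A" "1/2"] by simp
  qed
  also have "\<dots> = 2 * (\<Sum>A\<in>le x. (x / N A) powr (1/2))" by (simp add: sum_distrib_left)
  also have "\<dots> \<le> 2 * (C1 / (1 - 1/2) * x)" by (intro mult_left_mono sum_powr_le x) auto
  finally show ?thesis by simp
qed

text \<open>Replacing ln^2 x by ln^2 (N A) costs O(x ln x), and ln^2 (N A) is the divisor sum of
  \<open>mang2\<close>; absolute values leave the sum of mang2 B |S(x / N B)|. Expanding |S| with
  the weights of \<open>abs_S_weights\<close> and exchanging the sums exposes the summatory function
  of \<open>mang2\<close>, to which Selberg's formula applies. Partial summation turns its main term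
  back into an integral of |S|.\<close>

theorem S_le_integral:
  obtains C where "C \<ge> 0" "\<And>g x. completely_mult g \<Longrightarrow> x \<ge> 1 \<Longrightarrow>
    cmod (S g x) * (ln x)\<^sup>2 \<le> 2 * x * (1 + ln x) * integral {1..x} (\<lambda>u. u powr (-2) * cmod (S g u)) + C * x * (1 + ln x)"
proof -
  obtain C where C: "C \<ge> 0" "\<And>x. x \<ge> 1 \<Longrightarrow> \<bar>(\<Sum>A\<in>le x. mang2 A) - 2 * x * ln x\<bar> \<le> C * x"
    by (rule selberg_formula) blast
  have "cmod (S g x) * (ln x)\<^sup>2 \<le> 2 * x * (1 + ln x) * integral {1..x} (\<lambda>u. u powr (-2) * cmod (S g u)) + (C * C1 + 8 * C1) * x * (1 + ln x)"
    if g: "completely_mult g" and x: "x \<ge> 1" for g x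
  proof -
    define l where "l = ln x"
    have l: "l \<ge> 0" using x by (simp add: l_def)
    have g1: "\<forall>A\<in>Ms. cmod (g A) \<le> 1" using completely_mult_le[OF g] by blast
    obtain e :: "'p multiset \<Rightarrow> real" where "\<forall>A\<in>Ms. \<bar>e A\<bar> \<le> 1" and "\<forall>u\<ge>0. cmod (S g u) = (\<Sum>A\<in>le u. e A)"
      using abs_S_weights[OF g1] by blast
    then have e: "\<And>A. A \<in> Ms \<Longrightarrow> \<bar>e A\<bar> \<le> 1" "\<And>u. u \<ge> 0 \<Longrightarrow> cmod (S g u) = (\<Sum>A\<in>le u. e A)" by auto
    have xN: "x / N A \<ge> 1" if "A \<in> le x" for A using that N_pos[of A] by (auto simp: le_def field_simps)
    have "of_real (l\<^sup>2) * S g x = (\<Sum>A\<in>le x. g A * of_real ((ln (N A))\<^sup>2)) + (\<Sum>A\<in>le x. g A * of_real (l\<^sup>2 - (ln (N A))\<^sup>2))"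
      unfolding S_def sum_distrib_left sum.distrib[symmetric] by (intro sum.cong refl) (simp add: algebra_simps)
    then have "cmod (of_real (l\<^sup>2) * S g x) \<le> cmod (\<Sum>A\<in>le x. g A * of_real ((ln (N A))\<^sup>2)) + cmod (\<Sum>A\<in>le x. g A * of_real (l\<^sup>2 - (ln (N A))\<^sup>2))"
      by (simp only: norm_triangle_ineq)
    then have 1: "cmod (S g x) * l\<^sup>2 \<le> cmod (\<Sum>A\<in>le x. g A * of_real ((ln (N A))\<^sup>2)) + cmod (\<Sum>A\<in>le x. g A * of_real (l\<^sup>2 - (ln (N A))\<^sup>2))"
      by (simp only: norm_mult norm_of_real) (simp add: mult.commute)
    have 2: "cmod (\<Sum>A\<in>le x. g A * of_real (l\<^sup>2 - (ln (N A))\<^sup>2)) \<le> 8 * C1 * x * l"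
    proof -
      have "cmod (\<Sum>A\<in>le x. g A * of_real (l\<^sup>2 - (ln (N A))\<^sup>2)) \<le> (\<Sum>A\<in>le x. 2 * l * ln (x / N A))"
      proof (rule order_trans[OF norm_sum sum_mono])
        fix A assume A: "A \<in> le x"
        then have N1: "N A \<ge> 1" "N A \<le> x" using N_ge_1 by (auto simp: le_def)
        have lN: "0 \<le> ln (N A)" "ln (N A) \<le> l" using N1 by (auto simp: l_def)
        have q: "ln (x / N A) = l - ln (N A)" using N1 x by (simp add: ln_div l_def)
        have "l\<^sup>2 - (ln (N A))\<^sup>2 = (l + ln (N A)) * (l - ln (N A))" by (simp add: power2_eq_square algebra_simps)
        also have "\<dots> \<le> (2 * l) * (l - ln (N A))" using lN by (intro mult_right_mono) auto
        finally have "l\<^sup>2 - (ln (N A))\<^sup>2 \<le> 2 * l * ln (x / N A)" by (simp add: q)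
        moreover have "l\<^sup>2 - (ln (N A))\<^sup>2 \<ge> 0" using lN power_mono[of "ln (N A)" l 2] by simp
        moreover have "cmod (g A * of_real (l\<^sup>2 - (ln (N A))\<^sup>2)) \<le> 1 * \<bar>l\<^sup>2 - (ln (N A))\<^sup>2\<bar>"
          unfolding norm_mult norm_of_real using g1 A by (intro mult_right_mono) (auto simp: le_def)
        ultimately show "cmod (g A * of_real (l\<^sup>2 - (ln (N A))\<^sup>2)) \<le> 2 * l * ln (x / N A)" by simp
      qed
      also have "\<dots> = 2 * l * (\<Sum>A\<in>le x. ln (x / N A))" by (simp add: sum_distrib_left)
      also have "\<dots> \<le> 2 * l * (4 * C1 * x)" using l by (intro mult_left_mono sum_log_quot_le x) auto
      finally show ?thesis by (simp add: mult_ac)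
    qed
    have "(\<Sum>A\<in>le x. g A * of_real ((ln (N A))\<^sup>2)) = (\<Sum>A\<in>le x. \<Sum>B | B \<subseteq># A. g B * of_real (mang2 B) * g (A - B))"
    proof (rule sum.cong[OF refl])
      fix A assume "A \<in> le x"
      then have A: "A \<in> Ms" by (simp add: le_def)
      have "g A * of_real ((ln (N A))\<^sup>2) = (\<Sum>B | B \<subseteq># A. g A * of_real (mang2 B))"
        by (simp add: sum_mang2[OF A, symmetric] sum_distrib_left)
      also have "\<dots> = (\<Sum>B | B \<subseteq># A. g B * of_real (mang2 B) * g (A - B))"
        by (intro sum.cong refl) (simp add: completely_mult_diff[OF g A])
      finally show "g A * of_real ((ln (N A))\<^sup>2) = \<dots>" .
    qed
    also have "\<dots> = (\<Sum>B\<in>le x. \<Sum>D\<in>le (x / N B). g B * of_real (mang2 B) * g D)" by (rule sum_conv)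
    also have "\<dots> = (\<Sum>B\<in>le x. g B * of_real (mang2 B) * S g (x / N B))" by (simp add: S_def sum_distrib_left)
    also have "cmod \<dots> \<le> (\<Sum>B\<in>le x. mang2 B * cmod (S g (x / N B)))"
    proof (rule order_trans[OF norm_sum sum_mono])
      fix B assume B: "B \<in> le x"
      then have "mang2 B \<ge> 0" using mang2_nonneg by (simp add: le_def)
      then have "cmod (g B) * mang2 B * cmod (S g (x / N B)) \<le> 1 * mang2 B * cmod (S g (x / N B))"
        using g1 B by (intro mult_right_mono) (auto simp: le_def)
      then show "cmod (g B * of_real (mang2 B) * S g (x / N B)) \<le> mang2 B * cmod (S g (x / N B))"
        using \<open>mang2 B \<ge> 0\<close> by (simp add: norm_mult)
    qed
    also have "\<dots> = (\<Sum>B\<in>le x. \<Sum>D\<in>le (x / N B). mang2 B * e D)"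
    proof (intro sum.cong refl)
      fix B assume "B \<in> le x"
      from xN[OF this] have "0 \<le> x / N B" by linarith
      from e(2)[OF this] show "mang2 B * cmod (S g (x / N B)) = (\<Sum>D\<in>le (x / N B). mang2 B * e D)"
        by (simp add: sum_distrib_left)
    qed
    also have "\<dots> = (\<Sum>D\<in>le x. \<Sum>B\<in>le (x / N D). mang2 B * e D)" by (rule sum_conv')
    also have "\<dots> = (\<Sum>D\<in>le x. e D * (\<Sum>B\<in>le (x / N D). mang2 B))" by (simp add: sum_distrib_left mult.commute)
    also have "\<dots> \<le> (\<Sum>D\<in>le x. e D * (2 * (x / N D) * ln (x / N D)) + C * x * (1 / N D))"
    proof (rule sum_mono)
      fix D assume D: "D \<in> le x"
      have DM: "D \<in> Ms" "N D > 0" using D N_pos by (auto simp: le_def)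
      have "e D * (\<Sum>B\<in>le (x / N D). mang2 B) - e D * (2 * (x / N D) * ln (x / N D))
          \<le> \<bar>e D * ((\<Sum>B\<in>le (x / N D). mang2 B) - 2 * (x / N D) * ln (x / N D))\<bar>"
        unfolding right_diff_distrib[symmetric] by (rule abs_ge_self)
      also have "\<dots> \<le> 1 * (C * (x / N D))" unfolding abs_mult
        using C(2)[OF xN[OF D]] e(1)[OF DM(1)] by (intro mult_mono) auto
      finally show "e D * (\<Sum>B\<in>le (x / N D). mang2 B) \<le> e D * (2 * (x / N D) * ln (x / N D)) + C * x * (1 / N D)" by simp
    qed
    also have "\<dots> = (\<Sum>D\<in>le x. e D * (2 * (x / N D) * ln (x / N D))) + C * x * (\<Sum>D\<in>le x. 1 / N D)"
      by (simp only: sum.distrib sum_distrib_left)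
    also have "C * x * (\<Sum>D\<in>le x. 1 / N D) \<le> C * x * (C1 * (1 + l))"
      unfolding l_def using C x by (intro mult_left_mono sum_inverse_le) auto
    finally have 3: "cmod (\<Sum>A\<in>le x. g A * of_real ((ln (N A))\<^sup>2)) \<le> (\<Sum>D\<in>le x. e D * (2 * (x / N D) * ln (x / N D))) + C * x * (C1 * (1 + l))" by simp
    \<comment> \<open>\<open>h\<close> is the primitive of \<open>k\<close> with h x = 0, and - 2 x
      h (N D) is exactly the main term 2 (x / N D) ln (x / N D).\<close>
    define k where "k = (\<lambda>u. u powr (-2) * (ln (x / u) + 1))"
    define h where "h = (\<lambda>u. - (1 / u * (ln x - ln u)))"
    have kc: "continuous_on {1..x} k" unfolding k_def using x by (intro continuous_intros) auto
    have "((\<lambda>u. k u * (\<Sum>A\<in>le u. e A)) has_integral (\<Sum>A\<in>le x. e A * (h x - h (N A)))) {1..x}"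
    proof (rule abel_deriv[OF kc x])
      fix u assume "u \<in> {1..x}"
      then have u: "u > 0" by simp
      show "(h has_real_derivative k u) (at u)" unfolding h_def
        using u x by (auto intro!: derivative_eq_intros simp: k_def ln_div powr_minus power2_eq_square field_simps)
    qed
    then have "((\<lambda>u. k u * cmod (S g u)) has_integral (\<Sum>A\<in>le x. e A * (h x - h (N A)))) {1..x}"
      by (rule has_integral_eq[rotated]) (simp add: e(2))
    then have "2 * x * integral {1..x} (\<lambda>u. k u * cmod (S g u)) = 2 * x * (\<Sum>A\<in>le x. e A * (h x - h (N A)))"
      by (simp add: integral_unique)
    also have "\<dots> = (\<Sum>D\<in>le x. e D * (2 * (x / N D) * ln (x / N D)))"
      unfolding sum_distrib_left by (intro sum.cong refl) (use x N_pos in \<open>auto simp: h_def ln_div le_def\<close>)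
    finally have 4: "(\<Sum>D\<in>le x. e D * (2 * (x / N D) * ln (x / N D))) = 2 * x * integral {1..x} (\<lambda>u. k u * cmod (S g u))" ..
    have "integral {1..x} (\<lambda>u. k u * cmod (S g u)) \<le> integral {1..x} (\<lambda>u. (1 + l) * (u powr (-2) * cmod (S g u)))"
    proof (rule integral_le)
      show "(\<lambda>u. k u * cmod (S g u)) integrable_on {1..x}" by (rule abs_S_integrable[OF g1 kc x])
      have "(\<lambda>u. u powr (-2) * cmod (S g u)) integrable_on {1..x}"
        by (rule abs_S_integrable[OF g1 _ x]) (auto intro!: continuous_intros)
      then show "(\<lambda>u. (1 + l) * (u powr (-2) * cmod (S g u))) integrable_on {1..x}"
        by (rule integrable_on_mult_right)
      fix u assume u: "u \<in> {1..x}"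
      have "ln (x / u) \<le> l" using u x by (simp add: l_def ln_div)
      then have "k u \<le> (1 + l) * u powr (-2)" unfolding k_def mult.commute[of "u powr (-2)"] by (intro mult_right_mono) auto
      then show "k u * cmod (S g u) \<le> (1 + l) * (u powr (-2) * cmod (S g u))"
        by (simp add: mult_right_mono flip: mult.assoc)
    qed
    then have "2 * x * integral {1..x} (\<lambda>u. k u * cmod (S g u)) \<le> 2 * x * ((1 + l) * integral {1..x} (\<lambda>u. u powr (-2) * cmod (S g u)))"
      using x by (intro mult_left_mono) auto
    moreover have "8 * C1 * x * l \<le> 8 * C1 * x * (1 + l)" using C1_pos x by (intro mult_left_mono) auto
    ultimately have "cmod (S g x) * l\<^sup>2 \<le> 2 * x * ((1 + l) * integral {1..x} (\<lambda>u. u powr (-2) * cmod (S g u))) + C * x * (C1 * (1 + l)) + 8 * C1 * x * (1 + l)"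
      using 1 2 3 4 by linarith
    then show ?thesis unfolding l_def by (simp add: algebra_simps)
  qed
  then show thesis using that[of "C * C1 + 8 * C1"] C(1) C1_pos by simp
qed

section \<open>The zeta function of the prime system and products of absolutely convergent
  series\<close>

lemma partial_powr_sum:
  assumes s: "\<sigma> > 1"
  shows "(\<Sum>A\<in>le X. N A powr (- \<sigma>)) \<le> C1 * \<sigma> / (\<sigma> - 1)"
proof (cases "X \<ge> 1")
  case False
  then show ?thesis using s C1_pos by (simp add: le_empty)
next
  case x: True
  have "((\<lambda>u. \<sigma> * u powr (- \<sigma> - 1) * cnt u) has_integral (cnt X * (- (X powr (- \<sigma>))) - (\<Sum>A\<in>le X. - (N A powr (- \<sigma>))))) {1..X}"
    by (rule abel_cnt) (use x in \<open>auto intro!: continuous_intros derivative_eq_intros\<close>)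
  moreover have "((\<lambda>u. \<sigma> * C1 * u powr (- \<sigma>)) has_integral (\<sigma> * C1 * ((X powr (- \<sigma>+1) - 1) / (- \<sigma>+1)))) {1..X}"
    by (intro has_integral_mult_right has_integral_powr) (use x s in auto)
  ultimately have "cnt X * (- (X powr (- \<sigma>))) - (\<Sum>A\<in>le X. - (N A powr (- \<sigma>))) \<le> \<sigma> * C1 * ((X powr (- \<sigma>+1) - 1) / (- \<sigma>+1))"
  proof (rule has_integral_le)
    fix u assume u: "u \<in> {1..X}"
    have "\<sigma> * u powr (- \<sigma> - 1) * cnt u \<le> \<sigma> * u powr (- \<sigma> - 1) * (C1 * u)" using cnt_le[of u] u s by (intro mult_left_mono) auto
    also have "\<dots> = \<sigma> * C1 * u powr (- \<sigma>)" using u by (simp add: powr_diff)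
    finally show "\<sigma> * u powr (- \<sigma> - 1) * cnt u \<le> \<sigma> * C1 * u powr (- \<sigma>)" .
  qed
  then have 1: "(\<Sum>A\<in>le X. N A powr (- \<sigma>)) \<le> cnt X * X powr (- \<sigma>) + \<sigma> * C1 * ((X powr (- \<sigma>+1) - 1) / (- \<sigma>+1))"
    by (simp add: sum_negf)
  define y where "y = X powr (1 - \<sigma>)"
  have "cnt X * X powr (- \<sigma>) \<le> C1 * X * X powr (- \<sigma>)" by (intro mult_right_mono cnt_le x) auto
  also have "\<dots> = C1 * y" using x by (simp add: y_def powr_mult_base)
  also have "\<dots> \<le> \<sigma> * C1 * (y / (\<sigma> - 1))"
  proof -
    have "C1 * y * (\<sigma> - 1) \<le> C1 * y * \<sigma>" using C1_pos by (intro mult_left_mono) (auto simp: y_def)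
    then show ?thesis using s by (simp add: field_simps)
  qed
  finally have 2: "cnt X * X powr (- \<sigma>) \<le> \<sigma> * C1 * (y / (\<sigma> - 1))" .
  have 3: "(X powr (- \<sigma>+1) - 1) / (- \<sigma>+1) = 1 / (\<sigma> - 1) - y / (\<sigma> - 1)" using s by (simp add: y_def field_simps)
  show ?thesis using 1 2 unfolding 3 by (simp add: algebra_simps)
qed

lemma summable_by_le:
  fixes f :: "'p multiset \<Rightarrow> real"
  assumes pos: "\<And>A. A \<in> Ms \<Longrightarrow> f A \<ge> 0" and bd: "\<And>X. (\<Sum>A\<in>le X. f A) \<le> B"
  shows "f summable_on Ms" "infsum f Ms \<le> B"
proof -
  have fb: "sum f F \<le> B" if F: "F \<subseteq> Ms" "finite F" for F
  proof -
    define X where "X = Max (insert 0 (N ` F))"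
    have "F \<subseteq> le X" using F by (auto simp: le_def X_def intro!: Max_ge)
    then have "sum f F \<le> sum f (le X)" using pos by (intro sum_mono2[OF finite_le]) (auto simp: le_def)
    then show ?thesis using bd[of X] by linarith
  qed
  show s: "f summable_on Ms"
    by (rule nonneg_bdd_above_summable_on[OF pos]) (auto intro!: bdd_aboveI2[where M=B] fb)
  show "infsum f Ms \<le> B" by (rule infsum_le_finite_sums[OF s]) (use fb in auto)
qed

definition Z :: "real \<Rightarrow> real" where "Z \<sigma> = (\<Sum>\<^sub>\<infinity>A\<in>Ms. N A powr (- \<sigma>))"

lemma summable_powr: "\<sigma> > 1 \<Longrightarrow> (\<lambda>A. N A powr (- \<sigma>)) summable_on Ms"
  by (rule summable_by_le(1)[OF _ partial_powr_sum]) auto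

lemma Z_le: "\<sigma> > 1 \<Longrightarrow> Z \<sigma> \<le> C1 * \<sigma> / (\<sigma> - 1)"
  unfolding Z_def by (rule summable_by_le(2)[OF _ partial_powr_sum]) auto

lemma Z_nonneg: "Z \<sigma> \<ge> 0" unfolding Z_def by (rule infsum_nonneg) auto

lemma summable_log_powr:
  assumes s: "\<sigma> > 1"
  shows "(\<lambda>A. ln (N A) * N A powr (- \<sigma>)) summable_on Ms"
proof (rule summable_on_comparison_test)
  show "(\<lambda>A. (2 / (\<sigma> - 1)) * N A powr (- ((\<sigma> + 1) / 2))) summable_on Ms"
    by (intro summable_on_cmult_right summable_powr) (use s in auto)
  fix A assume "A \<in> Ms"
  then have N1: "N A \<ge> 1" by (rule N_ge_1)
  have "ln (N A) \<le> N A powr ((\<sigma> - 1) / 2) / ((\<sigma> - 1) / 2)" using N1 s by (intro ln_powr_bound) auto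
  then have "ln (N A) * N A powr (- \<sigma>) \<le> N A powr ((\<sigma> - 1) / 2) / ((\<sigma> - 1) / 2) * N A powr (- \<sigma>)"
    by (intro mult_right_mono) auto
  also have "\<dots> = (2 / (\<sigma> - 1)) * (N A powr ((\<sigma> - 1) / 2) * N A powr (- \<sigma>))" by simp
  also have "N A powr ((\<sigma> - 1) / 2) * N A powr (- \<sigma>) = N A powr (- ((\<sigma> + 1) / 2))"
    by (rule powr_add') (simp add: field_simps)
  finally show "ln (N A) * N A powr (- \<sigma>) \<le> (2 / (\<sigma> - 1)) * N A powr (- ((\<sigma> + 1) / 2))" .
  show "0 \<le> ln (N A) * N A powr (- \<sigma>)" using N1 by simp
qed

text \<open>Absolute convergence allows summation over all pairs (B, D), which are then grouped by A
  = B + D.\<close>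

lemma infsum_conv:
  fixes \<psi> \<eta> :: "'p multiset \<Rightarrow> complex"
  assumes "(\<lambda>A. cmod (\<psi> A)) summable_on Ms" "(\<lambda>A. cmod (\<eta> A)) summable_on Ms"
  shows "(\<Sum>\<^sub>\<infinity>A\<in>Ms. \<Sum>B | B \<subseteq># A. \<psi> B * \<eta> (A - B)) = (\<Sum>\<^sub>\<infinity>A\<in>Ms. \<psi> A) * (\<Sum>\<^sub>\<infinity>A\<in>Ms. \<eta> A)"
proof -
  let ?f = "\<lambda>(B, D). \<psi> B * \<eta> D"
  have "(\<lambda>p. norm (?f p)) summable_on (Ms \<times> Ms)"
    unfolding Infinite_Sum.abs_summable_on_Sigma_iff
  proof (intro conjI ballI)
    fix B
    show "(\<lambda>D. norm (?f (B, D))) summable_on Ms" using assms(2) by (simp add: norm_mult summable_on_cmult_right)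
  next
    have "(\<lambda>B. cmod (\<psi> B) * (\<Sum>\<^sub>\<infinity>D\<in>Ms. cmod (\<eta> D))) summable_on Ms" by (intro summable_on_cmult_left assms)
    moreover have "norm (\<Sum>\<^sub>\<infinity>D\<in>Ms. norm (?f (B, D))) = cmod (\<psi> B) * (\<Sum>\<^sub>\<infinity>D\<in>Ms. cmod (\<eta> D))" for B
    proof -
      have "(\<Sum>\<^sub>\<infinity>D\<in>Ms. norm (?f (B, D))) = cmod (\<psi> B) * (\<Sum>\<^sub>\<infinity>D\<in>Ms. cmod (\<eta> D))"
        using assms(2) by (simp add: norm_mult infsum_cmult_right)
      moreover have "(\<Sum>\<^sub>\<infinity>D\<in>Ms. cmod (\<eta> D)) \<ge> 0" by (rule infsum_nonneg) simp
      ultimately show ?thesis by (simp add: abs_mult)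
    qed
    ultimately show "(\<lambda>B. norm (\<Sum>\<^sub>\<infinity>D\<in>Ms. norm (?f (B, D)))) summable_on Ms" by simp
  qed
  then have fs: "?f summable_on (Ms \<times> Ms)" by (rule Infinite_Sum.abs_summable_summable)
  have s1: "\<psi> summable_on Ms" "\<eta> summable_on Ms" using assms by (auto intro: Infinite_Sum.abs_summable_summable)
  have "(\<Sum>\<^sub>\<infinity>A\<in>Ms. \<psi> A) * (\<Sum>\<^sub>\<infinity>A\<in>Ms. \<eta> A) = (\<Sum>\<^sub>\<infinity>B\<in>Ms. \<Sum>\<^sub>\<infinity>D\<in>Ms. ?f (B, D))"
    using s1 by (simp add: infsum_cmult_right infsum_cmult_left)
  also have "\<dots> = infsum ?f (Ms \<times> Ms)" by (rule infsum_Sigma_banach[OF fs])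
  also have "\<dots> = infsum (\<lambda>(A,B). \<psi> B * \<eta> (A - B)) (Sigma Ms (\<lambda>A. {B. B \<subseteq># A}))"
    by (rule infsum_reindex_bij_witness[of _ "\<lambda>(A,B). (B, A - B)" "\<lambda>(B,D). (B + D, B)"]) (auto simp: Ms_subset Ms_diff)
  also have "\<dots> = (\<Sum>\<^sub>\<infinity>A\<in>Ms. \<Sum>\<^sub>\<infinity>B\<in>{B. B \<subseteq># A}. (\<lambda>(A,B). \<psi> B * \<eta> (A - B)) (A, B))"
  proof (rule infsum_Sigma_banach[symmetric])
    show "(\<lambda>(A,B). \<psi> B * \<eta> (A - B)) summable_on (Sigma Ms (\<lambda>A. {B. B \<subseteq># A}))"
      using fs
      by (subst summable_on_reindex_bij_witness[of _ "\<lambda>(B,D). (B + D, B)" "\<lambda>(A,B). (B, A - B)" "Ms \<times> Ms" ?f])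
         (auto simp: Ms_subset Ms_diff)
  qed
  also have "\<dots> = (\<Sum>\<^sub>\<infinity>A\<in>Ms. \<Sum>B | B \<subseteq># A. \<psi> B * \<eta> (A - B))" by simp
  finally show ?thesis by simp
qed

end

context prime_system
begin

section \<open>The Dirichlet series of g and its Euler factors\<close>

definition ch :: "('p multiset \<Rightarrow> complex) \<Rightarrow> real \<Rightarrow> real \<Rightarrow> 'p multiset \<Rightarrow> complex" where
  "ch g \<sigma> t A = g A * of_real (N A powr (- \<sigma>)) * cis (- t * ln (N A))"

definition F :: "('p multiset \<Rightarrow> complex) \<Rightarrow> real \<Rightarrow> real \<Rightarrow> complex" where
  "F g \<sigma> t = (\<Sum>\<^sub>\<infinity>A\<in>Ms. ch g \<sigma> t A)"

definition primes_le :: "real \<Rightarrow> 'p set" where "primes_le x = {p \<in> P. real (nrm p) \<le> x}"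

text \<open>The squared pretentious distance between g and N^(it), taken over the primes of norm at
  most x.\<close>

definition pdist :: "('p multiset \<Rightarrow> complex) \<Rightarrow> real \<Rightarrow> real \<Rightarrow> real" where
  "pdist g x t = (\<Sum>p\<in>primes_le x. (1 - Re (g {#p#} * cis (- t * ln (real (nrm p))))) / real (nrm p))"

lemma finite_primes_le [simp]: "finite (primes_le x)"
proof -
  have "(\<lambda>p. {#p#}) ` primes_le x \<subseteq> le x" by (auto simp: primes_le_def le_def Ms_def)
  then have "finite ((\<lambda>p. {#p#}) ` primes_le x)" using finite_subset by blast
  then show ?thesis by (rule finite_imageD) (auto simp: inj_on_def)
qed

lemma primes_le_P: "p \<in> primes_le x \<Longrightarrow> p \<in> P" by (simp add: primes_le_def)

lemma norm_ch: "cmod (ch g \<sigma> t A) = cmod (g A) * N A powr (- \<sigma>)"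
  by (simp add: ch_def norm_mult)

lemma norm_ch_le: "completely_mult g \<Longrightarrow> A \<in> Ms \<Longrightarrow> cmod (ch g \<sigma> t A) \<le> N A powr (- \<sigma>)"
  unfolding norm_ch using completely_mult_le[of g A] by (intro mult_left_le_one_le) auto

lemma ch_plus: "completely_mult g \<Longrightarrow> A \<in> Ms \<Longrightarrow> B \<in> Ms \<Longrightarrow> ch g \<sigma> t (A + B) = ch g \<sigma> t A * ch g \<sigma> t B"
proof -
  assume *: "completely_mult g" "A \<in> Ms" "B \<in> Ms"
  have p: "N A > 0" "N B > 0" using * N_pos by auto
  then have "cis (- t * ln (N A * N B)) = cis (- t * ln (N A)) * cis (- t * ln (N B))"
    by (simp add: ln_mult cis_mult ring_distribs)
  moreover have "g (A + B) = g A * g B" using * by (simp add: completely_mult_def)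
  ultimately show ?thesis using p by (simp add: ch_def powr_mult mult_ac)
qed

lemma summable_ch: "completely_mult g \<Longrightarrow> \<sigma> > 1 \<Longrightarrow> (\<lambda>A. cmod (ch g \<sigma> t A)) summable_on Ms"
  by (rule summable_on_comparison_test[OF summable_powr]) (auto intro: norm_ch_le)

lemma norm_F_le: 
  assumes "completely_mult g" "\<sigma> > 1" shows "cmod (F g \<sigma> t) \<le> Z \<sigma>"
proof -
  have "cmod (F g \<sigma> t) \<le> (\<Sum>\<^sub>\<infinity>A\<in>Ms. cmod (ch g \<sigma> t A))" unfolding F_def by (rule norm_infsum_bound[OF summable_ch[OF assms]])
  also have "\<dots> \<le> Z \<sigma>" unfolding Z_def
    by (rule infsum_mono[OF summable_ch[OF assms] summable_powr[OF assms(2)]]) (rule norm_ch_le[OF assms(1)])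
  finally show ?thesis .
qed

text \<open>Euler factors are divided out one prime at a time, which avoids infinite products.\<close>

definition MsQ :: "'p set \<Rightarrow> 'p multiset set" where "MsQ Q = {A \<in> Ms. set_mset A \<inter> Q = {}}"

text \<open>An element prime to Q either avoids p or is p times an element prime to Q; the second
  kind contributes \<eta>(p) times the whole sum.\<close>

lemma euler_factor:
  fixes \<eta> :: "'p multiset \<Rightarrow> 'b::{banach, real_normed_field}"
  assumes m: "\<And>A B. A \<in> Ms \<Longrightarrow> B \<in> Ms \<Longrightarrow> \<eta> (A + B) = \<eta> A * \<eta> B"
    and s: "\<eta> summable_on MsQ Q" "\<eta> summable_on MsQ (insert p Q)" and p: "p \<in> P" "p \<notin> Q"
  shows "infsum \<eta> (MsQ (insert p Q)) = (1 - \<eta> {#p#}) * infsum \<eta> (MsQ Q)"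
proof -
  have split: "MsQ Q = MsQ (insert p Q) \<union> add_mset p ` MsQ Q"
  proof (intro equalityI subsetI)
    fix A assume A: "A \<in> MsQ Q"
    show "A \<in> MsQ (insert p Q) \<union> add_mset p ` MsQ Q"
    proof (cases "p \<in># A")
      case True
      then have "A = add_mset p (A - {#p#})" by simp
      moreover have "A - {#p#} \<in> MsQ Q" using A by (auto simp: MsQ_def Ms_diff dest: in_diffD)
      ultimately show ?thesis by blast
    next
      case False
      then show ?thesis using A by (auto simp: MsQ_def)
    qed
  qed (use p in \<open>auto simp: MsQ_def\<close>)
  have eq: "\<eta> (add_mset p A) = \<eta> {#p#} * \<eta> A" if "A \<in> MsQ Q" for A
    using m[of "{#p#}" A] that p by (simp add: MsQ_def)
  have s2: "(\<lambda>A. \<eta> {#p#} * \<eta> A) summable_on MsQ Q" using s(1) by (rule summable_on_cmult_right)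
  have inj: "inj_on (add_mset p) (MsQ Q)" by (auto simp: inj_on_def)
  have s3: "\<eta> summable_on (add_mset p ` MsQ Q)"
    unfolding summable_on_reindex[OF inj] using s2 eq by (simp cong: summable_on_cong)
  have "infsum \<eta> (MsQ Q) = infsum \<eta> (MsQ (insert p Q)) + infsum \<eta> (add_mset p ` MsQ Q)"
    by (subst split, rule infsum_Un_disjoint[OF s(2) s3]) (auto simp: MsQ_def)
  also have "infsum \<eta> (add_mset p ` MsQ Q) = (\<Sum>\<^sub>\<infinity>A\<in>MsQ Q. \<eta> {#p#} * \<eta> A)"
    unfolding infsum_reindex[OF inj] using eq by (simp cong: infsum_cong)
  also have "\<dots> = \<eta> {#p#} * infsum \<eta> (MsQ Q)" using s(1) by (simp add: infsum_cmult_right)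
  finally have "infsum \<eta> (MsQ (insert p Q)) = infsum \<eta> (MsQ Q) - \<eta> {#p#} * infsum \<eta> (MsQ Q)"
    unfolding eq_diff_eq by (rule sym)
  then show ?thesis by (simp only: left_diff_distrib mult_1_left)
qed

lemma euler_product:
  fixes \<eta> :: "'p multiset \<Rightarrow> 'b::{banach, real_normed_field}"
  assumes m: "\<And>A B. A \<in> Ms \<Longrightarrow> B \<in> Ms \<Longrightarrow> \<eta> (A + B) = \<eta> A * \<eta> B"
    and s: "\<eta> summable_on Ms" and Q: "finite Q" "Q \<subseteq> P"
  shows "infsum \<eta> (MsQ Q) = (\<Prod>p\<in>Q. 1 - \<eta> {#p#}) * infsum \<eta> Ms"
  using Q
proof (induction Q rule: finite_induct)
  case empty
  then show ?case by (simp add: MsQ_def)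
next
  case (insert p Q)
  have "\<eta> summable_on MsQ R" for R by (rule summable_on_subset_banach[OF s]) (auto simp: MsQ_def)
  then have "infsum \<eta> (MsQ (insert p Q)) = (1 - \<eta> {#p#}) * infsum \<eta> (MsQ Q)"
    using insert by (intro euler_factor m) auto
  then show ?case using insert by simp
qed

text \<open>Compares the Euler factor 1 - z of g with the factor 1 - r of zeta. With a = Re z and
  |a| \<le> r \<le> 1/2 one has ln (1 - a) \<ge> - a - 2 r^2, whereas ln (1 - r) \<le> - r; the
  difference of these bounds is the exponent.\<close>

lemma factor_bound:
  fixes z :: complex and r :: real
  assumes "cmod z \<le> r" "r \<le> 1/2"
  shows "1 - r \<le> cmod (1 - z) * exp (- (r - Re z) + 2 * r\<^sup>2)"
proof -
  define a where "a = Re z"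
  have a: "\<bar>a\<bar> \<le> r" using assms abs_Re_le_cmod[of z] by (simp add: a_def)
  have "\<bar>a\<bar>\<^sup>2 \<le> r\<^sup>2" using a by (intro power_mono) auto
  then have sq: "a\<^sup>2 \<le> r\<^sup>2" by simp
  have "exp (- a - 2 * r\<^sup>2) \<le> 1 - a"
  proof (cases "a \<ge> 0")
    case True
    have "- a - 2 * r\<^sup>2 \<le> - a - 2 * a\<^sup>2" using sq by simp
    also have "\<dots> \<le> ln (1 - a)" using True a assms by (intro ln_one_minus_pos_lower_bound) auto
    finally show ?thesis using a assms by (simp add: ln_ge_iff)
  next
    case False
    have "- a - 2 * r\<^sup>2 \<le> (- a) - (- a)\<^sup>2" using sq zero_le_power2[of r] unfolding power2_minus by linarith
    also have "\<dots> \<le> ln (1 + (- a))" using False a assms by (intro ln_one_plus_pos_lower_bound) auto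
    finally show ?thesis using a assms False by (simp add: ln_ge_iff)
  qed
  also have "1 - a \<le> cmod (1 - z)" using complex_Re_le_cmod[of "1 - z"] by (simp add: a_def)
  finally have 1: "exp (- a - 2 * r\<^sup>2) \<le> cmod (1 - z)" .
  have "1 - r \<le> exp (- r)" using exp_ge_add_one_self[of "- r"] by simp
  also have "exp (- r) = exp (- a - 2 * r\<^sup>2) * exp (- (r - a) + 2 * r\<^sup>2)" by (simp flip: exp_add)
  also have "\<dots> \<le> cmod (1 - z) * exp (- (r - a) + 2 * r\<^sup>2)" using 1 by (intro mult_right_mono) auto
  finally show ?thesis by (simp add: a_def)
qed

text \<open>After removal of the primes up to x, the series of g is still dominated termwise by that
  of zeta. Restoring the factors multiplies \<open>Z \<sigma>\<close> by quotients (1 - r) / |1 -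
  z|, which \<open>factor_bound\<close> controls; the squares r^2 add up to at most Z 2.\<close>

lemma F_euler_bound:
  assumes g: "completely_mult g" and s: "\<sigma> > 1"
  shows "cmod (F g \<sigma> t) \<le> Z \<sigma> * exp (- (\<Sum>p\<in>primes_le x. (1 - Re (g {#p#} * cis (- t * ln (real (nrm p))))) * real (nrm p) powr (- \<sigma>)) + 2 * Z 2)"
proof -
  define Q where "Q = primes_le x"
  define \<eta> where "\<eta> = ch g \<sigma> t"
  define \<rho> where "\<rho> = (\<lambda>A. N A powr (- \<sigma>))"
  have Q: "finite Q" "Q \<subseteq> P" unfolding Q_def by (rule finite_primes_le, auto simp: primes_le_def)
  have rm: "\<rho> (A + B) = \<rho> A * \<rho> B" if "A \<in> Ms" "B \<in> Ms" for A B
    using N_pos[OF that(1)] N_pos[OF that(2)] by (simp add: \<rho>_def powr_mult)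
  have sr: "\<rho> summable_on Ms" unfolding \<rho>_def by (rule summable_powr[OF s])
  have sc: "(\<lambda>A. cmod (\<eta> A)) summable_on Ms" unfolding \<eta>_def by (rule summable_ch[OF g s])
  have e1: "infsum \<eta> (MsQ Q) = (\<Prod>p\<in>Q. 1 - \<eta> {#p#}) * F g \<sigma> t"
    unfolding F_def \<eta>_def[symmetric]
    by (rule euler_product[OF _ Infinite_Sum.abs_summable_summable[OF sc] Q]) (simp add: \<eta>_def ch_plus[OF g])
  have e2: "infsum \<rho> (MsQ Q) = (\<Prod>p\<in>Q. 1 - \<rho> {#p#}) * Z \<sigma>"
    unfolding Z_def \<rho>_def[symmetric] by (rule euler_product[OF _ sr Q]) (rule rm)
  have "cmod (infsum \<eta> (MsQ Q)) \<le> (\<Sum>\<^sub>\<infinity>A\<in>MsQ Q. cmod (\<eta> A))"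
    by (rule norm_infsum_bound, rule summable_on_subset_banach[OF sc]) (auto simp: MsQ_def)
  also have "\<dots> \<le> infsum \<rho> (MsQ Q)"
  proof (rule infsum_mono)
    show "(\<lambda>A. cmod (\<eta> A)) summable_on MsQ Q" by (rule summable_on_subset_banach[OF sc]) (auto simp: MsQ_def)
    show "\<rho> summable_on MsQ Q" by (rule summable_on_subset_banach[OF sr]) (auto simp: MsQ_def)
  qed (auto simp: MsQ_def \<eta>_def \<rho>_def intro: norm_ch_le[OF g])
  finally have 1: "(\<Prod>p\<in>Q. cmod (1 - \<eta> {#p#})) * cmod (F g \<sigma> t) \<le> (\<Prod>p\<in>Q. 1 - \<rho> {#p#}) * Z \<sigma>"
    unfolding e1 e2 by (simp add: norm_mult prod_norm[symmetric])
  have pb: "cmod (\<eta> {#p#}) \<le> \<rho> {#p#}" "\<rho> {#p#} \<le> 1/2" "0 \<le> \<rho> {#p#}" "(\<rho> {#p#})\<^sup>2 \<le> N {#p#} powr (-2)" if "p \<in> Q" for p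
  proof -
    have p: "{#p#} \<in> Ms" "real (nrm p) \<ge> 2" using that Q nrm_ge_2[of p] by (auto simp: Ms_def)
    show "cmod (\<eta> {#p#}) \<le> \<rho> {#p#}" unfolding \<eta>_def \<rho>_def by (rule norm_ch_le[OF g p(1)])
    have "real (nrm p) powr (- \<sigma>) \<le> real (nrm p) powr (-1)" using p s by (intro powr_mono) auto
    also have "\<dots> \<le> 1/2" using p by (simp add: powr_minus field_simps)
    finally show "\<rho> {#p#} \<le> 1/2" by (simp add: \<rho>_def)
    show "0 \<le> \<rho> {#p#}" by (simp add: \<rho>_def)
    have "(\<rho> {#p#})\<^sup>2 = real (nrm p) powr (- (2 * \<sigma>))" using p by (simp add: \<rho>_def powr_power mult.commute)
    also have "\<dots> \<le> real (nrm p) powr (-2)" using p s by (intro powr_mono) auto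
    finally show "(\<rho> {#p#})\<^sup>2 \<le> N {#p#} powr (-2)" by simp
  qed
  define E where "E = (\<Sum>p\<in>Q. - (\<rho> {#p#} - Re (\<eta> {#p#})) + 2 * (\<rho> {#p#})\<^sup>2)"
  have "(\<Prod>p\<in>Q. 1 - \<rho> {#p#}) \<le> (\<Prod>p\<in>Q. cmod (1 - \<eta> {#p#}) * exp (- (\<rho> {#p#} - Re (\<eta> {#p#})) + 2 * (\<rho> {#p#})\<^sup>2))"
  proof (intro prod_mono conjI)
    fix p assume p: "p \<in> Q"
    show "0 \<le> 1 - \<rho> {#p#}" using pb(2)[OF p] by simp
    show "1 - \<rho> {#p#} \<le> cmod (1 - \<eta> {#p#}) * exp (- (\<rho> {#p#} - Re (\<eta> {#p#})) + 2 * (\<rho> {#p#})\<^sup>2)"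
      by (rule factor_bound[OF pb(1,2)[OF p]])
  qed
  also have "\<dots> = (\<Prod>p\<in>Q. cmod (1 - \<eta> {#p#})) * exp E"
    unfolding prod.distrib E_def using Q by (simp add: exp_sum)
  finally have "(\<Prod>p\<in>Q. 1 - \<rho> {#p#}) * Z \<sigma> \<le> (\<Prod>p\<in>Q. cmod (1 - \<eta> {#p#})) * exp E * Z \<sigma>"
    using Z_nonneg by (intro mult_right_mono) auto
  with 1 have "(\<Prod>p\<in>Q. cmod (1 - \<eta> {#p#})) * cmod (F g \<sigma> t) \<le> (\<Prod>p\<in>Q. cmod (1 - \<eta> {#p#})) * (exp E * Z \<sigma>)" by (simp add: mult_ac)
  moreover have "(\<Prod>p\<in>Q. cmod (1 - \<eta> {#p#})) > 0"
  proof (rule prod_pos)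
    fix p assume p: "p \<in> Q"
    have "cmod (\<eta> {#p#}) < 1" using pb(1,2)[OF p] by linarith
    then have "\<eta> {#p#} \<noteq> 1" by auto
    then show "0 < cmod (1 - \<eta> {#p#})" by simp
  qed
  ultimately have 2: "cmod (F g \<sigma> t) \<le> Z \<sigma> * exp E" by (simp add: mult.commute)
  have "(\<Sum>p\<in>Q. (\<rho> {#p#})\<^sup>2) \<le> (\<Sum>p\<in>Q. N {#p#} powr (-2))" by (intro sum_mono pb)
  also have "\<dots> = (\<Sum>A\<in>(\<lambda>p. {#p#}) ` Q. N A powr (-2))" by (subst sum.reindex) (auto simp: inj_on_def)
  also have "\<dots> \<le> Z 2" unfolding Z_def
    by (rule finite_sum_le_infsum[OF summable_powr]) (use Q in \<open>auto simp: Ms_def\<close>)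
  finally have 3: "(\<Sum>p\<in>Q. (\<rho> {#p#})\<^sup>2) \<le> Z 2" .
  have "E = - (\<Sum>p\<in>Q. \<rho> {#p#} - Re (\<eta> {#p#})) + 2 * (\<Sum>p\<in>Q. (\<rho> {#p#})\<^sup>2)"
    unfolding E_def by (simp only: sum.distrib sum_negf sum_distrib_left)
  also have "(\<Sum>p\<in>Q. \<rho> {#p#} - Re (\<eta> {#p#})) = (\<Sum>p\<in>Q. (1 - Re (g {#p#} * cis (- t * ln (real (nrm p))))) * real (nrm p) powr (- \<sigma>))"
    by (intro sum.cong refl) (simp add: \<rho>_def \<eta>_def ch_def algebra_simps)
  finally have "E \<le> - (\<Sum>p\<in>Q. (1 - Re (g {#p#} * cis (- t * ln (real (nrm p))))) * real (nrm p) powr (- \<sigma>)) + 2 * Z 2"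
    using 3 by linarith
  then have "Z \<sigma> * exp E \<le> Z \<sigma> * exp (- (\<Sum>p\<in>Q. (1 - Re (g {#p#} * cis (- t * ln (real (nrm p))))) * real (nrm p) powr (- \<sigma>)) + 2 * Z 2)"
    using Z_nonneg by (intro mult_left_mono) auto
  with 2 show ?thesis unfolding Q_def by linarith
qed

lemma sum_log_primes_le:
  assumes x: "x \<ge> 1"
  shows "(\<Sum>p\<in>primes_le x. ln (real (nrm p)) / real (nrm p)) \<le> C1 / c1 * ln x"
proof -
  have "(\<Sum>p\<in>primes_le x. ln (real (nrm p)) / real (nrm p)) = (\<Sum>p\<in>primes_le x. mang {#p#} / N {#p#})"
    using mang_replicate[of 1] by (intro sum.cong refl) simp
  also have "\<dots> = (\<Sum>A\<in>(\<lambda>p. {#p#}) ` primes_le x. mang A / N A)" by (subst sum.reindex) (auto simp: inj_on_def)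
  also have "\<dots> \<le> (\<Sum>A\<in>le x. mang A / N A)"
    by (rule sum_mono2[OF finite_le]) (auto simp: primes_le_def le_def Ms_def intro!: divide_nonneg_nonneg mang_nonneg order_trans[OF _ N_ge_1])
  also have "\<dots> \<le> C1 / c1 * ln x" by (rule sum_mang_div_le[OF x])
  finally show ?thesis .
qed

lemma pterm_bounds:
  assumes g: "completely_mult g" and p: "p \<in> P"
  shows "0 \<le> 1 - Re (g {#p#} * cis s)" "1 - Re (g {#p#} * cis s) \<le> 2"
proof -
  have "\<bar>Re (g {#p#} * cis s)\<bar> \<le> cmod (g {#p#} * cis s)" by (rule abs_Re_le_cmod)
  also have "\<dots> \<le> 1" using completely_mult_le[OF g, of "{#p#}"] p by (simp add: norm_mult Ms_def)
  finally show "0 \<le> 1 - Re (g {#p#} * cis s)" "1 - Re (g {#p#} * cis s) \<le> 2" by linarith+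
qed

text \<open>On this line Z is O(ln x). Exchanging N^(-\<sigma>) for 1 / N in the exponent costs at
  most 2 ln N / (N ln x) per prime, which the Mertens bound sums to O(1); so the distance itself
  appears in the exponent.\<close>

theorem F_near_one:
  obtains C where "C \<ge> 0" "\<And>g x t M. completely_mult g \<Longrightarrow> x \<ge> 3 \<Longrightarrow> M \<le> pdist g x t \<Longrightarrow>
    cmod (F g (1 + 1 / ln x) t) \<le> C * ln x * exp (- M)"
proof -
  define K where "K = 2 * C1 * exp (2 * (C1 / c1) + 2 * Z 2)"
  have K0: "K \<ge> 0" using C1_pos by (simp add: K_def)
  have "cmod (F g (1 + 1 / ln x) t) \<le> K * ln x * exp (- M)" if g: "completely_mult g" and x: "x \<ge> 3" and M: "M \<le> pdist g x t" for g x t M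
  proof -
    define \<sigma> where "\<sigma> = 1 + 1 / ln x"
    have l1: "ln x \<ge> 1"
    proof -
      have "exp 1 \<le> x" using exp_le x by linarith
      then show ?thesis using x by (simp add: ln_ge_iff)
    qed
    have s: "\<sigma> > 1" using l1 by (simp add: \<sigma>_def)
    define w where "w = (\<lambda>p. 1 - Re (g {#p#} * cis (- t * ln (real (nrm p)))))"
    have w: "0 \<le> w p" "w p \<le> 2" if "p \<in> P" for p unfolding w_def by (rule pterm_bounds[OF g that])+
    have "pdist g x t - (\<Sum>p\<in>primes_le x. w p * real (nrm p) powr (- \<sigma>)) = (\<Sum>p\<in>primes_le x. w p * (1 / real (nrm p) - real (nrm p) powr (- \<sigma>)))"
      unfolding pdist_def w_def sum_subtractf[symmetric]
      by (rule sum.cong[OF refl]) (simp only: right_diff_distrib times_divide_eq_right mult_1_right)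
    also have "\<dots> \<le> (\<Sum>p\<in>primes_le x. 2 * ((1 / ln x) * (ln (real (nrm p)) / real (nrm p))))"
    proof (rule sum_mono)
      fix p assume p: "p \<in> primes_le x"
      have n: "real (nrm p) \<ge> 2" using nrm_ge_2[of p] p by (simp add: primes_le_def)
      have "real (nrm p) powr (- \<sigma>) = real (nrm p) powr (-1) * real (nrm p) powr (- (1 / ln x))"
        by (rule powr_add'[symmetric]) (simp add: \<sigma>_def)
      also have "\<dots> = (1 / real (nrm p)) * exp (- (ln (real (nrm p)) / ln x))" 
      proof -
        have "real (nrm p) powr (-1) = 1 / real (nrm p)" using n by (simp add: powr_minus divide_inverse)
        moreover have "real (nrm p) powr (- (1 / ln x)) = exp (- (ln (real (nrm p)) / ln x))" using n by (simp add: powr_def)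
        ultimately show ?thesis by simp
      qed
      finally have e: "real (nrm p) powr (- \<sigma>) = (1 / real (nrm p)) * exp (- (ln (real (nrm p)) / ln x))" .
      have "1 - exp (- (ln (real (nrm p)) / ln x)) \<le> ln (real (nrm p)) / ln x"
        using exp_ge_add_one_self[of "- (ln (real (nrm p)) / ln x)"] by linarith
      then have "(1 / real (nrm p)) * (1 - exp (- (ln (real (nrm p)) / ln x))) \<le> (1 / real (nrm p)) * (ln (real (nrm p)) / ln x)"
        using n by (intro mult_left_mono) auto
      then have d: "1 / real (nrm p) - real (nrm p) powr (- \<sigma>) \<le> (1 / ln x) * (ln (real (nrm p)) / real (nrm p))"
        unfolding e by (simp add: right_diff_distrib mult_ac)
      have "exp (- (ln (real (nrm p)) / ln x)) \<le> 1" using n l1 by simp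
      then have d0: "0 \<le> 1 / real (nrm p) - real (nrm p) powr (- \<sigma>)" unfolding e using n by (simp add: divide_right_mono)
      show "w p * (1 / real (nrm p) - real (nrm p) powr (- \<sigma>)) \<le> 2 * ((1 / ln x) * (ln (real (nrm p)) / real (nrm p)))"
        using w[OF primes_le_P[OF p]] d d0 by (intro mult_mono) auto
    qed
    also have "\<dots> = 2 * (1 / ln x) * (\<Sum>p\<in>primes_le x. ln (real (nrm p)) / real (nrm p))"
      by (simp add: sum_distrib_left mult_ac)
    also have "\<dots> \<le> 2 * (1 / ln x) * (C1 / c1 * ln x)" using l1 x by (intro mult_left_mono sum_log_primes_le) auto
    also have "\<dots> = 2 * (C1 / c1)" using l1 by simp
    finally have 1: "M - 2 * (C1 / c1) \<le> (\<Sum>p\<in>primes_le x. w p * real (nrm p) powr (- \<sigma>))" using M by linarith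
    have "cmod (F g \<sigma> t) \<le> Z \<sigma> * exp (- (\<Sum>p\<in>primes_le x. w p * real (nrm p) powr (- \<sigma>)) + 2 * Z 2)"
      unfolding w_def by (rule F_euler_bound[OF g s])
    also have "\<dots> \<le> (2 * C1 * ln x) * exp (- M + (2 * (C1 / c1) + 2 * Z 2))"
    proof (rule mult_mono)
      have "Z \<sigma> \<le> C1 * \<sigma> / (\<sigma> - 1)" by (rule Z_le[OF s])
      also have "\<dots> = C1 * (ln x + 1)" using l1 by (simp add: \<sigma>_def field_simps)
      also have "\<dots> \<le> C1 * (2 * ln x)" using l1 C1_pos by (intro mult_left_mono) auto
      finally show "Z \<sigma> \<le> 2 * C1 * ln x" by simp
    qed (use 1 l1 C1_pos in auto)
    also have "\<dots> = K * ln x * exp (- M)" by (simp only: exp_add K_def mult_ac)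
    finally show ?thesis by (simp add: \<sigma>_def)
  qed
  then show thesis using that K0 by blast
qed

end

context prime_system
begin

lemma L_ge_1: "x \<ge> 3 \<Longrightarrow> ln x > (1::real)"
proof -
  assume "x \<ge> 3"
  then have "ln 3 \<le> ln x" by simp
  then show ?thesis using ln3_gt_1 by linarith
qed

lemma abs_dirichlet_ch:
  assumes g: "completely_mult g" and s: "\<sigma> > 1"
  shows "abs_dirichlet Ms N (\<lambda>A. g A * of_real (N A powr (- \<sigma>)))"
proof
  show "(\<lambda>A. cmod (g A * of_real (N A powr (- \<sigma>)))) summable_on Ms"
    using summable_ch[OF g s, of 0] by (simp add: ch_def norm_mult)
  show "finite {A \<in> Ms. N A \<le> Y}" for Y using finite_le[of Y] by (simp add: le_def)
qed (rule N_ge_1)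

lemma F_shift:
  assumes g: "completely_mult g" and L: "L \<ge> 1" and a: "1 / L \<le> \<alpha>" "\<alpha> \<le> 1"
    and G: "\<And>u. \<bar>u\<bar> \<le> L \<Longrightarrow> cmod (F g (1 + 1 / L) u) \<le> G" and G0: "G \<ge> 0" and t: "\<bar>t\<bar> \<le> L / 2"
  shows "cmod (F g (1 + \<alpha>) t) \<le> G + 8 * C1"
proof (cases "\<alpha> = 1 / L")
  case True
  then show ?thesis using G[of t] t L C1_pos by auto
next
  case False
  define \<beta> where "\<beta> = \<alpha> - 1 / L"
  have b: "\<beta> > 0" "\<beta> \<le> 1" using a False L by (auto simp: \<beta>_def) (smt (verit) divide_pos_pos)
  have s: "1 + 1 / L > 1" using L by simp
  interpret D: abs_dirichlet Ms N "\<lambda>A. g A * of_real (N A powr (- (1 + 1 / L)))"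
    by (rule abs_dirichlet_ch[OF g s])
  have DF: "D.D u = F g (1 + 1 / L) u" for u
    by (simp only: D.D_def F_def ch_def)
  have "cmod (\<Sum>\<^sub>\<infinity>A\<in>Ms. g A * of_real (N A powr (- (1 + 1 / L))) * of_real (N A powr (- \<beta>)) * cis (- t * ln (N A))) \<le> G + 2 * \<beta> * D.A / (L / 2)"
  proof (rule D.shift_bound[OF b(1) _ _ G0 t])
    show "L / 2 > 0" using L by simp
    fix u assume "\<bar>u\<bar> \<le> 2 * (L / 2)"
    then show "cmod (D.D u) \<le> G" unfolding DF by (intro G) simp
  qed
  also have "(\<Sum>\<^sub>\<infinity>A\<in>Ms. g A * of_real (N A powr (- (1 + 1 / L))) * of_real (N A powr (- \<beta>)) * cis (- t * ln (N A))) = F g (1 + \<alpha>) t"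
    unfolding F_def ch_def
  proof (rule infsum_cong)
    fix A
    have "N A powr (- (1 + 1 / L)) * N A powr (- \<beta>) = N A powr (- (1 + \<alpha>))"
      by (rule powr_add') (simp add: \<beta>_def)
    then show "g A * of_real (N A powr (- (1 + 1 / L))) * of_real (N A powr (- \<beta>)) * cis (- t * ln (N A)) = g A * of_real (N A powr (- (1 + \<alpha>))) * cis (- t * ln (N A))"
      by (metis mult.assoc of_real_mult)
  qed
  also have "2 * \<beta> * D.A / (L / 2) \<le> 2 * 1 * (2 * C1 * L) / (L / 2)"
  proof -
    have "D.A \<le> Z (1 + 1 / L)" unfolding D.A_def Z_def
      by (rule infsum_mono[OF D.summable summable_powr[OF s]])
         (use norm_ch_le[OF g, of _ "1 + 1/L" 0] in \<open>simp add: ch_def norm_mult\<close>)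
    also have "\<dots> \<le> C1 * (1 + 1 / L) / (1 + 1 / L - 1)" by (rule Z_le[OF s])
    also have "\<dots> = C1 * (L + 1)" using L by (simp add: field_simps)
    also have "\<dots> \<le> C1 * (2 * L)" using L C1_pos by (intro mult_left_mono) auto
    finally have "D.A \<le> 2 * C1 * L" by simp
    then show ?thesis using b D.A_nonneg L C1_pos by (intro divide_right_mono mult_mono) auto
  qed
  also have "2 * 1 * (2 * C1 * L) / (L / 2) = 8 * C1" using L by simp
  finally show ?thesis by simp
qed

text \<open>The summatory function of the coefficients of - F'. It is preferred to \<open>S\<close>
  because F' factors into F and a series over prime powers.\<close>

definition S1 :: "('p multiset \<Rightarrow> complex) \<Rightarrow> real \<Rightarrow> complex" where
  "S1 g u = (\<Sum>A\<in>le u. g A * of_real (ln (N A)))"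

text \<open>The point is the leading coefficient c / a: its decay for large a makes the range of
  large |t| harmless. The integral in the partial summation is subtracted, so a lower bound for
  \<open>cnt\<close> with the exact density c is required.\<close>

lemma partial_powr_sum_pos:
  assumes a: "a \<ge> 1" and x: "x \<ge> 1"
  shows "(\<Sum>A\<in>le x. N A powr (a - 1)) \<le> c / a * x powr a + (c + 2 * C0) * x powr (a - 1/2)"
proof -
  define R where "R = (\<lambda>u. cnt u - c * u)"
  have 1: "((\<lambda>u. (a - 1) * u powr (a - 2) * cnt u) has_integral (cnt x * x powr (a - 1) - (\<Sum>A\<in>le x. N A powr (a - 1)))) {1..x}"
    by (rule abel_cnt) (use x in \<open>auto intro!: continuous_intros derivative_eq_intros\<close>)
  have 2: "((\<lambda>u. (a - 1) * c * u powr (a - 1) - (a - 1) * C0 * u powr (a - 3/2)) has_integral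
      ((a - 1) * c * ((x powr (a - 1 + 1) - 1) / (a - 1 + 1)) - (a - 1) * C0 * ((x powr (a - 3/2 + 1) - 1) / (a - 3/2 + 1)))) {1..x}"
    by (intro has_integral_diff has_integral_mult_right has_integral_powr x) (use a in auto)
  have "(a - 1) * c * ((x powr (a - 1 + 1) - 1) / (a - 1 + 1)) - (a - 1) * C0 * ((x powr (a - 3/2 + 1) - 1) / (a - 3/2 + 1))
     \<le> cnt x * x powr (a - 1) - (\<Sum>A\<in>le x. N A powr (a - 1))"
  proof (rule has_integral_le[OF 2 1])
    fix u assume u: "u \<in> {1..x}"
    have "c * u - C0 * u powr (1/2) \<le> cnt u" using cnt_approx[of u] u by (simp add: powr_half_sqrt abs_le_iff)
    then have "(a - 1) * u powr (a - 2) * (c * u - C0 * u powr (1/2)) \<le> (a - 1) * u powr (a - 2) * cnt u"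
      using a by (intro mult_left_mono) auto
    also have "(a - 1) * u powr (a - 2) * (c * u - C0 * u powr (1/2)) = (a - 1) * c * (u powr (a - 2) * u powr 1) - (a - 1) * C0 * (u powr (a - 2) * u powr (1/2))"
      using u by (simp add: algebra_simps)
    also have "u powr (a - 2) * u powr 1 = u powr (a - 1)" by (rule powr_add') simp
    also have "u powr (a - 2) * u powr (1/2) = u powr (a - 3/2)" by (rule powr_add') simp
    finally show "(a - 1) * c * u powr (a - 1) - (a - 1) * C0 * u powr (a - 3/2) \<le> (a - 1) * u powr (a - 2) * cnt u" .
  qed
  then have 3: "(\<Sum>A\<in>le x. N A powr (a - 1)) \<le> cnt x * x powr (a - 1) - (a - 1) * c * ((x powr a - 1) / a) + (a - 1) * C0 * ((x powr (a - 1/2) - 1) / (a - 1/2))"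
    by simp
  have "cnt x * x powr (a - 1) \<le> (c * x + C0 * sqrt x) * x powr (a - 1)"
    using cnt_approx[OF x] by (intro mult_right_mono) auto
  also have "\<dots> = c * (x powr 1 * x powr (a - 1)) + C0 * (x powr (1/2) * x powr (a - 1))" using x by (simp add: powr_half_sqrt algebra_simps)
  also have "x powr 1 * x powr (a - 1) = x powr a" by (rule powr_add') simp
  also have "x powr (1/2) * x powr (a - 1) = x powr (a - 1/2)" by (rule powr_add') simp
  finally have 4: "cnt x * x powr (a - 1) \<le> c * x powr a + C0 * x powr (a - 1/2)" .
  have 5: "(a - 1) * c * ((x powr a - 1) / a) \<ge> c * x powr a - c / a * x powr a - c"
  proof -
    have "(a - 1) * c * ((x powr a - 1) / a) = c * x powr a - c / a * x powr a - c + c / a" using a by (simp add: field_simps)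
    then show ?thesis using a c_pos by simp
  qed
  have 6: "(a - 1) * C0 * ((x powr (a - 1/2) - 1) / (a - 1/2)) \<le> C0 * x powr (a - 1/2)"
  proof -
    have "(a - 1) * C0 * ((x powr (a - 1/2) - 1) / (a - 1/2)) \<le> (a - 1/2) * C0 * (x powr (a - 1/2) / (a - 1/2))"
      using a C0_nonneg x by (intro mult_mono divide_right_mono) (auto simp: ge_one_powr_ge_zero)
    then show ?thesis using a by simp
  qed
  have "c * 1 \<le> c * x powr (a - 1/2)" using a x c_pos by (intro mult_left_mono) (auto simp: ge_one_powr_ge_zero)
  then show ?thesis using 3 4 5 6 by (simp add: algebra_simps)
qed

text \<open>Plancherel with b = 1 + \<alpha>. For |t| \<le> L / 2 the factor F is at most G, and the
  prime power series is treated by Plancherel in the other direction with the Chebyshev bound. For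
  |t| > T = L / 2 the weight is at most 2 / (T^2 + t^2), the Plancherel weight of abscissa T, where
  trivial bounds for the coefficients suffice.\<close>

theorem S1_mean_square:
  assumes g: "completely_mult g" and L: "L \<ge> 4" and a: "0 < \<alpha>" "\<alpha> \<le> 1"
    and G: "\<And>t. \<bar>t\<bar> \<le> L / 2 \<Longrightarrow> cmod (F g (1 + \<alpha>) t) \<le> G"
    and Ch: "\<And>x. x \<ge> 1 \<Longrightarrow> (\<Sum>A\<in>le x. mang A) \<le> Ch * x" "Ch > 0"
  shows "set_integrable lborel {1..X} (\<lambda>u. (cmod (S1 g u))\<^sup>2 * u powr (- 3 - 2 * \<alpha>))"
    and "(LBINT u:{1..X}. (cmod (S1 g u))\<^sup>2 * u powr (- 3 - 2 * \<alpha>))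
      \<le> G\<^sup>2 * Ch\<^sup>2 / (2 * \<alpha>) + 256 * c\<^sup>2 / (L\<^sup>2 * \<alpha> ^ 3) + 128 * (c + 2 * C0)\<^sup>2"
proof -
  define b where "b = 1 + \<alpha>"
  have b: "b > 1" using a by (simp add: b_def)
  define T where "T = L / 2"
  have T: "T \<ge> 2" using L by (simp add: T_def)
  define d1 where "d1 = (\<lambda>A. g A * of_real (ln (N A)) * of_real (N A powr (- b)))"
  define dL where "dL = (\<lambda>A. g A * of_real (mang A) * of_real (N A powr (- b)))"
  have nd1: "cmod (d1 A) \<le> ln (N A) * N A powr (- b)" and ndL: "cmod (dL A) \<le> mang A * N A powr (- b)" if "A \<in> Ms" for A
  proof -
    have l: "0 \<le> ln (N A)" "0 \<le> mang A" using N_ge_1[OF that] mang_nonneg[OF that] by auto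
    have "cmod (g A) * (ln (N A) * N A powr (- b)) \<le> 1 * (ln (N A) * N A powr (- b))"
      "cmod (g A) * (mang A * N A powr (- b)) \<le> 1 * (mang A * N A powr (- b))"
      using completely_mult_le[OF g that] l by (intro mult_right_mono; simp)+
    then show "cmod (d1 A) \<le> ln (N A) * N A powr (- b)" "cmod (dL A) \<le> mang A * N A powr (- b)"
      using l by (simp_all add: d1_def dL_def norm_mult)
  qed
  have sm1: "(\<lambda>A. cmod (d1 A)) summable_on Ms"
    by (rule summable_on_comparison_test[OF summable_log_powr[OF b]]) (use nd1 in auto)
  have smL: "(\<lambda>A. cmod (dL A)) summable_on Ms"
  proof (rule summable_on_comparison_test[OF summable_log_powr[OF b]])
    fix A assume A: "A \<in> Ms"
    have "mang A * N A powr (- b) \<le> ln (N A) * N A powr (- b)" using mang_le[OF A] by (intro mult_right_mono) auto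
    then show "cmod (dL A) \<le> ln (N A) * N A powr (- b)" using ndL[OF A] by linarith
  qed auto
  have fin: "finite {A \<in> Ms. N A \<le> Y}" for Y using finite_le[of Y] by (simp add: le_def)
  interpret D1: abs_dirichlet Ms N d1 by unfold_locales (use N_ge_1 fin sm1 in auto)
  interpret DL: abs_dirichlet Ms N dL by unfold_locales (use N_ge_1 fin smL in auto)
  \<comment> \<open>This is - F' = F times the series of g \<open>mang\<close>: by complete
    multiplicativity, the convolution of g \<open>mang\<close> with g is g times the divisor sum of
    \<open>mang\<close>, that is g ln N.\<close>
  have prod: "D1.D t = DL.D t * F g b t" for t
  proof -
    let ?\<psi> = "\<lambda>A. dL A * cis (- t * ln (N A))"
    have "(\<Sum>\<^sub>\<infinity>A\<in>Ms. \<Sum>B | B \<subseteq># A. ?\<psi> B * ch g b t (A - B)) = infsum ?\<psi> Ms * infsum (ch g b t) Ms"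
      by (rule infsum_conv[OF _ summable_ch[OF g b]]) (use smL in \<open>simp add: norm_mult\<close>)
    moreover have "(\<Sum>\<^sub>\<infinity>A\<in>Ms. \<Sum>B | B \<subseteq># A. ?\<psi> B * ch g b t (A - B)) = D1.D t"
      unfolding D1.D_def
    proof (rule infsum_cong)
      fix A assume A: "A \<in> Ms"
      have "?\<psi> B * ch g b t (A - B) = of_real (mang B) * ch g b t A" if B: "B \<subseteq># A" for B
      proof -
        have "ch g b t A = ch g b t B * ch g b t (A - B)"
          using ch_plus[OF g, of B "A - B"] B Ms_subset[OF A B] Ms_diff[OF A, of B] by simp
        moreover have "?\<psi> B = of_real (mang B) * ch g b t B" by (simp add: dL_def ch_def mult_ac)
        ultimately show ?thesis by simp
      qed
      then have "(\<Sum>B | B \<subseteq># A. ?\<psi> B * ch g b t (A - B)) = (\<Sum>B | B \<subseteq># A. of_real (mang B) * ch g b t A)" by simp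
      also have "\<dots> = of_real (ln (N A)) * ch g b t A"
        unfolding sum_mang[OF A, symmetric] by (simp add: sum_distrib_right)
      also have "\<dots> = d1 A * cis (- t * ln (N A))" by (simp add: d1_def ch_def mult_ac)
      finally show "(\<Sum>B | B \<subseteq># A. ?\<psi> B * ch g b t (A - B)) = d1 A * cis (- t * ln (N A))" .
    qed
    ultimately show ?thesis by (simp add: DL.D_def F_def)
  qed
  have S1eq: "(\<Sum>A | A \<in> Ms \<and> N A \<le> u. d1 A * of_real (N A powr b)) = S1 g u" for u
    unfolding S1_def le_def
  proof (rule sum.cong)
    fix A assume "A \<in> {A \<in> Ms. N A \<le> u}"
    then have "N A > 0" using N_pos by auto
    then have "complex_of_real (N A powr (- b)) * complex_of_real (N A powr b) = 1"
      by (simp add: powr_minus flip: of_real_mult)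
    then show "d1 A * of_real (N A powr b) = g A * of_real (ln (N A))" by (simp add: d1_def mult.assoc)
  qed auto
  have eb: "- 1 - 2 * b = - 3 - 2 * \<alpha>" by (simp add: b_def)
  have b0: "b > 0" using b by simp
  show "set_integrable lborel {1..X} (\<lambda>u. (cmod (S1 g u))\<^sup>2 * u powr (- 3 - 2 * \<alpha>))"
    using D1.time_le_freq(2)[OF b0, of X] unfolding S1eq eb .
  have A1: "(LBINT u:{1..X}. (cmod (S1 g u))\<^sup>2 * u powr (- 3 - 2 * \<alpha>)) \<le> (LBINT t. (cmod (D1.D t))\<^sup>2 / (b\<^sup>2 + t\<^sup>2)) / (2 * pi)"
    using D1.time_le_freq(1)[OF b0, of X] unfolding S1eq eb .
  have T0: "T > 0" using T by simp
  have "(LBINT t. (cmod (D1.D t))\<^sup>2 / (b\<^sup>2 + t\<^sup>2)) \<le> (LBINT t. G\<^sup>2 * ((cmod (DL.D t))\<^sup>2 / (b\<^sup>2 + t\<^sup>2)) + 2 * ((cmod (D1.D t))\<^sup>2 / (T\<^sup>2 + t\<^sup>2)))"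
  proof (rule integral_mono)
    fix t :: real
    have p: "b\<^sup>2 + t\<^sup>2 > 0" "T\<^sup>2 + t\<^sup>2 > 0" using b T by (auto intro: add_pos_nonneg)
    show "(cmod (D1.D t))\<^sup>2 / (b\<^sup>2 + t\<^sup>2) \<le> G\<^sup>2 * ((cmod (DL.D t))\<^sup>2 / (b\<^sup>2 + t\<^sup>2)) + 2 * ((cmod (D1.D t))\<^sup>2 / (T\<^sup>2 + t\<^sup>2))"
    proof (cases "\<bar>t\<bar> \<le> T")
      case True
      then have "cmod (F g b t) \<le> G" using G by (simp add: b_def T_def)
      then have "(cmod (F g b t))\<^sup>2 \<le> G\<^sup>2" by (intro power_mono) auto
      then have "(cmod (D1.D t))\<^sup>2 \<le> (cmod (DL.D t))\<^sup>2 * G\<^sup>2"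
        unfolding prod norm_mult power_mult_distrib by (intro mult_left_mono) auto
      then have "(cmod (D1.D t))\<^sup>2 / (b\<^sup>2 + t\<^sup>2) \<le> (cmod (DL.D t))\<^sup>2 * G\<^sup>2 / (b\<^sup>2 + t\<^sup>2)"
        using p by (intro divide_right_mono) auto
      moreover have "(cmod (DL.D t))\<^sup>2 * G\<^sup>2 / (b\<^sup>2 + t\<^sup>2) = G\<^sup>2 * ((cmod (DL.D t))\<^sup>2 / (b\<^sup>2 + t\<^sup>2))" by simp
      moreover have "0 \<le> (cmod (D1.D t))\<^sup>2 / (T\<^sup>2 + t\<^sup>2)" using p by simp
      ultimately show ?thesis by linarith
    next
      case False
      have "T\<^sup>2 \<le> t\<^sup>2" using False T by (metis abs_le_square_iff abs_of_pos T0 le_cases)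
      then have "1 / (b\<^sup>2 + t\<^sup>2) \<le> 2 / (T\<^sup>2 + t\<^sup>2)" using p
        by (simp add: divide_simps) (use zero_le_power2[of b] in linarith)
      then have "(cmod (D1.D t))\<^sup>2 * (1 / (b\<^sup>2 + t\<^sup>2)) \<le> (cmod (D1.D t))\<^sup>2 * (2 / (T\<^sup>2 + t\<^sup>2))" by (intro mult_left_mono) auto
      then have "(cmod (D1.D t))\<^sup>2 / (b\<^sup>2 + t\<^sup>2) \<le> 2 * ((cmod (D1.D t))\<^sup>2 / (T\<^sup>2 + t\<^sup>2))" by (simp add: mult.commute)
      moreover have "0 \<le> G\<^sup>2 * ((cmod (DL.D t))\<^sup>2 / (b\<^sup>2 + t\<^sup>2))" using p by simp
      ultimately show ?thesis by linarith
    qed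
  qed (intro D1.integrable_D DL.integrable_D b0 T0 Bochner_Integration.integrable_add integrable_mult_right)+
  also have "\<dots> = G\<^sup>2 * (LBINT t. (cmod (DL.D t))\<^sup>2 / (b\<^sup>2 + t\<^sup>2)) + 2 * (LBINT t. (cmod (D1.D t))\<^sup>2 / (T\<^sup>2 + t\<^sup>2))"
    by (rule has_bochner_integral_integral_eq, intro has_bochner_integral_add has_bochner_integral_mult_right
         has_bochner_integral_integrable D1.integrable_D DL.integrable_D b0 T0)
  finally have A2: "(LBINT t. (cmod (D1.D t))\<^sup>2 / (b\<^sup>2 + t\<^sup>2)) \<le> \<dots>" .
  have A3: "(LBINT t. (cmod (DL.D t))\<^sup>2 / (b\<^sup>2 + t\<^sup>2)) \<le> 2 * pi * (Ch\<^sup>2 * (1 / (2 * \<alpha>)))"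
  proof -
    have eq: "indicator {1..} u * ((Ch * u)\<^sup>2 * u powr (- 1 - 2 * b)) = Ch\<^sup>2 * (indicator {1..} u * u powr (- 1 - 2 * \<alpha>))" for u :: real
    proof (cases "u \<ge> 1")
      case True
      have "u\<^sup>2 * u powr (- 1 - 2 * b) = u powr 2 * u powr (- 1 - 2 * b)" using True by simp
      also have "\<dots> = u powr (- 1 - 2 * \<alpha>)" by (rule powr_add') (simp add: b_def)
      finally show ?thesis using True by (simp add: power_mult_distrib mult.assoc)
    qed auto
    have hb: "has_bochner_integral lborel (\<lambda>u. Ch\<^sup>2 * (indicator {1..} u * u powr (- 1 - 2 * \<alpha>))) (Ch\<^sup>2 * (1 powr (- (2 * \<alpha>)) / (2 * \<alpha>)))"
      by (intro has_bochner_integral_mult_right has_bochner_integral_powr_to_inf) (use a in auto)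
    have "(LBINT t. (cmod (DL.D t))\<^sup>2 / (b\<^sup>2 + t\<^sup>2)) \<le> 2 * pi * (LBINT u. indicator {1..} u * ((Ch * u)\<^sup>2 * u powr (- 1 - 2 * b)))"
    proof (rule DL.freq_le_time[OF b0])
      fix u :: real assume u: "u \<ge> 1"
      have "(\<Sum>A | A \<in> Ms \<and> N A \<le> u. cmod (dL A) * N A powr b) \<le> (\<Sum>A\<in>le u. mang A)"
        unfolding le_def
      proof (rule sum_mono)
        fix A assume "A \<in> {A \<in> Ms. N A \<le> u}"
        then have A: "A \<in> Ms" by auto
        have "cmod (dL A) * N A powr b \<le> mang A * N A powr (- b) * N A powr b" by (intro mult_right_mono ndL A) auto
        also have "\<dots> = mang A" using N_pos[OF A] by (simp add: powr_minus)
        finally show "cmod (dL A) * N A powr b \<le> mang A" .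
      qed
      also have "\<dots> \<le> Ch * u" by (rule Ch(1)[OF u])
      finally show "(\<Sum>A | A \<in> Ms \<and> N A \<le> u. cmod (dL A) * N A powr b) \<le> Ch * u" .
    next
      show "integrable lborel (\<lambda>u. indicator {1..} u * ((Ch * u)\<^sup>2 * u powr (- 1 - 2 * b)))"
        unfolding eq using hb by (simp only: has_bochner_integral_iff)
    qed
    then show ?thesis unfolding eq has_bochner_integral_integral_eq[OF hb] by simp
  qed
  \<comment> \<open>\<open>p\<close> and \<open>q\<close> are the coefficients of the two powers of
    u that bound the sum of |d1| N^T. The logarithm is absorbed into u^(\<alpha>/2) at the price 2 /
    \<alpha>, respectively into u^(1/4) at the price 4, and c / (T - \<alpha>) \<le> 2 c /
    T.\<close>
  define p where "p = 4 * c / (T * \<alpha>)"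
  define q where "q = 4 * (c + 2 * C0)"
  have pq: "p \<ge> 0" "q \<ge> 0" using c_pos C0_nonneg T a by (auto simp: p_def q_def)
  have A4: "(LBINT t. (cmod (D1.D t))\<^sup>2 / (T\<^sup>2 + t\<^sup>2)) \<le> 2 * pi * (2 * p\<^sup>2 * (1 / \<alpha>) + 2 * q\<^sup>2 * (1 / (1/2)))"
  proof -
    \<comment> \<open>Defined through its square, using (y + z)^2 \<le> 2 y^2 + 2 z^2, so that B^2
      u^(-1-2T) is a sum of two pure powers with explicit integrals.\<close>
    define B where "B = (\<lambda>u. sqrt (2 * p\<^sup>2 * u powr (2 * T - \<alpha>) + 2 * q\<^sup>2 * u powr (2 * T - 1/2)))"
    have eq: "indicator {1..} u * ((B u)\<^sup>2 * u powr (- 1 - 2 * T)) = 2 * p\<^sup>2 * (indicator {1..} u * u powr (- 1 - \<alpha>)) + 2 * q\<^sup>2 * (indicator {1..} u * u powr (- 1 - 1/2))" for u :: real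
    proof (cases "u \<ge> 1")
      case True
      have "(B u)\<^sup>2 = 2 * p\<^sup>2 * u powr (2 * T - \<alpha>) + 2 * q\<^sup>2 * u powr (2 * T - 1/2)" unfolding B_def by (simp add: real_sqrt_pow2)
      then have "(B u)\<^sup>2 * u powr (- 1 - 2 * T) = 2 * p\<^sup>2 * (u powr (2 * T - \<alpha>) * u powr (- 1 - 2 * T)) + 2 * q\<^sup>2 * (u powr (2 * T - 1/2) * u powr (- 1 - 2 * T))"
        by (simp only: distrib_right mult.assoc)
      also have "u powr (2 * T - \<alpha>) * u powr (- 1 - 2 * T) = u powr (- 1 - \<alpha>)" by (rule powr_add') simp
      also have "u powr (2 * T - 1/2) * u powr (- 1 - 2 * T) = u powr (- 1 - 1/2)" by (rule powr_add') simp
      finally show ?thesis using True by simp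
    qed auto
    have hb: "has_bochner_integral lborel (\<lambda>u. 2 * p\<^sup>2 * (indicator {1..} u * u powr (- 1 - \<alpha>)) + 2 * q\<^sup>2 * (indicator {1..} u * u powr (- 1 - 1/2)))
       (2 * p\<^sup>2 * (1 powr (- \<alpha>) / \<alpha>) + 2 * q\<^sup>2 * (1 powr (- (1/2)) / (1/2)))"
      by (intro has_bochner_integral_add has_bochner_integral_mult_right has_bochner_integral_powr_to_inf) (use a in auto)
    have "(LBINT t. (cmod (D1.D t))\<^sup>2 / (T\<^sup>2 + t\<^sup>2)) \<le> 2 * pi * (LBINT u. indicator {1..} u * ((B u)\<^sup>2 * u powr (- 1 - 2 * T)))"
    proof (rule D1.freq_le_time[OF T0])
      fix u :: real assume u: "u \<ge> 1"
      have aT: "T - \<alpha> \<ge> 1" "T - \<alpha> \<ge> T / 2" using T a by auto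
      have "(\<Sum>A | A \<in> Ms \<and> N A \<le> u. cmod (d1 A) * N A powr T) \<le> (\<Sum>A\<in>le u. ln u * N A powr (T - \<alpha> - 1))"
        unfolding le_def
      proof (rule sum_mono)
        fix A assume "A \<in> {A \<in> Ms. N A \<le> u}"
        then have A: "A \<in> Ms" "N A \<le> u" by auto
        have "cmod (d1 A) * N A powr T \<le> ln (N A) * N A powr (- b) * N A powr T" by (intro mult_right_mono nd1 A) auto
        also have "\<dots> = ln (N A) * (N A powr (- b) * N A powr T)" by simp
        also have "N A powr (- b) * N A powr T = N A powr (T - \<alpha> - 1)" by (rule powr_add') (simp add: b_def)
        also have "ln (N A) * N A powr (T - \<alpha> - 1) \<le> ln u * N A powr (T - \<alpha> - 1)"
          using A N_pos[OF A(1)] by (intro mult_right_mono) auto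
        finally show "cmod (d1 A) * N A powr T \<le> ln u * N A powr (T - \<alpha> - 1)" .
      qed
      also have "\<dots> = ln u * (\<Sum>A\<in>le u. N A powr ((T - \<alpha>) - 1))" by (simp add: sum_distrib_left)
      also have "\<dots> \<le> ln u * (c / (T - \<alpha>) * u powr (T - \<alpha>) + (c + 2 * C0) * u powr (T - \<alpha> - 1/2))"
        using u by (intro mult_left_mono partial_powr_sum_pos aT) auto
      also have "\<dots> = c / (T - \<alpha>) * (ln u * u powr (T - \<alpha>)) + (c + 2 * C0) * (ln u * u powr (T - \<alpha> - 1/2))" by (simp add: algebra_simps)
      also have "\<dots> \<le> c / (T / 2) * (2 / \<alpha> * u powr (T - \<alpha> / 2)) + (c + 2 * C0) * (4 * u powr (T - 1/4))"
      proof (rule add_mono[OF mult_mono mult_left_mono])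
        show "c / (T - \<alpha>) \<le> c / (T / 2)" using aT T c_pos by (intro divide_left_mono) auto
        have "ln u * u powr (T - \<alpha>) \<le> u powr (\<alpha> / 2) / (\<alpha> / 2) * u powr (T - \<alpha>)"
          using u a by (intro mult_right_mono ln_powr_bound) auto
        also have "\<dots> = 2 / \<alpha> * (u powr (\<alpha> / 2) * u powr (T - \<alpha>))" by simp
        also have "u powr (\<alpha> / 2) * u powr (T - \<alpha>) = u powr (T - \<alpha> / 2)" by (rule powr_add') (simp add: field_simps)
        finally show "ln u * u powr (T - \<alpha>) \<le> 2 / \<alpha> * u powr (T - \<alpha> / 2)" .
        have "ln u * u powr (T - \<alpha> - 1/2) \<le> u powr (1/4) / (1/4) * u powr (T - 1/2)"
          using u a by (intro mult_mono ln_powr_bound powr_mono) auto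
        also have "\<dots> = 4 * (u powr (1/4) * u powr (T - 1/2))" by simp
        also have "u powr (1/4) * u powr (T - 1/2) = u powr (T - 1/4)" by (rule powr_add') simp
        finally show "ln u * u powr (T - \<alpha> - 1/2) \<le> 4 * u powr (T - 1/4)" .
      qed (use c_pos C0_nonneg u a T in auto)
      also have "\<dots> = p * u powr (T - \<alpha> / 2) + q * u powr (T - 1/4)" unfolding p_def q_def by (simp add: algebra_simps)
      also have "\<dots> \<le> B u"
      proof -
        define y z where "y = p * u powr (T - \<alpha> / 2)" and "z = q * u powr (T - 1/4)"
        have "(y + z)\<^sup>2 \<le> 2 * y\<^sup>2 + 2 * z\<^sup>2" using sum_squares_bound[of y z] by (simp add: power2_eq_square algebra_simps)
        also have "\<dots> = 2 * p\<^sup>2 * u powr (2 * T - \<alpha>) + 2 * q\<^sup>2 * u powr (2 * T - 1/2)"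
          using u by (simp add: y_def z_def power_mult_distrib powr_power algebra_simps)
        finally show ?thesis unfolding B_def y_def[symmetric] z_def[symmetric] by (rule real_le_rsqrt)
      qed
      finally show "(\<Sum>A | A \<in> Ms \<and> N A \<le> u. cmod (d1 A) * N A powr T) \<le> B u" .
    next
      show "integrable lborel (\<lambda>u. indicator {1..} u * ((B u)\<^sup>2 * u powr (- 1 - 2 * T)))"
        unfolding eq using hb by (simp only: has_bochner_integral_iff)
    qed
    then show ?thesis unfolding eq has_bochner_integral_integral_eq[OF hb] by simp
  qed
  have "(LBINT t. (cmod (D1.D t))\<^sup>2 / (b\<^sup>2 + t\<^sup>2)) \<le> G\<^sup>2 * (2 * pi * (Ch\<^sup>2 * (1 / (2 * \<alpha>)))) + 2 * (2 * pi * (2 * p\<^sup>2 * (1 / \<alpha>) + 2 * q\<^sup>2 * (1 / (1/2))))"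
    using A2 mult_left_mono[OF A3, of "G\<^sup>2"] A4 by simp
  also have "\<dots> = (2 * pi) * (G\<^sup>2 * (Ch\<^sup>2 * (1 / (2 * \<alpha>))) + 2 * (2 * p\<^sup>2 * (1 / \<alpha>) + 2 * q\<^sup>2 * (1 / (1/2))))" by (simp add: algebra_simps)
  finally have "(LBINT t. (cmod (D1.D t))\<^sup>2 / (b\<^sup>2 + t\<^sup>2)) / (2 * pi) \<le> G\<^sup>2 * (Ch\<^sup>2 * (1 / (2 * \<alpha>))) + 2 * (2 * p\<^sup>2 * (1 / \<alpha>) + 2 * q\<^sup>2 * (1 / (1/2)))"
    by (subst pos_divide_le_eq) (simp_all only: mult.commute[of _ "2 * pi"], simp)
  also have "\<dots> = G\<^sup>2 * Ch\<^sup>2 / (2 * \<alpha>) + 256 * c\<^sup>2 / (L\<^sup>2 * \<alpha> ^ 3) + 128 * (c + 2 * C0)\<^sup>2"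
  proof -
    have "2 * (2 * p\<^sup>2 * (1 / \<alpha>)) = 256 * c\<^sup>2 / (L\<^sup>2 * \<alpha> ^ 3)"
      unfolding p_def T_def using a L by (simp add: power2_eq_square power3_eq_cube field_simps)
    moreover have "2 * (2 * q\<^sup>2 * (1 / (1/2))) = 128 * (c + 2 * C0)\<^sup>2" unfolding q_def power_mult_distrib by simp
    ultimately show ?thesis by (simp add: distrib_left)
  qed
  finally show "(LBINT u:{1..X}. (cmod (S1 g u))\<^sup>2 * u powr (- 3 - 2 * \<alpha>))
      \<le> G\<^sup>2 * Ch\<^sup>2 / (2 * \<alpha>) + 256 * c\<^sup>2 / (L\<^sup>2 * \<alpha> ^ 3) + 128 * (c + 2 * C0)\<^sup>2"
    using A1 by linarith
qed

end

context prime_system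
begin

section \<open>Halasz's bound for completely multiplicative functions\<close>

lemma norm_S_le:
  assumes g: "\<forall>A\<in>Ms. cmod (g A) \<le> 1" and x: "x \<ge> 1"
  shows "cmod (S g x) \<le> C1 * x"
proof -
  have "cmod (S g x) \<le> (\<Sum>A\<in>le x. 1)"
    unfolding S_def by (rule order_trans[OF norm_sum sum_mono]) (use g in \<open>auto simp: le_def\<close>)
  also have "\<dots> \<le> C1 * x" using cnt_le[OF x] by (simp add: cnt_def)
  finally show ?thesis .
qed

text \<open>Passing from ln u to ln (N A) costs the sum of ln (u / N A), which is O(u).\<close>

lemma norm_S_log_le:
  assumes g: "\<forall>A\<in>Ms. cmod (g A) \<le> 1" and u: "u \<ge> 1"
  shows "cmod (S g u) * ln u \<le> cmod (S1 g u) + 4 * C1 * u"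
proof -
  have "of_real (ln u) * S g u = S1 g u + (\<Sum>A\<in>le u. g A * of_real (ln u - ln (N A)))"
    unfolding S_def S1_def sum_distrib_left sum.distrib[symmetric] by (intro sum.cong refl) (simp add: algebra_simps)
  then have "cmod (of_real (ln u) * S g u) \<le> cmod (S1 g u) + cmod (\<Sum>A\<in>le u. g A * of_real (ln u - ln (N A)))"
    by (simp only: norm_triangle_ineq)
  also have "cmod (\<Sum>A\<in>le u. g A * of_real (ln u - ln (N A))) \<le> (\<Sum>A\<in>le u. ln (u / N A))"
  proof (rule order_trans[OF norm_sum sum_mono])
    fix A assume A: "A \<in> le u"
    then have N1: "N A \<ge> 1" "N A \<le> u" using N_ge_1 by (auto simp: le_def)
    have q: "ln (u / N A) = ln u - ln (N A)" "ln u - ln (N A) \<ge> 0" using N1 u by (auto simp: ln_div)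
    have "cmod (g A) * \<bar>ln u - ln (N A)\<bar> \<le> 1 * \<bar>ln u - ln (N A)\<bar>"
      using g A by (intro mult_right_mono) (auto simp: le_def)
    then show "cmod (g A * of_real (ln u - ln (N A))) \<le> ln (u / N A)" using q by (simp only: norm_mult norm_of_real) simp
  qed
  also have "\<dots> \<le> 4 * C1 * u" by (rule sum_log_quot_le[OF u])
  finally show ?thesis using u by (simp add: norm_mult mult.commute)
qed

text \<open>On the block, ln u lies between 2^k and 2^(k+1). So with \<alpha> = 2^(-k) the damping
  u^(2 \<alpha>) is at most e^4, and |S| is at most \<alpha> (|S1| + 4 C1 u). The mean square V^2 /
  \<alpha> then balances the length of the block, at most 1 / \<alpha> in the measure du /
  u.\<close>

lemma S_block:
  assumes g: "completely_mult g" and L: "ln x \<ge> 4" "x \<ge> 1" and k: "2 ^ k \<le> ln x"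
    and y: "exp (2 ^ k) \<le> y'" "y' \<le> exp (2 ^ Suc k)" "y' \<le> x"
    and G: "\<And>t. \<bar>t\<bar> \<le> ln x / 2 \<Longrightarrow> cmod (F g (1 + 1 / 2 ^ k) t) \<le> G" and G0: "G \<ge> 0"
    and Ch: "\<And>x. x \<ge> 1 \<Longrightarrow> (\<Sum>A\<in>le x. mang A) \<le> Ch * x" "Ch > 0"
  shows "integral {exp (2 ^ k)..y'} (\<lambda>u. u powr (-2) * cmod (S g u))
    \<le> exp 4 * (Ch * G + 16 * c * 2 ^ k / ln x + 12 * (c + 2 * C0)) + 4 * C1"
proof -
  define \<alpha> :: real where "\<alpha> = 1 / 2 ^ k"
  define y where "y = exp ((2::real) ^ k)"
  define Lx where "Lx = ln x"
  \<comment> \<open>Chosen so that V^2 / \<alpha> dominates all three terms of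
    \<open>S1_mean_square\<close> (12^2 = 144 \<ge> 128); the last summand makes V positive.\<close>
  define V where "V = Ch * G + 16 * c * 2 ^ k / Lx + 12 * (c + 2 * C0)"
  have a: "0 < \<alpha>" "\<alpha> \<le> 1" by (auto simp: \<alpha>_def)
  have ai: "1 / \<alpha> = 2 ^ k" by (simp add: \<alpha>_def)
  have Lx: "Lx \<ge> 4" using L by (simp add: Lx_def)
  have g1: "\<forall>A\<in>Ms. cmod (g A) \<le> 1" using completely_mult_le[OF g] by blast
  have Vs: "Ch * G \<ge> 0" "16 * c * 2 ^ k / Lx \<ge> 0" "12 * (c + 2 * C0) > 0"
    using Ch G0 c_pos C0_nonneg Lx by auto
  have V: "V > 0" using Vs by (simp add: V_def)
  have y1: "y \<ge> 1" by (simp add: y_def)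
  have yy: "y \<le> y'" using assms(5) by (simp add: y_def)
  note ms = S1_mean_square[OF g Lx a, of G Ch x]
  have si: "set_integrable lborel {1..x} (\<lambda>u. (cmod (S1 g u))\<^sup>2 * u powr (- 3 - 2 * \<alpha>))"
    by (rule ms(1)) (use G Ch in \<open>auto simp: Lx_def \<alpha>_def\<close>)
  have "(LBINT u:{1..x}. (cmod (S1 g u))\<^sup>2 * u powr (- 3 - 2 * \<alpha>)) \<le> G\<^sup>2 * Ch\<^sup>2 / (2 * \<alpha>) + 256 * c\<^sup>2 / (Lx\<^sup>2 * \<alpha> ^ 3) + 128 * (c + 2 * C0)\<^sup>2"
    by (rule ms(2)) (use G Ch in \<open>auto simp: Lx_def \<alpha>_def\<close>)
  also have "\<dots> \<le> V\<^sup>2 / \<alpha>"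
  proof -
    have sq: "p\<^sup>2 + q\<^sup>2 + r\<^sup>2 \<le> (p + q + r)\<^sup>2" if "p \<ge> 0" "q \<ge> 0" "r \<ge> 0" for p q r :: real
      using that by (simp add: power2_eq_square algebra_simps add_nonneg_nonneg)
    have "G\<^sup>2 * Ch\<^sup>2 / (2 * \<alpha>) \<le> (Ch * G)\<^sup>2 / \<alpha>"
      using a by (simp add: power_mult_distrib field_simps)
    moreover have "256 * c\<^sup>2 / (Lx\<^sup>2 * \<alpha> ^ 3) = (16 * c * 2 ^ k / Lx)\<^sup>2 / \<alpha>"
      unfolding ai[symmetric] using a Lx by (simp add: power2_eq_square power3_eq_cube field_simps)
    moreover have "128 * (c + 2 * C0)\<^sup>2 \<le> (12 * (c + 2 * C0))\<^sup>2 / \<alpha>"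
    proof -
      have "128 * (c + 2 * C0)\<^sup>2 * \<alpha> \<le> 144 * (c + 2 * C0)\<^sup>2 * 1" using a by (intro mult_mono) auto
      moreover have "(12 * (c + 2 * C0))\<^sup>2 = 144 * (c + 2 * C0)\<^sup>2" unfolding power_mult_distrib by simp
      ultimately show ?thesis using a by (simp only: pos_le_divide_eq mult_1_right)
    qed
    ultimately have "G\<^sup>2 * Ch\<^sup>2 / (2 * \<alpha>) + 256 * c\<^sup>2 / (Lx\<^sup>2 * \<alpha> ^ 3) + 128 * (c + 2 * C0)\<^sup>2
      \<le> ((Ch * G)\<^sup>2 + (16 * c * 2 ^ k / Lx)\<^sup>2 + (12 * (c + 2 * C0))\<^sup>2) / \<alpha>" by (simp add: add_divide_distrib)
    also have "\<dots> \<le> V\<^sup>2 / \<alpha>" unfolding V_def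
      using sq[of "Ch * G" "16 * c * 2 ^ k / Lx" "12 * (c + 2 * C0)"] Vs a by (intro divide_right_mono) auto
    finally show ?thesis .
  qed
  finally have J: "integral {1..x} (\<lambda>u. (cmod (S1 g u))\<^sup>2 * u powr (- 3 - 2 * \<alpha>)) \<le> V\<^sup>2 / \<alpha>"
    using set_borel_integral_eq_integral(2)[OF si] by simp
  have int1: "(\<lambda>u. (cmod (S1 g u))\<^sup>2 * u powr (- 3 - 2 * \<alpha>)) integrable_on {1..x}"
    by (rule set_borel_integral_eq_integral(1)[OF si])
  have int2: "(\<lambda>u. (cmod (S1 g u))\<^sup>2 * u powr (- 3 - 2 * \<alpha>)) integrable_on {y..y'}"
    by (rule integrable_subinterval_real[OF int1]) (use y1 assms(7) in auto)
  have "integral {y..y'} (\<lambda>u. (cmod (S1 g u))\<^sup>2 * u powr (- 3 - 2 * \<alpha>)) \<le> integral {1..x} (\<lambda>u. (cmod (S1 g u))\<^sup>2 * u powr (- 3 - 2 * \<alpha>))"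
    by (rule integral_subset_le[OF _ int2 int1]) (use y1 assms(7) in auto)
  with J have J2: "integral {y..y'} (\<lambda>u. (cmod (S1 g u))\<^sup>2 * u powr (- 3 - 2 * \<alpha>)) \<le> V\<^sup>2 / \<alpha>" by linarith
  have hi: "((\<lambda>u. 1 / u) has_integral (ln y' - ln y)) {y..y'}"
    using y1 yy by (intro fundamental_theorem_of_calculus)
      (auto intro!: derivative_eq_intros simp flip: has_real_derivative_iff_has_vector_derivative)
  have lnl: "ln y' - ln y \<le> 1 / \<alpha>" "ln y' \<ge> ln y"
  proof -
    have "ln y' \<le> ln (exp (2 ^ Suc k))" using assms(6) y1 yy by (subst ln_le_cancel_iff) auto
    then show "ln y' - ln y \<le> 1 / \<alpha>" by (simp add: y_def ai)
    show "ln y' \<ge> ln y" using y1 yy by simp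
  qed
  define w where "w = \<alpha> / 2 * V * exp 4 + 4 * C1 * \<alpha>"
  have w0: "w \<ge> 0" using a V C1_pos by (simp add: w_def)
  have "integral {y..y'} (\<lambda>u. u powr (-2) * cmod (S g u)) \<le> integral {y..y'} (\<lambda>u. \<alpha> / (2 * V) * ((cmod (S1 g u))\<^sup>2 * u powr (- 3 - 2 * \<alpha>)) + w * (1 / u))"
  proof (rule integral_le)
    have "(\<lambda>u. u powr (-2) * cmod (S g u)) integrable_on {1..x}"
      by (rule abs_S_integrable[OF g1 _ L(2)]) (auto intro!: continuous_intros)
    then show "(\<lambda>u. u powr (-2) * cmod (S g u)) integrable_on {y..y'}"
      by (rule integrable_subinterval_real) (use y1 assms(7) in auto)
    show "(\<lambda>u. \<alpha> / (2 * V) * ((cmod (S1 g u))\<^sup>2 * u powr (- 3 - 2 * \<alpha>)) + w * (1 / u)) integrable_on {y..y'}"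
      by (intro integrable_add integrable_on_mult_right int2 has_integral_integrable[OF hi])
    fix u assume u: "u \<in> {y..y'}"
    have u1: "u \<ge> 1" "u > 0" using u y1 by auto
    have lu: "1 / \<alpha> \<le> ln u" "2 * \<alpha> * ln u \<le> 4"
    proof -
      have "ln y \<le> ln u" using u y1 by auto
      then show "1 / \<alpha> \<le> ln u" by (simp add: y_def ai)
      have "ln u \<le> ln (exp (2 ^ Suc k))" using assms(6) u u1 by (subst ln_le_cancel_iff) auto
      then have "ln u \<le> 2 * 2 ^ k" by simp
      then have "2 * \<alpha> * ln u \<le> 2 * \<alpha> * (2 * 2 ^ k)" using a by (intro mult_left_mono) auto
      also have "\<dots> = 4" by (simp add: \<alpha>_def)
      finally show "2 * \<alpha> * ln u \<le> 4" .
    qed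
    have "cmod (S g u) * (1 / \<alpha>) \<le> cmod (S g u) * ln u" using lu by (intro mult_left_mono) auto
    also have "\<dots> \<le> cmod (S1 g u) + 4 * C1 * u" by (rule norm_S_log_le[OF g1 u1(1)])
    finally have s: "cmod (S g u) \<le> \<alpha> * (cmod (S1 g u) + 4 * C1 * u)" using a by (simp add: field_simps)
    \<comment> \<open>A weighted inequality of arithmetic and geometric means, tuned to the known
      value V^2 / \<alpha>: a pointwise form of the Cauchy-Schwarz inequality.\<close>
    have am: "p \<le> (1 / (2 * V)) * p\<^sup>2 * q + V / 2 * (1 / q)" if "q > 0" for p q :: real
    proof -
      have "0 \<le> (p * q - V)\<^sup>2 / (2 * V * q)" using V that by simp
      also have "\<dots> = (1 / (2 * V)) * p\<^sup>2 * q + V / 2 * (1 / q) - p"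
        using V that by (simp add: power2_eq_square field_simps)
      finally show ?thesis by simp
    qed
    have q: "u powr (2 * \<alpha>) \<le> exp 4" using lu u1 by (simp add: powr_def)
    have "cmod (S1 g u) \<le> (1 / (2 * V)) * (cmod (S1 g u))\<^sup>2 * u powr (- 1 - 2 * \<alpha>) + V / 2 * (1 / u powr (- 1 - 2 * \<alpha>))"
      by (rule am) (use u1 in auto)
    also have "1 / u powr (- 1 - 2 * \<alpha>) = u * u powr (2 * \<alpha>)" using u1 by (simp add: powr_diff powr_minus divide_simps)
    finally have "cmod (S1 g u) \<le> (1 / (2 * V)) * (cmod (S1 g u))\<^sup>2 * u powr (- 1 - 2 * \<alpha>) + V / 2 * (u * u powr (2 * \<alpha>))" .
    moreover have "V / 2 * (u * u powr (2 * \<alpha>)) \<le> V / 2 * (u * exp 4)" using V u1 q by (intro mult_left_mono) auto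
    ultimately have "cmod (S g u) \<le> \<alpha> * ((1 / (2 * V)) * (cmod (S1 g u))\<^sup>2 * u powr (- 1 - 2 * \<alpha>) + V / 2 * (u * exp 4) + 4 * C1 * u)"
      using s a by (meson add_mono_thms_linordered_semiring(3) mult_left_mono less_imp_le order_trans add_left_mono)
    then have "u powr (-2) * cmod (S g u) \<le> u powr (-2) * (\<alpha> * ((1 / (2 * V)) * (cmod (S1 g u))\<^sup>2 * u powr (- 1 - 2 * \<alpha>) + V / 2 * (u * exp 4) + 4 * C1 * u))"
      by (intro mult_left_mono) auto
    also have "\<dots> = \<alpha> / (2 * V) * ((cmod (S1 g u))\<^sup>2 * (u powr (- 1 - 2 * \<alpha>) * u powr (-2))) + w * (u powr 1 * u powr (-2))"
      using u1 by (simp add: w_def algebra_simps)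
    also have "u powr (- 1 - 2 * \<alpha>) * u powr (-2) = u powr (- 3 - 2 * \<alpha>)" by (rule powr_add') simp
    also have "u powr 1 * u powr (-2) = 1 / u" using u1 by (simp add: powr_minus power2_eq_square field_simps)
    finally show "u powr (-2) * cmod (S g u) \<le> \<alpha> / (2 * V) * ((cmod (S1 g u))\<^sup>2 * u powr (- 3 - 2 * \<alpha>)) + w * (1 / u)" .
  qed
  also have "\<dots> = \<alpha> / (2 * V) * integral {y..y'} (\<lambda>u. (cmod (S1 g u))\<^sup>2 * u powr (- 3 - 2 * \<alpha>)) + w * (ln y' - ln y)"
    by (rule integral_unique) (intro has_integral_add has_integral_mult_right integrable_integral int2 hi)
  also have "\<dots> \<le> \<alpha> / (2 * V) * (V\<^sup>2 / \<alpha>) + w * (1 / \<alpha>)"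
    using J2 lnl w0 a V by (intro add_mono mult_left_mono) auto
  also have "\<dots> = V / 2 + V / 2 * exp 4 + 4 * C1" using a V by (simp add: w_def power2_eq_square field_simps)
  also have "\<dots> \<le> exp 4 * V + 4 * C1"
  proof -
    have "V * 1 \<le> V * exp 4" using V by (intro mult_left_mono) auto
    then show ?thesis by (simp add: field_simps)
  qed
  finally show ?thesis by (simp add: y_def V_def Lx_def)
qed

text \<open>The last r terms, with 2^r \<ge> e^M, are bounded by a. The earlier ones form a
  geometric series with sum at most b 2^(m - r) \<le> 2 b L e^(-M). As ln 2 > 1/2, r is at most 2 M
  + 1; this is the origin of the factor 1 + M.\<close>

lemma sum_min_geometric:
  fixes a b L M :: real
  assumes L: "L \<ge> 1" and M: "M \<ge> 0" and a: "a \<ge> 0" and b: "b \<ge> 0" and m: "2 ^ m \<le> 2 * L"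
  shows "(\<Sum>j<m. min a (b * 2 ^ j)) \<le> 2 * b * L * exp (- M) + (2 * M + 1) * a"
proof -
  define r where "r = nat \<lceil>M / ln 2\<rceil>"
  have l2: "ln (2::real) > 1/2" using ln2_ge_two_thirds by simp
  have "M / ln 2 \<le> 2 * M" using l2 M by (simp add: divide_le_eq mult_left_mono[of 1 "2 * ln 2" M, simplified] mult_ac)
  then have r1: "real r \<le> 2 * M + 1" using M l2 unfolding r_def by linarith
  have "M / ln 2 \<le> real r" unfolding r_def by linarith
  then have "M \<le> real r * ln 2" using l2 by (simp add: field_simps)
  then have "exp M \<le> exp (real r * ln 2)" by simp
  also have "\<dots> = 2 ^ r" by (simp add: exp_of_nat_mult)
  finally have r2: "exp M \<le> 2 ^ r" .
  define s where "s = min m r"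
  have "{..<m} = {..<m - s} \<union> {m - s..<m}" by auto
  then have "(\<Sum>j<m. min a (b * 2 ^ j)) = (\<Sum>j\<in>{..<m - s} \<union> {m - s..<m}. min a (b * 2 ^ j))" by simp
  also have "\<dots> = (\<Sum>j<m - s. min a (b * 2 ^ j)) + (\<Sum>j\<in>{m - s..<m}. min a (b * 2 ^ j))"
    by (rule sum.union_disjoint) auto
  also have "\<dots> \<le> (\<Sum>j<m - s. b * 2 ^ j) + (\<Sum>j\<in>{m - s..<m}. a)"
    by (intro add_mono sum_mono) auto
  also have "(\<Sum>j\<in>{m - s..<m}. a) = real s * a" by (simp add: s_def)
  also have "\<dots> \<le> (2 * M + 1) * a" using r1 a by (intro mult_right_mono) (auto simp: s_def)
  also have "(\<Sum>j<m - s. b * 2 ^ j) \<le> 2 * b * L * exp (- M)"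
  proof (cases "m \<le> r")
    case True
    then show ?thesis using b L by (simp add: s_def)
  next
    case False
    have "(\<Sum>j<m - s. b * 2 ^ j) = b * (2 ^ (m - s) - 1)"
      by (simp add: sum_distrib_left[symmetric] mask_eq_sum_exp_nat geometric_sum)
    also have "\<dots> \<le> b * 2 ^ (m - s)" using b by (intro mult_left_mono) auto
    also have "(2::real) ^ (m - s) = 2 ^ m / 2 ^ r" using False by (simp add: s_def power_diff)
    also have "b * (2 ^ m / 2 ^ r) \<le> b * (2 * L / exp M)" using b m r2 L by (intro mult_left_mono frac_le) auto
    finally show ?thesis by (simp add: exp_minus field_simps)
  qed
  finally show ?thesis by simp
qed

text \<open>Block j contributes a multiple of min(a, 2 C1 2^j) with a = KF L e^(-M), a term of order
  2^j / L that sums to O(1) over the blocks, and a bounded error. \<open>S_le_integral\<close>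
  divided by ln^2 x leaves the total over all blocks divided by L.\<close>

theorem halasz_cm:
  obtains C where "C \<ge> 0" "\<And>g x M. completely_mult g \<Longrightarrow> x \<ge> 3 \<Longrightarrow> 0 \<le> M \<Longrightarrow> (\<And>t. \<bar>t\<bar> \<le> ln x \<Longrightarrow> M \<le> pdist g x t) \<Longrightarrow>
    cmod (S g x) \<le> C * x * ((1 + M) * exp (- M) + ln (ln x) / ln x)"
proof -
  obtain Ch where Ch: "Ch > 0" "\<And>x. x \<ge> 1 \<Longrightarrow> (\<Sum>A\<in>le x. mang A) \<le> Ch * x" by (rule chebyshev) blast
  obtain KF where KF: "KF \<ge> 0" "\<And>g x t M. completely_mult g \<Longrightarrow> x \<ge> 3 \<Longrightarrow> M \<le> pdist g x t \<Longrightarrow>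
    cmod (F g (1 + 1 / ln x) t) \<le> KF * ln x * exp (- M)" by (rule F_near_one) blast
  obtain KS where KS: "KS \<ge> 0" "\<And>g x. completely_mult g \<Longrightarrow> x \<ge> 1 \<Longrightarrow>
    cmod (S g x) * (ln x)\<^sup>2 \<le> 2 * x * (1 + ln x) * integral {1..x} (\<lambda>u. u powr (-2) * cmod (S g u)) + KS * x * (1 + ln x)"
    by (rule S_le_integral) blast
  \<comment> \<open>For ln x < 4 the trivial bound is enough, since then ln (ln x) / ln x is at
    least \<delta>, which is positive because ln 3 > 1.\<close>
  define \<delta> where "\<delta> = ln (ln 3) / (4::real)"
  have d: "\<delta> > 0" using ln3_gt_1 by (simp add: \<delta>_def)
  define K1 where "K1 = exp 4 * (Ch * (8 * C1) + 12 * (c + 2 * C0)) + 4 * C1"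
  define K2 where "K2 = exp 4 * Ch * (4 * C1 + 2 * KF)"
  define K3 where "K3 = K2 + (C1 + exp 4 * (32 * c) + 3 * K1)"
  define K where "K = 4 * K3 + 2 * KS + C1 / \<delta>"
  have K0: "K1 \<ge> 0" "K2 \<ge> 0" "K3 \<ge> 0" using Ch C1_pos c_pos C0_nonneg KF by (auto simp: K1_def K2_def K3_def)
  have main: "cmod (S g x) \<le> K * x * ((1 + M) * exp (- M) + ln (ln x) / ln x)"
    if g: "completely_mult g" and x: "x \<ge> 3" and M: "0 \<le> M" "\<And>t. \<bar>t\<bar> \<le> ln x \<Longrightarrow> M \<le> pdist g x t" for g x M
  proof (cases "ln x \<ge> 4")
    case False
    have l1: "ln x > 1" by (rule L_ge_1[OF x])
    have g1: "\<forall>A\<in>Ms. cmod (g A) \<le> 1" using completely_mult_le[OF g] by blast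
    have "ln 3 \<le> ln x" using x by simp
    then have "ln (ln 3) \<le> ln (ln x)" using ln3_gt_1 by (subst ln_le_cancel_iff) auto
    then have "\<delta> \<le> ln (ln x) / ln x" unfolding \<delta>_def using False l1 ln3_gt_1 by (intro frac_le) auto
    then have "\<delta> * (C1 / \<delta> * x) \<le> ln (ln x) / ln x * (K * x)"
      using K0 KS d C1_pos x l1 by (intro mult_mono) (auto simp: K_def)
    then have "C1 * x \<le> K * x * (ln (ln x) / ln x)" using d by (simp add: mult_ac)
    also have "\<dots> \<le> K * x * ((1 + M) * exp (- M) + ln (ln x) / ln x)"
      using K0 KS d C1_pos x M by (intro mult_left_mono) (auto simp: K_def)
    finally show ?thesis using norm_S_le[OF g1, of x] x by linarith
  next
    case L4: True
    define L where "L = ln x"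
    have L: "L \<ge> 4" using L4 by (simp add: L_def)
    have lL: "ln L \<ge> 1"
    proof -
      have "exp 1 \<le> L" using exp_le L by linarith
      then show ?thesis using L by (simp add: ln_ge_iff)
    qed
    have g1: "\<forall>A\<in>Ms. cmod (g A) \<le> 1" using completely_mult_le[OF g] by blast
    define a where "a = KF * L * exp (- M)"
    have a0: "a \<ge> 0" using KF L by (simp add: a_def)
    define I where "I = (\<lambda>y. integral {1..y} (\<lambda>u. u powr (-2) * cmod (S g u)))"
    have int: "(\<lambda>u. u powr (-2) * cmod (S g u)) integrable_on {1..y}" if "y \<ge> 1" for y
      by (rule abs_S_integrable[OF g1 _ that]) (auto intro!: continuous_intros)
    define T where "T = (\<lambda>j::nat. exp 4 * (Ch * (min a (2 * C1 * 2 ^ j) + 8 * C1) + 16 * c * 2 ^ j / L + 12 * (c + 2 * C0)) + 4 * C1)"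
    have FG: "cmod (F g (1 + 1 / 2 ^ j) t) \<le> min a (2 * C1 * 2 ^ j) + 8 * C1" if j: "2 ^ j \<le> L" and t: "\<bar>t\<bar> \<le> L / 2" for j :: nat and t
    proof -
      have "cmod (F g (1 + 1 / 2 ^ j) t) \<le> a + 8 * C1"
      proof (rule F_shift[OF g _ _ _ _ a0 t])
        show "1 / L \<le> 1 / 2 ^ j" using j L by (intro divide_left_mono) auto
        fix u assume "\<bar>u\<bar> \<le> L"
        then show "cmod (F g (1 + 1 / L) u) \<le> a" using KF(2)[OF g x M(2)[of u]] by (simp add: L_def a_def)
      qed (use L in auto)
      moreover have "cmod (F g (1 + 1 / 2 ^ j) t) \<le> 2 * C1 * 2 ^ j"
      proof -
        have "cmod (F g (1 + 1 / 2 ^ j) t) \<le> Z (1 + 1 / 2 ^ j)" by (rule norm_F_le[OF g]) simp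
        also have "\<dots> \<le> C1 * (1 + 1 / 2 ^ j) / (1 + 1 / 2 ^ j - 1)" by (rule Z_le) simp
        also have "\<dots> = C1 * (2 ^ j + 1)" by (simp add: field_simps)
        also have "\<dots> \<le> C1 * (2 * 2 ^ j)" using C1_pos by (intro mult_left_mono) auto
        finally show ?thesis by simp
      qed
      ultimately show ?thesis using C1_pos by auto
    qed
    \<comment> \<open>The minimum with x cuts off the last block. Once 2^j > L the block lies beyond
      x and contributes 0.\<close>
    have step: "I (min x (exp (2 ^ k))) \<le> C1 + (\<Sum>j<k. if 2 ^ j \<le> L then T j else 0)" for k :: nat
    proof (induction k)
      case 0
      \<comment> \<open>The dyadic blocks begin at u = e; below that, the trivial bound |S u| \<le>
        C1 u is integrated against u^(-2).\<close>
      have ex: "exp 1 \<le> x" using exp_le x by linarith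
      have h: "((\<lambda>u. C1 * (1 / u)) has_integral (C1 * ln (exp 1))) {1..exp 1::real}"
        by (intro has_integral_mult_right integral_inverse) simp
      have "I (exp 1) \<le> C1 * ln (exp 1)" unfolding I_def
      proof (rule has_integral_le[OF integrable_integral[OF int] h])
        fix u :: real assume u: "u \<in> {1..exp 1}"
        have "u powr (-2) * cmod (S g u) \<le> u powr (-2) * (C1 * u)" using norm_S_le[OF g1, of u] u by (intro mult_left_mono) auto
        also have "\<dots> = C1 * (1 / u)" using u by (simp add: powr_minus power2_eq_square field_simps)
        finally show "u powr (-2) * cmod (S g u) \<le> C1 * (1 / u)" .
      qed simp
      then show ?case using ex by (simp add: min_absorb2)
    next
      case (Suc k)
      show ?case
      proof (cases "2 ^ k \<le> L")
        case False
        then have "exp (ln x) \<le> exp (2 ^ k)" unfolding L_def exp_le_cancel_iff by linarith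
        then have "x \<le> exp (2 ^ k)" using x by simp
        moreover have "exp (2 ^ k) \<le> exp ((2::real) ^ Suc k)" by simp
        ultimately have "min x (exp (2 ^ Suc k)) = min x (exp (2 ^ k))" by linarith
        then show ?thesis using Suc False by simp
      next
        case True
        define y y' where "y = exp ((2::real) ^ k)" and "y' = min x (exp ((2::real) ^ Suc k))"
        have yx: "y \<le> x" using True x by (metis L_def exp_le_cancel_iff exp_ln less_le_trans y_def zero_less_numeral)
        have "y \<le> exp ((2::real) ^ Suc k)" by (simp add: y_def)
        then have yy: "y \<le> y'" using yx by (simp add: y'_def)
        have y1: "y \<ge> 1" by (simp add: y_def)
        have "I y' = I y + integral {y..y'} (\<lambda>u. u powr (-2) * cmod (S g u))"
          unfolding I_def using y1 yy int[of y'] Henstock_Kurzweil_Integration.integral_combine[of 1 y y' "\<lambda>u. u powr (-2) * cmod (S g u)"] by simp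
        moreover have "integral {y..y'} (\<lambda>u. u powr (-2) * cmod (S g u)) \<le> T k"
          unfolding T_def y_def L_def
          by (rule S_block[OF g L4]) (use x True yy FG[OF True] Ch a0 C1_pos in \<open>auto simp: y_def y'_def L_def\<close>)
        moreover have "I (min x (exp (2 ^ k))) = I y" using yx by (simp add: y_def)
        moreover have "(\<Sum>j<Suc k. if 2 ^ j \<le> L then T j else 0) = (\<Sum>j<k. if 2 ^ j \<le> L then T j else 0) + T k"
          using True by simp
        ultimately show ?thesis using Suc unfolding y'_def[symmetric] by linarith
      qed
    qed
    \<comment> \<open>The number of blocks: L \<le> 2^m \<le> 2 L, hence x \<le> exp (2^m), and m
      \<le> 3 ln L.\<close>
    define m where "m = Suc (nat \<lfloor>log 2 L\<rfloor>)"
    have lg: "log 2 L \<ge> 0" using L by (simp add: zero_le_log_cancel_iff)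
    have "2 ^ nat \<lfloor>log 2 L\<rfloor> \<le> L"
    proof -
      define n where "n = nat \<lfloor>log 2 L\<rfloor>"
      have "real n \<le> log 2 L" using lg unfolding n_def by linarith
      then have "2 powr real n \<le> 2 powr log 2 L" by (intro powr_mono) auto
      then show ?thesis unfolding n_def[symmetric] using L by (simp add: powr_realpow)
    qed
    then have m2: "2 ^ m \<le> 2 * L" by (simp add: m_def)
    have m1: "L \<le> 2 ^ m"
    proof -
      have "log 2 L \<le> real m" using lg unfolding m_def by linarith
      then have "2 powr log 2 L \<le> 2 powr real m" by (intro powr_mono) auto
      then show ?thesis using L by (simp add: powr_realpow)
    qed
    have mL: "real m \<le> 3 * ln L"
    proof -
      have "ln (2::real) > 1/2" using ln2_ge_two_thirds by simp
      then have "log 2 L \<le> ln L / (1/2)" unfolding log_def using lL by (intro divide_left_mono) auto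
      also have "\<dots> = 2 * ln L" by simp
      finally have "log 2 L \<le> 2 * ln L" .
      moreover have "real m \<le> log 2 L + 1" using lg unfolding m_def by linarith
      ultimately show ?thesis using lL by linarith
    qed
    have "x \<le> exp (2 ^ m)"
      using m1 x by (metis L_def exp_le_cancel_iff exp_ln less_le_trans zero_less_numeral)
    then have "I x \<le> C1 + (\<Sum>j<m. if 2 ^ j \<le> L then T j else 0)" using step[of m] by (simp add: min_absorb1)
    also have "(\<Sum>j<m. if 2 ^ j \<le> L then T j else 0) \<le> (\<Sum>j<m. T j)"
    proof (intro sum_mono)
      fix j
      have "T j \<ge> 0" unfolding T_def using Ch a0 C1_pos c_pos C0_nonneg L by (intro add_nonneg_nonneg mult_nonneg_nonneg divide_nonneg_nonneg) auto
      then show "(if 2 ^ j \<le> L then T j else 0) \<le> T j" by simp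
    qed
    also have "(\<Sum>j<m. T j) = (\<Sum>j<m. exp 4 * Ch * min a (2 * C1 * 2 ^ j) + exp 4 * (16 * c / L) * 2 ^ j + K1)"
      by (intro sum.cong refl) (simp add: T_def K1_def algebra_simps)
    also have "\<dots> = exp 4 * Ch * (\<Sum>j<m. min a (2 * C1 * 2 ^ j)) + exp 4 * (16 * c / L) * (\<Sum>j<m. 2 ^ j) + real m * K1"
      by (simp add: sum.distrib sum_distrib_left)
    also have "\<dots> \<le> exp 4 * Ch * ((4 * C1 + 2 * KF) * (L * exp (- M) * (1 + M))) + exp 4 * (16 * c / L) * (2 * L) + (3 * ln L) * K1"
    proof (intro add_mono mult_left_mono mult_right_mono)
      have "(\<Sum>j<m. min a (2 * C1 * 2 ^ j)) \<le> 2 * (2 * C1) * L * exp (- M) + (2 * M + 1) * a"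
        by (rule sum_min_geometric) (use L M a0 C1_pos m2 in auto)
      also have "\<dots> = (L * exp (- M)) * (4 * C1 + (2 * M + 1) * KF)" by (simp add: a_def algebra_simps)
      also have "\<dots> \<le> (L * exp (- M)) * ((4 * C1 + 2 * KF) * (1 + M))"
        using L M C1_pos KF(1) by (intro mult_left_mono) (auto simp: algebra_simps)
      finally show "(\<Sum>j<m. min a (2 * C1 * 2 ^ j)) \<le> (4 * C1 + 2 * KF) * (L * exp (- M) * (1 + M))" by (simp add: mult_ac)
      have "(\<Sum>j<m. (2::real) ^ j) = 2 ^ m - 1" by (simp add: geometric_sum)
      then show "(\<Sum>j<m. (2::real) ^ j) \<le> 2 * L" using m2 by linarith
    qed (use mL K0 Ch c_pos L in auto)
    also have "\<dots> = K2 * (L * exp (- M) * (1 + M)) + exp 4 * (32 * c) + 3 * K1 * ln L"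
      using L by (simp add: K2_def)
    finally have "I x \<le> K2 * (L * exp (- M) * (1 + M)) + (C1 + exp 4 * (32 * c)) + 3 * K1 * ln L" by simp
    moreover have "(C1 + exp 4 * (32 * c)) * 1 \<le> (C1 + exp 4 * (32 * c)) * ln L" using lL C1_pos c_pos by (intro mult_left_mono) auto
    moreover have "K2 * (L * exp (- M) * (1 + M)) \<le> K3 * (L * exp (- M) * (1 + M))"
      using K0 C1_pos c_pos L M by (intro mult_right_mono) (auto simp: K3_def)
    moreover have "(C1 + exp 4 * (32 * c) + 3 * K1) * ln L \<le> K3 * ln L"
      using K0 lL by (intro mult_right_mono) (auto simp: K3_def)
    ultimately have Ix: "I x \<le> K3 * (L * exp (- M) * (1 + M)) + K3 * ln L" by (simp add: distrib_right)
    have "cmod (S g x) * L\<^sup>2 \<le> 2 * x * (1 + L) * I x + KS * x * (1 + L)"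
      using KS(2)[OF g, of x] x by (simp add: L_def I_def)
    also have "\<dots> \<le> 2 * x * (2 * L) * (K3 * (L * exp (- M) * (1 + M)) + K3 * ln L) + KS * x * (2 * L) * ln L"
    proof (rule add_mono)
      have "I x \<ge> 0" unfolding I_def by (rule integral_nonneg[OF int]) (use x in auto)
      then show "2 * x * (1 + L) * I x \<le> 2 * x * (2 * L) * (K3 * (L * exp (- M) * (1 + M)) + K3 * ln L)"
        using Ix x L by (intro mult_mono) auto
      have "KS * x * (1 + L) * 1 \<le> KS * x * (2 * L) * ln L" using KS(1) x L lL by (intro mult_mono) auto
      then show "KS * x * (1 + L) \<le> KS * x * (2 * L) * ln L" by simp
    qed
    also have "\<dots> = L\<^sup>2 * (4 * K3 * x * ((1 + M) * exp (- M)) + (4 * K3 + 2 * KS) * x * (ln L / L))"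
      using L by (simp add: power2_eq_square field_simps)
    finally have "L\<^sup>2 * cmod (S g x) \<le> L\<^sup>2 * (4 * K3 * x * ((1 + M) * exp (- M)) + (4 * K3 + 2 * KS) * x * (ln L / L))" by (simp add: mult.commute)
    then have "cmod (S g x) \<le> 4 * K3 * x * ((1 + M) * exp (- M)) + (4 * K3 + 2 * KS) * x * (ln L / L)"
      using L by (subst (asm) mult_le_cancel_left_pos) auto
    also have "\<dots> \<le> K * x * ((1 + M) * exp (- M)) + K * x * (ln L / L)"
      using K0 KS(1) C1_pos d x M L lL by (intro add_mono mult_right_mono) (auto simp: K_def)
    finally show ?thesis by (simp add: L_def distrib_left)
  qed
  have "K \<ge> 0" using K0 KS(1) C1_pos d by (simp add: K_def)
  then show thesis using that main by blast
qed

end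

section \<open>From completely multiplicative to multiplicative functions\<close>

context prime_system
begin

definition unit_mult :: "('p multiset \<Rightarrow> complex) \<Rightarrow> bool" where
  "unit_mult f \<longleftrightarrow> f {#} = 1 \<and> (\<forall>A\<in>Ms. \<forall>B\<in>Ms. set_mset A \<inter> set_mset B = {} \<longrightarrow> f (A + B) = f A * f B) \<and> (\<forall>A\<in>Ms. cmod (f A) \<le> 1)"

definition cmpart :: "('p multiset \<Rightarrow> complex) \<Rightarrow> 'p multiset \<Rightarrow> complex" where
  "cmpart f A = (\<Prod>p\<in>#A. f {#p#})"

text \<open>The convolution of f with the Dirichlet inverse of \<open>cmpart f\<close>; the inverse
  of a completely multiplicative function is its product with \<open>mu\<close>.\<close>

definition sqfull_part :: "('p multiset \<Rightarrow> complex) \<Rightarrow> 'p multiset \<Rightarrow> complex" where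
  "sqfull_part f A = (\<Sum>B | B \<subseteq># A. of_real (mu B) * cmpart f B * f (A - B))"

definition divisor_count :: "'p multiset \<Rightarrow> real" where "divisor_count A = real (card {B. B \<subseteq># A})"

lemma completely_mult_cmpart:
  assumes f: "unit_mult f"
  shows "completely_mult (cmpart f)"
proof -
  have "cmod (cmpart f A) \<le> 1" if "A \<in> Ms" for A
    using that
  proof (induction A)
    case (add p A)
    then have "{#p#} \<in> Ms" "cmod (cmpart f A) \<le> 1" by auto
    moreover from this(1) have "cmod (f {#p#}) \<le> 1" using f unfolding unit_mult_def by blast
    ultimately have "cmod (f {#p#}) * cmod (cmpart f A) \<le> 1 * 1" by (intro mult_mono) auto
    then show ?case by (simp add: cmpart_def norm_mult)
  qed (simp add: cmpart_def)
  then show ?thesis by (simp add: completely_mult_def cmpart_def)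
qed

text \<open>By associativity \<open>cmpart f\<close> meets its inverse first: for each B their
  convolution is \<open>cmpart f B\<close> times the divisor sum of \<open>mu\<close>, which leaves
  only B = \<open>{#}\<close>.\<close>

lemma conv_sqfull_part:
  assumes A: "A \<in> Ms"
  shows "(\<Sum>B | B \<subseteq># A. sqfull_part f B * cmpart f (A - B)) = f A"
proof -
  let ?g = "cmpart f"
  define G where "G = (\<lambda>D E. ?g D * (of_real (mu E) * ?g E * f (A - D - E)))"
  have "(\<Sum>B | B \<subseteq># A. sqfull_part f B * ?g (A - B)) = (\<Sum>D | D \<subseteq># A. ?g D * sqfull_part f (A - D))"
  proof -
    have "(\<Sum>B | B \<subseteq># A. sqfull_part f B * ?g (A - B)) = (\<Sum>B | B \<subseteq># A. (\<lambda>D. ?g D * sqfull_part f (A - D)) (A - B))"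
      by (intro sum.cong refl) (simp add: diff_diff_subs mult.commute)
    then show ?thesis using sum_diff_subs[of "\<lambda>D. ?g D * sqfull_part f (A - D)" A] by simp
  qed
  also have "\<dots> = (\<Sum>D | D \<subseteq># A. \<Sum>E | E \<subseteq># A - D. G D E)"
    by (simp add: sqfull_part_def G_def sum_distrib_left)
  also have "\<dots> = (\<Sum>B | B \<subseteq># A. \<Sum>D | D \<subseteq># B. G D (B - D))" by (rule sum_nested[symmetric])
  also have "\<dots> = (\<Sum>B | B \<subseteq># A. if B = {#} then f A else 0)"
  proof (intro sum.cong refl)
    fix B assume "B \<in> {B. B \<subseteq># A}"
    have "G D (B - D) = of_real (mu (B - D)) * (?g B * f (A - B))" if D: "D \<subseteq># B" for D
    proof -
      have "?g D * ?g (B - D) = ?g (D + (B - D))" by (simp add: cmpart_def)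
      also have "D + (B - D) = B" using D by simp
      finally have e1: "?g B = ?g D * ?g (B - D)" by simp
      have e2: "A - D - (B - D) = A - B" using D by (metis diff_diff_add_mset subset_mset.add_diff_inverse)
      show ?thesis unfolding G_def e2 e1 by (simp add: mult_ac)
    qed
    then have "(\<Sum>D | D \<subseteq># B. G D (B - D)) = (\<Sum>D | D \<subseteq># B. of_real (mu (B - D))) * (?g B * f (A - B))"
      by (simp add: sum_distrib_right)
    also have "(\<Sum>D | D \<subseteq># B. complex_of_real (mu (B - D))) = of_real (\<Sum>D | D \<subseteq># B. mu (B - D))" by simp
    also have "(\<Sum>D | D \<subseteq># B. mu (B - D)) = (if B = {#} then 1 else 0)"
      unfolding sum_diff_subs by (rule sum_mu)
    finally show "(\<Sum>D | D \<subseteq># B. G D (B - D)) = (if B = {#} then f A else 0)"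
      by (simp add: cmpart_def)
  qed
  also have "\<dots> = f A" by (simp add: sum.delta)
  finally show ?thesis .
qed

lemma S_conv: "S f x = (\<Sum>B\<in>le x. sqfull_part f B * S (cmpart f) (x / N B))"
proof -
  have "S f x = (\<Sum>A\<in>le x. \<Sum>B | B \<subseteq># A. sqfull_part f B * cmpart f (A - B))"
    unfolding S_def by (intro sum.cong refl) (simp add: conv_sqfull_part le_def)
  also have "\<dots> = (\<Sum>B\<in>le x. \<Sum>D\<in>le (x / N B). sqfull_part f B * cmpart f D)" by (rule sum_conv)
  finally show ?thesis by (simp add: S_def sum_distrib_left)
qed

text \<open>If p divides A exactly once, divisors B without p are paired with B + p. As p is prime
  to the rest of A - B, f splits off the value f(p) in the first term; in the second,
  \<open>cmpart f\<close> supplies the same value and \<open>mu\<close> the opposite sign.\<close>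

lemma sqfull_part_zero:
  assumes f: "unit_mult f" and A: "A \<in> Ms" and p: "count A p = 1"
  shows "sqfull_part f A = 0"
proof -
  define s where "s = (\<lambda>B. of_real (mu B) * cmpart f B * f (A - B))"
  have pA: "p \<in># A" using p by (simp flip: count_greater_zero_iff)
  let ?X = "{B. B \<subseteq># A \<and> p \<notin># B}"
  have fX: "finite ?X" by (rule finite_subset[OF _ finite_subs[of A]]) auto
  have inj: "inj_on (add_mset p) ?X" by (auto simp: inj_on_def)
  have cp: "count B p \<le> 1" if "B \<subseteq># A" for B using that p by (metis mset_subset_eq_count)
  have split: "{B. B \<subseteq># A} = ?X \<union> add_mset p ` ?X"
  proof (intro equalityI subsetI)
    fix B assume "B \<in> {B. B \<subseteq># A}"
    then have B: "B \<subseteq># A" by simp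
    show "B \<in> ?X \<union> add_mset p ` ?X"
    proof (cases "p \<in># B")
      case True
      then obtain B' where B': "B = add_mset p B'" by (metis insert_DiffM)
      have 2: "p \<notin># B'" using cp[OF B] by (simp add: B' count_eq_zero_iff)
      have 3: "B' \<subseteq># A" using B unfolding B' by (rule subset_mset.order_trans[rotated]) simp
      show ?thesis unfolding B' using 2 3 by blast
    qed (use B in blast)
  next
    fix B assume "B \<in> ?X \<union> add_mset p ` ?X"
    then show "B \<in> {B. B \<subseteq># A}"
    proof
      assume "B \<in> add_mset p ` ?X"
      then obtain B' where B': "B = add_mset p B'" "B' \<subseteq># A" "p \<notin># B'" by blast
      have "count B q \<le> count A q" for q
        using B'(2)[unfolded subseteq_mset_def, rule_format, of q] p B'(3) by (auto simp: B'(1) not_in_iff)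
      then show ?thesis by (simp add: subseteq_mset_def)
    qed blast
  qed
  have "sqfull_part f A = sum s ?X + sum s (add_mset p ` ?X)"
    unfolding sqfull_part_def s_def[symmetric] split by (rule sum.union_disjoint) (use fX in auto)
  also have "sum s (add_mset p ` ?X) = (\<Sum>B\<in>?X. - s B)"
  proof (subst sum.reindex[OF inj], rule sum.cong[OF refl])
    fix B assume "B \<in> ?X"
    then have B: "B \<subseteq># A" "p \<notin># B" by auto
    have "(\<forall>q. count (add_mset p B) q \<le> 1) \<longleftrightarrow> (\<forall>q. count B q \<le> 1)"
    proof (intro iff_allI)
      fix q show "(count (add_mset p B) q \<le> 1) = (count B q \<le> 1)"
        using B(2) by (cases "q = p") (simp_all add: not_in_iff)
    qed
    then have m: "mu (add_mset p B) = - mu B" by (simp add: mu_def)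
    have AB: "A - B = add_mset p (A - add_mset p B)"
    proof (rule multiset_eqI)
      fix q show "count (A - B) q = count (add_mset p (A - add_mset p B)) q"
        using B(2) p by (auto simp: not_in_iff)
    qed
    have "p \<notin># A - add_mset p B" using p B(2) by (simp add: not_in_iff)
    then have "set_mset {#p#} \<inter> set_mset (A - add_mset p B) = {}" by auto
    moreover have "{#p#} \<in> Ms" "A - add_mset p B \<in> Ms" using A pA Ms_diff[OF A] by (auto simp: Ms_def)
    ultimately have "f ({#p#} + (A - add_mset p B)) = f {#p#} * f (A - add_mset p B)"
      using f unfolding unit_mult_def by blast
    then have "f (A - B) = f {#p#} * f (A - add_mset p B)" unfolding AB by simp
    then show "(s \<circ> add_mset p) B = - s B" by (simp add: s_def m cmpart_def mult_ac)
  qed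
  finally show ?thesis by (simp add: sum_negf)
qed

text \<open>A multiset needs finite support, which the halved multiplicities inherit from A.\<close>

lemma count_half:
  shows "\<exists>B. \<forall>p. count B p = count A p div 2"
proof -
  have "{x. 0 < count A x div 2} \<subseteq> set_mset A" by (auto simp flip: count_greater_zero_iff)
  then have "finite {x. 0 < count A x div 2}" by (rule finite_subset) simp
  then have "count (Abs_multiset (\<lambda>p. count A p div 2)) p = count A p div 2" for p
    by (simp add: count_Abs_multiset)
  then show ?thesis by blast
qed

text \<open>A square-full \<open>A\<close> is of the form \<open>3C + 2E\<close>: halve the multiplicities, and let \<open>C\<close> be the parities.\<close>

lemma sqfull_decomp:
  assumes sf: "\<And>p. count A p \<noteq> 1"
  obtains C E where "A = C + C + C + E + E" "\<And>D. D \<subseteq># A \<Longrightarrow> (\<forall>p. count D p \<le> 1) \<Longrightarrow> D \<subseteq># C + E"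
proof -
  obtain B where "\<forall>p. count B p = count A p div 2" using count_half[of A] by blast
  then have B: "count B p = count A p div 2" for p by simp
  define C where "C = A - (B + B)"
  have cC: "count C p = count A p mod 2" for p unfolding C_def by (simp add: B) presburger
  have CB: "C \<subseteq># B"
  proof -
    \<comment> \<open>An odd multiplicity different from 1 is at least 3, so its half is at least
      1.\<close>
    have "count C p \<le> count B p" for p using sf[of p] unfolding cC B by presburger
    then show ?thesis by (simp add: subseteq_mset_def)
  qed
  have A: "A = C + C + C + (B - C) + (B - C)"
  proof (rule multiset_eqI)
    fix p
    have "count C p \<le> count B p" using CB by (simp add: subseteq_mset_def)
    then show "count A p = count (C + C + C + (B - C) + (B - C)) p" by (simp add: cC B) presburger
  qed
  have D: "D \<subseteq># C + (B - C)" if D: "D \<subseteq># A" "\<forall>p. count D p \<le> 1" for D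
  proof -
    have "count D p \<le> count B p" for p
    proof (cases "count D p = 0")
      case False
      then have "count A p \<ge> 1" using D(1) by (metis One_nat_def Suc_leI gr0I mset_subset_eq_count order_trans)
      then have "count A p div 2 \<ge> 1" using sf[of p] by presburger
      then show ?thesis using D(2)[rule_format, of p] by (simp add: B)
    qed simp
    then show ?thesis using CB by (simp add: subseteq_mset_def)
  qed
  show thesis by (rule that[OF A D])
qed

text \<open>Every divisor D of A + B is the sum of D \<inter> A, which divides A, and D - A, which
  divides B.\<close>

lemma divisor_count_plus_le: "divisor_count (A + B) \<le> divisor_count A * divisor_count B"
proof -
  have "{D. D \<subseteq># A + B} \<subseteq> (\<lambda>(C, E). C + E) ` ({C. C \<subseteq># A} \<times> {E. E \<subseteq># B})"
  proof
    fix D assume "D \<in> {D. D \<subseteq># A + B}"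
    then have D: "D \<subseteq># A + B" by simp
    have "D = (D \<inter># A) + (D - A)" by (rule multiset_eqI) simp
    moreover have "D \<inter># A \<subseteq># A" by simp
    moreover have "D - A \<subseteq># B" using D by (simp add: subset_eq_diff_conv add.commute)
    ultimately show "D \<in> (\<lambda>(C, E). C + E) ` ({C. C \<subseteq># A} \<times> {E. E \<subseteq># B})" by force
  qed
  then have "card {D. D \<subseteq># A + B} \<le> card ((\<lambda>(C, E). C + E) ` ({C. C \<subseteq># A} \<times> {E. E \<subseteq># B}))"
    by (intro card_mono) auto
  also have "\<dots> \<le> card ({C. C \<subseteq># A} \<times> {E. E \<subseteq># B})" by (intro card_image_le) auto
  finally have "card {D. D \<subseteq># A + B} \<le> card {C. C \<subseteq># A} * card {E. E \<subseteq># B}" by (simp add: card_cartesian_product)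
  then show ?thesis unfolding divisor_count_def by (metis of_nat_le_iff of_nat_mult)
qed

text \<open>The divisor function is the convolution of 1 with itself, so its Dirichlet series is the
  square of zeta.\<close>

lemma sum_divisor_count_le:
  assumes s: "s > 1"
  shows "(\<Sum>A\<in>le X. divisor_count A * N A powr (- s)) \<le> (C1 * s / (s - 1))\<^sup>2"
proof -
  have "(\<Sum>A\<in>le X. divisor_count A * N A powr (- s)) = (\<Sum>A\<in>le X. \<Sum>B | B \<subseteq># A. N B powr (- s) * N (A - B) powr (- s))"
  proof (intro sum.cong refl)
    fix A assume A: "A \<in> le X"
    have "N B powr (- s) * N (A - B) powr (- s) = N A powr (- s)" if B: "B \<subseteq># A" for B
    proof -
      have "N B > 0" "N (A - B) > 0" using A Ms_subset[OF _ B] Ms_diff N_pos by (auto simp: le_def)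
      then have "N B powr (- s) * N (A - B) powr (- s) = (N (B + (A - B))) powr (- s)" by (simp add: powr_mult)
      then show ?thesis using B by simp
    qed
    then show "divisor_count A * N A powr (- s) = (\<Sum>B | B \<subseteq># A. N B powr (- s) * N (A - B) powr (- s))" by (simp add: divisor_count_def)
  qed
  also have "\<dots> = (\<Sum>B\<in>le X. \<Sum>D\<in>le (X / N B). N B powr (- s) * N D powr (- s))" by (rule sum_conv)
  also have "\<dots> \<le> (\<Sum>B\<in>le X. N B powr (- s) * (C1 * s / (s - 1)))"
    unfolding sum_distrib_left[symmetric] by (intro sum_mono mult_left_mono partial_powr_sum s) auto
  also have "\<dots> = (\<Sum>B\<in>le X. N B powr (- s)) * (C1 * s / (s - 1))" by (rule sum_distrib_right[symmetric])
  also have "\<dots> \<le> (C1 * s / (s - 1)) * (C1 * s / (s - 1))"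
    using s C1_pos by (intro mult_right_mono partial_powr_sum) auto
  finally show ?thesis by (simp add: power2_eq_square)
qed

text \<open>For A = 3C + 2E the exponent 3/4 on N A becomes 9/4 on N C and 3/2 on N E, both above 1;
  each factor is a bound for the square of zeta.\<close>

definition "Hb = (C1 * (9/4) / (9/4 - 1))\<^sup>2 * (C1 * (3/2) / (3/2 - 1))\<^sup>2"

text \<open>The value at A is at most the number of squarefree divisors of A. These all divide C +
  E, and submultiplicativity of the divisor count separates C from E. The map from A to (C, E) is
  injective, as A is recovered from the pair, so the sum may be extended to all pairs.\<close>

lemma sum_sqfull_part_le:
  assumes f: "unit_mult f"
  shows "(\<Sum>A\<in>le X. cmod (sqfull_part f A) * N A powr (- (3/4))) \<le> Hb"
proof -
  define F where "F = {A \<in> le X. \<forall>p. count A p \<noteq> 1}"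
  have finF: "finite F" unfolding F_def by (rule finite_subset[OF _ finite_le[of X]]) auto
  have "\<forall>A\<in>F. \<exists>CE. A = fst CE + fst CE + fst CE + snd CE + snd CE \<and> (\<forall>D. D \<subseteq># A \<longrightarrow> (\<forall>p. count D p \<le> 1) \<longrightarrow> D \<subseteq># fst CE + snd CE)"
  proof
    fix A assume "A \<in> F"
    then have "\<And>p. count A p \<noteq> 1" by (auto simp: F_def)
    from sqfull_decomp[OF this] obtain C E where "A = C + C + C + E + E" "\<And>D. D \<subseteq># A \<Longrightarrow> (\<forall>p. count D p \<le> 1) \<Longrightarrow> D \<subseteq># C + E" by metis
    then show "\<exists>CE. A = fst CE + fst CE + fst CE + snd CE + snd CE \<and> (\<forall>D. D \<subseteq># A \<longrightarrow> (\<forall>p. count D p \<le> 1) \<longrightarrow> D \<subseteq># fst CE + snd CE)"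
      by (intro exI[of _ "(C, E)"]) auto
  qed
  then obtain \<phi> where ph: "\<forall>A\<in>F. A = fst (\<phi> A) + fst (\<phi> A) + fst (\<phi> A) + snd (\<phi> A) + snd (\<phi> A) \<and>
      (\<forall>D. D \<subseteq># A \<longrightarrow> (\<forall>p. count D p \<le> 1) \<longrightarrow> D \<subseteq># fst (\<phi> A) + snd (\<phi> A))" by (rule bchoice[THEN exE])
  define T where "T = (\<lambda>(C, E). (divisor_count C * N C powr (- (9/4))) * (divisor_count E * N E powr (- (3/2))))"
  have inj: "inj_on \<phi> F"
  proof (rule inj_onI)
    fix A A' assume "A \<in> F" "A' \<in> F" "\<phi> A = \<phi> A'"
    then show "A = A'" using ph by metis
  qed
  have tm: "cmod (sqfull_part f A) * N A powr (- (3/4)) \<le> T (\<phi> A) \<and> \<phi> A \<in> le X \<times> le X" if AF: "A \<in> F" for A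
  proof -
    obtain C E where CE: "\<phi> A = (C, E)" by (cases "\<phi> A")
    have A: "A = C + C + C + E + E" and sub: "\<And>D. D \<subseteq># A \<Longrightarrow> (\<forall>p. count D p \<le> 1) \<Longrightarrow> D \<subseteq># C + E"
      using ph AF CE by auto
    have AM: "A \<in> Ms" "N A \<le> X" using AF by (auto simp: F_def le_def)
    have CEM: "C \<in> Ms" "E \<in> Ms" using AM A by auto
    have "C \<subseteq># A" "E \<subseteq># A" unfolding A by (auto simp: subseteq_mset_def)
    then have leX: "C \<in> le X" "E \<in> le X" using N_mono[OF AM(1)] CEM AM(2) by (auto simp: le_def intro: order_trans)
    have f1: "cmod (f B) \<le> 1" if "B \<in> Ms" for B using f that by (auto simp: unit_mult_def)
    have "cmod (sqfull_part f A) \<le> (\<Sum>B | B \<subseteq># A. cmod (of_real (mu B) * cmpart f B * f (A - B)))"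
      unfolding sqfull_part_def by (rule norm_sum)
    also have "\<dots> \<le> (\<Sum>B | B \<subseteq># A. if \<forall>p. count B p \<le> 1 then 1 else 0)"
    proof (rule sum_mono)
      fix B assume "B \<in> {B. B \<subseteq># A}"
      then have B: "B \<in> Ms" "A - B \<in> Ms" using Ms_subset[OF AM(1)] Ms_diff[OF AM(1)] by auto
      have "cmod (cmpart f B) * cmod (f (A - B)) \<le> 1 * 1"
        using completely_mult_le[OF completely_mult_cmpart[OF f] B(1)] f1[OF B(2)] by (intro mult_mono) auto
      then show "cmod (of_real (mu B) * cmpart f B * f (A - B)) \<le> (if \<forall>p. count B p \<le> 1 then 1 else 0)"
        by (auto simp: mu_def norm_mult power_abs norm_power)
    qed
    also have "\<dots> = real (card {B. B \<subseteq># A \<and> (\<forall>p. count B p \<le> 1)})"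
      by (simp add: sum.If_cases Int_def)
    also have "\<dots> \<le> divisor_count (C + E)" unfolding divisor_count_def using sub by (intro of_nat_mono card_mono) auto
    also have "\<dots> \<le> divisor_count C * divisor_count E" by (rule divisor_count_plus_le)
    finally have 1: "cmod (sqfull_part f A) \<le> divisor_count C * divisor_count E" .
    have "N A = N C ^ 3 * N E ^ 2" unfolding A by (simp add: power3_eq_cube power2_eq_square)
    then have 2: "N A powr (- (3/4)) = N C powr (- (9/4)) * N E powr (- (3/2))"
      using N_pos[OF CEM(1)] N_pos[OF CEM(2)] by (simp add: powr_mult powr_powr flip: powr_numeral)
    have "cmod (sqfull_part f A) * N A powr (- (3/4)) \<le> divisor_count C * divisor_count E * (N C powr (- (9/4)) * N E powr (- (3/2)))"
      unfolding 2 using 1 by (intro mult_right_mono) auto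
    also have "\<dots> = T (\<phi> A)" by (simp add: T_def CE)
    finally show ?thesis using leX CE by simp
  qed
  have "(\<Sum>A\<in>le X. cmod (sqfull_part f A) * N A powr (- (3/4))) = (\<Sum>A\<in>F. cmod (sqfull_part f A) * N A powr (- (3/4)))"
  proof (rule sum.mono_neutral_right)
    show "\<forall>A\<in>le X - F. cmod (sqfull_part f A) * N A powr (- (3/4)) = 0"
    proof
      fix A assume "A \<in> le X - F"
      then obtain p where "A \<in> Ms" "count A p = 1" by (auto simp: F_def le_def)
      then show "cmod (sqfull_part f A) * N A powr (- (3/4)) = 0" using sqfull_part_zero[OF f] by simp
    qed
  qed (auto simp: F_def)
  also have "\<dots> \<le> (\<Sum>A\<in>F. T (\<phi> A))" using tm by (intro sum_mono) blast
  also have "\<dots> = sum T (\<phi> ` F)" using inj by (simp add: sum.reindex)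
  also have "\<dots> \<le> sum T (le X \<times> le X)"
  proof (rule sum_mono2)
    show "\<phi> ` F \<subseteq> le X \<times> le X" using tm by blast
  qed (auto simp: T_def divisor_count_def)
  also have "\<dots> = (\<Sum>C\<in>le X. \<Sum>E\<in>le X. (divisor_count C * N C powr (- (9/4))) * (divisor_count E * N E powr (- (3/2))))"
    unfolding T_def by (rule sum.cartesian_product[symmetric])
  also have "\<dots> = (\<Sum>C\<in>le X. divisor_count C * N C powr (- (9/4))) * (\<Sum>E\<in>le X. divisor_count E * N E powr (- (3/2)))"
    by (rule sum_product[symmetric])
  also have "\<dots> \<le> Hb" unfolding Hb_def
    by (intro mult_mono sum_divisor_count_le) (auto intro!: sum_nonneg simp: divisor_count_def)
  finally show ?thesis .
qed

lemma Hb_pos: "Hb > 0" using C1_pos by (simp add: Hb_def)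

text \<open>Each prime with y < N \<le> x contributes at most 2 / N, which is at most (2 / ln y) ln
  N / N. The Mertens bound up to x and ln x \<le> 2 ln y make the total bounded.\<close>

lemma pdist_change:
  assumes g: "completely_mult g" and xy: "3 \<le> y" "y \<le> x" "ln x \<le> 2 * ln y"
  shows "pdist g x t - 4 * (C1 / c1) \<le> pdist g y t"
proof -
  define w where "w = (\<lambda>p. 1 - Re (g {#p#} * cis (- t * ln (real (nrm p)))))"
  have w: "0 \<le> w p" "w p \<le> 2" if "p \<in> P" for p unfolding w_def by (rule pterm_bounds[OF g that])+
  have ly: "ln y > 1" by (rule L_ge_1[OF xy(1)])
  have sub: "primes_le y \<subseteq> primes_le x" using xy by (auto simp: primes_le_def)
  have "pdist g x t = pdist g y t + (\<Sum>p\<in>primes_le x - primes_le y. w p / real (nrm p))"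
    unfolding pdist_def w_def using sum.subset_diff[OF sub finite_primes_le] by (simp only: add.commute)
  also have "(\<Sum>p\<in>primes_le x - primes_le y. w p / real (nrm p)) \<le> (\<Sum>p\<in>primes_le x - primes_le y. (2 / ln y) * (ln (real (nrm p)) / real (nrm p)))"
  proof (rule sum_mono)
    fix p assume p: "p \<in> primes_le x - primes_le y"
    then have pP: "p \<in> P" "y < real (nrm p)" by (auto simp: primes_le_def)
    have "w p * ln y \<le> 2 * ln (real (nrm p))" using w[OF pP(1)] pP(2) xy ly by (intro mult_mono) auto
    then have "w p \<le> (2 / ln y) * ln (real (nrm p))" using ly by (simp add: field_simps)
    then have "w p / real (nrm p) \<le> (2 / ln y) * ln (real (nrm p)) / real (nrm p)" by (intro divide_right_mono) auto
    then show "w p / real (nrm p) \<le> (2 / ln y) * (ln (real (nrm p)) / real (nrm p))" by simp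
  qed
  also have "\<dots> = (2 / ln y) * (\<Sum>p\<in>primes_le x - primes_le y. ln (real (nrm p)) / real (nrm p))" by (simp add: sum_distrib_left)
  also have "\<dots> \<le> (2 / ln y) * (\<Sum>p\<in>primes_le x. ln (real (nrm p)) / real (nrm p))"
  proof (intro mult_left_mono sum_mono2)
    fix p assume "p \<in> primes_le x - (primes_le x - primes_le y)"
    then have "nrm p \<ge> 2" using nrm_ge_2[of p] by (auto simp: primes_le_def)
    then show "0 \<le> ln (real (nrm p)) / real (nrm p)" by simp
  qed (use ly in auto)
  also have "\<dots> \<le> (2 / ln y) * (C1 / c1 * ln x)" using ly xy by (intro mult_left_mono sum_log_primes_le) auto
  also have "\<dots> \<le> (2 / ln y) * (C1 / c1 * (2 * ln y))" using ly xy C1_pos c1_pos by (intro mult_left_mono) auto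
  also have "\<dots> = 4 * (C1 / c1)" using ly by simp
  finally show ?thesis by simp
qed

lemma pdist_nonneg: "completely_mult g \<Longrightarrow> pdist g x t \<ge> 0"
  unfolding pdist_def by (intro sum_nonneg divide_nonneg_nonneg pterm_bounds) (auto dest: primes_le_P)

text \<open>For N A \<le> sqrt x, \<open>halasz_cm\<close> is applied at x / N A, where the distance
  has dropped by at most \<open>K5\<close>. For larger N A the trivial bound is enough: keeping only
  the exponent 3/4 for the convergent sum leaves N^(-1/4) \<le> x^(-1/8), which is O(1 / ln
  x).\<close>

theorem halasz:
  obtains C where "C \<ge> 0" "\<And>f x M. unit_mult f \<Longrightarrow> x \<ge> 3 \<Longrightarrow> 0 \<le> M \<Longrightarrow> (\<And>t. \<bar>t\<bar> \<le> ln x \<Longrightarrow> M \<le> pdist f x t) \<Longrightarrow>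
    cmod (S f x) \<le> C * x * ((1 + M) * exp (- M) + ln (ln x) / ln x)"
proof -
  obtain K where K: "K \<ge> 0" "\<And>g x M. completely_mult g \<Longrightarrow> x \<ge> 3 \<Longrightarrow> 0 \<le> M \<Longrightarrow> (\<And>t. \<bar>t\<bar> \<le> ln x \<Longrightarrow> M \<le> pdist g x t) \<Longrightarrow>
    cmod (S g x) \<le> K * x * ((1 + M) * exp (- M) + ln (ln x) / ln x)" by (rule halasz_cm) blast
  define \<delta> where "\<delta> = ln (ln (3::real))"
  have d: "\<delta> > 0" using ln3_gt_1 by (simp add: \<delta>_def)
  define K5 where "K5 = 4 * (C1 / c1)"
  have K5: "K5 \<ge> 0" using C1_pos c1_pos by (simp add: K5_def)
  define C where "C = K * Hb * (exp K5 + 2) + 8 * C1 * Hb / \<delta> + 8 * C1 / \<delta>"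
  have C0: "C \<ge> 0" using K Hb_pos C1_pos d by (auto simp: C_def intro!: add_nonneg_nonneg)
  have "cmod (S f x) \<le> C * x * ((1 + M) * exp (- M) + ln (ln x) / ln x)"
    if f: "unit_mult f" and x: "x \<ge> 3" and M: "0 \<le> M" "\<And>t. \<bar>t\<bar> \<le> ln x \<Longrightarrow> M \<le> pdist f x t" for f x M
  proof -
    define g where "g = cmpart f"
    have g: "completely_mult g" unfolding g_def by (rule completely_mult_cmpart[OF f])
    have g1: "\<forall>A\<in>Ms. cmod (g A) \<le> 1" using completely_mult_le[OF g] by blast
    have f1: "\<forall>A\<in>Ms. cmod (f A) \<le> 1" using f by (simp add: unit_mult_def)
    have pd: "pdist f y t = pdist g y t" for y t by (simp add: pdist_def g_def cmpart_def)
    define l where "l = ln x"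
    have l: "l > 1" unfolding l_def by (rule L_ge_1[OF x])
    have "ln 3 \<le> l" using x by (simp add: l_def)
    then have "\<delta> \<le> ln l" unfolding \<delta>_def using ln3_gt_1 by (subst ln_le_cancel_iff) auto
    then have il: "1 / l \<le> (1 / \<delta>) * (ln l / l)" using d l by (simp add: divide_simps)
    have ll: "ln l > 0" using l by simp
    define R where "R = (1 + M) * exp (- M) + ln l / l"
    have R: "ln l / l \<le> R" "(1 + M) * exp (- M) \<le> R" "R \<ge> 0" using M(1) l ll by (auto simp: R_def)
    show ?thesis
    \<comment> \<open>\<open>halasz_cm\<close> needs x / N A \<ge> sqrt x \<ge> 3. Below 9 the
      trivial bound suffices because l \<le> 8.\<close>
    proof (cases "x < 9")
      case True
      have "l \<le> x - 1" unfolding l_def using x by (intro ln_le_minus_one) auto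
      then have l8: "l \<le> 8" using True by simp
      have "1 \<le> 8 * (1 / l)" using l l8 by (simp add: field_simps)
      also have "\<dots> \<le> 8 * ((1 / \<delta>) * R)" using il R d by (intro mult_left_mono order_trans[OF il]) auto
      finally have "C1 * x * 1 \<le> C1 * x * (8 * ((1 / \<delta>) * R))" using C1_pos x by (intro mult_left_mono) auto
      also have "\<dots> = (8 * C1 / \<delta>) * x * R" by simp
      also have "\<dots> \<le> C * x * R" using K Hb_pos C1_pos d R x by (intro mult_right_mono) (auto simp: C_def)
      finally have "cmod (S f x) \<le> C * x * R" using norm_S_le[OF f1, of x] x by linarith
      then show ?thesis by (simp add: R_def l_def)
    next
      case False
      then have x9: "x \<ge> 9" by simp
      define B where "B = {A \<in> le x. N A \<le> sqrt x}"
      define W where "W = K * x * ((exp K5 + 2) * R)"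
      define h where "h = (\<lambda>A. cmod (sqfull_part f A))"
      have term1: "h A * cmod (S g (x / N A)) \<le> W * (h A * N A powr (- (3/4)))" if A: "A \<in> le x" "N A \<le> sqrt x" for A
      proof -
        have N1: "N A \<ge> 1" using A N_ge_1 by (auto simp: le_def)
        define y where "y = x / N A"
        have sx: "sqrt x \<ge> 3" using x9 by (simp add: real_le_rsqrt)
        have "x / sqrt x \<le> y" unfolding y_def using A N1 x by (intro divide_left_mono) auto
        then have ys: "sqrt x \<le> y" using x by (simp add: real_div_sqrt)
        then have y3: "y \<ge> 3" using sx by linarith
        have yx: "y \<le> x" unfolding y_def using N1 x by (simp add: divide_le_eq mult_le_cancel_left1)
        have lny: "l \<le> 2 * ln y"
        proof -
          have "ln (sqrt x) \<le> ln y" using ys sx x by (subst ln_le_cancel_iff) auto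
          then show ?thesis using x by (simp add: ln_sqrt l_def)
        qed
        have ly: "ln y > 1" by (rule L_ge_1[OF y3])
        have lyx: "ln y \<le> l" using yx y3 by (simp add: l_def)
        \<comment> \<open>The maximum keeps M' nonnegative; since M - K5 \<le> M' \<le> M, the value
          (1 + M') e^(-M') exceeds that for M by at most the factor e^K5.\<close>
        define M' where "M' = max 0 (M - K5)"
        have M': "0 \<le> M'" "M' \<le> M" "M - K5 \<le> M'" using M(1) K5 by (auto simp: M'_def)
        have "cmod (S g y) \<le> K * y * ((1 + M') * exp (- M') + ln (ln y) / ln y)"
        proof (rule K(2)[OF g y3 M'(1)])
          fix t assume "\<bar>t\<bar> \<le> ln y"
          then have "\<bar>t\<bar> \<le> ln x" using lyx by (simp add: l_def)
          then have "M \<le> pdist g x t" using M(2) pd by simp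
          moreover have "pdist g x t - K5 \<le> pdist g y t" unfolding K5_def
            by (rule pdist_change[OF g y3 yx]) (use lny in \<open>simp add: l_def\<close>)
          ultimately show "M' \<le> pdist g y t" using pdist_nonneg[OF g, of y t] by (simp add: M'_def)
        qed
        also have "\<dots> \<le> K * y * ((exp K5 + 2) * R)"
        proof (intro mult_left_mono)
          have "(1 + M') * exp (- M') \<le> (1 + M) * exp (K5 - M)" using M' M(1) by (intro mult_mono) auto
          also have "\<dots> = exp K5 * ((1 + M) * exp (- M))" by (simp add: exp_diff exp_minus divide_simps)
          also have "\<dots> \<le> exp K5 * R" using R by (intro mult_left_mono) auto
          finally have 1: "(1 + M') * exp (- M') \<le> exp K5 * R" .
          have "ln (ln y) / ln y \<le> ln l / (l / 2)"
            using ly lny lyx l ll by (intro frac_le) auto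
          also have "\<dots> = 2 * (ln l / l)" by simp
          also have "\<dots> \<le> 2 * R" using R by simp
          finally show "(1 + M') * exp (- M') + ln (ln y) / ln y \<le> (exp K5 + 2) * R" using 1 by (simp add: distrib_right)
        qed (use K y3 in auto)
        also have "\<dots> = W * (1 / N A)" by (simp add: W_def y_def)
        also have "\<dots> \<le> W * N A powr (- (3/4))"
        proof (intro mult_left_mono)
          have "1 / N A = N A powr (-1)" using N1 by (simp add: powr_minus divide_inverse)
          also have "\<dots> \<le> N A powr (- (3/4))" using N1 by (intro powr_mono) auto
          finally show "1 / N A \<le> N A powr (- (3/4))" .
          show "W \<ge> 0" using K R x by (simp add: W_def add_nonneg_nonneg)
        qed
        finally have "h A * cmod (S g y) \<le> h A * (W * N A powr (- (3/4)))" by (intro mult_left_mono) (auto simp: h_def)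
        then show ?thesis by (simp add: y_def mult_ac)
      qed
      define W2 where "W2 = C1 * x * (8 * ((1 / \<delta>) * R))"
      have term2: "h A * cmod (S g (x / N A)) \<le> W2 * (h A * N A powr (- (3/4)))" if A: "A \<in> le x" "N A > sqrt x" for A
      proof -
        have N1: "N A \<ge> 1" "N A \<le> x" using A N_ge_1 by (auto simp: le_def)
        have "1 \<le> x / N A" using N1 by simp
        then have "cmod (S g (x / N A)) \<le> C1 * (x / N A)" using norm_S_le g1 by blast
        also have "\<dots> = C1 * x * (N A powr (- (1/4)) * N A powr (- (3/4)))"
        proof -
          have "N A powr (- (1/4)) * N A powr (- (3/4)) = N A powr (- 1)" unfolding powr_add[symmetric] by simp
          also have "\<dots> = 1 / N A" using N1 by (simp add: powr_minus divide_inverse)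
          finally show ?thesis by simp
        qed
        also have "\<dots> \<le> C1 * x * (8 * ((1 / \<delta>) * R) * N A powr (- (3/4)))"
        proof (intro mult_left_mono mult_right_mono)
          have "N A powr (- (1/4)) \<le> (x powr (1/2)) powr (- (1/4))"
            using A N1 x by (intro powr_mono2') (auto simp: powr_half_sqrt)
          also have "\<dots> = x powr (- (1/8))" by (simp add: powr_powr)
          also have "\<dots> \<le> 8 * (1 / l)"
          proof -
            have "l \<le> x powr (1/8) / (1/8)" unfolding l_def using x by (intro ln_powr_bound) auto
            then show ?thesis using l x by (simp add: powr_minus field_simps)
          qed
          also have "\<dots> \<le> 8 * ((1 / \<delta>) * R)" using il R d by (intro mult_left_mono order_trans[OF il]) auto
          finally show "N A powr (- (1/4)) \<le> 8 * ((1 / \<delta>) * R)" .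
        qed (use C1_pos x in auto)
        finally have "h A * cmod (S g (x / N A)) \<le> h A * (C1 * x * (8 * ((1 / \<delta>) * R) * N A powr (- (3/4))))"
          by (intro mult_left_mono) (auto simp: h_def)
        then show ?thesis by (simp add: W2_def mult_ac)
      qed
      have W: "W \<ge> 0" "W2 \<ge> 0" using K R x C1_pos d by (auto simp: W_def W2_def intro!: mult_nonneg_nonneg add_nonneg_nonneg)
      have "cmod (S f x) \<le> (\<Sum>A\<in>le x. h A * cmod (S g (x / N A)))"
        unfolding S_conv[of f x] g_def h_def by (rule order_trans[OF norm_sum]) (simp add: norm_mult)
      also have "\<dots> \<le> (\<Sum>A\<in>le x. (W + W2) * (h A * N A powr (- (3/4))))"
      proof (rule sum_mono)
        fix A assume A: "A \<in> le x"
        have nn: "0 \<le> h A * N A powr (- (3/4))" by (simp add: h_def)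
        then have "W * (h A * N A powr (- (3/4))) \<le> (W + W2) * (h A * N A powr (- (3/4)))"
          "W2 * (h A * N A powr (- (3/4))) \<le> (W + W2) * (h A * N A powr (- (3/4)))"
          using W by (intro mult_right_mono; simp)+
        then show "h A * cmod (S g (x / N A)) \<le> (W + W2) * (h A * N A powr (- (3/4)))"
          using term1[OF A] term2[OF A] by linarith
      qed
      also have "\<dots> = (W + W2) * (\<Sum>A\<in>le x. h A * N A powr (- (3/4)))" by (simp add: sum_distrib_left)
      also have "\<dots> \<le> (W + W2) * Hb" using W unfolding h_def by (intro mult_left_mono sum_sqfull_part_le[OF f]) auto
      also have "\<dots> = (K * Hb * (exp K5 + 2) + 8 * C1 * Hb / \<delta>) * x * R" by (simp add: W_def W2_def algebra_simps)
      also have "\<dots> \<le> C * x * R" using C1_pos d R x by (intro mult_right_mono) (auto simp: C_def)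
      finally show ?thesis by (simp add: R_def l_def)
    qed
  qed
  then show thesis using that C0 by blast
qed

end

section \<open>Gaussian integers and their ideals\<close>

text \<open>A type of its own with integer coordinates, so that the type classes for Euclidean rings
  supply unique factorisation; \<open>toC\<close> maps it onto the carrier of
  \<open>ZI\<close>.\<close>

datatype gauss = Gauss (gre: int) (gim: int)

lemma gauss_eq_iff: "z = w \<longleftrightarrow> gre z = gre w \<and> gim z = gim w"
  by (cases z; cases w) auto

instantiation gauss :: comm_ring_1
begin
definition "0 = Gauss 0 0"
definition "1 = Gauss 1 0"
definition "z + w = Gauss (gre z + gre w) (gim z + gim w)"
definition "- z = Gauss (- gre z) (- gim z)"
definition "z - w = Gauss (gre z - gre w) (gim z - gim w)"
definition "z * w = Gauss (gre z * gre w - gim z * gim w) (gre z * gim w + gim z * gre w)"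
instance
  by standard (auto simp: gauss_eq_iff zero_gauss_def one_gauss_def plus_gauss_def uminus_gauss_def
    minus_gauss_def times_gauss_def algebra_simps)
end

lemma gauss_sel [simp]:
  "gre 0 = 0" "gim 0 = 0" "gre 1 = 1" "gim 1 = 0"
  "gre (z + w) = gre z + gre w" "gim (z + w) = gim z + gim w"
  "gre (- z) = - gre z" "gim (- z) = - gim z"
  "gre (z - w) = gre z - gre w" "gim (z - w) = gim z - gim w"
  "gre (z * w) = gre z * gre w - gim z * gim w" "gim (z * w) = gre z * gim w + gim z * gre w"
  by (simp_all add: zero_gauss_def one_gauss_def plus_gauss_def uminus_gauss_def minus_gauss_def times_gauss_def)

definition gnorm :: "gauss \<Rightarrow> nat" where "gnorm z = nat ((gre z)\<^sup>2 + (gim z)\<^sup>2)"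

lemma int_gnorm: "int (gnorm z) = (gre z)\<^sup>2 + (gim z)\<^sup>2" by (simp add: gnorm_def)

lemma gnorm_mult: "gnorm (z * w) = gnorm z * gnorm w"
proof -
  have "int (gnorm (z * w)) = int (gnorm z * gnorm w)"
    by (simp add: int_gnorm power2_eq_square algebra_simps)
  then show ?thesis by (simp only: of_nat_eq_iff)
qed

lemma gnorm_eq_0_iff [simp]: "gnorm z = 0 \<longleftrightarrow> z = 0"
proof -
  have "gnorm z = 0 \<longleftrightarrow> (gre z)\<^sup>2 + (gim z)\<^sup>2 = 0" by (simp flip: int_gnorm)
  then show ?thesis by (simp add: gauss_eq_iff sum_power2_eq_zero_iff)
qed

lemma gnorm_pos: "z \<noteq> 0 \<Longrightarrow> gnorm z > 0"
  by (metis gnorm_eq_0_iff gr0I)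

lemma gnorm_1 [simp]: "gnorm 1 = 1" "gnorm 0 = 0" by (simp_all add: gnorm_def)

definition gcnj :: "gauss \<Rightarrow> gauss" where "gcnj z = Gauss (gre z) (- gim z)"

lemma gcnj_sel [simp]: "gre (gcnj z) = gre z" "gim (gcnj z) = - gim z" by (simp_all add: gcnj_def)

text \<open>An integer nearest to x / n, for n > 0.\<close>

definition round_div :: "int \<Rightarrow> int \<Rightarrow> int" where "round_div x n = (2 * x + n) div (2 * n)"

lemma round_div_exact: "n > 0 \<Longrightarrow> round_div (a * n) n = a"
proof -
  assume n: "n > 0"
  have "(n + a * (2 * n)) div (2 * n) = a + n div (2 * n)" using n by (subst div_mult_self1) auto
  also have "n div (2 * n) = 0" using n by simp
  finally show ?thesis by (simp add: round_div_def algebra_simps)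
qed

lemma round_div_bound: "n > 0 \<Longrightarrow> \<bar>2 * (x - round_div x n * n)\<bar> \<le> n"
proof -
  assume n: "n > 0"
  define r where "r = (2 * x + n) mod (2 * n)"
  have "0 \<le> r" "r < 2 * n" using n by (auto simp: r_def)
  moreover have "2 * x + n = round_div x n * (2 * n) + r" unfolding round_div_def r_def by (rule div_mult_mod_eq[symmetric])
  ultimately show ?thesis by (simp add: algebra_simps)
qed

instantiation gauss :: normalization_euclidean_semiring
begin
definition "divide_gauss z w = (if w = 0 then 0 else
   Gauss (round_div (gre (z * gcnj w)) (int (gnorm w))) (round_div (gim (z * gcnj w)) (int (gnorm w))))"
definition "modulo_gauss z w = z - z div w * (w :: gauss)"
definition "euclidean_size_gauss = gnorm"
text \<open>The unit that rotates the half-open first quadrant onto the one containing z. With this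
  choice \<open>normalize\<close> yields exactly the generator singled out by
  \<open>idl_gen\<close>.\<close>

definition "unit_factor_gauss z = (if z = 0 then 0 else if gre z > 0 \<and> gim z \<ge> 0 then 1
   else if gre z \<le> 0 \<and> gim z > 0 then Gauss 0 1 else if gre z < 0 \<and> gim z \<le> 0 then - 1 else Gauss 0 (- 1))"
definition "normalize_gauss z = z * gcnj (unit_factor z)"

lemma gauss_no_zero_div: "z * w = 0 \<Longrightarrow> z = 0 \<or> w = (0 :: gauss)"
  by (metis gnorm_eq_0_iff gnorm_mult mult_eq_0_iff)

lemma gauss_mult_cnj: "w * gcnj w = Gauss (int (gnorm w)) 0"
  by (simp add: gauss_eq_iff int_gnorm power2_eq_square)

text \<open>Rounding moves each coordinate of the exact quotient by at most 1/2. So the remainder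
  times the conjugate of w has norm at most n^2 / 2 with n = gnorm w, and one factor n is
  cancelled.\<close>

lemma gauss_mod_less:
  assumes w: "(w :: gauss) \<noteq> 0"
  shows "gnorm (z mod w) < gnorm w"
proof -
  define n where "n = int (gnorm w)"
  have n: "n > 0" using gnorm_pos[OF w] by (simp add: n_def)
  define c where "c = z * gcnj w"
  define q where "q = z div w"
  have q: "gre q = round_div (gre c) n" "gim q = round_div (gim c) n"
    using w by (simp_all add: q_def divide_gauss_def c_def n_def)
  define d where "d = (z mod w) * gcnj w"
  have "d = c - q * (w * gcnj w)" by (simp add: d_def modulo_gauss_def c_def q_def algebra_simps)
  then have d: "gre d = gre c - gre q * n" "gim d = gim c - gim q * n"
    unfolding gauss_mult_cnj by (simp_all add: n_def)
  have b: "\<bar>2 * gre d\<bar> \<le> n" "\<bar>2 * gim d\<bar> \<le> n" unfolding d q by (rule round_div_bound[OF n])+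
  have sq: "(2 * gre d)\<^sup>2 \<le> n\<^sup>2" "(2 * gim d)\<^sup>2 \<le> n\<^sup>2"
    using b n by (metis abs_le_square_iff abs_of_pos)+
  have "4 * int (gnorm d) = (2 * gre d)\<^sup>2 + (2 * gim d)\<^sup>2" by (simp add: int_gnorm power_mult_distrib)
  also have "\<dots> \<le> 2 * n\<^sup>2" using sq by simp
  also have "\<dots> < 4 * n\<^sup>2" using n by simp
  finally have "int (gnorm d) < n * n" by (simp add: power2_eq_square)
  moreover have "gnorm d = gnorm (z mod w) * gnorm w"
    unfolding d_def gnorm_mult by (simp add: gnorm_def)
  ultimately have "int (gnorm (z mod w)) * n < n * n" by (simp add: n_def)
  then show ?thesis using n by (simp add: n_def)
qed

lemma gauss_unit: "z dvd (1 :: gauss) \<longleftrightarrow> z = 1 \<or> z = - 1 \<or> z = Gauss 0 1 \<or> z = Gauss 0 (- 1)"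
proof
  assume "z dvd 1"
  then obtain w where "1 = z * w" by (elim dvdE)
  then have "gnorm z * gnorm w = 1" by (metis gnorm_mult gnorm_1(1))
  then have g: "gnorm z = 1" by simp
  then have e: "(gre z)\<^sup>2 + (gim z)\<^sup>2 = 1" using int_gnorm[of z] by simp
  then have "(gre z)\<^sup>2 \<le> 1" "(gim z)\<^sup>2 \<le> 1" by (smt (verit) zero_le_power2)+
  then have "\<bar>gre z\<bar> \<le> 1" "\<bar>gim z\<bar> \<le> 1" by (simp_all add: abs_square_le_1)
  then have "gre z \<in> {-1,0,1}" "gim z \<in> {-1,0,1}" by auto
  then show "z = 1 \<or> z = - 1 \<or> z = Gauss 0 1 \<or> z = Gauss 0 (- 1)" using e by (auto simp: gauss_eq_iff)
next
  have "1 = (-1) * (-1 :: gauss)" "1 = Gauss 0 1 * Gauss 0 (-1)" "1 = Gauss 0 (-1) * Gauss 0 1" by (simp_all add: gauss_eq_iff)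
  moreover assume "z = 1 \<or> z = - 1 \<or> z = Gauss 0 1 \<or> z = Gauss 0 (- 1)"
  ultimately show "z dvd 1" by (metis dvd_refl dvd_triv_left)
qed

lemma gauss_unit_factor_unit: "z \<noteq> 0 \<Longrightarrow> unit_factor z = 1 \<or> unit_factor z = - 1 \<or> unit_factor z = Gauss 0 1 \<or> unit_factor z = Gauss 0 (- 1)"
  by (auto simp: unit_factor_gauss_def)

text \<open>Every unit is a power of i, so this one case gives compatibility with all units.\<close>

lemma gauss_unit_factor_mult_i: "unit_factor (Gauss 0 1 * b) = Gauss 0 1 * unit_factor b"
proof -
  consider "gre b = 0" "gim b = 0" | "gre b > 0" "gim b \<ge> 0" | "gre b \<le> 0" "gim b > 0"
    | "gre b < 0" "gim b \<le> 0" | "gre b \<ge> 0" "gim b < 0" by linarith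
  then show ?thesis by cases (simp_all add: unit_factor_gauss_def gauss_eq_iff)
qed

lemma gauss_unit_factor_mult_unit:
  assumes "a dvd (1 :: gauss)" shows "unit_factor (a * b) = a * unit_factor b"
proof -
  let ?i = "Gauss 0 1"
  have i: "- 1 = ?i * ?i" "Gauss 0 (- 1) = ?i * (?i * ?i)" by (simp_all add: gauss_eq_iff)
  consider "a = 1" | "a = ?i * ?i" | "a = ?i" | "a = ?i * (?i * ?i)"
    using assms unfolding gauss_unit i by blast
  then show ?thesis by cases (simp_all only: mult_1_left mult.assoc gauss_unit_factor_mult_i)
qed

instance
proof
  fix a b c :: gauss
  show "a * b \<noteq> 0" if "a \<noteq> 0" "b \<noteq> 0" using that gauss_no_zero_div by blast
  show "a div 0 = 0" by (simp add: divide_gauss_def)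
  show "a * b div b = a" if "b \<noteq> 0"
  proof -
    have "a * b * gcnj b = a * Gauss (int (gnorm b)) 0" by (metis gauss_mult_cnj mult.assoc)
    then have "gre (a * b * gcnj b) = gre a * int (gnorm b)" "gim (a * b * gcnj b) = gim a * int (gnorm b)" by simp_all
    moreover have "int (gnorm b) > 0" using gnorm_pos[OF that] by simp
    ultimately show ?thesis using that by (simp only: divide_gauss_def if_False round_div_exact gauss.collapse)
  qed
  show "a div b * b + a mod b = a" by (simp add: modulo_gauss_def)
  show "euclidean_size (0 :: gauss) = 0" by (simp add: euclidean_size_gauss_def)
  show "euclidean_size (a mod b) < euclidean_size b" if "b \<noteq> 0"
    unfolding euclidean_size_gauss_def by (rule gauss_mod_less[OF that])
  show "euclidean_size a \<le> euclidean_size (a * b)" if "b \<noteq> 0"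
    using gnorm_pos[OF that] unfolding euclidean_size_gauss_def gnorm_mult by simp
  show "unit_factor (0 :: gauss) = 0" by (simp add: unit_factor_gauss_def)
  show "unit_factor a = a" if "a dvd 1"
    using that unfolding gauss_unit by (auto simp: unit_factor_gauss_def gauss_eq_iff)
  show "unit_factor a dvd 1" if "a \<noteq> 0"
    unfolding gauss_unit by (rule gauss_unit_factor_unit[OF that])
  show "unit_factor (a * b) = a * unit_factor b" if "a dvd 1"
    using that gauss_unit_factor_mult_unit by blast
  show "unit_factor a * normalize a = a"
  proof (cases "a = 0")
    case False
    have "unit_factor a * normalize a = a * (unit_factor a * gcnj (unit_factor a))" by (simp add: normalize_gauss_def mult_ac)
    also have "unit_factor a * gcnj (unit_factor a) = 1"
      using gauss_unit_factor_unit[OF False] by (auto simp: gauss_eq_iff)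
    finally show ?thesis by simp
  qed (simp add: normalize_gauss_def)
  show "normalize (0 :: gauss) = 0" by (simp add: normalize_gauss_def)
qed

end

lemma normalize_gauss_quadrant:
  "z \<noteq> 0 \<Longrightarrow> gre (normalize z) > 0 \<and> gim (normalize z) \<ge> 0"
  by (auto simp: normalize_gauss_def unit_factor_gauss_def gauss_eq_iff)

lemma normalize_gauss_eq_self:
  "gre z > 0 \<Longrightarrow> gim z \<ge> 0 \<Longrightarrow> normalize z = z"
  by (auto simp: normalize_gauss_def unit_factor_gauss_def gauss_eq_iff)

instance gauss :: idom ..

lemma gnorm_normalize [simp]: "gnorm (normalize z) = gnorm z"
proof (cases "z = 0")
  case False
  have "gnorm (gcnj (unit_factor z)) = 1"
    using gauss_unit_factor_unit[OF False] by (auto simp: gnorm_def)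
  then show ?thesis by (simp add: normalize_gauss_def gnorm_mult)
qed simp

section \<open>Ideals of Z[i] described by their generators\<close>

definition toC :: "gauss \<Rightarrow> complex" where "toC z = Complex (of_int (gre z)) (of_int (gim z))"

lemma toC_simps [simp]: "toC 0 = 0" "toC 1 = 1" "toC (z + w) = toC z + toC w" "toC (z * w) = toC z * toC w"
   "toC (- z) = - toC z" "toC (z - w) = toC z - toC w"
  by (simp_all add: toC_def complex_eq_iff)

lemma toC_sel [simp]: "Re (toC z) = of_int (gre z)" "Im (toC z) = of_int (gim z)"
  by (simp_all add: toC_def)

lemma toC_eq_iff [simp]: "toC z = toC w \<longleftrightarrow> z = w"
  by (simp add: complex_eq_iff gauss_eq_iff)

lemma toC_eq_0_iff [simp]: "toC z = 0 \<longleftrightarrow> z = 0"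
  using toC_eq_iff[of z 0] by simp

definition gid :: "gauss \<Rightarrow> complex set" where "gid z = range (\<lambda>w. toC (w * z))"

lemma carrier_ZI: "carrier ZI = range toC"
proof
  show "carrier ZI \<subseteq> range toC"
  proof
    fix z assume "z \<in> carrier ZI"
    then obtain a b where "Re z = of_int a" "Im z = of_int b" by (auto simp: ZI_def Ints_def)
    then have "z = toC (Gauss a b)" by (simp add: complex_eq_iff)
    then show "z \<in> range toC" by blast
  qed
qed (auto simp: ZI_def)

lemma ZI_ops [simp]: "x \<otimes>\<^bsub>ZI\<^esub> y = x * y" "x \<oplus>\<^bsub>ZI\<^esub> y = x + y" "\<zero>\<^bsub>ZI\<^esub> = 0"
  by (simp_all add: ZI_def)

lemma ZI_ring: "Ring.ring ZI"
  using ZI_cring by (rule cring.axioms)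

lemma gid_PIdl: "PIdl\<^bsub>ZI\<^esub> (toC z) = gid z"
  unfolding cgenideal_def carrier_ZI gid_def by auto

lemma gid_ideal: "ideal (gid z) ZI"
  unfolding gid_PIdl[symmetric] by (rule cring.cgenideal_ideal[OF ZI_cring]) (simp add: carrier_ZI)

lemma toC_in_gid: "toC z \<in> gid w \<longleftrightarrow> w dvd z"
  unfolding gid_def dvd_def image_iff toC_eq_iff by (auto simp: mult.commute)

lemma gid_eq: "gid w = toC ` {z. w dvd z}" (is "?L = ?R")
proof (intro equalityI subsetI)
  fix x assume "x \<in> ?L"
  then obtain v where "x = toC (v * w)" unfolding gid_def by blast
  then show "x \<in> ?R" by (intro image_eqI[of _ _ "v * w"]) simp_all
qed (use toC_in_gid in blast)


lemma gid_cases: "x \<in> gid w \<Longrightarrow> \<exists>v. w dvd v \<and> x = toC v"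
  unfolding gid_eq by blast

text \<open>A nonzero element of least norm generates the ideal, by division with remainder.\<close>

lemma ideal_principal:
  assumes "ideal I ZI" shows "\<exists>z. I = gid z"
proof -
  note sub = ideal.axioms(1)[OF assms]
  define J where "J = {z. toC z \<in> I}"
  have I: "I = toC ` J" unfolding J_def using additive_subgroup.a_subset[OF sub] unfolding carrier_ZI by auto
  have 0: "0 \<in> J" using additive_subgroup.zero_closed[OF sub] by (simp add: J_def)
  have add: "a + b \<in> J" if "a \<in> J" "b \<in> J" for a b
    using additive_subgroup.a_closed[OF sub, of "toC a" "toC b"] that by (simp add: J_def)
  have mult: "r * a \<in> J" if "a \<in> J" for r a
    using ideal.I_l_closed[OF assms, of "toC a" "toC r"] that by (simp add: J_def carrier_ZI)
  show ?thesis
  proof (cases "J = {0}")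
    case True
    then show ?thesis unfolding I gid_eq by (intro exI[of _ 0]) auto
  next
    case False
    then obtain w where "w \<in> J \<and> w \<noteq> 0" using 0 by blast
    then obtain z where z: "z \<in> J" "z \<noteq> 0" and min: "\<And>v. v \<in> J \<Longrightarrow> v \<noteq> 0 \<Longrightarrow> gnorm z \<le> gnorm v"
      using ex_has_least_nat[of "\<lambda>v. v \<in> J \<and> v \<noteq> 0" w gnorm] by blast
    have "J = {v. z dvd v}"
    proof (intro equalityI subsetI CollectI)
      fix v assume v: "v \<in> J"
      have "v mod z = v + (- (v div z)) * z" by (simp add: modulo_gauss_def)
      then have "v mod z \<in> J" using add[OF v mult[OF z(1)]] by metis
      then have "v mod z = 0" using min gauss_mod_less[OF z(2)] by (meson not_less)
      then show "z dvd v" by (simp add: dvd_eq_mod_eq_0)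
    next
      fix v assume "v \<in> {v. z dvd v}"
      then show "v \<in> J" using mult[OF z(1)] by (auto simp: dvd_def mult.commute)
    qed
    then show ?thesis unfolding I gid_eq by blast
  qed
qed

lemma gid_subset_iff: "gid z \<subseteq> gid w \<longleftrightarrow> w dvd z"
proof
  assume "gid z \<subseteq> gid w"
  then have "toC z \<in> gid w" using toC_in_gid[of z z] by auto
  then show "w dvd z" by (simp only: toC_in_gid)
qed (auto simp only: gid_eq intro: dvd_trans)

lemma gid_eq_iff: "gid z = gid w \<longleftrightarrow> normalize z = normalize w"
  unfolding associated_iff_dvd using gid_subset_iff by blast

lemma gid_normalize [simp]: "gid (normalize z) = gid z"
  unfolding gid_eq_iff by simp

lemma gid_1: "gid 1 = carrier ZI"
  unfolding gid_def carrier_ZI by simp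

lemma gid_in_nz_ideals [simp]: "gid z \<in> nz_ideals \<longleftrightarrow> z \<noteq> 0"
proof -
  have "gid z = {0} \<longleftrightarrow> z = 0"
  proof
    assume "gid z = {0}"
    then have "toC z \<in> {0}" using toC_in_gid[of z z] by simp
    then show "z = 0" by simp
  qed (simp add: gid_def)
  then show ?thesis by (simp add: nz_ideals_def gid_ideal)
qed

lemma nz_ideals_cases: "I \<in> nz_ideals \<Longrightarrow> \<exists>z. z \<noteq> 0 \<and> I = gid z"
  using ideal_principal[of I] gid_in_nz_ideals by (fastforce simp: nz_ideals_def)

lemma primeideal_gid:
  assumes z: "z \<noteq> 0" shows "primeideal (gid z) ZI \<longleftrightarrow> prime_elem z"
proof
  assume "primeideal (gid z) ZI"
  note I_notcarr = primeideal.I_notcarr[OF this] and I_prime = primeideal.I_prime[OF this]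
  show "prime_elem z"
  proof (rule prime_elemI[OF z])
    show "\<not> z dvd 1" using I_notcarr gid_1 gid_subset_iff[of z 1] gid_subset_iff[of 1 z] by auto
    fix a b assume "z dvd a * b"
    then have "toC a \<otimes>\<^bsub>ZI\<^esub> toC b \<in> gid z" using toC_in_gid[of "a * b"] by simp
    then have "toC a \<in> gid z \<or> toC b \<in> gid z" by (intro I_prime) (auto simp: carrier_ZI)
    then show "z dvd a \<or> z dvd b" by (simp add: toC_in_gid)
  qed
next
  assume p: "prime_elem z"
  show "primeideal (gid z) ZI"
  proof (rule primeidealI[OF gid_ideal ZI_cring])
    show "carrier ZI \<noteq> gid z"
    proof
      assume "carrier ZI = gid z"
      then have "z dvd 1" using gid_1 gid_subset_iff[of 1 z] by simp
      then show False using p prime_elem_not_unit by blast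
    qed
    fix a b assume "a \<in> carrier ZI" "b \<in> carrier ZI" and ab: "a \<otimes>\<^bsub>ZI\<^esub> b \<in> gid z"
    then obtain u v where uv: "a = toC u" "b = toC v" unfolding carrier_ZI by blast
    then have "z dvd u * v" using ab toC_in_gid[of "u * v" z] by simp
    then have "z dvd u \<or> z dvd v" by (rule prime_elem_dvd_multD[OF p])
    then show "a \<in> gid z \<or> b \<in> gid z" by (simp add: uv toC_in_gid)
  qed
qed

lemma nz_primes_eq: "nz_primes = gid ` {p. prime p}"
proof (intro equalityI subsetI)
  fix I assume I: "I \<in> nz_primes"
  then obtain z where z: "z \<noteq> 0" "I = gid z" using nz_ideals_cases unfolding nz_primes_def by blast
  then have "prime (normalize z)" using I primeideal_gid by (simp add: nz_primes_def)
  moreover have "I = gid (normalize z)" by (simp add: z)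
  ultimately show "I \<in> gid ` {p. prime p}" by blast
next
  fix I assume "I \<in> gid ` {p. prime p}"
  then obtain p where "prime p" "I = gid p" by blast
  moreover from this have "p \<noteq> 0" by auto
  ultimately show "I \<in> nz_primes" using primeideal_gid by (simp add: nz_primes_def prime_imp_prime_elem)
qed

lemma ideal_prod_gid: "ideal_prod ZI (gid a) (gid b) = gid (a * b)"
proof (intro equalityI subsetI)
  fix x assume "x \<in> ideal_prod ZI (gid a) (gid b)"
  then show "x \<in> gid (a * b)"
  proof (induction rule: ideal_prod.induct)
    case (prod i j)
    then obtain u v where "i = toC u" "a dvd u" "j = toC v" "b dvd v" using gid_cases by meson
    then show ?case using toC_in_gid[of "u * v" "a * b"] by (simp add: mult_dvd_mono)
  next
    case (sum s1 s2)
    then obtain u v where "s1 = toC u" "a * b dvd u" "s2 = toC v" "a * b dvd v" using gid_cases by meson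
    then show ?case using toC_in_gid[of "u + v" "a * b"] by simp
  qed
next
  fix x assume "x \<in> gid (a * b)"
  then obtain w where "x = toC (w * (a * b))" unfolding gid_def by blast
  then have "x = toC (w * a) \<otimes>\<^bsub>ZI\<^esub> toC b" by simp
  moreover have "toC (w * a) \<in> gid a" "toC b \<in> gid b" unfolding toC_in_gid by simp_all
  ultimately show "x \<in> ideal_prod ZI (gid a) (gid b)" using ideal_prod.prod by metis
qed

text \<open>The sum of the two ideals is principal; its generator divides both a and b and is
  therefore a unit.\<close>

lemma coprime_idl_gid:
  assumes "coprime a b" shows "coprime_idl (gid a) (gid b)"
proof -
  have "ideal (gid a <+>\<^bsub>ZI\<^esub> gid b) ZI" by (rule ring.add_ideals[OF ZI_ring gid_ideal gid_ideal])
  then obtain c where c: "gid a <+>\<^bsub>ZI\<^esub> gid b = gid c" using ideal_principal by blast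
  have "h + k \<in> gid c" if "h \<in> gid a" "k \<in> gid b" for h k
    unfolding c[symmetric] set_add_def' ZI_ops using that by blast
  from this[of "toC a" "toC 0"] this[of "toC 0" "toC b"]
  have "toC a + toC 0 \<in> gid c" "toC 0 + toC b \<in> gid c" unfolding toC_in_gid by simp_all
  then have "toC a \<in> gid c" "toC b \<in> gid c" by simp_all
  then have "c dvd a" "c dvd b" by (simp_all only: toC_in_gid)
  then have "c dvd 1" using assms coprime_common_divisor by blast
  then have "gid c = gid 1" using gid_subset_iff[of c 1] gid_subset_iff[of 1 c] by simp
  then show ?thesis unfolding coprime_idl_def c gid_1 .
qed

text \<open>With d the gcd of the coordinates of z and n = gnorm z / d, the lattice of multiples of
  z contains (n, 0) and a vector with second coordinate d. As in the Hermite normal form, the n by d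
  rectangle \<open>T\<close> represents every residue class once.\<close>

lemma idl_norm_gid:
  assumes z: "z \<noteq> 0" shows "idl_norm (gid z) = gnorm z"
proof -
  define a b where "a = gre z" and "b = gim z"
  define d where "d = gcd a b"
  have d0: "d > 0" using z by (simp add: d_def a_def b_def gauss_eq_iff)
  have "int (gnorm z) = a * a + b * b" by (simp add: int_gnorm a_def b_def power2_eq_square)
  moreover have "d dvd a * a + b * b" by (simp add: d_def)
  ultimately obtain n where n: "int (gnorm z) = d * n" "a * a + b * b = d * n" by (metis dvdE)
  have n0: "n > 0" using gnorm_pos[OF z] n(1) d0 by (metis of_nat_0_less_iff zero_less_mult_pos)
  obtain u v where uv: "u * a + v * b = d" using bezout_int[of a b] unfolding d_def by blast
  have zn: "z dvd Gauss n 0"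
  proof -
    obtain a' b' where ab: "a = d * a'" "b = d * b'" unfolding d_def by (meson gcd_dvd1 gcd_dvd2 dvdE)
    have "d * n = d * (a * a' + b * b')" unfolding n(2)[symmetric] using ab by (simp add: algebra_simps)
    then have "n = a * a' + b * b'" using d0 by simp
    moreover have "a * b' = b * a'" by (simp add: ab)
    ultimately have "Gauss n 0 = z * Gauss a' (- b')"
      by (simp add: gauss_eq_iff a_def b_def algebra_simps)
    then show ?thesis by simp
  qed
  define T where "T = (\<lambda>(x, y). Gauss x y) ` ({0..<n} \<times> {0..<d})"
  define q where "q = (\<lambda>w. gid z +>\<^bsub>ZI\<^esub> toC w)"
  have q_mem: "c \<in> q w \<longleftrightarrow> (\<exists>h. z dvd h \<and> c = toC (h + w))" for c w
    unfolding q_def a_r_coset_def' gid_eq by auto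
  have q_eq: "q w = q w' \<longleftrightarrow> z dvd w - w'" for w w'
  proof
    assume "q w = q w'"
    moreover have "toC w \<in> q w" unfolding q_mem by (intro exI[of _ 0]) simp
    ultimately obtain h where "z dvd h" "w = h + w'" by (auto simp only: q_mem toC_eq_iff)
    then show "z dvd w - w'" by simp
  next
    have sub: "q w \<subseteq> q w'" if "z dvd w - w'" for w w'
    proof
      fix c assume "c \<in> q w"
      then obtain h where h: "z dvd h" "c = toC (h + w)" unfolding q_mem by blast
      have "z dvd h + (w - w')" using h(1) that by (rule dvd_add)
      moreover have "c = toC ((h + (w - w')) + w')" by (simp add: h(2))
      ultimately show "c \<in> q w'" unfolding q_mem by blast
    qed
    assume zw: "z dvd w - w'"
    then have "z dvd w' - w" using dvd_minus_iff[of z "w - w'"] by simp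
    then show "q w = q w'" using sub zw by blast
  qed
  have inj: "inj_on q T"
  proof (rule inj_onI)
    fix w w' assume "w \<in> T" "w' \<in> T" "q w = q w'"
    then obtain x y x' y' where w: "w = Gauss x y" "w' = Gauss x' y'" and r: "0 \<le> x" "x < n" "0 \<le> x'" "x' < n" "0 \<le> y" "y < d" "0 \<le> y'" "y' < d"
      and "z dvd w - w'" unfolding T_def q_eq by auto
    then obtain s where s: "w - w' = z * s" by (elim dvdE)
    have re: "x - x' = a * gre s - b * gim s" and im: "y - y' = a * gim s + b * gre s"
      using arg_cong[OF s, of gre] arg_cong[OF s, of gim] by (simp_all add: w a_def b_def)
    have "d dvd y - y'" unfolding im d_def by simp
    then have y: "y = y'" using r zdvd_not_zless[of "y - y'" d] zdvd_not_zless[of "y' - y" d] by (cases y y' rule: linorder_cases) (auto simp: dvd_diff_commute)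
    \<comment> \<open>A Bezout combination: after the vanishing coordinate is inserted, every term
      carries the factor a^2 + b^2 = d n, so n divides x - x'.\<close>
    have "d * (x - x') = (u * a + v * b) * (x - x')" by (simp add: uv)
    also have "\<dots> = u * (a * (a * gre s - b * gim s)) + v * (b * (a * gre s - b * gim s))" unfolding re by (simp add: algebra_simps)
    also have "a * (a * gre s - b * gim s) = (a * a + b * b) * gre s - b * (a * gim s + b * gre s)" by (simp add: algebra_simps)
    also have "b * (a * gre s - b * gim s) = a * (a * gim s + b * gre s) - (a * a + b * b) * gim s" by (simp add: algebra_simps)
    also have "a * gim s + b * gre s = 0" using im y by simp
    also have "u * ((a * a + b * b) * gre s - b * 0) + v * (a * 0 - (a * a + b * b) * gim s) = d * (n * (u * gre s - v * gim s))"
      unfolding n(2) by (simp add: algebra_simps)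
    finally have "n dvd x - x'" using d0 by simp
    then have "x = x'" using r zdvd_not_zless[of "x - x'" n] zdvd_not_zless[of "x' - x" n] by (cases x x' rule: linorder_cases) (auto simp: dvd_diff_commute)
    then show "w = w'" by (simp add: w y)
  qed
  have surj: "\<exists>t\<in>T. q w = q t" for w
  proof -
    define k where "k = gim w div d"
    \<comment> \<open>By Bezout this multiple of z has imaginary part d. It reduces imaginary parts
      modulo d; then the multiple \<open>Gauss n 0\<close> reduces real parts modulo n.\<close>
    define s where "s = z * Gauss v u"
    have gs: "gim s = d" using uv by (simp add: s_def a_def b_def algebra_simps)
    define w1 where "w1 = w - Gauss k 0 * s"
    have y1: "gim w1 = gim w mod d" by (simp add: w1_def gs k_def minus_div_mult_eq_mod)
    define t where "t = w1 - Gauss (gre w1 div n) 0 * Gauss n 0"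
    have t: "gim t = gim w mod d" "gre t = gre w1 mod n" by (simp_all add: t_def y1 minus_div_mult_eq_mod)
    have "z dvd Gauss k 0 * s + Gauss (gre w1 div n) 0 * Gauss n 0"
      unfolding s_def using zn by (intro dvd_add dvd_mult dvd_triv_left)
    moreover have "w - t = Gauss k 0 * s + Gauss (gre w1 div n) 0 * Gauss n 0" by (simp add: t_def w1_def)
    ultimately have "q w = q t" unfolding q_eq by simp
    moreover have "t \<in> T"
    proof -
      have "t = (\<lambda>(x, y). Gauss x y) (gre t, gim t)" by simp
      moreover have "(gre t, gim t) \<in> {0..<n} \<times> {0..<d}" using t n0 d0 by simp
      ultimately show ?thesis unfolding T_def by blast
    qed
    ultimately show ?thesis by blast
  qed
  have "carrier (ZI Quot gid z) = q ` T"
  proof -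
    have "carrier (ZI Quot gid z) = range q"
      unfolding FactRing_def A_RCOSETS_def' carrier_ZI q_def by auto
    also have "\<dots> = q ` T" using surj by blast
    finally show ?thesis .
  qed
  then have "idl_norm (gid z) = card T" unfolding idl_norm_def by (simp add: card_image[OF inj])
  also have "\<dots> = card ({0..<n} \<times> {0..<d})" unfolding T_def by (intro card_image inj_onI) auto
  also have "\<dots> = nat (n * d)" using n0 d0 by (simp add: card_cartesian_product nat_mult_distrib)
  also have "\<dots> = gnorm z" using n(1) by (simp add: mult.commute flip: n(1))
  finally show ?thesis .
qed

lemma quadrant_iff_Arg: "w \<noteq> 0 \<Longrightarrow> 0 \<le> Arg w \<and> Arg w < pi / 2 \<longleftrightarrow> Re w > 0 \<and> Im w \<ge> 0"
proof -
  assume w: "w \<noteq> 0"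
  have c: "cos (Arg w) = Re w / cmod w" using cis_Arg[OF w] by (metis Re_sgn cis.sel(1))
  have b: "- pi < Arg w" "Arg w \<le> pi" using Arg_bounded by auto
  show ?thesis
  proof
    assume a: "0 \<le> Arg w \<and> Arg w < pi / 2"
    then have "cos (Arg w) > 0" by (intro cos_gt_zero_pi) auto
    then show "Re w > 0 \<and> Im w \<ge> 0" using c w a Arg_less_0[of w] by (simp add: zero_less_divide_iff)
  next
    assume a: "Re w > 0 \<and> Im w \<ge> 0"
    then have g: "0 \<le> Arg w" using Arg_less_0 by simp
    moreover have "Arg w < pi / 2"
    proof (rule ccontr)
      assume "\<not> Arg w < pi / 2"
      then have "cos (Arg w) \<le> cos (pi / 2)" using b by (intro cos_monotone_0_pi_le) auto
      moreover have "cos (Arg w) > 0" using c a w by simp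
      ultimately show False by simp
    qed
    ultimately show "0 \<le> Arg w \<and> Arg w < pi / 2" ..
  qed
qed

lemma idl_gen_gid:
  assumes z: "z \<noteq> 0" shows "idl_gen (gid z) = toC (normalize z)"
  unfolding idl_gen_def
proof (rule the_equality)
  have "toC (normalize z) \<noteq> 0" using z by simp
  then show "toC (normalize z) \<in> carrier ZI \<and> PIdl\<^bsub>ZI\<^esub> toC (normalize z) = gid z \<and> 0 \<le> Arg (toC (normalize z)) \<and> Arg (toC (normalize z)) < pi / 2"
    using quadrant_iff_Arg[of "toC (normalize z)"] normalize_gauss_quadrant[OF z]
    by (auto simp: gid_PIdl carrier_ZI)
next
  fix w assume w: "w \<in> carrier ZI \<and> PIdl\<^bsub>ZI\<^esub> w = gid z \<and> 0 \<le> Arg w \<and> Arg w < pi / 2"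
  then obtain v where v: "w = toC v" unfolding carrier_ZI by blast
  have e: "normalize v = normalize z" using w by (simp add: v gid_PIdl gid_eq_iff)
  then have "v \<noteq> 0" using z by auto
  then have "gre v > 0 \<and> gim v \<ge> 0" using quadrant_iff_Arg[of w] w by (simp add: v)
  then show "w = toC (normalize z)" using normalize_gauss_eq_self[of v] e v by simp
qed

lemma idl_arg_gid: "z \<noteq> 0 \<Longrightarrow> idl_arg (gid z) = Arg (toC (normalize z))"
  by (simp add: idl_arg_def idl_gen_gid)

lemma idl_arg_range: "I \<in> nz_ideals \<Longrightarrow> 0 \<le> idl_arg I \<and> idl_arg I < pi / 2"
proof -
  assume "I \<in> nz_ideals"
  then obtain z where z: "z \<noteq> 0" "I = gid z" using nz_ideals_cases by blast
  then have "toC (normalize z) \<noteq> 0" by simp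
  then show ?thesis using quadrant_iff_Arg normalize_gauss_quadrant[OF z(1)] by (simp add: z idl_arg_gid)
qed

lemma hecke_char_cis: "hecke_char m I = cis (of_int m * (4 * idl_arg I))"
  by (simp add: hecke_char_def cis_conv_exp mult_ac)

lemma norm_hecke_char: "cmod (hecke_char m I) = 1"
  by (simp add: hecke_char_cis)

text \<open>Units satisfy u^4 = 1, so the fourth power does not depend on the generator. In this
  form multiplicativity is immediate, although the argument of the normalised generator is not
  additive.\<close>

lemma hecke_char_gid:
  assumes z: "z \<noteq> 0" shows "hecke_char m (gid z) = (sgn (toC z) ^ 4) powi m"
proof -
  define u where "u = gcnj (unit_factor z)"
  have u: "toC u ^ 4 = 1" "cmod (toC u) = 1"
    using gauss_unit_factor_unit[OF z] by (auto simp: u_def toC_def gcnj_def cmod_def power4_eq_xxxx complex_eq_iff)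
  have su: "sgn (toC u) = toC u" using u(2) by (simp add: sgn_div_norm)
  have "toC (normalize z) = toC z * toC u" by (simp add: normalize_gauss_def u_def)
  then have "sgn (toC (normalize z)) ^ 4 = sgn (toC z) ^ 4"
    using u(1) su by (simp add: sgn_mult power_mult_distrib)
  moreover have "hecke_char m (gid z) = (cis (Arg (toC (normalize z))) ^ 4) powi m"
    unfolding hecke_char_cis idl_arg_gid[OF z] Complex.DeMoivre cis_power_int by (simp add: mult.commute)
  ultimately show ?thesis using z by (simp add: cis_Arg)
qed

lemma hecke_char_mult:
  "a \<noteq> 0 \<Longrightarrow> b \<noteq> 0 \<Longrightarrow> hecke_char m (gid (a * b)) = hecke_char m (gid a) * hecke_char m (gid b)"
  by (simp add: hecke_char_gid sgn_mult power_mult_distrib power_int_mult_distrib)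

lemma gnorm_prod_mset: "gnorm (prod_mset A) = (\<Prod>p\<in>#A. gnorm p)"
  by (induction A) (simp_all add: gnorm_mult)

lemma prod_primes_nonzero: "set_mset A \<subseteq> {p::gauss. prime p} \<Longrightarrow> prod_mset A \<noteq> 0"
  by (induction A) auto

text \<open>The predicate \<open>prime\<close> includes normalisation, so each prime ideal has
  exactly one prime generator, and unique factorisation of elements becomes that of ideals.\<close>

lemma bij_multisets_ideals:
  "bij_betw (\<lambda>A. gid (prod_mset A)) {A. set_mset A \<subseteq> {p. prime p}} nz_ideals"
proof (rule bij_betw_imageI)
  show "inj_on (\<lambda>A. gid (prod_mset A)) {A. set_mset A \<subseteq> {p. prime p}}"
  proof (rule inj_onI)
    fix A B :: "gauss multiset"
    assume A: "A \<in> {A. set_mset A \<subseteq> {p. prime p}}" and B: "B \<in> {A. set_mset A \<subseteq> {p. prime p}}"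
      and "gid (prod_mset A) = gid (prod_mset B)"
    then have "normalize (prod_mset A) = normalize (prod_mset B)" by (simp add: gid_eq_iff)
    then have "prime_factorization (prod_mset A) = prime_factorization (prod_mset B)"
      using A B prod_primes_nonzero prime_factorization_unique by blast
    moreover have "prime_factorization (prod_mset A) = A" "prime_factorization (prod_mset B) = B"
      using A B by (auto intro!: prime_factorization_prod_mset_primes)
    ultimately show "A = B" by simp
  qed
  show "(\<lambda>A. gid (prod_mset A)) ` {A. set_mset A \<subseteq> {p. prime p}} = nz_ideals"
  proof (intro equalityI subsetI)
    fix I assume "I \<in> (\<lambda>A. gid (prod_mset A)) ` {A. set_mset A \<subseteq> {p. prime p}}"
    then show "I \<in> nz_ideals" using prod_primes_nonzero by auto
  next
    fix I assume "I \<in> nz_ideals"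
    then obtain z where z: "z \<noteq> 0" "I = gid z" using nz_ideals_cases by blast
    have "normalize (prod_mset (prime_factorization z)) = normalize z" by (rule prod_mset_prime_factorization_weak[OF z(1)])
    then have "I = gid (prod_mset (prime_factorization z))" by (simp add: z gid_eq_iff)
    moreover have "set_mset (prime_factorization z) \<subseteq> {p. prime p}" by auto
    ultimately show "I \<in> (\<lambda>A. gid (prod_mset A)) ` {A. set_mset A \<subseteq> {p. prime p}}" by blast
  qed
qed

lemma coprime_prod_primes:
  assumes A: "set_mset A \<subseteq> {p::gauss. prime p}" and B: "set_mset B \<subseteq> {p. prime p}" and AB: "set_mset A \<inter> set_mset B = {}"
  shows "coprime (prod_mset A) (prod_mset B)"
proof (rule coprimeI)
  fix c assume c: "c dvd prod_mset A" "c dvd prod_mset B"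
  show "c dvd 1"
  proof (rule ccontr)
    assume "\<not> c dvd 1"
    moreover have "c \<noteq> 0" using c(1) prod_primes_nonzero[OF A] by auto
    ultimately obtain p where p: "p dvd c" "prime p" using prime_divisor_exists by blast
    then have "p dvd prod_mset A" "p dvd prod_mset B" using c dvd_trans by blast+
    then have "p \<in># A" "p \<in># B" using p(2) A B prime_dvd_prod_mset_primes_iff by blast+
    then show False using AB by blast
  qed
qed

section \<open>Lattice points in a quadrant and in thin sectors\<close>

text \<open>The number pi / 4, kept as an integral because \<open>card_quad_pts\<close> compares a
  sum over columns with it.\<close>

definition quarter_area :: real where "quarter_area = integral {0..1} (\<lambda>v. sqrt (1 - v\<^sup>2))"

lemma quarter_has_integral: "((\<lambda>v. sqrt (1 - v\<^sup>2)) has_integral quarter_area) {0..1}"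
  unfolding quarter_area_def by (intro integrable_integral integrable_continuous_real continuous_intros)

lemma quarter_area_pos: "quarter_area > 0"
proof -
  have i: "((\<lambda>v::real. 1 - v) has_integral (1 - 1\<^sup>2 / 2) - (0 - 0\<^sup>2 / 2)) {0..1}"
    by (rule fundamental_theorem_of_calculus)
      (auto intro!: derivative_eq_intros simp: has_real_derivative_iff_has_vector_derivative[symmetric])
  have "(1 - 1\<^sup>2 / 2) - (0 - 0\<^sup>2 / 2) \<le> quarter_area"
  proof (rule has_integral_le[OF i quarter_has_integral])
    fix v :: real assume v: "v \<in> {0..1}"
    then have "(1 - v)\<^sup>2 \<le> 1 - v\<^sup>2" by (simp add: power2_eq_square algebra_simps mult_left_le)
    then show "1 - v \<le> sqrt (1 - v\<^sup>2)" by (rule real_le_rsqrt)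
  qed
  then show ?thesis by simp
qed

text \<open>The first-quadrant generators a + b i of norm at most x: the positive real axis belongs
  to the quadrant, the imaginary axis does not.\<close>

definition quad_pts :: "real \<Rightarrow> (nat \<times> nat) set" where
  "quad_pts x = {(a, b). 1 \<le> a \<and> (real a)\<^sup>2 + (real b)\<^sup>2 \<le> x}"

definition root_floor :: "real \<Rightarrow> nat" where "root_floor x = nat \<lfloor>sqrt x\<rfloor>"

lemma root_floor:
  assumes "x \<ge> 1" shows "real (root_floor x) \<le> sqrt x" "sqrt x < real (root_floor x) + 1" "a \<le> root_floor x \<longleftrightarrow> (real a)\<^sup>2 \<le> x"
proof -
  have s: "sqrt x \<ge> 0" using assms by simp
  show 1: "real (root_floor x) \<le> sqrt x" "sqrt x < real (root_floor x) + 1"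
    using s unfolding root_floor_def by linarith+
  have "a \<le> root_floor x \<longleftrightarrow> real a \<le> sqrt x" using s unfolding root_floor_def by (simp add: le_nat_floor le_nat_iff le_floor_iff)
  also have "\<dots> \<longleftrightarrow> (real a)\<^sup>2 \<le> x" using real_sqrt_le_iff[of "(real a)\<^sup>2" x] by simp
  finally show "a \<le> root_floor x \<longleftrightarrow> (real a)\<^sup>2 \<le> x" .
qed

lemma quad_pts_subset:
  assumes "x \<ge> 1" shows "quad_pts x \<subseteq> {1..root_floor x} \<times> {0..root_floor x}"
proof
  fix p assume "p \<in> quad_pts x"
  then obtain a b where p: "p = (a, b)" "1 \<le> a" "(real a)\<^sup>2 + (real b)\<^sup>2 \<le> x" unfolding quad_pts_def by auto
  moreover have "(real a)\<^sup>2 \<ge> 0" "(real b)\<^sup>2 \<ge> 0" by simp_all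
  ultimately have "(real a)\<^sup>2 \<le> x" "(real b)\<^sup>2 \<le> x" by linarith+
  then show "p \<in> {1..root_floor x} \<times> {0..root_floor x}" using p root_floor(3)[OF assms] by simp
qed

lemma finite_quad_pts: "x \<ge> 1 \<Longrightarrow> finite (quad_pts x)"
  using quad_pts_subset finite_subset by blast

text \<open>Column a holds floor (f a) + 1 points. Four errors of at most sqrt x arise: rounding in
  the n columns, sum against integral for the decreasing f, the piece from n to sqrt x, and the term
  f 0, whose column is not counted.\<close>

lemma card_quad_pts:
  assumes x: "x \<ge> 1" shows "\<bar>real (card (quad_pts x)) - quarter_area * x\<bar> \<le> 4 * sqrt x"
proof -
  define n where "n = root_floor x"
  define f where "f = (\<lambda>u. sqrt (max 0 (x - u\<^sup>2)))"
  define y where "y = sqrt x"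
  have y: "y \<ge> 1" "y * y = x" using x by (simp_all add: y_def)
  have n: "real n \<le> y" "y < real n + 1" using root_floor[OF x] by (simp_all add: n_def y_def)
  have f0: "f u \<ge> 0" for u by (simp add: f_def)
  have fy: "f u \<le> y" for u unfolding f_def y_def using x by simp
  interpret antimono_fun_sum_integral_diff f
  proof
    fix u v :: real assume "u \<ge> 0" "u \<le> v"
    then have "u\<^sup>2 \<le> v\<^sup>2" by (intro power_mono)
    then show "f u \<ge> f v" unfolding f_def by (intro real_sqrt_le_mono) auto
  next
    show "continuous_on {0..} f" unfolding f_def by (intro continuous_intros)
  qed (rule f0)
  have int: "f integrable_on {a..b}" for a b unfolding f_def by (intro integrable_continuous_real continuous_intros)
  have tot: "(f has_integral quarter_area * x) {0..y}"
  proof -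
    have "((\<lambda>u. y * sqrt (1 - (1 / y * u)\<^sup>2)) has_integral y * ((1 / \<bar>1 / y\<bar>) *\<^sub>R quarter_area)) ((\<lambda>u. u / (1 / y)) ` {0..1})"
      by (intro has_integral_mult_right has_integral_stretch_real quarter_has_integral) (use y in simp)
    moreover have "(\<lambda>u. u / (1 / y)) ` {0..1} = {0..y}" using y by (subst image_divide_atLeastAtMost) auto
    moreover have "y * ((1 / \<bar>1 / y\<bar>) *\<^sub>R quarter_area) = quarter_area * x" using y by (simp add: mult_ac flip: y(2))
    ultimately have h: "((\<lambda>u. y * sqrt (1 - (1 / y * u)\<^sup>2)) has_integral quarter_area * x) {0..y}" by (simp only:)
    have "y * sqrt (1 - (1 / y * u)\<^sup>2) = f u" if "u \<in> {0..y}" for u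
    proof -
      have "u\<^sup>2 \<le> y\<^sup>2" using that by (intro power_mono) auto
      then have u: "u\<^sup>2 \<le> x" using y(2) by (simp add: power2_eq_square)
      have "y * sqrt (1 - (1 / y * u)\<^sup>2) = sqrt (x * (1 - (1 / y * u)\<^sup>2))" by (simp add: y_def real_sqrt_mult)
      also have "x * (1 - (1 / y * u)\<^sup>2) = x - u\<^sup>2" using x y(1) unfolding y(2)[symmetric] by (simp add: power_divide power2_eq_square right_diff_distrib)
      finally show ?thesis using u by (simp add: f_def)
    qed
    then show ?thesis using has_integral_eq[OF _ h, of f] by blast
  qed
  have split: "integral {0..real n} f + integral {real n..y} f = quarter_area * x"
    using Henstock_Kurzweil_Integration.integral_combine[of 0 "real n" y f] n int integral_unique[OF tot] by simp
  have last: "0 \<le> integral {real n..y} f" "integral {real n..y} f \<le> y"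
  proof -
    show "0 \<le> integral {real n..y} f" by (rule integral_nonneg[OF int]) (simp add: f0)
    have "integral {real n..y} f \<le> integral {real n..y} (\<lambda>_. y)" by (intro integral_le int integrable_continuous_real continuous_intros fy)
    also have "\<dots> = (y - real n) * y" using n by simp
    also have "\<dots> \<le> 1 * y" using n y by (intro mult_right_mono) auto
    finally show "integral {real n..y} f \<le> y" by simp
  qed
  have series: "0 \<le> (\<Sum>k\<le>n. f (real k)) - integral {0..real n} f" "(\<Sum>k\<le>n. f (real k)) - integral {0..real n} f \<le> y"
    using sum_integral_diff_series_nonneg[of n] sum_integral_diff_series_antimono[of 0 n] fy[of 0]
    by (simp_all add: sum_integral_diff_series_def)
  have col: "real (card {b. (a, b) \<in> quad_pts x}) = real (nat \<lfloor>f (real a)\<rfloor> + 1)" if a: "a \<in> {1..n}" for a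
  proof -
    have "(real a)\<^sup>2 \<le> x" using a root_floor(3)[OF x] by (simp add: n_def)
    then have fa: "f (real a) = sqrt (x - (real a)\<^sup>2)" by (simp add: f_def)
    have "(a, b) \<in> quad_pts x \<longleftrightarrow> b \<le> nat \<lfloor>f (real a)\<rfloor>" for b
    proof -
      have "(a, b) \<in> quad_pts x \<longleftrightarrow> (real b)\<^sup>2 \<le> x - (real a)\<^sup>2" using a by (auto simp: quad_pts_def)
      also have "\<dots> \<longleftrightarrow> real b \<le> f (real a)" unfolding fa using real_sqrt_le_iff[of "(real b)\<^sup>2" "x - (real a)\<^sup>2"] by simp
      also have "\<dots> \<longleftrightarrow> b \<le> nat \<lfloor>f (real a)\<rfloor>" using f0[of "real a"] by (simp add: le_nat_iff le_floor_iff)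
      finally show ?thesis .
    qed
    then have "{b. (a, b) \<in> quad_pts x} = {..nat \<lfloor>f (real a)\<rfloor>}" by auto
    then show ?thesis by simp
  qed
  have fin: "finite {b. (a, b) \<in> quad_pts x}" for a
    by (rule finite_subset[of _ "snd ` quad_pts x"]) (use finite_quad_pts[OF x] in force)+
  have "(SIGMA a:{1..n}. {b. (a, b) \<in> quad_pts x}) = quad_pts x" using quad_pts_subset[OF x] by (auto simp: n_def)
  moreover have "card (SIGMA a:{1..n}. {b. (a, b) \<in> quad_pts x}) = (\<Sum>a\<in>{1..n}. card {b. (a, b) \<in> quad_pts x})"
    by (rule card_SigmaI) (simp_all add: fin)
  ultimately have "card (quad_pts x) = (\<Sum>a\<in>{1..n}. card {b. (a, b) \<in> quad_pts x})" by (simp only:)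
  then have c: "real (card (quad_pts x)) = (\<Sum>a\<in>{1..n}. real (nat \<lfloor>f (real a)\<rfloor> + 1))" using col by simp
  have "\<bar>real (nat \<lfloor>f (real a)\<rfloor> + 1) - f (real a)\<bar> \<le> 1" for a
    using f0[of "real a"] by linarith
  then have "(\<Sum>a\<in>{1..n}. \<bar>real (nat \<lfloor>f (real a)\<rfloor> + 1) - f (real a)\<bar>) \<le> (\<Sum>a\<in>{1..n}. 1)" by (intro sum_mono)
  then have "(\<Sum>a\<in>{1..n}. \<bar>real (nat \<lfloor>f (real a)\<rfloor> + 1) - f (real a)\<bar>) \<le> y" using n by simp
  then have d1: "\<bar>real (card (quad_pts x)) - (\<Sum>a\<in>{1..n}. f (real a))\<bar> \<le> y"
    unfolding c sum_subtractf[symmetric] by (rule order_trans[OF sum_abs])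
  have "{..n} = insert 0 {1..n}" by auto
  then have "(\<Sum>k\<le>n. f (real k)) = f 0 + (\<Sum>a\<in>{1..n}. f (real a))" by simp
  then show ?thesis using d1 series last split fy[of 0] f0[of 0] unfolding y_def[symmetric] abs_le_iff by linarith
qed

lemma card_le_spread:
  fixes S :: "nat set"
  assumes "finite S" and d: "\<And>b b'. b \<in> S \<Longrightarrow> b' \<in> S \<Longrightarrow> \<bar>real b' - real b\<bar> \<le> D" and "D \<ge> 0"
  shows "real (card S) \<le> D + 1"
proof (cases "S = {}")
  case False
  have "S \<subseteq> {Min S..Max S}" using assms(1) by auto
  then have "card S \<le> Suc (Max S) - Min S" using card_mono[of "{Min S..Max S}" S] by simp
  moreover have "Min S \<le> Max S" using assms(1) False by simp
  moreover have "\<bar>real (Max S) - real (Min S)\<bar> \<le> D" using d assms(1) False by (meson Min_in Max_in)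
  ultimately show ?thesis by linarith
qed (use assms in simp)

text \<open>Column a holds at most 2 a \<eta> + 1 points; summing over a \<le> n gives the area term
  and one extra point per column.\<close>

lemma card_columns:
  fixes X :: "(nat \<times> nat) set"
  assumes X: "X \<subseteq> {1..n} \<times> {0..n}" and e: "\<eta> \<ge> 0"
    and d: "\<And>a b b'. (a, b) \<in> X \<Longrightarrow> (a, b') \<in> X \<Longrightarrow> \<bar>real b' - real b\<bar> \<le> 2 * real a * \<eta>"
  shows "real (card X) \<le> 2 * \<eta> * (real n)\<^sup>2 + real n"
proof -
  have fin: "finite {b. (a, b) \<in> X}" for a by (rule finite_subset[of _ "{0..n}"]) (use X in auto)
  have "(SIGMA a:{1..n}. {b. (a, b) \<in> X}) = X" using X by auto
  moreover have "card (SIGMA a:{1..n}. {b. (a, b) \<in> X}) = (\<Sum>a\<in>{1..n}. card {b. (a, b) \<in> X})"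
    by (rule card_SigmaI) (simp_all add: fin)
  ultimately have "card X = (\<Sum>a\<in>{1..n}. card {b. (a, b) \<in> X})" by (simp only:)
  then have "real (card X) = (\<Sum>a\<in>{1..n}. real (card {b. (a, b) \<in> X}))" by simp
  also have "\<dots> \<le> (\<Sum>a\<in>{1..n}. 2 * real n * \<eta> + 1)"
  proof (rule sum_mono)
    fix a assume a: "a \<in> {1..n}"
    have "real (card {b. (a, b) \<in> X}) \<le> 2 * real a * \<eta> + 1"
      by (rule card_le_spread[OF fin]) (use d e in auto)
    also have "2 * real a * \<eta> \<le> 2 * real n * \<eta>" using a e by (intro mult_right_mono) auto
    finally show "real (card {b. (a, b) \<in> X}) \<le> 2 * real n * \<eta> + 1" by simp
  qed
  also have "\<dots> = 2 * \<eta> * (real n)\<^sup>2 + real n" by (simp add: power2_eq_square algebra_simps)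
  finally show ?thesis .
qed

text \<open>The left side is |z| |w| times the sine of the angle between z and w, and |z| |w| is at
  most the mean of the two squares.\<close>

lemma cross_le_angle:
  assumes "z \<noteq> 0" "w \<noteq> 0"
  shows "\<bar>Re z * Im w - Im z * Re w\<bar> \<le> ((cmod z)\<^sup>2 + (cmod w)\<^sup>2) / 2 * \<bar>Arg w - Arg z\<bar>"
proof -
  have p: "Re v = cmod v * cos (Arg v)" "Im v = cmod v * sin (Arg v)" if "v \<noteq> 0" for v
  proof -
    have "v = of_real (cmod v) * cis (Arg v)" using that by (simp add: cis_Arg sgn_div_norm scaleR_conv_of_real)
    then have "Re v = Re (of_real (cmod v) * cis (Arg v))" "Im v = Im (of_real (cmod v) * cis (Arg v))" by (simp_all only:)
    then show "Re v = cmod v * cos (Arg v)" "Im v = cmod v * sin (Arg v)" by simp_all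
  qed
  have "Re z * Im w - Im z * Re w = cmod z * cmod w * sin (Arg w - Arg z)"
    unfolding p[OF assms(1)] p[OF assms(2)] sin_diff by (simp add: algebra_simps)
  then have "\<bar>Re z * Im w - Im z * Re w\<bar> = cmod z * cmod w * \<bar>sin (Arg w - Arg z)\<bar>" by (simp add: abs_mult)
  also have "\<dots> \<le> ((cmod z)\<^sup>2 + (cmod w)\<^sup>2) / 2 * \<bar>Arg w - Arg z\<bar>"
  proof (rule mult_mono)
    have "0 \<le> (cmod z - cmod w)\<^sup>2" by simp
    then show "cmod z * cmod w \<le> ((cmod z)\<^sup>2 + (cmod w)\<^sup>2) / 2" by (simp add: power2_diff)
  qed (simp_all add: abs_sin_x_le_abs_x)
  finally show ?thesis .
qed

text \<open>The sector is split along the diagonal. For b \<le> a, two points of column a have cross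
  product a |b' - b|, which is at most 2 a^2 (\<beta> - \<alpha>); so the spread in the column is at
  most 2 a (\<beta> - \<alpha>). Above the diagonal, rows take the place of columns. No tangent
  occurs, and the bound stays uniform up to the imaginary axis.\<close>

lemma card_sector:
  assumes x: "x \<ge> 1" and ab: "\<alpha> \<le> \<beta>"
  shows "real (card {(a, b) \<in> quad_pts x. \<alpha> \<le> Arg (Complex (real a) (real b)) \<and> Arg (Complex (real a) (real b)) \<le> \<beta>})
    \<le> 4 * ((\<beta> - \<alpha>) * x + sqrt x)"
proof -
  define n where "n = root_floor x"
  have n: "real n \<le> sqrt x" using root_floor[OF x] by (simp add: n_def)
  then have n2: "(real n)\<^sup>2 \<le> x" using power_mono[OF n, of 2] x by simp
  define Z where "Z = (\<lambda>a b. Complex (real a) (real b))"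
  define Y where "Y = {(a, b) \<in> quad_pts x. \<alpha> \<le> Arg (Z a b) \<and> Arg (Z a b) \<le> \<beta>}"
  have sub: "Y \<subseteq> {1..n} \<times> {0..n}" using quad_pts_subset[OF x] unfolding Y_def n_def by blast
  have key: "\<bar>real a * real b' - real b * real a'\<bar> \<le> ((real a)\<^sup>2 + (real b)\<^sup>2 + (real a')\<^sup>2 + (real b')\<^sup>2) / 2 * (\<beta> - \<alpha>)"
    if "(a, b) \<in> Y" "(a', b') \<in> Y" for a b a' b'
  proof -
    have nz: "Z a b \<noteq> 0" "Z a' b' \<noteq> 0" using that sub by (auto simp: Z_def complex_eq_iff)
    have "\<bar>Arg (Z a' b') - Arg (Z a b)\<bar> \<le> \<beta> - \<alpha>" using that unfolding Y_def by auto
    then have "((cmod (Z a b))\<^sup>2 + (cmod (Z a' b'))\<^sup>2) / 2 * \<bar>Arg (Z a' b') - Arg (Z a b)\<bar> \<le> ((cmod (Z a b))\<^sup>2 + (cmod (Z a' b'))\<^sup>2) / 2 * (\<beta> - \<alpha>)"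
      by (rule mult_left_mono) simp
    then show ?thesis using cross_le_angle[OF nz] by (simp add: Z_def cmod_power2 add.assoc)
  qed
  define Y1 where "Y1 = {(a, b) \<in> Y. b \<le> a}"
  \<comment> \<open>The coordinates are exchanged, so that \<open>card_columns\<close> applies to
    rows as well.\<close>
  define Y2 where "Y2 = {(b, a). (a, b) \<in> Y \<and> a < b}"
  have bound: "\<bar>c\<bar> \<le> 2 * real a * \<eta>" if "real a * \<bar>c\<bar> \<le> s / 2 * \<eta>" "s \<le> 4 * (real a)\<^sup>2" "a \<ge> 1" "\<eta> \<ge> 0" for a :: nat and c s \<eta> :: real
  proof -
    have "s / 2 * \<eta> \<le> (2 * (real a)\<^sup>2) * \<eta>" using that by (intro mult_right_mono) auto
    then have "real a * \<bar>c\<bar> \<le> real a * (2 * real a * \<eta>)" using that(1) by (simp add: power2_eq_square mult_ac)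
    then show ?thesis using that(3) by simp
  qed
  have "real (card Y1) \<le> 2 * (\<beta> - \<alpha>) * (real n)\<^sup>2 + real n"
  proof (rule card_columns)
    fix a b b' assume h: "(a, b) \<in> Y1" "(a, b') \<in> Y1"
    then have Y: "(a, b) \<in> Y" "(a, b') \<in> Y" "b \<le> a" "b' \<le> a" by (auto simp: Y1_def)
    have "(real b)\<^sup>2 \<le> (real a)\<^sup>2" "(real b')\<^sup>2 \<le> (real a)\<^sup>2" using Y by (auto intro!: power_mono)
    then have "(real a)\<^sup>2 + (real b)\<^sup>2 + (real a)\<^sup>2 + (real b')\<^sup>2 \<le> 4 * (real a)\<^sup>2" by linarith
    moreover have "real a * \<bar>real b' - real b\<bar> = \<bar>real a * real b' - real b * real a\<bar>" by (simp add: abs_mult mult.commute flip: right_diff_distrib)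
    ultimately show "\<bar>real b' - real b\<bar> \<le> 2 * real a * (\<beta> - \<alpha>)"
      using key[OF Y(1,2)] sub Y(1) ab by (intro bound[where s="(real a)\<^sup>2 + (real b)\<^sup>2 + (real a)\<^sup>2 + (real b')\<^sup>2"]) auto
  qed (use sub ab in \<open>auto simp: Y1_def\<close>)
  moreover have "real (card Y2) \<le> 2 * (\<beta> - \<alpha>) * (real n)\<^sup>2 + real n"
  proof (rule card_columns)
    fix b a a' assume h: "(b, a) \<in> Y2" "(b, a') \<in> Y2"
    then have Y: "(a, b) \<in> Y" "(a', b) \<in> Y" "a \<le> b" "a' \<le> b" "1 \<le> b" by (auto simp: Y2_def)
    have "(real a)\<^sup>2 \<le> (real b)\<^sup>2" "(real a')\<^sup>2 \<le> (real b)\<^sup>2" using Y by (auto intro!: power_mono)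
    then have "(real a)\<^sup>2 + (real b)\<^sup>2 + (real a')\<^sup>2 + (real b)\<^sup>2 \<le> 4 * (real b)\<^sup>2" by linarith
    moreover have "real b * \<bar>real a' - real a\<bar> = \<bar>real a * real b - real b * real a'\<bar>"
      by (simp add: mult.commute[of "real a"] abs_mult abs_minus_commute flip: right_diff_distrib)
    ultimately show "\<bar>real a' - real a\<bar> \<le> 2 * real b * (\<beta> - \<alpha>)"
      using key[OF Y(1,2)] Y(5) ab by (intro bound[where s="(real a)\<^sup>2 + (real b)\<^sup>2 + (real a')\<^sup>2 + (real b)\<^sup>2"]) auto
  qed (use sub ab in \<open>auto simp: Y2_def\<close>)
  moreover have "card Y \<le> card Y1 + card Y2"
  proof -
    have fin: "finite Y" using sub finite_subset by blast
    have "Y2 \<subseteq> {0..n} \<times> {1..n}" using sub by (auto simp: Y2_def)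
    then have fin2: "finite Y2" by (rule finite_subset) simp
    have "Y1 \<subseteq> Y" by (auto simp: Y1_def)
    then have "finite (Y1 \<union> prod.swap ` Y2)" using fin fin2 finite_subset by blast
    moreover have "Y \<subseteq> Y1 \<union> prod.swap ` Y2" by (auto simp: Y1_def Y2_def prod.swap_def image_def)
    ultimately have "card Y \<le> card (Y1 \<union> prod.swap ` Y2)" by (intro card_mono)
    also have "\<dots> \<le> card Y1 + card (prod.swap ` Y2)" by (rule card_Un_le)
    also have "card (prod.swap ` Y2) \<le> card Y2" using fin2 by (rule card_image_le)
    finally show ?thesis by simp
  qed
  moreover have "(\<beta> - \<alpha>) * (real n)\<^sup>2 \<le> (\<beta> - \<alpha>) * x" using n2 ab by (intro mult_left_mono) auto
  ultimately have "real (card Y) \<le> 4 * ((\<beta> - \<alpha>) * x) + 2 * sqrt x" using n by linarith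
  also have "\<dots> \<le> 4 * ((\<beta> - \<alpha>) * x + sqrt x)" using x by simp
  finally show ?thesis unfolding Y_def Z_def .
qed

section \<open>Ideals as lattice points and as multisets of primes\<close>

definition ideals_le :: "real \<Rightarrow> complex set set" where
  "ideals_le x = {I \<in> nz_ideals. real (idl_norm I) \<le> x}"

definition pt_ideal :: "nat \<times> nat \<Rightarrow> complex set" where
  "pt_ideal = (\<lambda>(a, b). gid (Gauss (int a) (int b)))"

lemma pt_ideal_bij: "bij_betw pt_ideal (quad_pts x) (ideals_le x)"
proof (rule bij_betw_imageI)
  show "inj_on pt_ideal (quad_pts x)"
  proof (rule inj_onI)
    fix p q assume p: "p \<in> quad_pts x" and q: "q \<in> quad_pts x" and e: "pt_ideal p = pt_ideal q"
    obtain a b where ab: "p = (a, b)" by (cases p)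
    obtain a' b' where ab': "q = (a', b')" by (cases q)
    have "normalize (Gauss (int a) (int b)) = normalize (Gauss (int a') (int b'))"
      using e by (simp add: pt_ideal_def ab ab' gid_eq_iff)
    moreover have "normalize (Gauss (int a) (int b)) = Gauss (int a) (int b)" "normalize (Gauss (int a') (int b')) = Gauss (int a') (int b')"
      using p q by (auto intro!: normalize_gauss_eq_self simp: quad_pts_def ab ab')
    ultimately show "p = q" by (simp add: ab ab')
  qed
  have norm: "idl_norm (pt_ideal (a, b)) = a\<^sup>2 + b\<^sup>2" "pt_ideal (a, b) \<in> nz_ideals" if "1 \<le> a" for a b
  proof -
    have z: "Gauss (int a) (int b) \<noteq> 0" using that by (simp add: gauss_eq_iff)
    have "int (gnorm (Gauss (int a) (int b))) = int (a\<^sup>2 + b\<^sup>2)" by (simp add: int_gnorm)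
    then show "idl_norm (pt_ideal (a, b)) = a\<^sup>2 + b\<^sup>2" using idl_norm_gid[OF z] by (simp only: of_nat_eq_iff pt_ideal_def prod.case)
    show "pt_ideal (a, b) \<in> nz_ideals" using z by (simp add: pt_ideal_def)
  qed
  show "pt_ideal ` quad_pts x = ideals_le x"
  proof (intro equalityI subsetI)
    fix I assume "I \<in> pt_ideal ` quad_pts x"
    then obtain a b where "I = pt_ideal (a, b)" "1 \<le> a" "(real a)\<^sup>2 + (real b)\<^sup>2 \<le> x" by (auto simp: quad_pts_def)
    then show "I \<in> ideals_le x" using norm[of a b] by (simp add: ideals_le_def)
  next
    fix I assume I: "I \<in> ideals_le x"
    then obtain z where z: "z \<noteq> 0" "I = gid z" using nz_ideals_cases unfolding ideals_le_def by blast
    define w where "w = normalize z"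
    have q: "gre w > 0" "gim w \<ge> 0" using normalize_gauss_quadrant[OF z(1)] by (simp_all add: w_def)
    have e: "I = pt_ideal (nat (gre w), nat (gim w))" using q by (simp add: pt_ideal_def z(2) w_def)
    moreover have "1 \<le> nat (gre w)" using q by simp
    moreover from this have "(real (nat (gre w)))\<^sup>2 + (real (nat (gim w)))\<^sup>2 \<le> x"
      using I norm(1)[of "nat (gre w)" "nat (gim w)"] e by (simp add: ideals_le_def)
    ultimately show "I \<in> pt_ideal ` quad_pts x" unfolding quad_pts_def by blast
  qed
qed

lemma finite_ideals_le: "finite (ideals_le x)"
proof -
  have "quad_pts x \<subseteq> quad_pts (max 1 x)" by (auto simp: quad_pts_def)
  moreover have "finite (quad_pts (max 1 x))" by (rule finite_quad_pts) simp
  ultimately have "finite (quad_pts x)" by (rule finite_subset)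
  then show ?thesis using bij_betw_finite[OF pt_ideal_bij] by blast
qed

lemma idl_arg_pt: "1 \<le> a \<Longrightarrow> idl_arg (pt_ideal (a, b)) = Arg (Complex (real a) (real b))"
proof -
  assume a: "1 \<le> a"
  then have "normalize (Gauss (int a) (int b)) = Gauss (int a) (int b)" by (intro normalize_gauss_eq_self) auto
  moreover have "Gauss (int a) (int b) \<noteq> 0" using a by (simp add: gauss_eq_iff)
  ultimately show ?thesis by (simp add: pt_ideal_def idl_arg_gid toC_def)
qed

lemma card_ideals_sector:
  assumes "x \<ge> 1" "\<alpha> \<le> \<beta>"
  shows "real (card {I \<in> ideals_le x. \<alpha> \<le> idl_arg I \<and> idl_arg I \<le> \<beta>}) \<le> 4 * ((\<beta> - \<alpha>) * x + sqrt x)"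
proof -
  let ?Y = "{(a, b) \<in> quad_pts x. \<alpha> \<le> Arg (Complex (real a) (real b)) \<and> Arg (Complex (real a) (real b)) \<le> \<beta>}"
  have "{I \<in> ideals_le x. \<alpha> \<le> idl_arg I \<and> idl_arg I \<le> \<beta>} \<subseteq> pt_ideal ` ?Y"
  proof
    fix I assume I: "I \<in> {I \<in> ideals_le x. \<alpha> \<le> idl_arg I \<and> idl_arg I \<le> \<beta>}"
    then have "I \<in> pt_ideal ` quad_pts x" using bij_betw_imp_surj_on[OF pt_ideal_bij] by simp
    then obtain a b where ab: "I = pt_ideal (a, b)" "(a, b) \<in> quad_pts x" by auto
    then have "1 \<le> a" by (simp add: quad_pts_def)
    then have "(a, b) \<in> ?Y" using I ab idl_arg_pt by simp
    then show "I \<in> pt_ideal ` ?Y" using ab(1) by blast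
  qed
  moreover have fin: "finite ?Y" by (rule finite_subset[OF _ finite_quad_pts[OF assms(1)]]) auto
  ultimately have "card {I \<in> ideals_le x. \<alpha> \<le> idl_arg I \<and> idl_arg I \<le> \<beta>} \<le> card (pt_ideal ` ?Y)" by (intro card_mono) auto
  also have "\<dots> \<le> card ?Y" by (rule card_image_le[OF fin])
  finally show ?thesis using card_sector[OF assms] by linarith
qed

definition mset_ideal :: "gauss multiset \<Rightarrow> complex set" where "mset_ideal A = gid (prod_mset A)"

lemma mset_ideal_norm:
  assumes "set_mset A \<subseteq> {p. prime p}" shows "idl_norm (mset_ideal A) = (\<Prod>p\<in>#A. gnorm p)"
  using idl_norm_gid[OF prod_primes_nonzero[OF assms]] by (simp add: mset_ideal_def gnorm_prod_mset)

lemma mset_ideal_bij: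
  "bij_betw mset_ideal {A. set_mset A \<subseteq> {p. prime p} \<and> real (\<Prod>p\<in>#A. gnorm p) \<le> x} (ideals_le x)"
proof (rule bij_betw_imageI)
  have b: "bij_betw mset_ideal {A. set_mset A \<subseteq> {p. prime p}} nz_ideals"
    using bij_multisets_ideals by (simp add: mset_ideal_def[abs_def])
  show "inj_on mset_ideal {A. set_mset A \<subseteq> {p. prime p} \<and> real (\<Prod>p\<in>#A. gnorm p) \<le> x}"
    by (rule inj_on_subset[OF bij_betw_imp_inj_on[OF b]]) blast
  show "mset_ideal ` {A. set_mset A \<subseteq> {p. prime p} \<and> real (\<Prod>p\<in>#A. gnorm p) \<le> x} = ideals_le x"
  proof (intro equalityI subsetI)
    fix I assume "I \<in> mset_ideal ` {A. set_mset A \<subseteq> {p. prime p} \<and> real (\<Prod>p\<in>#A. gnorm p) \<le> x}"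
    then obtain A where A: "I = mset_ideal A" "set_mset A \<subseteq> {p. prime p}" "real (\<Prod>p\<in>#A. gnorm p) \<le> x" by blast
    have "I \<in> nz_ideals" unfolding A(1) using bij_betw_imp_surj_on[OF b] A(2) by blast
    then show "I \<in> ideals_le x" using A(3) mset_ideal_norm[OF A(2)] by (simp add: ideals_le_def A(1))
  next
    fix I assume I: "I \<in> ideals_le x"
    then have "I \<in> mset_ideal ` {A. set_mset A \<subseteq> {p. prime p}}" unfolding bij_betw_imp_surj_on[OF b] by (simp add: ideals_le_def)
    then obtain A where A: "I = mset_ideal A" "set_mset A \<subseteq> {p. prime p}" by blast
    then have "real (\<Prod>p\<in>#A. gnorm p) \<le> x" using I mset_ideal_norm[OF A(2)] by (simp add: ideals_le_def)
    then show "I \<in> mset_ideal ` {A. set_mset A \<subseteq> {p. prime p} \<and> real (\<Prod>p\<in>#A. gnorm p) \<le> x}" using A by blast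
  qed
qed

text \<open>Two bijections onto the same set of ideals meet here: multisets of primes through
  factorisation, and lattice points of the quadrant through generators. The lattice count supplies
  the density and the error constant 4.\<close>

interpretation gaussian: prime_system "{p::gauss. prime p}" gnorm quarter_area 4
proof
  fix p :: gauss assume "p \<in> {p. prime p}"
  then have p: "prime p" by simp
  have "gnorm p \<noteq> 0" using p by auto
  moreover have "gnorm p \<noteq> 1"
  proof
    assume "gnorm p = 1"
    then have "p * gcnj p = 1" by (simp add: gauss_mult_cnj gauss_eq_iff)
    then have "p dvd 1" by (metis dvd_triv_left)
    then show False using p not_prime_unit by blast
  qed
  ultimately show "2 \<le> gnorm p" by linarith
next
  show "0 < quarter_area" by (rule quarter_area_pos)
  show "finite {A. set_mset A \<subseteq> {p::gauss. prime p} \<and> real (\<Prod>p\<in>#A. gnorm p) \<le> x}" for x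
    using bij_betw_finite[OF mset_ideal_bij] finite_ideals_le by blast
  show "\<bar>real (card {A. set_mset A \<subseteq> {p::gauss. prime p} \<and> real (\<Prod>p\<in>#A. gnorm p) \<le> x}) - quarter_area * x\<bar> \<le> 4 * sqrt x" if "1 \<le> x" for x
    using card_quad_pts[OF that] bij_betw_same_card[OF mset_ideal_bij, of x] bij_betw_same_card[OF pt_ideal_bij, of x] by simp
qed

section \<open>Twisted sums over ideals and the final estimate\<close>

lemma sum_ideals_le: "(\<Sum>I\<in>ideals_le x. h I) = gaussian.S (\<lambda>A. h (mset_ideal A)) x"
proof -
  have "gaussian.le x = {A. set_mset A \<subseteq> {p. prime p} \<and> real (\<Prod>p\<in>#A. gnorm p) \<le> x}"
    by (simp add: gaussian.le_def gaussian.Ms_def gaussian.N_def)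
  then show ?thesis unfolding gaussian.S_def using sum.reindex_bij_betw[OF mset_ideal_bij, of h x] by simp
qed

lemma unit_mult_twist:
  assumes f: "multiplicative_idl f" and f1: "\<forall>I\<in>nz_ideals. cmod (f I) \<le> 1"
  shows "gaussian.unit_mult (\<lambda>A. f (mset_ideal A) * hecke_char m (mset_ideal A))"
  unfolding gaussian.unit_mult_def gaussian.Ms_def
proof (intro conjI ballI impI)
  show "f (mset_ideal {#}) * hecke_char m (mset_ideal {#}) = 1"
    using f hecke_char_gid[of 1 m] by (simp add: mset_ideal_def gid_1 multiplicative_idl_def)
  fix A :: "gauss multiset" assume A: "A \<in> {A. set_mset A \<subseteq> {p. prime p}}"
  then have a: "prod_mset A \<noteq> 0" using prod_primes_nonzero by blast
  then have "cmod (f (mset_ideal A)) \<le> 1" using f1 by (simp add: mset_ideal_def)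
  then show "cmod (f (mset_ideal A) * hecke_char m (mset_ideal A)) \<le> 1" by (simp add: norm_mult norm_hecke_char)
  fix B :: "gauss multiset" assume B: "B \<in> {A. set_mset A \<subseteq> {p. prime p}}" and AB: "set_mset A \<inter> set_mset B = {}"
  then have b: "prod_mset B \<noteq> 0" using prod_primes_nonzero by blast
  have "coprime_idl (mset_ideal A) (mset_ideal B)"
    unfolding mset_ideal_def using A B AB by (intro coprime_idl_gid coprime_prod_primes) auto
  then have "f (ideal_prod ZI (mset_ideal A) (mset_ideal B)) = f (mset_ideal A) * f (mset_ideal B)"
    using f a b by (simp add: multiplicative_idl_def mset_ideal_def)
  moreover have e: "mset_ideal (A + B) = ideal_prod ZI (mset_ideal A) (mset_ideal B)"
    by (simp add: mset_ideal_def ideal_prod_gid)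
  moreover have "hecke_char m (mset_ideal (A + B)) = hecke_char m (mset_ideal A) * hecke_char m (mset_ideal B)"
    using hecke_char_mult[OF a b] by (simp add: mset_ideal_def)
  ultimately show "f (mset_ideal (A + B)) * hecke_char m (mset_ideal (A + B)) =
      f (mset_ideal A) * hecke_char m (mset_ideal A) * (f (mset_ideal B) * hecke_char m (mset_ideal B))"
    by (simp add: mult_ac)
qed

lemma pdist_eq_twist_dist:
  "gaussian.pdist (\<lambda>A. f (mset_ideal A) * hecke_char m (mset_ideal A)) x t = twist_dist f m x t"
proof -
  have inj: "inj_on gid (gaussian.primes_le x)"
    by (rule inj_onI) (simp add: gaussian.primes_le_def gid_eq_iff normalize_prime)
  have nz: "p \<noteq> 0" if "prime p" for p :: gauss using that by auto
  have im: "gid ` gaussian.primes_le x = {P \<in> nz_primes. real (idl_norm P) \<le> x}"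
    unfolding nz_primes_eq gaussian.primes_le_def using idl_norm_gid[OF nz] by auto
  have "(1 - Re (f (mset_ideal {#p#}) * hecke_char m (mset_ideal {#p#}) * cis (- t * ln (real (gnorm p))))) / real (gnorm p)
    = (1 - Re (f (gid p) * hecke_char m (gid p) * of_nat (idl_norm (gid p)) powr (- \<i> * of_real t))) / real (idl_norm (gid p))"
    if p: "p \<in> gaussian.primes_le x" for p
  proof -
    have p0: "p \<noteq> 0" using p nz[of p] by (simp add: gaussian.primes_le_def)
    then have n: "gnorm p > 0" by (rule gnorm_pos)
    have "(of_nat (gnorm p) :: complex) powr (- \<i> * of_real t) = exp (- \<i> * of_real t * of_real (ln (real (gnorm p))))"
      using n p0 by (simp add: powr_def Ln_of_nat)
    also have "\<dots> = cis (- t * ln (real (gnorm p)))" by (simp add: cis_conv_exp mult_ac)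
    finally show ?thesis by (simp add: idl_norm_gid[OF p0] mset_ideal_def)
  qed
  then show ?thesis unfolding gaussian.pdist_def twist_dist_def im[symmetric] sum.reindex[OF inj] o_def
    by (intro sum.cong refl)
qed

lemma M_dist_nonneg:
  assumes f1: "\<forall>I\<in>nz_ideals. cmod (f I) \<le> 1" and x: "x \<ge> 1"
  shows "0 \<le> M_dist f m x"
proof -
  have "0 \<le> twist_dist f m x t" for t
    unfolding twist_dist_def
  proof (rule sum_nonneg)
    fix P assume "P \<in> {P \<in> nz_primes. real (idl_norm P) \<le> x}"
    then have P: "P \<in> nz_ideals" by (simp add: nz_primes_def)
    \<comment> \<open>The default value 0 \<open>powr\<close> s = 0 covers norm 0, so positivity of
      the norm is not consulted here.\<close>
    have "cmod ((of_nat (idl_norm P) :: complex) powr (- \<i> * of_real t)) \<le> 1"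
      by (cases "idl_norm P = 0") (simp_all add: powr_def norm_exp_eq_Re Ln_of_nat)
    then have "cmod (f P * hecke_char m P * of_nat (idl_norm P) powr (- \<i> * of_real t)) \<le> 1"
      using f1 P unfolding norm_mult norm_hecke_char by (simp add: mult_le_one)
    then have "Re (f P * hecke_char m P * of_nat (idl_norm P) powr (- \<i> * of_real t)) \<le> 1"
      using complex_Re_le_cmod order_trans by blast
    then show "0 \<le> (1 - Re (f P * hecke_char m P * of_nat (idl_norm P) powr (- \<i> * of_real t))) / real (idl_norm P)"
      by simp
  qed
  then show ?thesis using M_dist_attained[OF x, of f m] by metis
qed

text \<open>\<open>M_dist\<close> is an admissible M: it is nonnegative and, being a minimum, lies
  below the distance at every |t| \<le> ln x. The constant depends neither on f nor on x nor on m,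
  as uniformity in T requires.\<close>

lemma halasz_hecke:
  "\<exists>C\<ge>0. \<forall>f x m. multiplicative_idl f \<longrightarrow> (\<forall>I\<in>nz_ideals. cmod (f I) \<le> 1) \<longrightarrow> x \<ge> 3 \<longrightarrow>
    cmod (\<Sum>I\<in>ideals_le x. f I * hecke_char m I)
      \<le> C * x * ((1 + M_dist f m x) * exp (- M_dist f m x) + ln (ln x) / ln x)"
proof -
  obtain C where C: "C \<ge> 0" "\<And>f x M. gaussian.unit_mult f \<Longrightarrow> x \<ge> 3 \<Longrightarrow> 0 \<le> M \<Longrightarrow> (\<And>t. \<bar>t\<bar> \<le> ln x \<Longrightarrow> M \<le> gaussian.pdist f x t) \<Longrightarrow>
    cmod (gaussian.S f x) \<le> C * x * ((1 + M) * exp (- M) + ln (ln x) / ln x)"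
    using gaussian.halasz by blast
  have "cmod (\<Sum>I\<in>ideals_le x. f I * hecke_char m I)
      \<le> C * x * ((1 + M_dist f m x) * exp (- M_dist f m x) + ln (ln x) / ln x)"
    if f: "multiplicative_idl f" and f1: "\<forall>I\<in>nz_ideals. cmod (f I) \<le> 1" and x: "x \<ge> 3" for f x m
    unfolding sum_ideals_le
  proof (rule C(2)[OF unit_mult_twist[OF f f1] x])
    show "0 \<le> M_dist f m x" using M_dist_nonneg[OF f1] x by simp
    show "M_dist f m x \<le> gaussian.pdist (\<lambda>A. f (mset_ideal A) * hecke_char m (mset_ideal A)) x t" if "\<bar>t\<bar> \<le> ln x" for t
      unfolding pdist_eq_twist_dist using M_dist_attained[of x f m] that x by auto
  qed
  then show ?thesis using C(1) by blast
qed

text \<open>Sector counting produces sqrt x times log (T + 1). The term x^(1/2) of the final bound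
  carries no logarithm of T, so this error is absorbed into the term with ln (ln x).\<close>

lemma sqrt_le_lnln:
  assumes x: "(x::real) \<ge> 3" shows "sqrt x \<le> 2 / ln (ln 3) * (x / ln x * ln (ln x))"
proof -
  have l3: "ln (3::real) > 1" by (rule ln3_gt_1)
  then have d: "ln (ln (3::real)) > 0" by simp
  have lx: "ln x \<ge> ln 3" using x by simp
  then have ll: "ln (ln x) \<ge> ln (ln 3)" using l3 by simp
  have "ln x = 2 * ln (sqrt x)" using x by (simp add: ln_sqrt)
  also have "ln (sqrt x) \<le> sqrt x" using ln_le_minus_one[of "sqrt x"] x by simp
  finally have "sqrt x * ln x \<le> sqrt x * (2 * sqrt x)" using x by (intro mult_left_mono) auto
  also have "\<dots> = 2 * x" using x by simp
  finally have "sqrt x \<le> 2 * x / ln x" using lx l3 by (simp add: pos_le_divide_eq)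
  also have "\<dots> \<le> 2 * x / ln x * (ln (ln x) / ln (ln 3))"
    using mult_left_mono[of 1 "ln (ln x) / ln (ln 3)" "2 * x / ln x"] ll d lx l3 x by simp
  also have "\<dots> = 2 / ln (ln 3) * (x / ln x * ln (ln x))" by (simp add: mult_ac)
  finally show ?thesis .
qed

theorem theorem5p5:
  shows "\<exists>C::real. \<forall>f :: complex set \<Rightarrow> complex.
    multiplicative_idl f \<longrightarrow> (\<forall>I\<in>nz_ideals. cmod (f I) \<le> 1) \<longrightarrow>
    (\<forall>(x::real) (\<theta>1::real) (\<theta>2::real) (T::int).
      x \<ge> 3 \<longrightarrow> 0 \<le> \<theta>1 \<longrightarrow> \<theta>1 \<le> \<theta>2 \<longrightarrow> \<theta>2 \<le> pi / 2 \<longrightarrow> T \<ge> 2 \<longrightarrow>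
      cmod (S_arg f {\<theta>1..<\<theta>2} x - of_real ((\<theta>2 - \<theta>1) / (pi / 2)) * S_all f x)
        \<le> C * (x * ln (of_int T + 1) *
                  (MAX m\<in>{m::int. 1 \<le> \<bar>m\<bar> \<and> \<bar>m\<bar> \<le> T}. (1 + M_dist f m x) * exp (- M_dist f m x))
              + x / ln x * ln (ln x) * ln (of_int T + 1)
              + x * ln (of_int T + 1) / of_int T
              + x powr (1 / 2)))"
proof -
  obtain C where C0: "C \<ge> 0" and C: "\<And>f x m. multiplicative_idl f \<Longrightarrow> (\<forall>I\<in>nz_ideals. cmod (f I) \<le> 1) \<Longrightarrow> x \<ge> 3 \<Longrightarrow>
    cmod (\<Sum>I\<in>ideals_le x. f I * hecke_char m I)
      \<le> C * x * ((1 + M_dist f m x) * exp (- M_dist f m x) + ln (ln x) / ln x)"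
    using halasz_hecke by blast
  define q where "q = 2 / ln (ln (3::real))"
  have q0: "q \<ge> 0" using ln3_gt_1 by (simp add: q_def)
  \<comment> \<open>24192 is 6048 times 4: the constant of \<open>arc_discrepancy\<close> and the
    factor in \<open>card_ideals_sector\<close>. The summand with \<open>q\<close> pays for the
    absorbed sqrt x.\<close>
  define C' where "C' = 2 * C + 24192 * (1 + q)"
  have C': "2 * C \<le> C'" "2 * C + 24192 * q \<le> C'" "24192 \<le> C'" "0 \<le> C'" using C0 q0 by (simp_all add: C'_def)
  show ?thesis
  proof (intro exI[of _ C'] allI impI)
    fix f :: "complex set \<Rightarrow> complex" and x \<theta>1 \<theta>2 :: real and T :: int
    assume f: "multiplicative_idl f" and f1: "\<forall>I\<in>nz_ideals. cmod (f I) \<le> 1" and x: "x \<ge> 3"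
      and t: "0 \<le> \<theta>1" "\<theta>1 \<le> \<theta>2" "\<theta>2 \<le> pi / 2" and T: "T \<ge> 2"
    define Q where "Q = {m::int. 1 \<le> \<bar>m\<bar> \<and> \<bar>m\<bar> \<le> T}"
    define E where "E = (\<lambda>m. (1 + M_dist f m x) * exp (- M_dist f m x))"
    define V where "V = Max (E ` Q)"
    define R where "R = x / ln x * ln (ln x)"
    define L where "L = ln (of_int T + 1 :: real)"
    have "Q \<subseteq> {- T..T}" by (auto simp: Q_def)
    then have finQ: "finite Q" by (rule finite_subset) simp
    have EV: "E m \<le> V" if "m \<in> Q" for m unfolding V_def using finQ that by (intro Max_ge) auto
    have "1 \<in> Q" using T by (simp add: Q_def)
    moreover have "E 1 \<ge> 0" using M_dist_nonneg[OF f1, of x 1] x by (simp add: E_def)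
    ultimately have V0: "V \<ge> 0" using EV order_trans by blast
    have L0: "L \<ge> 0" using T by (simp add: L_def)
    have nT: "real (nat T) = of_int T" "nat T \<ge> 2" using T by simp_all
    have sector: "S_arg f {\<theta>1..<\<theta>2} x = (\<Sum>I | I \<in> ideals_le x \<and> idl_arg I \<in> {\<theta>1..<\<theta>2}. f I)"
      unfolding S_arg_def by (rule sum.cong) (auto simp: ideals_le_def)
    have all: "S_all f x = (\<Sum>I\<in>ideals_le x. f I)" unfolding S_all_def ideals_le_def ..
    have "cmod ((\<Sum>I | I \<in> ideals_le x \<and> idl_arg I \<in> {\<theta>1..<\<theta>2}. f I) - of_real ((\<theta>2 - \<theta>1) / (pi / 2)) * (\<Sum>I\<in>ideals_le x. f I))
      \<le> ln (real (nat T) + 1) * (2 * (C * (x * V + R)) + 6048 * 4 * (x / real (nat T) + sqrt x))"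
    proof (rule arc_discrepancy[OF finite_ideals_le])
      fix I assume I: "I \<in> ideals_le x"
      then have I': "I \<in> nz_ideals" by (simp add: ideals_le_def)
      show "0 \<le> idl_arg I \<and> idl_arg I < pi / 2" by (rule idl_arg_range[OF I'])
      show "cmod (f I) \<le> 1" using f1 I' by blast
    next
      fix \<alpha> \<beta> :: real assume "\<alpha> \<le> \<beta>"
      then show "real (card {I \<in> ideals_le x. \<alpha> \<le> idl_arg I \<and> idl_arg I \<le> \<beta>}) \<le> 4 * ((\<beta> - \<alpha>) * x + sqrt x)"
        using x by (intro card_ideals_sector) auto
    next
      fix m :: int assume "1 \<le> \<bar>m\<bar>" "\<bar>m\<bar> \<le> int (nat T)"
      then have m: "m \<in> Q" using T by (simp add: Q_def)
      have "cmod (\<Sum>I\<in>ideals_le x. f I * cis (of_int m * (4 * idl_arg I))) \<le> C * x * (E m + ln (ln x) / ln x)"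
        using C[OF f f1 x, of m] unfolding E_def hecke_char_cis .
      also have "\<dots> \<le> C * x * (V + ln (ln x) / ln x)" using EV[OF m] C0 x by (intro mult_left_mono) auto
      also have "\<dots> = C * (x * V + R)" by (simp add: R_def algebra_simps)
      finally show "cmod (\<Sum>I\<in>ideals_le x. f I * cis (of_int m * (4 * idl_arg I))) \<le> C * (x * V + R)" .
    qed (use x t nT in auto)
    also have "\<dots> = L * (2 * C * (x * V) + 2 * C * R + 24192 * (x / of_int T) + 24192 * sqrt x)"
      unfolding nT L_def by (simp add: algebra_simps)
    also have "\<dots> \<le> L * (2 * C * (x * V) + 2 * C * R + 24192 * (x / of_int T) + 24192 * (q * R))"
      using sqrt_le_lnln[OF x] L0 by (intro mult_left_mono add_left_mono) (auto simp: q_def R_def)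
    also have "\<dots> = L * (2 * C * (x * V) + (2 * C + 24192 * q) * R + 24192 * (x / of_int T))" by (simp add: algebra_simps)
    also have "\<dots> \<le> L * (C' * (x * V) + C' * R + C' * (x / of_int T))"
    proof -
      have "ln x > 1" using ln3_gt_1 x by (smt (verit) ln_le_cancel_iff)
      then have "R \<ge> 0" using x by (simp add: R_def)
      then show ?thesis using L0 V0 x T C' by (intro mult_left_mono add_mono mult_right_mono) auto
    qed
    also have "\<dots> = C' * (x * L * V + R * L + x * L / of_int T)" by (simp add: algebra_simps)
    also have "\<dots> \<le> C' * (x * L * V + R * L + x * L / of_int T + x powr (1 / 2))"
      using C'(4) by (intro mult_left_mono) auto
    finally show "cmod (S_arg f {\<theta>1..<\<theta>2} x - of_real ((\<theta>2 - \<theta>1) / (pi / 2)) * S_all f x)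
        \<le> C' * (x * ln (of_int T + 1) *
                  (MAX m\<in>{m::int. 1 \<le> \<bar>m\<bar> \<and> \<bar>m\<bar> \<le> T}. (1 + M_dist f m x) * exp (- M_dist f m x))
              + x / ln x * ln (ln x) * ln (of_int T + 1)
              + x * ln (of_int T + 1) / of_int T
              + x powr (1 / 2))"
      unfolding sector all V_def E_def Q_def R_def L_def .
  qed
qed

end
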